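(* Let $H$ be a Hopf algebra over a field $\mathbf{k}$ with a bijective antipode and $B/A$ a faithfully flat $H$-Galois extension. Let $L_\bullet$ be a projective resolution of the trivial right $H$-module $\mathbf{k}$, let $K_\bullet$ be a projective resolution of the left $\Gamma$-module $A$, and let $N$ be a $(B,B)$-bimodule. Then there is a bicomplex isomorphism $$\Phi_N^{\bullet,\bullet}:\operatorname{Hom}_H(L_\bullet,\operatorname{Hom}_{A^e}(K_\bullet,N))\cong\operatorname{Hom}_{B^e}(L_\bullet\otimes_H(B^e\otimes_{A^e}K_\bullet),N).$$
   Context: Unadorned $\otimes$, $\operatorname{Hom}$ are over $\mathbf{k}$; $R^e=R\otimes R^{\mathrm{op}}$; Sweedler notation. $B$ is a right $H$-comodule algebra with coaction $\rho(b)=\sum b_{(0)}\otimes b_{(1)}$, $A=B^{\mathrm{co}H}=\{b\mid\rho(b)=b\otimes1\}$. $B/A$ is $H$-Galois if $\beta:B\otimes_AB\to B\otimes H$, $b\otimes_Ab'\mapsto\sum bb'_{(0)}\otimes b'_{(1)}$, is bijective; faithfully flat if moreover $B$ is faithfully flat as a left (equivalently right) $A$-module. Write $\beta^{-1}(1\otimes h)=\sum_il_i(h)\otimes_Ar_i(h)$. $\Gamma=\{\sum_pb_p\otimes b_p'^{\mathrm{op}}\in B^e\mid\sum_p(b_p)_{(0)}\otimes(b'_p)_{(0)}^{\mathrm{op}}\otimes(b_p)_{(1)}(b'_p)_{(1)}=\sum_pb_p\otimes b_p'^{\mathrm{op}}\otimes1_H\}$ is a subalgebra of $B^e$ containing $A^e$.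 For a left $\Gamma$-module $M$ write $\sum_px_pmy_p$ for $(\sum_px_p\otimes y_p^{\mathrm{op}})\cdot m$. $A$ is a left $\Gamma$-module via $(\sum_p x_p\otimes y_p^{\mathrm{op}})\cdot a=\sum_p x_pay_p$. For $h\in H$, the element $\sum_{i,j}l_i(h_{(1)})\otimes_A(r_i(h_{(1)})\otimes l_j(h_{(2)})^{\mathrm{op}})\otimes_Ar_j(h_{(2)})$ lies in $B\otimes_A\Gamma\otimes_AB$. Hence for a left $\Gamma$-module $M$ and $(B,B)$-bimodule $N$: $\operatorname{Hom}_{A^e}(M,N)$ is a right $H$-module via $(f\leftharpoonup h)(m)=\sum_{i,j}l_i(h_{(1)})f(r_i(h_{(1)})ml_j(h_{(2)}))r_j(h_{(2)})$, and $B^e\otimes_{A^e}M$ is a left $H$-module via $h\rightharpoonup((b\otimes b'^{\mathrm{op}})\otimes_{A^e}m)=\sum_{i,j}(bl_i(h_{(1)})\otimes(r_j(h_{(2)})b')^{\mathrm{op}})\otimes_{A^e}(r_i(h_{(1)})ml_j(h_{(2)}))$, commuting with left multiplication by $B^e$. Bicomplexes (first quadrant, $d_hd_v+d_vd_h=0$): on $f\in\operatorname{Hom}_H(L_i,\operatorname{Hom}_{A^e}(K_j,N))$, $(d_hf)(l)(k)=(-1)^{i+j}f(d^L(l))(k)$ and $(d_vf)(l)(k)=(-1)^jf(l)(d^K(k))$; on $F\in\operatorname{Hom}_{B^e}(L_i\otimes_H(B^e\otimes_{A^e}K_j),N)$, $\delta_hF=(-1)^{i+j}F\circ(d^L\otimes\mathrm{id})$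 and $\delta_vF=(-1)^jF\circ(\mathrm{id}\otimes(\mathrm{id}\otimes d^K))$. *)

theory Defs
  imports "HOL-Algebra.Free_Abelian_Groups" "HOL-Algebra.Module"
begin

section \<open>Modules over noncommutative rings\<close>

definition op_ring :: "('a, 'x) ring_scheme \<Rightarrow> ('a, 'x) ring_scheme" where
  "op_ring R = R\<lparr>monoid.mult := (\<lambda>x y. y \<otimes>\<^bsub>R\<^esub> x)\<rparr>"

text \<open>
  Modules reuse the record type of HOL-Algebra; only its additive part and \<open>\<odot>\<close> matter, the fields
  for multiplication and unit are ignored. A right \<open>R\<close>-module is a left module over the opposite
  ring, so for right modules \<open>r \<odot> x\<close> is to be read as \<open>x \<cdot> r\<close>.
\<close>

locale left_module = R?: ring R + M?: abelian_group M
  for R :: "('r, 'x) ring_scheme" (structure) and M :: "('r, 'm, 'y) module_scheme" (structure) +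
  assumes lm_smult_closed:
      "\<lbrakk>a \<in> carrier R; x \<in> carrier M\<rbrakk> \<Longrightarrow> a \<odot>\<^bsub>M\<^esub> x \<in> carrier M"
    and lm_smult_l_distr:
      "\<lbrakk>a \<in> carrier R; b \<in> carrier R; x \<in> carrier M\<rbrakk>
        \<Longrightarrow> (a \<oplus> b) \<odot>\<^bsub>M\<^esub> x = a \<odot>\<^bsub>M\<^esub> x \<oplus>\<^bsub>M\<^esub> b \<odot>\<^bsub>M\<^esub> x"
    and lm_smult_r_distr:
      "\<lbrakk>a \<in> carrier R; x \<in> carrier M; y \<in> carrier M\<rbrakk>
        \<Longrightarrow> a \<odot>\<^bsub>M\<^esub> (x \<oplus>\<^bsub>M\<^esub> y) = a \<odot>\<^bsub>M\<^esub> x \<oplus>\<^bsub>M\<^esub> a \<odot>\<^bsub>M\<^esub> y"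
    and lm_smult_assoc:
      "\<lbrakk>a \<in> carrier R; b \<in> carrier R; x \<in> carrier M\<rbrakk>
        \<Longrightarrow> (a \<otimes> b) \<odot>\<^bsub>M\<^esub> x = a \<odot>\<^bsub>M\<^esub> (b \<odot>\<^bsub>M\<^esub> x)"
    and lm_smult_one: "x \<in> carrier M \<Longrightarrow> \<one> \<odot>\<^bsub>M\<^esub> x = x"

abbreviation right_module :: "('r, 'x) ring_scheme \<Rightarrow> ('r, 'm, 'y) module_scheme \<Rightarrow> bool" where
  "right_module R M \<equiv> left_module (op_ring R) M"

definition mk_module :: "('m, 'x) ring_scheme \<Rightarrow> ('r \<Rightarrow> 'm \<Rightarrow> 'm) \<Rightarrow> ('r, 'm) module" where
  "mk_module G act = \<lparr>carrier = carrier G, monoid.mult = undefined, one = undefined,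
     ring.zero = \<zero>\<^bsub>G\<^esub>, add = add G, smult = act\<rparr>"

definition left_reg :: "('b, 'x) ring_scheme \<Rightarrow> ('b, 'b) module" where
  "left_reg B = mk_module B (\<lambda>a b. a \<otimes>\<^bsub>B\<^esub> b)"

definition right_reg :: "('b, 'x) ring_scheme \<Rightarrow> ('b, 'b) module" where
  "right_reg B = mk_module B (\<lambda>a b. b \<otimes>\<^bsub>B\<^esub> a)"

definition is_hom :: "('r, 'x) ring_scheme \<Rightarrow> ('r, 'm, 'y) module_scheme
    \<Rightarrow> ('r, 'n, 'z) module_scheme \<Rightarrow> ('m \<Rightarrow> 'n) \<Rightarrow> bool" where
  "is_hom R M N f \<longleftrightarrow> f \<in> carrier M \<rightarrow> carrier N
     \<and> (\<forall>x\<in>carrier M. \<forall>y\<in>carrier M. f (x \<oplus>\<^bsub>M\<^esub> y) = f x \<oplus>\<^bsub>N\<^esub> f y)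
     \<and> (\<forall>r\<in>carrier R. \<forall>x\<in>carrier M. f (r \<odot>\<^bsub>M\<^esub> x) = r \<odot>\<^bsub>N\<^esub> f x)"

text \<open>
  \<open>Hom\<^sub>R(M,N)\<close> as a vector space. Homs are extensional functions, so that equality of homs is
  equality on \<open>M\<close>; \<open>sc\<close> is the scalar multiplication of the ground field on \<open>N\<close>.
\<close>

definition Hom_mod :: "('r, 'x) ring_scheme \<Rightarrow> ('r, 'm, 'y) module_scheme
    \<Rightarrow> ('r, 'n, 'z) module_scheme \<Rightarrow> ('k \<Rightarrow> 'n \<Rightarrow> 'n) \<Rightarrow> ('k, 'm \<Rightarrow> 'n) module" where
  "Hom_mod R M N sc = \<lparr>carrier = {f. is_hom R M N f \<and> f \<in> extensional (carrier M)},
     monoid.mult = undefined, one = undefined,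
     ring.zero = (\<lambda>x\<in>carrier M. \<zero>\<^bsub>N\<^esub>), add = (\<lambda>f g. \<lambda>x\<in>carrier M. f x \<oplus>\<^bsub>N\<^esub> g x),
     smult = (\<lambda>c f. \<lambda>x\<in>carrier M. sc c (f x))\<rparr>"

definition exact_at :: "('m, 'x) ring_scheme \<Rightarrow> ('n, 'y) ring_scheme \<Rightarrow> ('p, 'z) ring_scheme
    \<Rightarrow> ('m \<Rightarrow> 'n) \<Rightarrow> ('n \<Rightarrow> 'p) \<Rightarrow> bool" where
  "exact_at X Y Z f g \<longleftrightarrow> f ` carrier X = {y \<in> carrier Y. g y = \<zero>\<^bsub>Z\<^esub>}"

text \<open>
  Projectivity is the lifting property. HOL cannot quantify over modules of all types; the
  universes chosen here are large enough, because \<open>Y = P\<close>, \<open>f = id\<close> and \<open>X\<close> the free module on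
  the set \<open>P\<close> (finitely supported functions \<open>P \<Rightarrow> R\<close>) are among the instances: they exhibit \<open>P\<close>
  as a direct summand of a free module, hence give the lifting property for all modules.
\<close>

definition projective :: "('r, 'x) ring_scheme \<Rightarrow> ('r, 'p, 'y) module_scheme \<Rightarrow> bool" where
  "projective R P \<longleftrightarrow> left_module R P \<and>
     (\<forall>(X :: ('r, 'p \<Rightarrow> 'r) module) (Y :: ('r, 'p) module) g f.
        left_module R X \<and> left_module R Y \<and> is_hom R X Y g \<and> g ` carrier X = carrier Y
        \<and> is_hom R P Y f
        \<longrightarrow> (\<exists>f'. is_hom R P X f' \<and> (\<forall>p\<in>carrier P. g (f' p) = f p)))"

definition projective_resolution :: "('r, 'x) ring_scheme \<Rightarrow> ('r, 'm, 'y) module_scheme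
    \<Rightarrow> (nat \<Rightarrow> ('r, 'p) module) \<Rightarrow> (nat \<Rightarrow> 'p \<Rightarrow> 'p) \<Rightarrow> ('p \<Rightarrow> 'm) \<Rightarrow> bool" where
  "projective_resolution R M P d e \<longleftrightarrow>
     (\<forall>n. projective R (P n)) \<and>
     (\<forall>n. is_hom R (P (Suc n)) (P n) (d n)) \<and>
     is_hom R (P 0) M e \<and>
     e ` carrier (P 0) = carrier M \<and>
     exact_at (P (Suc 0)) (P 0) M (d 0) e \<and>
     (\<forall>n. exact_at (P (Suc (Suc n))) (P (Suc n)) (P n) (d (Suc n)) (d n))"


section \<open>Tensor products\<close>

text \<open>
  \<open>M \<otimes>\<^sub>R N\<close> for a right module \<open>M\<close> and a left module \<open>N\<close>: the free abelian group on \<open>M \<times> N\<close> modulo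
  the usual relations. Over a commutative ring the two sides need not be distinguished.
\<close>

type_synonym ('m, 'n) tensors = "('m \<times> 'n \<Rightarrow>\<^sub>0 int) set"

definition tensor_relators :: "('r, 'x) ring_scheme \<Rightarrow> ('r, 'm, 'y) module_scheme
    \<Rightarrow> ('r, 'n, 'z) module_scheme \<Rightarrow> ('m \<times> 'n \<Rightarrow>\<^sub>0 int) set" where
  "tensor_relators R M N =
     {frag_of (x \<oplus>\<^bsub>M\<^esub> x', y) - frag_of (x, y) - frag_of (x', y) | x x' y.
        x \<in> carrier M \<and> x' \<in> carrier M \<and> y \<in> carrier N}
   \<union> {frag_of (x, y \<oplus>\<^bsub>N\<^esub> y') - frag_of (x, y) - frag_of (x, y') | x y y'.
        x \<in> carrier M \<and> y \<in> carrier N \<and> y' \<in> carrier N}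
   \<union> {frag_of (r \<odot>\<^bsub>M\<^esub> x, y) - frag_of (x, r \<odot>\<^bsub>N\<^esub> y) | r x y.
        r \<in> carrier R \<and> x \<in> carrier M \<and> y \<in> carrier N}"

definition tensor_relations :: "('r, 'x) ring_scheme \<Rightarrow> ('r, 'm, 'y) module_scheme
    \<Rightarrow> ('r, 'n, 'z) module_scheme \<Rightarrow> ('m \<times> 'n \<Rightarrow>\<^sub>0 int) set" where
  "tensor_relations R M N =
     generate (free_Abelian_group (carrier M \<times> carrier N)) (tensor_relators R M N)"

definition tensor :: "('r, 'x) ring_scheme \<Rightarrow> ('r, 'm, 'y) module_scheme
    \<Rightarrow> ('r, 'n, 'z) module_scheme \<Rightarrow> ('m, 'n) tensors ring" where
  "tensor R M N =
     (let Q = free_Abelian_group (carrier M \<times> carrier N) Mod tensor_relations R M N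
      in \<lparr>carrier = carrier Q, monoid.mult = undefined, one = undefined,
          ring.zero = \<one>\<^bsub>Q\<^esub>, add = monoid.mult Q\<rparr>)"

definition ptensor :: "('r, 'x) ring_scheme \<Rightarrow> ('r, 'm, 'y) module_scheme
    \<Rightarrow> ('r, 'n, 'z) module_scheme \<Rightarrow> 'm \<Rightarrow> 'n \<Rightarrow> ('m, 'n) tensors" where
  "ptensor R M N x y = tensor_relations R M N
     #>\<^bsub>free_Abelian_group (carrier M \<times> carrier N)\<^esub> frag_of (x, y)"

text \<open>
  \<open>tlift G f t = \<Sum>\<^sub>p f x\<^sub>p y\<^sub>p\<close> in \<open>G\<close> for \<open>t = \<Sum>\<^sub>p x\<^sub>p \<otimes> y\<^sub>p\<close>. The sum is taken over an arbitrary
  representative of \<open>t\<close>, on which it does not depend if \<open>f\<close> is balanced biadditive.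
\<close>

definition tlift :: "('g, 'x) ring_scheme \<Rightarrow> ('m \<Rightarrow> 'n \<Rightarrow> 'g) \<Rightarrow> ('m, 'n) tensors \<Rightarrow> 'g" where
  "tlift G f t = (let p = (SOME p. p \<in> t) in
     \<Oplus>\<^bsub>G\<^esub>z\<in>Poly_Mapping.keys p. [Poly_Mapping.lookup p z] \<cdot>\<^bsub>G\<^esub> f (fst z) (snd z))"

text \<open>
  Faithful flatness of a left module \<open>M\<close>: a sequence \<open>X \<rightarrow> Y \<rightarrow> Z\<close> of right modules is exact iff
  its tensor product with \<open>M\<close> is. The modules have elements of type \<open>'u\<close>; it suffices to test
  finitely generated modules, so the condition is the usual one as soon as \<open>'u\<close> is infinite and has
  at least the cardinality of \<open>R\<close>.
\<close>

definition faithfully_flat ::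
    "'u itself \<Rightarrow> ('r, 'x) ring_scheme \<Rightarrow> ('r, 'm, 'y) module_scheme \<Rightarrow> bool" where
  "faithfully_flat (_ :: 'u itself) R M \<longleftrightarrow> left_module R M \<and>
     (\<forall>(X :: ('r, 'u) module) (Y :: ('r, 'u) module) (Z :: ('r, 'u) module) f g.
        right_module R X \<and> right_module R Y \<and> right_module R Z
        \<and> is_hom (op_ring R) X Y f \<and> is_hom (op_ring R) Y Z g
        \<longrightarrow> (exact_at X Y Z f g \<longleftrightarrow>
             exact_at (tensor R X M) (tensor R Y M) (tensor R Z M)
               (tlift (tensor R Y M) (\<lambda>x m. ptensor R Y M (f x) m))
               (tlift (tensor R Z M) (\<lambda>y m. ptensor R Z M (g y) m))))"


section \<open>Algebras, Hopf algebras and comodule algebras\<close>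

locale assoc_algebra = module K X + X?: ring X
  for K :: "('k, 'x) ring_scheme" (structure) and X :: "('k, 'a, 'y) module_scheme" (structure) +
  assumes scale_mult_left:
      "\<lbrakk>c \<in> carrier K; x \<in> carrier X; y \<in> carrier X\<rbrakk>
        \<Longrightarrow> (c \<odot>\<^bsub>X\<^esub> x) \<otimes>\<^bsub>X\<^esub> y = c \<odot>\<^bsub>X\<^esub> (x \<otimes>\<^bsub>X\<^esub> y)"
    and scale_mult_right:
      "\<lbrakk>c \<in> carrier K; x \<in> carrier X; y \<in> carrier X\<rbrakk>
        \<Longrightarrow> x \<otimes>\<^bsub>X\<^esub> (c \<odot>\<^bsub>X\<^esub> y) = c \<odot>\<^bsub>X\<^esub> (x \<otimes>\<^bsub>X\<^esub> y)"

definition alg_hom :: "('k, 'x) ring_scheme \<Rightarrow> ('k, 'a, 'y) module_scheme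
    \<Rightarrow> ('k, 'b, 'z) module_scheme \<Rightarrow> ('a \<Rightarrow> 'b) \<Rightarrow> bool" where
  "alg_hom K X Y f \<longleftrightarrow> f \<in> ring_hom X Y \<and>
     (\<forall>c\<in>carrier K. \<forall>x\<in>carrier X. f (c \<odot>\<^bsub>X\<^esub> x) = c \<odot>\<^bsub>Y\<^esub> f x)"

definition alg_tensor :: "('k, 'x) ring_scheme \<Rightarrow> ('k, 'a, 'y) module_scheme
    \<Rightarrow> ('k, 'b, 'z) module_scheme \<Rightarrow> ('k, ('a, 'b) tensors) module" where
  "alg_tensor K X Y = (let T = tensor K X Y in
     \<lparr>carrier = carrier T,
      monoid.mult = (\<lambda>s t. tlift T (\<lambda>x y. tlift T (\<lambda>x' y'.
                ptensor K X Y (x \<otimes>\<^bsub>X\<^esub> x') (y \<otimes>\<^bsub>Y\<^esub> y')) t) s),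
      one = ptensor K X Y \<one>\<^bsub>X\<^esub> \<one>\<^bsub>Y\<^esub>,
      ring.zero = \<zero>\<^bsub>T\<^esub>, add = add T,
      smult = (\<lambda>c. tlift T (\<lambda>x y. ptensor K X Y (c \<odot>\<^bsub>X\<^esub> x) y))\<rparr>)"

definition env :: "('k, 'x) ring_scheme \<Rightarrow> ('k, 'b, 'y) module_scheme
    \<Rightarrow> ('k, ('b, 'b) tensors) module" where
  "env K R = alg_tensor K R (op_ring R)"

definition scalars :: "('k, 'x) ring_scheme \<Rightarrow> ('k, 'k) module" where
  "scalars K = \<lparr>carrier = carrier K, monoid.mult = monoid.mult K, one = \<one>\<^bsub>K\<^esub>,
     ring.zero = \<zero>\<^bsub>K\<^esub>, add = add K, smult = monoid.mult K\<rparr>"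

text \<open>
  In the coassociativity axioms \<open>(\<Delta> \<otimes> id) \<circ> \<Delta>\<close> is rebracketed to land in \<open>H \<otimes> (H \<otimes> H)\<close>.
\<close>

locale hopf_algebra = assoc_algebra K H
  for K :: "'k ring" and H :: "('k, 'h) module" +
  fixes comul :: "'h \<Rightarrow> ('h, 'h) tensors" and counit :: "'h \<Rightarrow> 'k" and antipode :: "'h \<Rightarrow> 'h"
  assumes field_K: "field K"
    and comul_hom: "alg_hom K H (alg_tensor K H H) comul"
    and counit_hom: "alg_hom K H (scalars K) counit"
    and antipode_hom: "is_hom K H H antipode"
    and coassoc: "h \<in> carrier H \<Longrightarrow>
      (let HH = alg_tensor K H H; T = tensor K H HH in
         tlift T (\<lambda>x y. tlift T (\<lambda>x' x''. ptensor K H HH x' (ptensor K H H x'' y)) (comul x)) (comul h)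
       = tlift T (\<lambda>x y. ptensor K H HH x (comul y)) (comul h))"
    and counit_left: "h \<in> carrier H \<Longrightarrow> tlift H (\<lambda>x y. counit x \<odot>\<^bsub>H\<^esub> y) (comul h) = h"
    and counit_right: "h \<in> carrier H \<Longrightarrow> tlift H (\<lambda>x y. counit y \<odot>\<^bsub>H\<^esub> x) (comul h) = h"
    and antipode_left: "h \<in> carrier H \<Longrightarrow>
      tlift H (\<lambda>x y. antipode x \<otimes>\<^bsub>H\<^esub> y) (comul h) = counit h \<odot>\<^bsub>H\<^esub> \<one>\<^bsub>H\<^esub>"
    and antipode_right: "h \<in> carrier H \<Longrightarrow>
      tlift H (\<lambda>x y. x \<otimes>\<^bsub>H\<^esub> antipode y) (comul h) = counit h \<odot>\<^bsub>H\<^esub> \<one>\<^bsub>H\<^esub>"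

locale comodule_algebra = hopf_algebra K H comul counit antipode + B: assoc_algebra K B
  for K :: "'k ring" and H :: "('k, 'h) module"
    and comul :: "'h \<Rightarrow> ('h, 'h) tensors" and counit :: "'h \<Rightarrow> 'k" and antipode :: "'h \<Rightarrow> 'h"
    and B :: "('k, 'b) module" +
  fixes coact :: "'b \<Rightarrow> ('b, 'h) tensors"
  assumes coact_hom: "alg_hom K B (alg_tensor K B H) coact"
    and coact_coassoc: "b \<in> carrier B \<Longrightarrow>
      (let HH = alg_tensor K H H; T = tensor K B HH in
         tlift T (\<lambda>x y. tlift T (\<lambda>x' x''. ptensor K B HH x' (ptensor K H H x'' y)) (coact x)) (coact b)
       = tlift T (\<lambda>x y. ptensor K B HH x (comul y)) (coact b))"
    and coact_counit: "b \<in> carrier B \<Longrightarrow> tlift B (\<lambda>x y. counit y \<odot>\<^bsub>B\<^esub> x) (coact b) = b"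

definition trivial_module :: "'k ring \<Rightarrow> ('h \<Rightarrow> 'k) \<Rightarrow> ('h, 'k) module" where
  "trivial_module K counit = mk_module K (\<lambda>h c. counit h \<otimes>\<^bsub>K\<^esub> c)"

record ('b, 'n) bimodule = "'n ring" +
  lact :: "'b \<Rightarrow> 'n \<Rightarrow> 'n"
  ract :: "'n \<Rightarrow> 'b \<Rightarrow> 'n"

text \<open>Bimodules over a \<open>K\<close>-algebra are \<open>K\<close>-central, i.e. they are modules over the enveloping algebra.\<close>

locale bimodule = B?: assoc_algebra K B + N?: abelian_group N
  for K :: "('k, 'x) ring_scheme" (structure) and B :: "('k, 'b, 'y) module_scheme" (structure)
    and N :: "('b, 'n, 'z) bimodule_scheme" (structure) +
  assumes left: "left_module B (mk_module N (lact N))"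
    and right: "right_module B (mk_module N (\<lambda>b n. ract N n b))"
    and lact_ract: "\<lbrakk>b \<in> carrier B; n \<in> carrier N; b' \<in> carrier B\<rbrakk>
      \<Longrightarrow> lact N b (ract N n b') = ract N (lact N b n) b'"
    and central: "\<lbrakk>c \<in> carrier K; n \<in> carrier N\<rbrakk>
      \<Longrightarrow> lact N (c \<odot>\<^bsub>B\<^esub> \<one>\<^bsub>B\<^esub>) n = ract N n (c \<odot>\<^bsub>B\<^esub> \<one>\<^bsub>B\<^esub>)"


section \<open>Galois extensions\<close>

text \<open>The locale has no assumptions; it only fixes the data entering the constructions.\<close>

locale galois_data =
  fixes K :: "'k ring" and H :: "('k, 'h) module" and comul :: "'h \<Rightarrow> ('h, 'h) tensors"
    and B :: "('k, 'b) module" and coact :: "'b \<Rightarrow> ('b, 'h) tensors"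
begin

definition A :: "('k, 'b) module" where
  "A = B\<lparr>carrier := {b \<in> carrier B. coact b = ptensor K B H b \<one>\<^bsub>H\<^esub>}\<rparr>"

abbreviation BB :: "('b, 'b) tensors ring" where
  "BB \<equiv> tensor A (right_reg B) (left_reg B)"

definition beta :: "('b, 'b) tensors \<Rightarrow> ('b, 'h) tensors" where
  "beta = tlift (tensor K B H)
     (\<lambda>b b'. tlift (tensor K B H) (\<lambda>x h. ptensor K B H (b \<otimes>\<^bsub>B\<^esub> x) h) (coact b'))"

definition H_Galois :: bool where
  "H_Galois \<longleftrightarrow> bij_betw beta (carrier BB) (carrier (tensor K B H))"

text \<open>
  Test modules have elements of the type of \<open>B\<^sup>e \<otimes> H\<close>: this type is infinite and at least as large
  as \<open>A\<close>, and sequences such as \<open>\<Gamma> \<rightarrow> B\<^sup>e \<rightarrow> B\<^sup>e \<otimes> H\<close> fit into it via \<open>t \<mapsto> t \<otimes> 1\<close>.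
\<close>

definition faithfully_flat_H_Galois :: bool where
  "faithfully_flat_H_Galois \<longleftrightarrow> H_Galois \<and>
     faithfully_flat TYPE((('b, 'b) tensors, 'h) tensors) A (left_reg B)"

text \<open>\<open>tau h = \<Sum>\<^sub>i l\<^sub>i(h) \<otimes>\<^sub>A r\<^sub>i(h)\<close>.\<close>

definition tau :: "'h \<Rightarrow> ('b, 'b) tensors" where
  "tau h = inv_into (carrier BB) beta (ptensor K B H \<one>\<^bsub>B\<^esub> h)"

abbreviation Be :: "('k, ('b, 'b) tensors) module" where
  "Be \<equiv> env K B"

abbreviation Ae :: "('k, ('b, 'b) tensors) module" where
  "Ae \<equiv> env K A"

abbreviation be :: "'b \<Rightarrow> 'b \<Rightarrow> ('b, 'b) tensors" where
  "be b b' \<equiv> ptensor K B (op_ring B) b b'"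

text \<open>The canonical map from \<open>A\<^sup>e\<close> to \<open>B\<^sup>e\<close>, whose image lies in \<open>\<Gamma>\<close>.\<close>

definition incl_e :: "('b, 'b) tensors \<Rightarrow> ('b, 'b) tensors" where
  "incl_e = tlift Be (\<lambda>a a'. be a a')"

definition codiag :: "('b, 'b) tensors \<Rightarrow> (('b, 'b) tensors, 'h) tensors" where
  "codiag = tlift (tensor K Be H) (\<lambda>b b'.
     tlift (tensor K Be H) (\<lambda>x h.
       tlift (tensor K Be H) (\<lambda>x' h'.
         ptensor K Be H (be x x') (h \<otimes>\<^bsub>H\<^esub> h')) (coact b')) (coact b))"

definition Gamma :: "('k, ('b, 'b) tensors) module" where
  "Gamma = Be\<lparr>carrier := {t \<in> carrier Be. codiag t = ptensor K Be H t \<one>\<^bsub>H\<^esub>}\<rparr>"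

definition A_Gamma :: "(('b, 'b) tensors, 'b) module" where
  "A_Gamma = mk_module A (\<lambda>t a. tlift B (\<lambda>x y. x \<otimes>\<^bsub>B\<^esub> a \<otimes>\<^bsub>B\<^esub> y) t)"


subsection \<open>The element \<open>\<Sum> l\<^sub>i(h\<^sub>1) \<otimes>\<^sub>A (r\<^sub>i(h\<^sub>1) \<otimes> l\<^sub>j(h\<^sub>2)) \<otimes>\<^sub>A r\<^sub>j(h\<^sub>2)\<close>\<close>

text \<open>
  \<open>(B \<otimes>\<^sub>A E) \<otimes>\<^sub>A B\<close> for \<open>E = B\<^sup>e\<close> or \<open>E = \<Gamma>\<close>, where \<open>E\<close> is an \<open>(A,A)\<close>-bimodule by
  left multiplication with \<open>A\<^sup>e\<close>, that is \<open>a(b \<otimes> b')a' = ab \<otimes> b'a'\<close>.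
\<close>

definition env_left :: "('k, ('b, 'b) tensors) module \<Rightarrow> ('b, ('b, 'b) tensors) module" where
  "env_left E = mk_module E (\<lambda>a t. be a \<one>\<^bsub>B\<^esub> \<otimes>\<^bsub>Be\<^esub> t)"

definition BE :: "('k, ('b, 'b) tensors) module \<Rightarrow> ('b, ('b, ('b, 'b) tensors) tensors) module" where
  "BE E = (let T = tensor A (right_reg B) (env_left E) in
     mk_module T (\<lambda>a. tlift T (\<lambda>x t.
       ptensor A (right_reg B) (env_left E) x (be \<one>\<^bsub>B\<^esub> a \<otimes>\<^bsub>Be\<^esub> t))))"

definition BEB :: "('k, ('b, 'b) tensors) module
    \<Rightarrow> (('b, ('b, 'b) tensors) tensors, 'b) tensors ring" where
  "BEB E = tensor A (BE E) (left_reg B)"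

definition ptensor3 :: "('k, ('b, 'b) tensors) module \<Rightarrow> 'b \<Rightarrow> ('b, 'b) tensors \<Rightarrow> 'b
    \<Rightarrow> (('b, ('b, 'b) tensors) tensors, 'b) tensors" where
  "ptensor3 E x t y =
     ptensor A (BE E) (left_reg B) (ptensor A (right_reg B) (env_left E) x t) y"

definition tlift3 :: "('g, 'z) ring_scheme \<Rightarrow> ('b \<Rightarrow> ('b, 'b) tensors \<Rightarrow> 'b \<Rightarrow> 'g)
    \<Rightarrow> (('b, ('b, 'b) tensors) tensors, 'b) tensors \<Rightarrow> 'g" where
  "tlift3 G f = tlift G (\<lambda>u y. tlift G (\<lambda>x t. f x t y) u)"

definition kappa :: "'h \<Rightarrow> (('b, ('b, 'b) tensors) tensors, 'b) tensors" where
  "kappa h = tlift (BEB Be) (\<lambda>h1 h2.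
     tlift (BEB Be) (\<lambda>l r.
       tlift (BEB Be) (\<lambda>l' r'. ptensor3 Be l (be r l') r') (tau h2)) (tau h1)) (comul h)"

text \<open>
  The same element in \<open>B \<otimes>\<^sub>A \<Gamma> \<otimes>\<^sub>A B\<close>, i.e. its (unique) preimage under the map induced by
  \<open>\<Gamma> \<subseteq> B\<^sup>e\<close>.
\<close>

definition kappa_Gamma :: "'h \<Rightarrow> (('b, ('b, 'b) tensors) tensors, 'b) tensors" where
  "kappa_Gamma h =
     inv_into (carrier (BEB Gamma)) (tlift3 (BEB Be) (\<lambda>x t y. ptensor3 Be x t y)) (kappa h)"


subsection \<open>The two functors and their \<open>H\<close>-actions\<close>

definition restr :: "(('b, 'b) tensors, 'm, 'z) module_scheme \<Rightarrow> (('b, 'b) tensors, 'm) module" where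
  "restr M = mk_module M (\<lambda>c m. incl_e c \<odot>\<^bsub>M\<^esub> m)"

definition env_module :: "('b, 'n) bimodule \<Rightarrow> (('b, 'b) tensors, 'n) module" where
  "env_module N = mk_module N (\<lambda>t n. tlift N (\<lambda>b b'. lact N b (ract N n b')) t)"

definition scale_N :: "('b, 'n) bimodule \<Rightarrow> 'k \<Rightarrow> 'n \<Rightarrow> 'n" where
  "scale_N N c n = lact N (c \<odot>\<^bsub>B\<^esub> \<one>\<^bsub>B\<^esub>) n"

text \<open>\<open>Hom\<^bsub>A\<^sup>e\<^esub>(M,N)\<close>, as a vector space and as a right \<open>H\<close>-module.\<close>

definition Hom_Ae :: "(('b, 'b) tensors, 'm) module \<Rightarrow> ('b, 'n) bimodule
    \<Rightarrow> ('k, 'm \<Rightarrow> 'n) module" where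
  "Hom_Ae M N = Hom_mod Ae (restr M) (restr (env_module N)) (scale_N N)"

definition Hom_Ae_H :: "(('b, 'b) tensors, 'm) module \<Rightarrow> ('b, 'n) bimodule
    \<Rightarrow> ('h, 'm \<Rightarrow> 'n) module" where
  "Hom_Ae_H M N = mk_module (Hom_Ae M N) (\<lambda>h f. \<lambda>m\<in>carrier M.
     tlift3 N (\<lambda>x t y. ract N (lact N x (f (t \<odot>\<^bsub>M\<^esub> m))) y) (kappa_Gamma h))"

text \<open>\<open>B\<^sup>e \<otimes>\<^bsub>A\<^sup>e\<^esub> M\<close>, as a left \<open>B\<^sup>e\<close>-module and as a left \<open>H\<close>-module.\<close>

abbreviation Be_right :: "(('b, 'b) tensors, ('b, 'b) tensors) module" where
  "Be_right \<equiv> mk_module Be (\<lambda>c t. t \<otimes>\<^bsub>Be\<^esub> incl_e c)"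

definition Ind :: "(('b, 'b) tensors, 'm) module
    \<Rightarrow> (('b, 'b) tensors, (('b, 'b) tensors, 'm) tensors) module" where
  "Ind M = (let T = tensor Ae Be_right (restr M) in
     mk_module T (\<lambda>c. tlift T (\<lambda>t m. ptensor Ae Be_right (restr M) (c \<otimes>\<^bsub>Be\<^esub> t) m)))"

definition Ind_H :: "(('b, 'b) tensors, 'm) module
    \<Rightarrow> ('h, (('b, 'b) tensors, 'm) tensors) module" where
  "Ind_H M = (let T = tensor Ae Be_right (restr M) in
     mk_module T (\<lambda>h. tlift T (\<lambda>s m. tlift T (\<lambda>b b'.
       tlift3 T (\<lambda>x t y. ptensor Ae Be_right (restr M)
         (be (b \<otimes>\<^bsub>B\<^esub> x) (y \<otimes>\<^bsub>B\<^esub> b')) (t \<odot>\<^bsub>M\<^esub> m)) (kappa_Gamma h)) s)))"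

definition tensor_Ind :: "('h, 'l) module \<Rightarrow> (('b, 'b) tensors, 'm) module
    \<Rightarrow> (('b, 'b) tensors, ('l, (('b, 'b) tensors, 'm) tensors) tensors) module" where
  "tensor_Ind L M = (let T = tensor H L (Ind_H M) in
     mk_module T (\<lambda>c. tlift T (\<lambda>l w. ptensor H L (Ind_H M) l (c \<odot>\<^bsub>Ind M\<^esub> w))))"

end


section \<open>Bicomplexes\<close>

definition bicomplex :: "('k, 'x) ring_scheme \<Rightarrow> (nat \<Rightarrow> nat \<Rightarrow> ('k, 'c) module)
    \<Rightarrow> (nat \<Rightarrow> nat \<Rightarrow> 'c \<Rightarrow> 'c) \<Rightarrow> (nat \<Rightarrow> nat \<Rightarrow> 'c \<Rightarrow> 'c) \<Rightarrow> bool" where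
  "bicomplex K C dh dv \<longleftrightarrow> (\<forall>i j. module K (C i j)
     \<and> is_hom K (C i j) (C (Suc i) j) (dh i j)
     \<and> is_hom K (C i j) (C i (Suc j)) (dv i j)
     \<and> (\<forall>f\<in>carrier (C i j).
          dh (Suc i) j (dh i j f) = \<zero>\<^bsub>C (Suc (Suc i)) j\<^esub>
        \<and> dv i (Suc j) (dv i j f) = \<zero>\<^bsub>C i (Suc (Suc j))\<^esub>
        \<and> dh i (Suc j) (dv i j f) \<oplus>\<^bsub>C (Suc i) (Suc j)\<^esub> dv (Suc i) j (dh i j f)
            = \<zero>\<^bsub>C (Suc i) (Suc j)\<^esub>))"

definition bicomplex_iso :: "('k, 'x) ring_scheme
    \<Rightarrow> (nat \<Rightarrow> nat \<Rightarrow> ('k, 'c) module) \<Rightarrow> (nat \<Rightarrow> nat \<Rightarrow> 'c \<Rightarrow> 'c) \<Rightarrow> (nat \<Rightarrow> nat \<Rightarrow> 'c \<Rightarrow> 'c)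
    \<Rightarrow> (nat \<Rightarrow> nat \<Rightarrow> ('k, 'd) module) \<Rightarrow> (nat \<Rightarrow> nat \<Rightarrow> 'd \<Rightarrow> 'd) \<Rightarrow> (nat \<Rightarrow> nat \<Rightarrow> 'd \<Rightarrow> 'd)
    \<Rightarrow> (nat \<Rightarrow> nat \<Rightarrow> 'c \<Rightarrow> 'd) \<Rightarrow> bool" where
  "bicomplex_iso K C dh dv D eh ev \<Phi> \<longleftrightarrow>
     bicomplex K C dh dv \<and> bicomplex K D eh ev \<and>
     (\<forall>i j. is_hom K (C i j) (D i j) (\<Phi> i j)
        \<and> bij_betw (\<Phi> i j) (carrier (C i j)) (carrier (D i j))
        \<and> (\<forall>f\<in>carrier (C i j).
             \<Phi> (Suc i) j (dh i j f) = eh i j (\<Phi> i j f)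
           \<and> \<Phi> i (Suc j) (dv i j f) = ev i j (\<Phi> i j f)))"

definition signed :: "('g, 'x) ring_scheme \<Rightarrow> nat \<Rightarrow> 'g \<Rightarrow> 'g" where
  "signed G n x = (if even n then x else \<ominus>\<^bsub>G\<^esub> x)"

context galois_data
begin

definition C_Hom :: "(nat \<Rightarrow> ('h, 'l) module) \<Rightarrow> (nat \<Rightarrow> (('b, 'b) tensors, 'm) module)
    \<Rightarrow> ('b, 'n) bimodule \<Rightarrow> nat \<Rightarrow> nat \<Rightarrow> ('k, 'l \<Rightarrow> 'm \<Rightarrow> 'n) module" where
  "C_Hom L P N i j = Hom_mod (op_ring H) (L i) (Hom_Ae_H (P j) N) (smult (Hom_Ae (P j) N))"

definition dh_Hom :: "(nat \<Rightarrow> ('h, 'l) module) \<Rightarrow> (nat \<Rightarrow> 'l \<Rightarrow> 'l)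
    \<Rightarrow> (nat \<Rightarrow> (('b, 'b) tensors, 'm) module) \<Rightarrow> ('b, 'n) bimodule
    \<Rightarrow> nat \<Rightarrow> nat \<Rightarrow> ('l \<Rightarrow> 'm \<Rightarrow> 'n) \<Rightarrow> 'l \<Rightarrow> 'm \<Rightarrow> 'n" where
  "dh_Hom L dL P N i j f =
     (\<lambda>l\<in>carrier (L (Suc i)). \<lambda>m\<in>carrier (P j). signed N (i + j) (f (dL i l) m))"

definition dv_Hom :: "(nat \<Rightarrow> ('h, 'l) module) \<Rightarrow> (nat \<Rightarrow> (('b, 'b) tensors, 'm) module)
    \<Rightarrow> (nat \<Rightarrow> 'm \<Rightarrow> 'm) \<Rightarrow> ('b, 'n) bimodule
    \<Rightarrow> nat \<Rightarrow> nat \<Rightarrow> ('l \<Rightarrow> 'm \<Rightarrow> 'n) \<Rightarrow> 'l \<Rightarrow> 'm \<Rightarrow> 'n" where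
  "dv_Hom L P dP N i j f =
     (\<lambda>l\<in>carrier (L i). \<lambda>m\<in>carrier (P (Suc j)). signed N j (f l (dP j m)))"

definition C_tensor :: "(nat \<Rightarrow> ('h, 'l) module) \<Rightarrow> (nat \<Rightarrow> (('b, 'b) tensors, 'm) module)
    \<Rightarrow> ('b, 'n) bimodule \<Rightarrow> nat \<Rightarrow> nat
    \<Rightarrow> ('k, ('l, (('b, 'b) tensors, 'm) tensors) tensors \<Rightarrow> 'n) module" where
  "C_tensor L P N i j = Hom_mod Be (tensor_Ind (L i) (P j)) (env_module N) (scale_N N)"

definition dh_tensor :: "(nat \<Rightarrow> ('h, 'l) module) \<Rightarrow> (nat \<Rightarrow> 'l \<Rightarrow> 'l)
    \<Rightarrow> (nat \<Rightarrow> (('b, 'b) tensors, 'm) module) \<Rightarrow> ('b, 'n) bimodule \<Rightarrow> nat \<Rightarrow> nat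
    \<Rightarrow> (('l, (('b, 'b) tensors, 'm) tensors) tensors \<Rightarrow> 'n)
    \<Rightarrow> ('l, (('b, 'b) tensors, 'm) tensors) tensors \<Rightarrow> 'n" where
  "dh_tensor L dL P N i j F = (\<lambda>w\<in>carrier (tensor_Ind (L (Suc i)) (P j)).
     signed N (i + j) (F (tlift (tensor_Ind (L i) (P j))
       (\<lambda>l v. ptensor H (L i) (Ind_H (P j)) (dL i l) v) w)))"

definition dv_tensor :: "(nat \<Rightarrow> ('h, 'l) module) \<Rightarrow> (nat \<Rightarrow> (('b, 'b) tensors, 'm) module)
    \<Rightarrow> (nat \<Rightarrow> 'm \<Rightarrow> 'm) \<Rightarrow> ('b, 'n) bimodule \<Rightarrow> nat \<Rightarrow> nat
    \<Rightarrow> (('l, (('b, 'b) tensors, 'm) tensors) tensors \<Rightarrow> 'n)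
    \<Rightarrow> ('l, (('b, 'b) tensors, 'm) tensors) tensors \<Rightarrow> 'n" where
  "dv_tensor L P dP N i j F = (\<lambda>w\<in>carrier (tensor_Ind (L i) (P (Suc j))).
     signed N j (F (tlift (tensor_Ind (L i) (P j))
       (\<lambda>l v. ptensor H (L i) (Ind_H (P j)) l
          (tlift (Ind (P j)) (\<lambda>t m. ptensor Ae Be_right (restr (P j)) t (dP j m)) v)) w)))"

end

end

theory Submission
  imports Defs
begin

text \<open>
  The isomorphism is \<open>f \<mapsto> (l \<otimes> (s \<otimes> m) \<mapsto> s \<cdot> f(l)(m))\<close>, where \<open>s \<cdot> n\<close> is the action of \<open>B\<^sup>e\<close> on the
  bimodule \<open>N\<close>, with inverse \<open>F \<mapsto> (l \<mapsto> m \<mapsto> F(l \<otimes> (1 \<otimes> m)))\<close>. It is the tensor-hom adjunction applied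
  twice: an \<open>A\<^sup>e\<close>-linear map \<open>M \<rightarrow> N\<close> extends uniquely to a \<open>B\<^sup>e\<close>-linear map \<open>B\<^sup>e \<otimes> M \<rightarrow> N\<close> (tensor product
  over \<open>A\<^sup>e\<close>), and under this extension the right \<open>H\<close>-action on the Hom space corresponds to the left
  \<open>H\<close>-action on the tensor product, since both insert the same element \<open>\<kappa>(h)\<close> of \<open>B \<otimes>\<^sub>A \<Gamma> \<otimes>\<^sub>A B\<close> (lemma
  \<open>extend_H\<close>). So an \<open>H\<close>-linear family \<open>l \<mapsto> f(l)\<close> is the same as a \<open>B\<^sup>e\<close>-linear map on the tensor product
  over \<open>H\<close>. The bijection is natural in both resolutions (lemmas \<open>adj_hpull\<close> and \<open>adj_vpull\<close>), hence
  commutes with the differentials, which are pullbacks up to a sign. The identities of the second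
  bicomplex are transported from those of the first along the bijection (\<open>bicomplex_iso_transport\<close>).

  The substance lies in the two \<open>H\<close>-actions being well defined. The element \<open>\<kappa>(h)\<close> is constructed in \<open>B
  \<otimes>\<^sub>A B\<^sup>e \<otimes>\<^sub>A B\<close>, but can act on \<open>\<Gamma>\<close>-modules only through a preimage in \<open>B \<otimes>\<^sub>A \<Gamma> \<otimes>\<^sub>A B\<close>. That such a
  preimage exists, and that nothing depends on its choice, follows from the isomorphism \<open>\<Gamma> \<otimes>\<^sub>A B \<cong>
  B\<^sup>e\<close>, \<open>t \<otimes> y \<mapsto> t \<cdot> y\<close>, with \<open>B\<close> acting on the second tensor factor (\<open>mu_bij\<close>). This is the structure
  theorem for Hopf modules, applied to \<open>B\<^sup>e\<close> with the codiagonal coaction, whose coinvariants are \<open>\<Gamma>\<close>.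
  Injectivity: \<open>m \<mapsto> \<Sum> m\<^sub>0 l(m\<^sub>1) \<otimes>\<^sub>A r(m\<^sub>1)\<close> is a left inverse up to the inclusion \<open>\<Gamma> \<otimes>\<^sub>A B \<rightarrow> B\<^sup>e \<otimes>\<^sub>A B\<close>, and
  this inclusion is injective because \<open>B\<close> is flat over \<open>A\<close>. Surjectivity: the element \<open>\<Sum> (b\<^sub>0 \<otimes> l(b\<^sub>1))
  \<otimes>\<^sub>A r(b\<^sub>1)\<close> is killed by the map whose kernel on \<open>B\<^sup>e\<close> is \<open>\<Gamma>\<close>, so flatness puts it into \<open>\<Gamma> \<otimes>\<^sub>A B\<close>, and it
  is mapped to \<open>b \<otimes> 1\<close>. Consequently \<open>B \<otimes>\<^sub>A \<Gamma> \<otimes>\<^sub>A B \<cong> B \<otimes>\<^sub>A B\<^sup>e\<close>, where \<open>\<kappa>(h)\<close> becomes \<open>\<Sum> l(h) \<otimes>\<^sub>A (r(h) \<otimes> 1)\<close>;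
  this is \<open>kappa_Gamma_sum\<close>. The identity \<open>a \<tau>(h) = \<tau>(h) a\<close> for \<open>a\<close> in \<open>A\<close> then yields \<open>a \<kappa>(h) a' = \<kappa>(h) (a
  \<otimes> a')\<close> (\<open>kappa_Gamma_central\<close>), which is precisely what makes the actions compatible with the
  tensor product over \<open>A\<^sup>e\<close> and with \<open>A\<^sup>e\<close>-linearity.

  Identities between Sweedler components are stated for sums \<open>tlift G f t\<close>, with \<open>f\<close> balanced and with
  values in an arbitrary abelian group \<open>G\<close>. Iterated sums then replace iterated tensor products, no
  rebracketing is needed, and all identities for the translation map \<open>\<tau>\<close> become consequences of two:
  \<open>tau_sum_coact_mult\<close>, which says \<open>\<beta>(\<tau>(h)) = 1 \<otimes> h\<close>, and \<open>galois_expand\<close>, which says \<open>\<beta>\<inverse>(\<beta>(x \<otimes> y)) = x \<otimes>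
  y\<close>.
\<close>

section \<open>Balanced maps and sums over tensors\<close>

definition add_hom :: "('a, 'x) ring_scheme \<Rightarrow> ('b, 'y) ring_scheme \<Rightarrow> ('a \<Rightarrow> 'b) \<Rightarrow> bool" where
  "add_hom G G' u \<longleftrightarrow> (\<forall>x\<in>carrier G. u x \<in> carrier G')
     \<and> (\<forall>x\<in>carrier G. \<forall>y\<in>carrier G. u (x \<oplus>\<^bsub>G\<^esub> y) = u x \<oplus>\<^bsub>G'\<^esub> u y)"

text \<open>
  The data from which a tensor product is formed: a group for each factor, and scalars that map it
  to itself, so that the relators lie in the free group. In this form \<open>B\<^sup>e \<otimes> M\<close> enters the tensor
  product over \<open>H\<close>.
\<close>

definition acted :: "('r, 'x) ring_scheme \<Rightarrow> ('r, 'm, 'y) module_scheme \<Rightarrow> bool" where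
  "acted R M \<longleftrightarrow> abelian_group M \<and> (\<forall>r\<in>carrier R. \<forall>x\<in>carrier M. r \<odot>\<^bsub>M\<^esub> x \<in> carrier M)"

definition balanced :: "('r, 'x) ring_scheme \<Rightarrow> ('r, 'm, 'y) module_scheme
    \<Rightarrow> ('r, 'n, 'z) module_scheme \<Rightarrow> ('g, 'w) ring_scheme \<Rightarrow> ('m \<Rightarrow> 'n \<Rightarrow> 'g) \<Rightarrow> bool" where
  "balanced R M N G f \<longleftrightarrow>
     (\<forall>x\<in>carrier M. \<forall>y\<in>carrier N. f x y \<in> carrier G)
   \<and> (\<forall>x\<in>carrier M. \<forall>x'\<in>carrier M. \<forall>y\<in>carrier N. f (x \<oplus>\<^bsub>M\<^esub> x') y = f x y \<oplus>\<^bsub>G\<^esub> f x' y)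
   \<and> (\<forall>x\<in>carrier M. \<forall>y\<in>carrier N. \<forall>y'\<in>carrier N. f x (y \<oplus>\<^bsub>N\<^esub> y') = f x y \<oplus>\<^bsub>G\<^esub> f x y')
   \<and> (\<forall>r\<in>carrier R. \<forall>x\<in>carrier M. \<forall>y\<in>carrier N. f (r \<odot>\<^bsub>M\<^esub> x) y = f x (r \<odot>\<^bsub>N\<^esub> y))"

lemma balancedI:
  assumes "\<And>x y. x \<in> carrier M \<Longrightarrow> y \<in> carrier N \<Longrightarrow> f x y \<in> carrier G"
    and "\<And>x x' y. x \<in> carrier M \<Longrightarrow> x' \<in> carrier M \<Longrightarrow> y \<in> carrier N \<Longrightarrow>
           f (x \<oplus>\<^bsub>M\<^esub> x') y = f x y \<oplus>\<^bsub>G\<^esub> f x' y"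
    and "\<And>x y y'. x \<in> carrier M \<Longrightarrow> y \<in> carrier N \<Longrightarrow> y' \<in> carrier N \<Longrightarrow>
           f x (y \<oplus>\<^bsub>N\<^esub> y') = f x y \<oplus>\<^bsub>G\<^esub> f x y'"
    and "\<And>r x y. r \<in> carrier R \<Longrightarrow> x \<in> carrier M \<Longrightarrow> y \<in> carrier N \<Longrightarrow>
           f (r \<odot>\<^bsub>M\<^esub> x) y = f x (r \<odot>\<^bsub>N\<^esub> y)"
  shows "balanced R M N G f"
  using assms unfolding balanced_def by blast

lemma balancedD:
  assumes "balanced R M N G f"
  shows "\<And>x y. x \<in> carrier M \<Longrightarrow> y \<in> carrier N \<Longrightarrow> f x y \<in> carrier G"
    and "\<And>x x' y. x \<in> carrier M \<Longrightarrow> x' \<in> carrier M \<Longrightarrow> y \<in> carrier N \<Longrightarrow>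
           f (x \<oplus>\<^bsub>M\<^esub> x') y = f x y \<oplus>\<^bsub>G\<^esub> f x' y"
    and "\<And>x y y'. x \<in> carrier M \<Longrightarrow> y \<in> carrier N \<Longrightarrow> y' \<in> carrier N \<Longrightarrow>
           f x (y \<oplus>\<^bsub>N\<^esub> y') = f x y \<oplus>\<^bsub>G\<^esub> f x y'"
    and "\<And>r x y. r \<in> carrier R \<Longrightarrow> x \<in> carrier M \<Longrightarrow> y \<in> carrier N \<Longrightarrow>
           f (r \<odot>\<^bsub>M\<^esub> x) y = f x (r \<odot>\<^bsub>N\<^esub> y)"
  using assms unfolding balanced_def by blast+

lemma balanced_cong:
  assumes "balanced R M N G f" and "acted R M" and "acted R N"
    and "\<And>x y. x \<in> carrier M \<Longrightarrow> y \<in> carrier N \<Longrightarrow> g x y = f x y"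
  shows "balanced R M N G g"
proof -
  interpret M: abelian_group M using assms by (simp add: acted_def)
  interpret N: abelian_group N using assms by (simp add: acted_def)
  show ?thesis
    using assms by (auto simp: balanced_def acted_def)
qed

lemma actedD:
  assumes "acted R M"
  shows "abelian_group M" "\<And>r x. r \<in> carrier R \<Longrightarrow> x \<in> carrier M \<Longrightarrow> r \<odot>\<^bsub>M\<^esub> x \<in> carrier M"
  using assms by (auto simp: acted_def)

lemma add_homD:
  assumes "add_hom G G' u"
  shows "\<And>x. x \<in> carrier G \<Longrightarrow> u x \<in> carrier G'"
    and "\<And>x y. x \<in> carrier G \<Longrightarrow> y \<in> carrier G \<Longrightarrow> u (x \<oplus>\<^bsub>G\<^esub> y) = u x \<oplus>\<^bsub>G'\<^esub> u y"
  using assms by (auto simp: add_hom_def)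

lemma add_homI:
  assumes "\<And>x. x \<in> carrier G \<Longrightarrow> u x \<in> carrier G'"
    and "\<And>x y. x \<in> carrier G \<Longrightarrow> y \<in> carrier G \<Longrightarrow> u (x \<oplus>\<^bsub>G\<^esub> y) = u x \<oplus>\<^bsub>G'\<^esub> u y"
  shows "add_hom G G' u"
  using assms by (auto simp: add_hom_def)

lemma add_hom_group_hom:
  assumes "add_hom G G' u" "abelian_group G" "abelian_group G'"
  shows "group_hom (add_monoid G) (add_monoid G') u"
proof -
  interpret G: abelian_group G by fact
  interpret G': abelian_group G' by fact
  show ?thesis
    using add_homD[OF assms(1)]
    by (auto simp: group_hom_def group_hom_axioms_def hom_def G.a_group G'.a_group)
qed

lemma add_hom_zero:
  assumes "add_hom G G' u" "abelian_group G" "abelian_group G'"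
  shows "u \<zero>\<^bsub>G\<^esub> = \<zero>\<^bsub>G'\<^esub>"
  using group_hom.hom_one[OF add_hom_group_hom[OF assms]] by simp

lemma add_hom_minus:
  assumes "add_hom G G' u" "abelian_group G" "abelian_group G'" "x \<in> carrier G"
  shows "u (\<ominus>\<^bsub>G\<^esub> x) = \<ominus>\<^bsub>G'\<^esub> u x"
  using group_hom.hom_inv[OF add_hom_group_hom[OF assms(1-3)]] assms(4)
  by (simp add: a_inv_def)

subsection \<open>Finite integer combinations\<close>

text \<open>
  The sum inside \<open>tlift\<close>, as a function of the formal combination. It is additive both in the
  combination and in the coefficient function.
\<close>

definition frag_sum :: "('g, 'w) ring_scheme \<Rightarrow> ('a \<Rightarrow> 'g) \<Rightarrow> ('a \<Rightarrow>\<^sub>0 int) \<Rightarrow> 'g" where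
  "frag_sum G f p = (\<Oplus>\<^bsub>G\<^esub>z\<in>Poly_Mapping.keys p. [Poly_Mapping.lookup p z] \<cdot>\<^bsub>G\<^esub> f z)"

context abelian_group
begin

lemma frag_sum_superset:
  assumes "finite S" "Poly_Mapping.keys p \<subseteq> S" "\<And>z. z \<in> S \<Longrightarrow> f z \<in> carrier G"
  shows "frag_sum G f p = (\<Oplus>z\<in>S. [Poly_Mapping.lookup p z] \<cdot> f z)"
  unfolding frag_sum_def
proof (rule add.finprod_mono_neutral_cong_left)
  show "[Poly_Mapping.lookup p i] \<cdot> f i = \<zero>" if "i \<in> S - Poly_Mapping.keys p" for i
    using that by (simp add: in_keys_iff add_pow_def int_pow_0)
qed (use assms in auto)

lemma frag_sum_closed:
  assumes "\<And>z. z \<in> Poly_Mapping.keys p \<Longrightarrow> f z \<in> carrier G"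
  shows "frag_sum G f p \<in> carrier G"
  unfolding frag_sum_def using assms by (intro finsum_closed) (auto simp: add.int_pow_closed)

lemma frag_sum_add:
  assumes "Poly_Mapping.keys p \<subseteq> S" "Poly_Mapping.keys q \<subseteq> S" "\<And>z. z \<in> S \<Longrightarrow> f z \<in> carrier G"
  shows "frag_sum G f (p + q) = frag_sum G f p \<oplus> frag_sum G f q"
proof -
  let ?S = "Poly_Mapping.keys p \<union> Poly_Mapping.keys q"
  have f: "\<And>z. z \<in> ?S \<Longrightarrow> f z \<in> carrier G" using assms by blast
  have "frag_sum G f (p + q) = (\<Oplus>z\<in>?S. [Poly_Mapping.lookup (p + q) z] \<cdot> f z)"
    by (rule frag_sum_superset) (use f in \<open>auto dest: subsetD[OF keys_add]\<close>)
  also have "\<dots> = (\<Oplus>z\<in>?S. [Poly_Mapping.lookup p z] \<cdot> f z \<oplus> [Poly_Mapping.lookup q z] \<cdot> f z)"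
    by (rule finsum_cong') (use f in \<open>auto simp: lookup_add add.int_pow_mult\<close>)
  also have "\<dots> = (\<Oplus>z\<in>?S. [Poly_Mapping.lookup p z] \<cdot> f z) \<oplus> (\<Oplus>z\<in>?S. [Poly_Mapping.lookup q z] \<cdot> f z)"
    by (rule finsum_addf) (use f in auto)
  also have "\<dots> = frag_sum G f p \<oplus> frag_sum G f q"
    using f by (subst (1 2) frag_sum_superset[where S = ?S]) auto
  finally show ?thesis .
qed

lemma frag_sum_zero [simp]: "frag_sum G f 0 = \<zero>"
  by (simp add: frag_sum_def)

lemma frag_sum_of: "f z \<in> carrier G \<Longrightarrow> frag_sum G f (frag_of z) = f z"
  by (simp add: frag_sum_def add.finprod_singleton)

lemma frag_sum_uminus:
  assumes "\<And>z. z \<in> Poly_Mapping.keys p \<Longrightarrow> f z \<in> carrier G"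
  shows "frag_sum G f (- p) = \<ominus> frag_sum G f p"
proof -
  have "frag_sum G f p \<oplus> frag_sum G f (- p) = frag_sum G f (p + - p)"
    by (rule frag_sum_add[symmetric, where S = "Poly_Mapping.keys p"]) (use assms in auto)
  then show ?thesis
    using frag_sum_closed[of p f] frag_sum_closed[of "- p" f] assms
    by (metis add.inv_closed add.inv_equality frag_sum_zero keys_minus local.add.m_comm right_minus)
qed

lemma frag_sum_cong:
  assumes "\<And>z. z \<in> Poly_Mapping.keys p \<Longrightarrow> g z \<in> carrier G"
    and "\<And>z. z \<in> Poly_Mapping.keys p \<Longrightarrow> f z = g z"
  shows "frag_sum G f p = frag_sum G g p"
  unfolding frag_sum_def by (rule finsum_cong') (use assms in auto)

lemma frag_sum_add_fun:
  assumes "\<And>z. z \<in> Poly_Mapping.keys p \<Longrightarrow> f z \<in> carrier G"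
    and "\<And>z. z \<in> Poly_Mapping.keys p \<Longrightarrow> g z \<in> carrier G"
  shows "frag_sum G (\<lambda>z. f z \<oplus> g z) p = frag_sum G f p \<oplus> frag_sum G g p"
proof -
  have "frag_sum G (\<lambda>z. f z \<oplus> g z) p
      = (\<Oplus>z\<in>Poly_Mapping.keys p. [Poly_Mapping.lookup p z] \<cdot> f z \<oplus> [Poly_Mapping.lookup p z] \<cdot> g z)"
    unfolding frag_sum_def
    by (rule finsum_cong') (use assms in \<open>auto simp: add.int_pow_distrib\<close>)
  also have "\<dots> = frag_sum G f p \<oplus> frag_sum G g p"
    unfolding frag_sum_def by (rule finsum_addf) (use assms in auto)
  finally show ?thesis .
qed

end

lemma frag_sum_hom:
  assumes u: "add_hom G G' u" "abelian_group G" "abelian_group G'"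
    and f: "\<And>z. z \<in> Poly_Mapping.keys p \<Longrightarrow> f z \<in> carrier G"
  shows "u (frag_sum G f p) = frag_sum G' (\<lambda>z. u (f z)) p"
proof -
  interpret G: abelian_group G by fact
  interpret G': abelian_group G' by fact
  interpret u: group_hom "add_monoid G" "add_monoid G'" u by (rule add_hom_group_hom[OF u])
  have uc: "\<And>x. x \<in> carrier G \<Longrightarrow> u x \<in> carrier G'" using u by (simp add: add_hom_def)
  have "u (\<Oplus>\<^bsub>G\<^esub>z\<in>S. [c z] \<cdot>\<^bsub>G\<^esub> f z) = (\<Oplus>\<^bsub>G'\<^esub>z\<in>S. [c z] \<cdot>\<^bsub>G'\<^esub> u (f z))"
    if "finite S" "S \<subseteq> Poly_Mapping.keys p" for S and c :: "'e \<Rightarrow> int"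
    using that
  proof (induction S rule: finite_induct)
    case empty
    then show ?case using u.hom_one by simp
  next
    case (insert z S)
    have 1: "u ([c z] \<cdot>\<^bsub>G\<^esub> f z) = [c z] \<cdot>\<^bsub>G'\<^esub> u (f z)"
      using u.hom_int_pow[of "f z" "c z"] f insert by (simp add: add_pow_def)
    have fc: "\<And>z'. z' \<in> insert z S \<Longrightarrow> f z' \<in> carrier G" using insert f by blast
    have "(\<Oplus>\<^bsub>G\<^esub>z\<in>S. [c z] \<cdot>\<^bsub>G\<^esub> f z) \<in> carrier G"
      by (rule G.finsum_closed) (use fc in auto)
    then show ?case
      using insert fc uc 1 add_homD[OF u(1)]
      by (subst G.finsum_insert) (auto simp: G'.finsum_insert)
  qed
  from this[of "Poly_Mapping.keys p"] show ?thesis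
    unfolding frag_sum_def by simp
qed

lemma frag_sum_swap:
  assumes G: "abelian_group G"
    and f: "\<And>y z. y \<in> Poly_Mapping.keys p \<Longrightarrow> z \<in> Poly_Mapping.keys q \<Longrightarrow> f y z \<in> carrier G"
  shows "frag_sum G (\<lambda>y. frag_sum G (f y) q) p = frag_sum G (\<lambda>z. frag_sum G (\<lambda>y. f y z) p) q"
proof -
  interpret G: abelian_group G by fact
  have "frag_sum G (\<lambda>y. frag_sum G (f y) q) p
     = (\<Oplus>\<^bsub>G\<^esub>z\<in>S. [c z] \<cdot>\<^bsub>G\<^esub> frag_sum G (\<lambda>y. f y z) p)"
    if "finite S" "S \<subseteq> Poly_Mapping.keys q"
      "\<And>y. y \<in> Poly_Mapping.keys p \<Longrightarrow> frag_sum G (f y) q = (\<Oplus>\<^bsub>G\<^esub>z\<in>S. [c z] \<cdot>\<^bsub>G\<^esub> f y z)"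
    for S and c :: "_ \<Rightarrow> int"
  proof -
    have "frag_sum G (\<lambda>y. \<Oplus>\<^bsub>G\<^esub>z\<in>S. [c z] \<cdot>\<^bsub>G\<^esub> f y z) p
       = (\<Oplus>\<^bsub>G\<^esub>z\<in>S. [c z] \<cdot>\<^bsub>G\<^esub> frag_sum G (\<lambda>y. f y z) p)"
      using that(1,2)
    proof (induction S rule: finite_induct)
      case empty
      then show ?case by (simp add: frag_sum_def G.finsum_zero)
    next
      case (insert z S)
      have fc: "\<And>y z'. y \<in> Poly_Mapping.keys p \<Longrightarrow> z' \<in> insert z S \<Longrightarrow> f y z' \<in> carrier G"
        using insert f by blast
      have 1: "frag_sum G (\<lambda>y. [c z] \<cdot>\<^bsub>G\<^esub> f y z) p = [c z] \<cdot>\<^bsub>G\<^esub> frag_sum G (\<lambda>y. f y z) p"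
      proof -
        have "add_hom G G (\<lambda>x. [c z] \<cdot>\<^bsub>G\<^esub> x)"
          by (rule add_homI) (auto simp: G.add.int_pow_distrib)
        from frag_sum_hom[OF this G G, of p "\<lambda>y. f y z"] show ?thesis using fc by simp
      qed
      have "frag_sum G (\<lambda>y. \<Oplus>\<^bsub>G\<^esub>z\<in>insert z S. [c z] \<cdot>\<^bsub>G\<^esub> f y z) p
          = frag_sum G (\<lambda>y. [c z] \<cdot>\<^bsub>G\<^esub> f y z \<oplus>\<^bsub>G\<^esub> (\<Oplus>\<^bsub>G\<^esub>z\<in>S. [c z] \<cdot>\<^bsub>G\<^esub> f y z)) p"
        by (rule G.frag_sum_cong)
          (use insert fc in \<open>auto intro!: G.finsum_insert G.finsum_closed G.add.m_closed\<close>)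
      also have "\<dots> = frag_sum G (\<lambda>y. [c z] \<cdot>\<^bsub>G\<^esub> f y z) p
             \<oplus>\<^bsub>G\<^esub> frag_sum G (\<lambda>y. \<Oplus>\<^bsub>G\<^esub>z\<in>S. [c z] \<cdot>\<^bsub>G\<^esub> f y z) p"
        by (rule G.frag_sum_add_fun) (use fc in \<open>auto intro!: G.finsum_closed\<close>)
      also have "\<dots> = (\<Oplus>\<^bsub>G\<^esub>z\<in>insert z S. [c z] \<cdot>\<^bsub>G\<^esub> frag_sum G (\<lambda>y. f y z) p)"
        using insert fc 1
        by (subst G.finsum_insert) (auto intro!: G.frag_sum_closed G.add.int_pow_closed)
      finally show ?case .
    qed
    moreover have "frag_sum G (\<lambda>y. frag_sum G (f y) q) p
        = frag_sum G (\<lambda>y. \<Oplus>\<^bsub>G\<^esub>z\<in>S. [c z] \<cdot>\<^bsub>G\<^esub> f y z) p"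
      by (rule G.frag_sum_cong) (use that f in \<open>auto intro!: G.finsum_closed\<close>)
    ultimately show ?thesis by simp
  qed
  from this[of "Poly_Mapping.keys q" "Poly_Mapping.lookup q"] show ?thesis
    by (simp add: frag_sum_def)
qed

subsection \<open>The tensor product\<close>

lemma tlift_frag_sum: "tlift G f t = frag_sum G (\<lambda>z. f (fst z) (snd z)) (SOME p. p \<in> t)"
  by (simp add: tlift_def frag_sum_def Let_def)

lemma relators_subset:
  assumes "acted R M" "acted R N"
  shows "tensor_relators R M N \<subseteq> carrier (free_Abelian_group (carrier M \<times> carrier N))"
proof -
  interpret M: abelian_group M using assms by (simp add: acted_def)
  interpret N: abelian_group N using assms by (simp add: acted_def)
  have *: "Poly_Mapping.keys (frag_of z - frag_of z' - frag_of z'') \<subseteq> {z, z', z''}"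
    for z z' z'' :: "'c \<times> 'e"
    using keys_diff[of "frag_of z - frag_of z'" "frag_of z''"] keys_diff[of "frag_of z" "frag_of z'"]
    by auto
  have **: "Poly_Mapping.keys (frag_of z - frag_of z') \<subseteq> {z, z'}"
    for z z' :: "'c \<times> 'e"
    using keys_diff[of "frag_of z" "frag_of z'"] by auto
  show ?thesis
    using assms unfolding tensor_relators_def
    by (auto simp: acted_def dest!: subsetD[OF *] subsetD[OF **])
qed

locale tensor_data =
  fixes R :: "('r, 'x) ring_scheme" and M :: "('r, 'm, 'y) module_scheme"
    and N :: "('r, 'n, 'z) module_scheme"
  assumes M: "acted R M" and N: "acted R N"
begin

abbreviation "FG \<equiv> free_Abelian_group (carrier M \<times> carrier N)"
abbreviation "RL \<equiv> tensor_relations R M N"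

sublocale M: abelian_group M using M by (simp add: acted_def)
sublocale N: abelian_group N using N by (simp add: acted_def)
sublocale FG: comm_group FG by (rule abelian_free_Abelian_group)

lemma RL_subgroup: "subgroup RL FG"
  unfolding tensor_relations_def
  by (rule FG.generate_is_subgroup[OF relators_subset[OF M N]])

sublocale RL: normal RL FG
  using FG.normal_iff_subgroup RL_subgroup by blast

lemma carrier_tensor: "carrier (tensor R M N) = (\<lambda>p. RL #>\<^bsub>FG\<^esub> p) ` carrier FG"
  by (simp add: tensor_def Let_def carrier_FactGroup)

lemma coset_add:
  assumes "p \<in> carrier FG" "q \<in> carrier FG"
  shows "(RL #>\<^bsub>FG\<^esub> p) \<oplus>\<^bsub>tensor R M N\<^esub> (RL #>\<^bsub>FG\<^esub> q) = RL #>\<^bsub>FG\<^esub> (p + q)"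
  using RL.rcos_sum[of p q] assms by (simp add: tensor_def Let_def)

lemma abelian_group_tensor: "abelian_group (tensor R M N)"
proof -
  have cg: "comm_group (FG Mod RL)"
    by (rule FG.abelian_FactGroup[OF RL_subgroup])
  have eq: "add_monoid (tensor R M N) = FG Mod RL"
    by (simp add: tensor_def Let_def FactGroup_def)
  have "comm_group (add_monoid (tensor R M N))"
    unfolding eq by (rule cg)
  then show ?thesis
    unfolding abelian_group_def abelian_group_axioms_def abelian_monoid_def
    by (simp add: comm_group_def)
qed

sublocale T: abelian_group "tensor R M N" by (rule abelian_group_tensor)

lemma rep:
  assumes "t \<in> carrier (tensor R M N)"
  shows "(SOME p. p \<in> t) \<in> carrier FG" "RL #>\<^bsub>FG\<^esub> (SOME p. p \<in> t) = t"
proof -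
  obtain p where p: "p \<in> carrier FG" "t = RL #>\<^bsub>FG\<^esub> p"
    using assms by (auto simp: carrier_tensor)
  then have "p \<in> t" using FG.rcos_self[OF _ RL_subgroup] by blast
  then have q: "(SOME p. p \<in> t) \<in> t" by (rule someI)
  then show "(SOME p. p \<in> t) \<in> carrier FG"
    using p FG.r_coset_subset_G RL.subset by blast
  show "RL #>\<^bsub>FG\<^esub> (SOME p. p \<in> t) = t"
    using FG.repr_independence[of "SOME p. p \<in> t" RL p] p q RL_subgroup by simp
qed

lemma ptensor_closed [simp, intro]:
  assumes "x \<in> carrier M" "y \<in> carrier N"
  shows "ptensor R M N x y \<in> carrier (tensor R M N)"
  using assms unfolding ptensor_def carrier_tensor by (intro imageI) auto

lemma coset_eqI:
  assumes "p \<in> carrier FG" "q \<in> carrier FG" "p - q \<in> RL"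
  shows "RL #>\<^bsub>FG\<^esub> p = RL #>\<^bsub>FG\<^esub> q"
proof -
  have "p \<in> RL #>\<^bsub>FG\<^esub> q"
    unfolding r_coset_def using assms(3) by (auto intro!: bexI[of _ "p - q"])
  then show ?thesis
    using FG.repr_independence[OF _ _ RL_subgroup] assms by blast
qed

lemma relator_in_RL: "z \<in> tensor_relators R M N \<Longrightarrow> z \<in> RL"
  unfolding tensor_relations_def by (rule generate.incl)

lemma ptensor_balanced: "balanced R M N (tensor R M N) (ptensor R M N)"
proof (rule balancedI)
  fix x x' y assume *: "x \<in> carrier M" "x' \<in> carrier M" "y \<in> carrier N"
  have k: "frag_of (x, y) + frag_of (x', y) \<in> carrier FG"
    using * keys_add[of "frag_of (x,y)" "frag_of (x',y)"] by auto
  show "ptensor R M N (x \<oplus>\<^bsub>M\<^esub> x') y = ptensor R M N x y \<oplus>\<^bsub>tensor R M N\<^esub> ptensor R M N x' y"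
    unfolding ptensor_def using * k
    by (subst coset_add, simp, simp, intro coset_eqI relator_in_RL)
      (auto simp: tensor_relators_def diff_diff_eq[symmetric])
next
  fix x y y' assume *: "x \<in> carrier M" "y \<in> carrier N" "y' \<in> carrier N"
  have k: "frag_of (x, y) + frag_of (x, y') \<in> carrier FG"
    using * keys_add[of "frag_of (x,y)" "frag_of (x,y')"] by auto
  show "ptensor R M N x (y \<oplus>\<^bsub>N\<^esub> y') = ptensor R M N x y \<oplus>\<^bsub>tensor R M N\<^esub> ptensor R M N x y'"
    unfolding ptensor_def using * k
    by (subst coset_add, simp, simp, intro coset_eqI relator_in_RL)
      (auto simp: tensor_relators_def diff_diff_eq[symmetric])
next
  fix r x y assume *: "r \<in> carrier R" "x \<in> carrier M" "y \<in> carrier N"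
  show "ptensor R M N (r \<odot>\<^bsub>M\<^esub> x) y = ptensor R M N x (r \<odot>\<^bsub>N\<^esub> y)"
    unfolding ptensor_def using * M N
    by (intro coset_eqI relator_in_RL) (auto simp: tensor_relators_def acted_def)
qed auto

lemmas ptensor_add_left = balancedD(2)[OF ptensor_balanced]
lemmas ptensor_add_right = balancedD(3)[OF ptensor_balanced]
lemmas ptensor_smult = balancedD(4)[OF ptensor_balanced]

lemma ptensor_minus:
  assumes "x \<in> carrier M" "y \<in> carrier N"
  shows "ptensor R M N (\<ominus>\<^bsub>M\<^esub> x) y = \<ominus>\<^bsub>tensor R M N\<^esub> ptensor R M N x y"
  using add_hom_minus[of M "tensor R M N" "\<lambda>x. ptensor R M N x y" x] assms
  by (simp add: add_hom_def ptensor_add_left M.abelian_group_axioms T.abelian_group_axioms)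

lemma ptensor_zero:
  assumes "y \<in> carrier N"
  shows "ptensor R M N \<zero>\<^bsub>M\<^esub> y = \<zero>\<^bsub>tensor R M N\<^esub>"
  using add_hom_zero[of M "tensor R M N" "\<lambda>x. ptensor R M N x y"] assms
  by (simp add: add_hom_def ptensor_add_left M.abelian_group_axioms T.abelian_group_axioms)

lemma tensor_induct [consumes 1, case_names pure add]:
  assumes "t \<in> carrier (tensor R M N)"
    and pure: "\<And>x y. x \<in> carrier M \<Longrightarrow> y \<in> carrier N \<Longrightarrow> P (ptensor R M N x y)"
    and add: "\<And>s t. s \<in> carrier (tensor R M N) \<Longrightarrow> t \<in> carrier (tensor R M N) \<Longrightarrow> P s \<Longrightarrow> P t \<Longrightarrow>
      P (s \<oplus>\<^bsub>tensor R M N\<^esub> t)"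
  shows "P t"
proof -
  obtain p where p: "Poly_Mapping.keys p \<subseteq> carrier M \<times> carrier N" "t = RL #>\<^bsub>FG\<^esub> p"
    using assms(1) by (auto simp: carrier_tensor)
  have "P (RL #>\<^bsub>FG\<^esub> p) \<and> P (RL #>\<^bsub>FG\<^esub> (- p))"
    using p(1)
  proof (induction p rule: free_Abelian_group_induct[consumes 1])
    case 1
    have "P (ptensor R M N \<zero>\<^bsub>M\<^esub> \<zero>\<^bsub>N\<^esub>)" by (rule pure) auto
    moreover have "ptensor R M N \<zero>\<^bsub>M\<^esub> \<zero>\<^bsub>N\<^esub> = RL #>\<^bsub>FG\<^esub> 0"
      using ptensor_zero[of "\<zero>\<^bsub>N\<^esub>"] FG.coset_mult_one RL.subset
      by (simp add: tensor_def Let_def)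
    ultimately show ?case by simp
  next
    case (2 x y)
    have "(RL #>\<^bsub>FG\<^esub> x) \<oplus>\<^bsub>tensor R M N\<^esub> (RL #>\<^bsub>FG\<^esub> (- y)) = RL #>\<^bsub>FG\<^esub> (x - y)"
      "(RL #>\<^bsub>FG\<^esub> (- x)) \<oplus>\<^bsub>tensor R M N\<^esub> (RL #>\<^bsub>FG\<^esub> y) = RL #>\<^bsub>FG\<^esub> (- (x - y))"
      using 2 by (auto simp: coset_add)
    moreover have "RL #>\<^bsub>FG\<^esub> x \<in> carrier (tensor R M N)" "RL #>\<^bsub>FG\<^esub> y \<in> carrier (tensor R M N)"
       "RL #>\<^bsub>FG\<^esub> (- x) \<in> carrier (tensor R M N)" "RL #>\<^bsub>FG\<^esub> (- y) \<in> carrier (tensor R M N)"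
      using 2 by (auto simp: carrier_tensor)
    ultimately show ?case using 2 add by metis
  next
    case (3 z)
    obtain x y where z: "z = (x, y)" "x \<in> carrier M" "y \<in> carrier N" using 3 by auto
    have "RL #>\<^bsub>FG\<^esub> (- frag_of z) = ptensor R M N (\<ominus>\<^bsub>M\<^esub> x) y"
    proof -
      have c: "RL #>\<^bsub>FG\<^esub> (- frag_of z) \<in> carrier (tensor R M N)"
        using 3 by (auto simp: carrier_tensor)
      have "RL #>\<^bsub>FG\<^esub> (0::_) = \<zero>\<^bsub>tensor R M N\<^esub>"
        using FG.coset_mult_one RL.subset by (simp add: tensor_def Let_def)
      then have "(RL #>\<^bsub>FG\<^esub> (- frag_of z)) \<oplus>\<^bsub>tensor R M N\<^esub> ptensor R M N x y = \<zero>\<^bsub>tensor R M N\<^esub>"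
        unfolding ptensor_def using 3 z by (subst coset_add) auto
      then show ?thesis
        using T.minus_equality[OF _ _ c] z ptensor_minus by auto
    qed
    then show ?case
      using pure[of x y] pure[of "\<ominus>\<^bsub>M\<^esub> x" y] z by (simp add: ptensor_def)
  qed
  then show ?thesis using p by simp
qed

lemma keys_rep:
  assumes "t \<in> carrier (tensor R M N)" "z \<in> Poly_Mapping.keys (SOME p. p \<in> t)"
  shows "fst z \<in> carrier M" "snd z \<in> carrier N"
  using rep(1)[OF assms(1)] assms(2) by (auto dest: subsetD)

context
  fixes G :: "('g, 'w) ring_scheme"
  assumes G: "abelian_group G"
begin

interpretation G: abelian_group G by (rule G)

lemma tlift_closed:
  assumes "t \<in> carrier (tensor R M N)"
    and "\<And>x y. x \<in> carrier M \<Longrightarrow> y \<in> carrier N \<Longrightarrow> f x y \<in> carrier G"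
  shows "tlift G f t \<in> carrier G"
  unfolding tlift_frag_sum using assms keys_rep by (intro G.frag_sum_closed) auto

lemma tlift_cong:
  assumes "t \<in> carrier (tensor R M N)"
    and "\<And>x y. x \<in> carrier M \<Longrightarrow> y \<in> carrier N \<Longrightarrow> g x y \<in> carrier G"
    and "\<And>x y. x \<in> carrier M \<Longrightarrow> y \<in> carrier N \<Longrightarrow> f x y = g x y"
  shows "tlift G f t = tlift G g t"
  unfolding tlift_frag_sum using assms keys_rep by (intro G.frag_sum_cong) auto

lemma tlift_add_fun:
  assumes "t \<in> carrier (tensor R M N)"
    and "\<And>x y. x \<in> carrier M \<Longrightarrow> y \<in> carrier N \<Longrightarrow> f x y \<in> carrier G"
    and "\<And>x y. x \<in> carrier M \<Longrightarrow> y \<in> carrier N \<Longrightarrow> g x y \<in> carrier G"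
  shows "tlift G (\<lambda>x y. f x y \<oplus>\<^bsub>G\<^esub> g x y) t = tlift G f t \<oplus>\<^bsub>G\<^esub> tlift G g t"
  unfolding tlift_frag_sum using assms keys_rep by (intro G.frag_sum_add_fun) auto

lemma tlift_split:
  assumes "t \<in> carrier (tensor R M N)"
    and "\<And>x y. x \<in> carrier M \<Longrightarrow> y \<in> carrier N \<Longrightarrow> f x y \<in> carrier G"
    and "\<And>x y. x \<in> carrier M \<Longrightarrow> y \<in> carrier N \<Longrightarrow> g x y \<in> carrier G"
    and "\<And>x y. x \<in> carrier M \<Longrightarrow> y \<in> carrier N \<Longrightarrow> h x y = f x y \<oplus>\<^bsub>G\<^esub> g x y"
  shows "tlift G h t = tlift G f t \<oplus>\<^bsub>G\<^esub> tlift G g t"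
  using tlift_cong[of t "\<lambda>x y. f x y \<oplus>\<^bsub>G\<^esub> g x y" h] assms by (simp add: tlift_add_fun)

lemma tlift_hom:
  assumes "add_hom G G' u" "abelian_group G'" "t \<in> carrier (tensor R M N)"
    and "\<And>x y. x \<in> carrier M \<Longrightarrow> y \<in> carrier N \<Longrightarrow> f x y \<in> carrier G"
  shows "u (tlift G f t) = tlift G' (\<lambda>x y. u (f x y)) t"
  unfolding tlift_frag_sum using assms G keys_rep by (intro frag_sum_hom) auto

text \<open>
  A balanced map sends every relator to zero, so the sum that defines \<open>tlift\<close> may be computed with
  any representative of a tensor.
\<close>

lemma frag_sum_relation:
  assumes f: "balanced R M N G f" and "p \<in> RL"
  shows "frag_sum G (\<lambda>z. f (fst z) (snd z)) p = \<zero>\<^bsub>G\<^esub>"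
proof -
  let ?f = "\<lambda>z. f (fst z) (snd z)"
  note fD = balancedD[OF f]
  have fc: "\<And>z. z \<in> carrier M \<times> carrier N \<Longrightarrow> ?f z \<in> carrier G" using fD by auto
  have add: "frag_sum G ?f (p + q) = frag_sum G ?f p \<oplus>\<^bsub>G\<^esub> frag_sum G ?f q"
    if "Poly_Mapping.keys p \<subseteq> carrier M \<times> carrier N" "Poly_Mapping.keys q \<subseteq> carrier M \<times> carrier N" for p q
    using that fc by (rule G.frag_sum_add)
  have um: "frag_sum G ?f (- p) = \<ominus>\<^bsub>G\<^esub> frag_sum G ?f p"
    if "Poly_Mapping.keys p \<subseteq> carrier M \<times> carrier N" for p
    using that fc by (intro G.frag_sum_uminus) auto
  have diff: "frag_sum G ?f (p - q) = frag_sum G ?f p \<ominus>\<^bsub>G\<^esub> frag_sum G ?f q"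
    if "Poly_Mapping.keys p \<subseteq> carrier M \<times> carrier N" "Poly_Mapping.keys q \<subseteq> carrier M \<times> carrier N" for p q
    using add[of p "- q"] um[of q] that by (simp add: a_minus_def)
  have of: "frag_sum G ?f (frag_of z) = ?f z" if "z \<in> carrier M \<times> carrier N" for z
    using fc[OF that] by (rule G.frag_sum_of)
  have kd: "Poly_Mapping.keys (frag_of z - frag_of z') \<subseteq> carrier M \<times> carrier N"
    if "z \<in> carrier M \<times> carrier N" "z' \<in> carrier M \<times> carrier N" for z z'
    using keys_diff[of "frag_of z" "frag_of z'"] that by auto
  have rel: "frag_sum G ?f p = \<zero>\<^bsub>G\<^esub>" if "p \<in> tensor_relators R M N" for p
    using that M N unfolding tensor_relators_def acted_def
    by (auto simp: diff of kd fD G.minus_eq G.minus_add G.a_ac G.r_neg)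
      (metis G.add.inv_closed G.add.m_assoc G.minus_add G.r_neg G.add.m_closed fD(1))+
  have "p \<in> carrier FG \<and> frag_sum G ?f p = \<zero>\<^bsub>G\<^esub>"
    using assms(2) unfolding tensor_relations_def
  proof (induction p rule: generate.induct)
    case (incl h)
    then show ?case using rel relators_subset[OF M N] by blast
  next
    case (inv h)
    then have h: "h \<in> carrier FG" using relators_subset[OF M N] by blast
    then show ?case using rel[OF inv] um[of h] by simp
  next
    case (eng h1 h2)
    then show ?case using keys_add[of h1 h2] by (auto simp: add)
  qed auto
  then show ?thesis by simp
qed

lemma tlift_coset:
  assumes f: "balanced R M N G f" and p: "p \<in> carrier FG"
  shows "tlift G f (RL #>\<^bsub>FG\<^esub> p) = frag_sum G (\<lambda>z. f (fst z) (snd z)) p"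
proof -
  let ?t = "RL #>\<^bsub>FG\<^esub> p"
  define q where "q = (SOME q. q \<in> ?t)"
  have "q \<in> ?t" unfolding q_def using FG.rcos_self[OF p RL_subgroup] by (rule someI)
  then obtain r where r: "r \<in> RL" "q = r + p" unfolding r_coset_def by auto
  have "r \<in> carrier FG" using r RL.subset by blast
  then have "frag_sum G (\<lambda>z. f (fst z) (snd z)) q
    = frag_sum G (\<lambda>z. f (fst z) (snd z)) r \<oplus>\<^bsub>G\<^esub> frag_sum G (\<lambda>z. f (fst z) (snd z)) p"
    unfolding r(2) using p balancedD(1)[OF f]
    by (intro G.frag_sum_add[where S = "carrier M \<times> carrier N"]) auto
  also have "\<dots> = frag_sum G (\<lambda>z. f (fst z) (snd z)) p"
    using frag_sum_relation[OF f r(1)] p balancedD(1)[OF f]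
    by (auto intro!: G.l_zero G.frag_sum_closed)
  finally show ?thesis unfolding tlift_frag_sum q_def .
qed

lemma tlift_ptensor:
  assumes f: "balanced R M N G f" and "x \<in> carrier M" "y \<in> carrier N"
  shows "tlift G f (ptensor R M N x y) = f x y"
  unfolding ptensor_def using assms(2,3) balancedD(1)[OF f]
  by (subst tlift_coset[OF f]) (auto simp: G.frag_sum_of)

lemma tlift_add:
  assumes f: "balanced R M N G f"
    and "s \<in> carrier (tensor R M N)" "t \<in> carrier (tensor R M N)"
  shows "tlift G f (s \<oplus>\<^bsub>tensor R M N\<^esub> t) = tlift G f s \<oplus>\<^bsub>G\<^esub> tlift G f t"
proof -
  obtain p where p: "p \<in> carrier FG" "s = RL #>\<^bsub>FG\<^esub> p"
    using assms by (auto simp: carrier_tensor)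
  obtain q where q: "q \<in> carrier FG" "t = RL #>\<^bsub>FG\<^esub> q"
    using assms by (auto simp: carrier_tensor)
  have pq: "p + q \<in> carrier FG" using p q FG.m_closed[of p q] by simp
  have "frag_sum G (\<lambda>z. f (fst z) (snd z)) (p + q)
    = frag_sum G (\<lambda>z. f (fst z) (snd z)) p \<oplus>\<^bsub>G\<^esub> frag_sum G (\<lambda>z. f (fst z) (snd z)) q"
    using p q balancedD(1)[OF f]
    by (intro G.frag_sum_add[where S = "carrier M \<times> carrier N"]) auto
  then show ?thesis
    using p q by (simp only: coset_add tlift_coset[OF f] pq)
qed

lemma tlift_add_hom:
  assumes f: "balanced R M N G f"
  shows "add_hom (tensor R M N) G (tlift G f)"
  by (rule add_homI) (auto simp: tlift_add[OF f] intro!: tlift_closed balancedD(1)[OF f])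

lemma tensor_ext:
  assumes "add_hom (tensor R M N) G u" "add_hom (tensor R M N) G v"
    and "\<And>x y. x \<in> carrier M \<Longrightarrow> y \<in> carrier N \<Longrightarrow> u (ptensor R M N x y) = v (ptensor R M N x y)"
    and "t \<in> carrier (tensor R M N)"
  shows "u t = v t"
  using assms(4) by (induction t rule: tensor_induct)
    (auto simp: assms(3) add_homD(2)[OF assms(1)] add_homD(2)[OF assms(2)])

end

lemma tlift_id:
  assumes "t \<in> carrier (tensor R M N)"
  shows "tlift (tensor R M N) (ptensor R M N) t = t"
proof (rule tensor_ext[OF abelian_group_tensor tlift_add_hom[OF abelian_group_tensor ptensor_balanced] _ _ assms,
      where v = "\<lambda>t. t"])
  show "add_hom (tensor R M N) (tensor R M N) (\<lambda>t. t)" by (simp add: add_hom_def)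
qed (rule tlift_ptensor[OF abelian_group_tensor ptensor_balanced])

end

text \<open>
  Fubini for Sweedler sums: both sides are double sums over the two chosen representatives.
\<close>

lemma tlift_swap:
  assumes "tensor_data R M N" "tensor_data R' M' N'" and G: "abelian_group G"
    and t: "t \<in> carrier (tensor R M N)" and t': "t' \<in> carrier (tensor R' M' N')"
    and f: "\<And>x y x' y'. x \<in> carrier M \<Longrightarrow> y \<in> carrier N \<Longrightarrow> x' \<in> carrier M' \<Longrightarrow> y' \<in> carrier N' \<Longrightarrow>
       f x y x' y' \<in> carrier G"
  shows "tlift G (\<lambda>x y. tlift G (\<lambda>x' y'. f x y x' y') t') t
       = tlift G (\<lambda>x' y'. tlift G (\<lambda>x y. f x y x' y') t) t'"
  unfolding tlift_frag_sum
  using tensor_data.keys_rep[OF assms(1) t] tensor_data.keys_rep[OF assms(2) t'] f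
  by (intro frag_sum_swap[OF G]) auto

section \<open>Sweedler calculus in comodule algebras\<close>

lemma acted_module: "module K M \<Longrightarrow> acted K M"
  by (simp add: acted_def module.smult_closed module.axioms)

lemma op_ring_simps [simp]:
  "carrier (op_ring R) = carrier R" "add (op_ring R) = add R" "zero (op_ring R) = zero R"
  "one (op_ring R) = one R" "x \<otimes>\<^bsub>op_ring R\<^esub> y = y \<otimes>\<^bsub>R\<^esub> x"
  by (simp_all add: op_ring_def)

lemma op_ring_smult [simp]: "smult (op_ring M) = smult M"
  by (simp add: op_ring_def)

lemma mk_module_simps [simp]:
  "carrier (mk_module G act) = carrier G" "add (mk_module G act) = add G"
  "zero (mk_module G act) = zero G" "smult (mk_module G act) = act"
  by (simp_all add: mk_module_def)

lemma abelian_group_transfer: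
  assumes "abelian_group G" "carrier G' = carrier G" "add G' = add G" "zero G' = zero G"
  shows "abelian_group G'"
proof -
  interpret abelian_group G by fact
  show ?thesis
    using assms(2-) a_assoc a_comm a_closed l_zero zero_closed l_neg a_inv_closed
    by (intro abelian_groupI) auto
qed

lemma a_inv_mk_module [simp]: "\<ominus>\<^bsub>mk_module G act\<^esub> x = \<ominus>\<^bsub>G\<^esub> x"
  by (simp add: a_inv_def m_inv_def mk_module_def)

lemma abelian_group_mk_module [simp]: "abelian_group (mk_module G act) \<longleftrightarrow> abelian_group G"
  by (auto elim: abelian_group_transfer)

lemma left_reg_simps [simp]:
  "carrier (left_reg B) = carrier B" "add (left_reg B) = add B" "zero (left_reg B) = zero B"
  "a \<odot>\<^bsub>left_reg B\<^esub> b = a \<otimes>\<^bsub>B\<^esub> b"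
  by (simp_all add: left_reg_def)

lemma right_reg_simps [simp]:
  "carrier (right_reg B) = carrier B" "add (right_reg B) = add B" "zero (right_reg B) = zero B"
  "a \<odot>\<^bsub>right_reg B\<^esub> b = b \<otimes>\<^bsub>B\<^esub> a"
  by (simp_all add: right_reg_def)

lemma alg_tensor_simps [simp]:
  "carrier (alg_tensor K X Y) = carrier (tensor K X Y)"
  "add (alg_tensor K X Y) = add (tensor K X Y)"
  "zero (alg_tensor K X Y) = zero (tensor K X Y)"
  by (simp_all add: alg_tensor_def Let_def)

lemma alg_tensor_smult:
  "c \<odot>\<^bsub>alg_tensor K X Y\<^esub> t
     = tlift (tensor K X Y) (\<lambda>x y. ptensor K X Y (c \<odot>\<^bsub>X\<^esub> x) y) t"
  by (simp add: alg_tensor_def Let_def)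

lemma alg_tensor_mult:
  "s \<otimes>\<^bsub>alg_tensor K X Y\<^esub> t = tlift (tensor K X Y) (\<lambda>x y. tlift (tensor K X Y) (\<lambda>x' y'.
      ptensor K X Y (x \<otimes>\<^bsub>X\<^esub> x') (y \<otimes>\<^bsub>Y\<^esub> y')) t) s"
  by (simp add: alg_tensor_def Let_def)

lemma alg_tensor_one: "\<one>\<^bsub>alg_tensor K X Y\<^esub> = ptensor K X Y \<one>\<^bsub>X\<^esub> \<one>\<^bsub>Y\<^esub>"
  by (simp add: alg_tensor_def Let_def)

lemma alg_homD:
  assumes "alg_hom K X Y f"
  shows "\<And>x. x \<in> carrier X \<Longrightarrow> f x \<in> carrier Y"
    and "\<And>x y. x \<in> carrier X \<Longrightarrow> y \<in> carrier X \<Longrightarrow> f (x \<oplus>\<^bsub>X\<^esub> y) = f x \<oplus>\<^bsub>Y\<^esub> f y"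
    and "\<And>x y. x \<in> carrier X \<Longrightarrow> y \<in> carrier X \<Longrightarrow> f (x \<otimes>\<^bsub>X\<^esub> y) = f x \<otimes>\<^bsub>Y\<^esub> f y"
    and "f \<one>\<^bsub>X\<^esub> = \<one>\<^bsub>Y\<^esub>"
    and "\<And>c x. c \<in> carrier K \<Longrightarrow> x \<in> carrier X \<Longrightarrow> f (c \<odot>\<^bsub>X\<^esub> x) = c \<odot>\<^bsub>Y\<^esub> f x"
  using assms by (auto simp: alg_hom_def ring_hom_def)

context tensor_data
begin

lemma tlift_smult_left:
  assumes "abelian_group G" "balanced R M N G f" "r \<in> carrier R" "t \<in> carrier (tensor R M N)"
  shows "tlift G f (tlift (tensor R M N) (\<lambda>x y. ptensor R M N (r \<odot>\<^bsub>M\<^esub> x) y) t)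
       = tlift G (\<lambda>x y. f (r \<odot>\<^bsub>M\<^esub> x) y) t"
proof -
  have rc: "\<And>x. x \<in> carrier M \<Longrightarrow> r \<odot>\<^bsub>M\<^esub> x \<in> carrier M" using M assms by (simp add: acted_def)
  have "tlift G f (tlift (tensor R M N) (\<lambda>x y. ptensor R M N (r \<odot>\<^bsub>M\<^esub> x) y) t)
     = tlift G (\<lambda>x y. tlift G f (ptensor R M N (r \<odot>\<^bsub>M\<^esub> x) y)) t"
    by (rule tlift_hom[OF abelian_group_tensor tlift_add_hom[OF assms(1,2)] assms(1,4)])
      (simp add: rc)
  also have "\<dots> = tlift G (\<lambda>x y. f (r \<odot>\<^bsub>M\<^esub> x) y) t"
    by (rule tlift_cong[OF assms(1,4)])
      (simp_all add: rc tlift_ptensor[OF assms(1,2)] balancedD(1)[OF assms(2)])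
  finally show ?thesis .
qed

lemma tlift_double_hom:
  assumes "abelian_group G" "balanced R M N G f" "tensor_data R' M' N'"
    "t \<in> carrier (tensor R' M' N')"
    and "\<And>x y. x \<in> carrier M' \<Longrightarrow> y \<in> carrier N' \<Longrightarrow> p x y \<in> carrier M"
    and "\<And>x y. x \<in> carrier M' \<Longrightarrow> y \<in> carrier N' \<Longrightarrow> q x y \<in> carrier N"
  shows "tlift G f (tlift (tensor R M N) (\<lambda>x y. ptensor R M N (p x y) (q x y)) t)
       = tlift G (\<lambda>x y. f (p x y) (q x y)) t"
proof -
  interpret T': tensor_data R' M' N' by fact
  have "tlift G f (tlift (tensor R M N) (\<lambda>x y. ptensor R M N (p x y) (q x y)) t)
     = tlift G (\<lambda>x y. tlift G f (ptensor R M N (p x y) (q x y))) t"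
    by (rule T'.tlift_hom[OF abelian_group_tensor tlift_add_hom[OF assms(1,2)] assms(1,4)])
      (simp add: assms(5,6))
  also have "\<dots> = tlift G (\<lambda>x y. f (p x y) (q x y)) t"
    by (rule T'.tlift_cong[OF assms(1,4)])
      (simp_all add: assms(5,6) tlift_ptensor[OF assms(1,2)] balancedD(1)[OF assms(2)])
  finally show ?thesis .
qed

end

lemma alg_tensor_acted:
  assumes "tensor_data K X Y"
  shows "acted K (alg_tensor K X Y)"
proof -
  interpret tensor_data K X Y by fact
  show ?thesis
    unfolding acted_def alg_tensor_smult
    using M by (auto intro!: abelian_group_transfer[OF abelian_group_tensor] tlift_closed
        abelian_group_tensor simp: acted_def)
qed

locale comod_alg = comodule_algebra K H comul counit antipode B coact
    + galois_data K H comul B coact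
  for K :: "'k ring" and H :: "('k, 'h) module" and comul :: "'h \<Rightarrow> ('h, 'h) tensors"
    and counit :: "'h \<Rightarrow> 'k" and antipode :: "'h \<Rightarrow> 'h"
    and B :: "('k, 'b) module" and coact :: "'b \<Rightarrow> ('b, 'h) tensors"
begin

lemma B_group: "abelian_group B" by (rule ring.is_abelian_group[OF B.X.ring_axioms])
lemma H_group: "abelian_group H" by (rule ring.is_abelian_group[OF X.ring_axioms])

lemma B_module: "module K B" by (rule B.module_axioms)
lemma H_module: "module K H" by (rule module_axioms)

lemma BK: "acted K B" by (rule acted_module[OF B_module])
lemma HK: "acted K H" by (rule acted_module[OF H_module])

lemmas B_smult_closed [simp] = actedD(2)[OF BK]
lemmas H_smult_closed [simp] = actedD(2)[OF HK]

sublocale BH: tensor_data K B H by (simp add: tensor_data_def BK HK)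
sublocale HH: tensor_data K H H by (simp add: tensor_data_def HK)

lemma BHH: "tensor_data K B (alg_tensor K H H)"
  by (rule tensor_data.intro[OF BK alg_tensor_acted[OF HH.tensor_data_axioms]])

sublocale BHH: tensor_data K B "alg_tensor K H H" by (rule BHH)

lemma K_comm: "c \<in> carrier K \<Longrightarrow> d \<in> carrier K \<Longrightarrow> c \<otimes>\<^bsub>K\<^esub> d = d \<otimes>\<^bsub>K\<^esub> c"
  by (rule cring.cring_simprules(14)[OF module.axioms(1)[OF B_module]])

lemmas coactD = alg_homD[OF coact_hom]
lemmas comulD = alg_homD[OF comul_hom]
lemmas counitD = alg_homD[OF counit_hom]

lemma coact_closed [simp]: "b \<in> carrier B \<Longrightarrow> coact b \<in> carrier (tensor K B H)"
  using coactD(1) by simp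
lemma comul_closed [simp]: "h \<in> carrier H \<Longrightarrow> comul h \<in> carrier (tensor K H H)"
  using comulD(1) by simp
lemma counit_closed [simp]: "h \<in> carrier H \<Longrightarrow> counit h \<in> carrier K"
  using counitD(1) by (simp add: scalars_def)

lemma B_scale_left: "c \<in> carrier K \<Longrightarrow> x \<in> carrier B \<Longrightarrow> y \<in> carrier B \<Longrightarrow>
    (c \<odot>\<^bsub>B\<^esub> x) \<otimes>\<^bsub>B\<^esub> y = c \<odot>\<^bsub>B\<^esub> (x \<otimes>\<^bsub>B\<^esub> y)"
  by (rule B.scale_mult_left)
lemma B_scale_right: "c \<in> carrier K \<Longrightarrow> x \<in> carrier B \<Longrightarrow> y \<in> carrier B \<Longrightarrow>
    x \<otimes>\<^bsub>B\<^esub> (c \<odot>\<^bsub>B\<^esub> y) = c \<odot>\<^bsub>B\<^esub> (x \<otimes>\<^bsub>B\<^esub> y)"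
  by (rule B.scale_mult_right)
lemma H_scale_left: "c \<in> carrier K \<Longrightarrow> x \<in> carrier H \<Longrightarrow> y \<in> carrier H \<Longrightarrow>
    (c \<odot>\<^bsub>H\<^esub> x) \<otimes>\<^bsub>H\<^esub> y = c \<odot>\<^bsub>H\<^esub> (x \<otimes>\<^bsub>H\<^esub> y)"
  by (rule scale_mult_left)
lemma H_scale_right: "c \<in> carrier K \<Longrightarrow> x \<in> carrier H \<Longrightarrow> y \<in> carrier H \<Longrightarrow>
    x \<otimes>\<^bsub>H\<^esub> (c \<odot>\<^bsub>H\<^esub> y) = c \<odot>\<^bsub>H\<^esub> (x \<otimes>\<^bsub>H\<^esub> y)"
  by (rule scale_mult_right)

lemma scalar_mult:
  "c \<in> carrier K \<Longrightarrow> x \<in> carrier B \<Longrightarrow> (c \<odot>\<^bsub>B\<^esub> \<one>\<^bsub>B\<^esub>) \<otimes>\<^bsub>B\<^esub> x = c \<odot>\<^bsub>B\<^esub> x"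
  "c \<in> carrier K \<Longrightarrow> x \<in> carrier B \<Longrightarrow> x \<otimes>\<^bsub>B\<^esub> (c \<odot>\<^bsub>B\<^esub> \<one>\<^bsub>B\<^esub>) = c \<odot>\<^bsub>B\<^esub> x"
  by (simp_all add: B_scale_left B_scale_right)

subsection \<open>The coaction and the comultiplication under balanced maps\<close>

text \<open>
  For a balanced map \<open>f\<close>, \<open>tlift G f (coact b)\<close> is \<open>\<Sum> f b\<^sub>0 b\<^sub>1\<close>. Each lemma of this part applies the
  homomorphism induced by a balanced map to one of the axioms.
\<close>

context
  fixes G :: "('g, 'w) ring_scheme"
  assumes G: "abelian_group G"
begin

interpretation G: abelian_group G by (rule G)

lemma coact_sum_add:
  assumes "balanced K B H G f" "b \<in> carrier B" "b' \<in> carrier B"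
  shows "tlift G f (coact (b \<oplus>\<^bsub>B\<^esub> b')) = tlift G f (coact b) \<oplus>\<^bsub>G\<^esub> tlift G f (coact b')"
  using assms coactD(2)[of b b'] by (simp add: BH.tlift_add[OF G])

lemma coact_sum_smult:
  assumes "balanced K B H G f" "c \<in> carrier K" "b \<in> carrier B"
  shows "tlift G f (coact (c \<odot>\<^bsub>B\<^esub> b)) = tlift G (\<lambda>x h. f (c \<odot>\<^bsub>B\<^esub> x) h) (coact b)"
  using assms coactD(5)[of c b] by (simp add: alg_tensor_smult BH.tlift_smult_left[OF G])

lemma comul_sum_add:
  assumes "balanced K H H G f" "b \<in> carrier H" "b' \<in> carrier H"
  shows "tlift G f (comul (b \<oplus>\<^bsub>H\<^esub> b')) = tlift G f (comul b) \<oplus>\<^bsub>G\<^esub> tlift G f (comul b')"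
  using assms comulD(2)[of b b'] by (simp add: HH.tlift_add[OF G])

lemma comul_sum_smult:
  assumes "balanced K H H G f" "c \<in> carrier K" "b \<in> carrier H"
  shows "tlift G f (comul (c \<odot>\<^bsub>H\<^esub> b)) = tlift G (\<lambda>x h. f (c \<odot>\<^bsub>H\<^esub> x) h) (comul b)"
  using assms comulD(5)[of c b] by (simp add: alg_tensor_smult HH.tlift_smult_left[OF G])

lemma coact_sum_one:
  assumes "balanced K B H G f"
  shows "tlift G f (coact \<one>\<^bsub>B\<^esub>) = f \<one>\<^bsub>B\<^esub> \<one>\<^bsub>H\<^esub>"
  using coactD(4) assms by (simp add: alg_tensor_one BH.tlift_ptensor[OF G])

lemma coact_sum_mult:
  assumes f: "balanced K B H G f" and b: "b \<in> carrier B" "b' \<in> carrier B"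
  shows "tlift G f (coact (b \<otimes>\<^bsub>B\<^esub> b'))
    = tlift G (\<lambda>x h. tlift G (\<lambda>x' h'. f (x \<otimes>\<^bsub>B\<^esub> x') (h \<otimes>\<^bsub>H\<^esub> h')) (coact b')) (coact b)"
proof -
  let ?T = "tensor K B H"
  have "tlift G f (coact (b \<otimes>\<^bsub>B\<^esub> b')) = tlift G f (tlift ?T (\<lambda>x h. tlift ?T (\<lambda>x' h'.
      ptensor K B H (x \<otimes>\<^bsub>B\<^esub> x') (h \<otimes>\<^bsub>H\<^esub> h')) (coact b')) (coact b))"
    using b by (simp add: coactD(3) alg_tensor_mult)
  also have "\<dots> = tlift G (\<lambda>x h. tlift G f (tlift ?T (\<lambda>x' h'.
      ptensor K B H (x \<otimes>\<^bsub>B\<^esub> x') (h \<otimes>\<^bsub>H\<^esub> h')) (coact b'))) (coact b)"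
    by (rule BH.tlift_hom[OF BH.abelian_group_tensor BH.tlift_add_hom[OF G f] G])
      (use b in \<open>auto intro!: BH.tlift_closed BH.abelian_group_tensor\<close>)
  also have "\<dots> = tlift G (\<lambda>x h. tlift G (\<lambda>x' h'. f (x \<otimes>\<^bsub>B\<^esub> x') (h \<otimes>\<^bsub>H\<^esub> h')) (coact b')) (coact b)"
  proof (rule BH.tlift_cong[OF G])
    fix x h assume "x \<in> carrier B" "h \<in> carrier H"
    then show "tlift G f (tlift ?T (\<lambda>x' h'. ptensor K B H (x \<otimes>\<^bsub>B\<^esub> x') (h \<otimes>\<^bsub>H\<^esub> h')) (coact b'))
       = tlift G (\<lambda>x' h'. f (x \<otimes>\<^bsub>B\<^esub> x') (h \<otimes>\<^bsub>H\<^esub> h')) (coact b')"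
      using b by (intro BH.tlift_double_hom[OF G f BH.tensor_data_axioms]) auto
  qed (use b balancedD(1)[OF f] in \<open>auto intro!: BH.tlift_closed G\<close>)
  finally show ?thesis .
qed

text \<open>
  Multilinear functions are described by balancedness in pairs of neighbouring arguments.
\<close>

lemma coact_sum_coassoc:
  assumes f1: "\<And>k. k \<in> carrier H \<Longrightarrow> balanced K B H G (\<lambda>b h. f b h k)"
    and f2: "\<And>b. b \<in> carrier B \<Longrightarrow> balanced K H H G (f b)"
    and b: "b \<in> carrier B"
  shows "tlift G (\<lambda>x y. tlift G (\<lambda>x' x''. f x' x'' y) (coact x)) (coact b)
       = tlift G (\<lambda>x y. tlift G (f x) (comul y)) (coact b)"
proof -
  let ?HH = "alg_tensor K H H"
  let ?T = "tensor K B ?HH"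
  let ?g = "\<lambda>x w. tlift G (f x) w"
  have fc: "\<And>b h k. b \<in> carrier B \<Longrightarrow> h \<in> carrier H \<Longrightarrow> k \<in> carrier H \<Longrightarrow> f b h k \<in> carrier G"
    using balancedD(1)[OF f2] by blast
  have g: "balanced K B ?HH G ?g"
  proof (rule balancedI)
    fix x y assume "x \<in> carrier B" "y \<in> carrier ?HH"
    then show "tlift G (f x) y \<in> carrier G" by (auto intro!: HH.tlift_closed G fc)
  next
    fix x x' y assume *: "x \<in> carrier B" "x' \<in> carrier B" "y \<in> carrier ?HH"
    have "tlift G (f (x \<oplus>\<^bsub>B\<^esub> x')) y = tlift G (\<lambda>h k. f x h k \<oplus>\<^bsub>G\<^esub> f x' h k) y"
      using * by (intro HH.tlift_cong[OF G]) (auto intro!: fc balancedD(2)[OF f1])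
    also have "\<dots> = tlift G (f x) y \<oplus>\<^bsub>G\<^esub> tlift G (f x') y"
      using * by (intro HH.tlift_add_fun[OF G]) (auto intro!: fc)
    finally show "tlift G (f (x \<oplus>\<^bsub>B\<^esub> x')) y = tlift G (f x) y \<oplus>\<^bsub>G\<^esub> tlift G (f x') y" .
  next
    fix x y y' assume "x \<in> carrier B" "y \<in> carrier ?HH" "y' \<in> carrier ?HH"
    then show "tlift G (f x) (y \<oplus>\<^bsub>?HH\<^esub> y') = tlift G (f x) y \<oplus>\<^bsub>G\<^esub> tlift G (f x) y'"
      by (auto intro!: HH.tlift_add[OF G f2])
  next
    fix r x y assume *: "r \<in> carrier K" "x \<in> carrier B" "y \<in> carrier ?HH"
    have "tlift G (f (r \<odot>\<^bsub>B\<^esub> x)) y = tlift G (\<lambda>h k. f x (r \<odot>\<^bsub>H\<^esub> h) k) y"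
      using * by (intro HH.tlift_cong[OF G]) (auto intro!: fc balancedD(4)[OF f1])
    then show "tlift G (f (r \<odot>\<^bsub>B\<^esub> x)) y = tlift G (f x) (r \<odot>\<^bsub>?HH\<^esub> y)"
      using * by (simp add: alg_tensor_smult HH.tlift_smult_left[OF G f2])
  qed
  note u = BHH.tlift_add_hom[OF G g]
  note ug = BHH.tlift_ptensor[OF G g]
  have ax: "tlift ?T (\<lambda>x y. tlift ?T (\<lambda>x' x''. ptensor K B ?HH x' (ptensor K H H x'' y)) (coact x)) (coact b)
       = tlift ?T (\<lambda>x y. ptensor K B ?HH x (comul y)) (coact b)"
    using coact_coassoc[OF b] by (simp add: Let_def)
  have L: "tlift G ?g (tlift ?T (\<lambda>x y. tlift ?T (\<lambda>x' x''. ptensor K B ?HH x' (ptensor K H H x'' y)) (coact x)) (coact b))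
    = tlift G (\<lambda>x y. tlift G (\<lambda>x' x''. f x' x'' y) (coact x)) (coact b)"
  proof -
    have "tlift G ?g (tlift ?T (\<lambda>x y. tlift ?T (\<lambda>x' x''. ptensor K B ?HH x' (ptensor K H H x'' y)) (coact x)) (coact b))
      = tlift G (\<lambda>x y. tlift G ?g (tlift ?T (\<lambda>x' x''. ptensor K B ?HH x' (ptensor K H H x'' y)) (coact x))) (coact b)"
      by (rule BH.tlift_hom[OF BHH.abelian_group_tensor u G])
        (use b in \<open>auto intro!: BH.tlift_closed BHH.abelian_group_tensor\<close>)
    also have "\<dots> = tlift G (\<lambda>x y. tlift G (\<lambda>x' x''. f x' x'' y) (coact x)) (coact b)"
    proof (rule BH.tlift_cong[OF G])
      fix x y assume *: "x \<in> carrier B" "y \<in> carrier H"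
      have "tlift G ?g (tlift ?T (\<lambda>x' x''. ptensor K B ?HH x' (ptensor K H H x'' y)) (coact x))
         = tlift G (\<lambda>x' x''. tlift G ?g (ptensor K B ?HH x' (ptensor K H H x'' y))) (coact x)"
        by (rule BH.tlift_hom[OF BHH.abelian_group_tensor u G]) (use * in auto)
      also have "\<dots> = tlift G (\<lambda>x' x''. f x' x'' y) (coact x)"
        by (rule BH.tlift_cong[OF G]) (use * in \<open>auto intro!: fc simp: ug HH.tlift_ptensor[OF G f2]\<close>)
      finally show "tlift G ?g (tlift ?T (\<lambda>x' x''. ptensor K B ?HH x' (ptensor K H H x'' y)) (coact x))
         = tlift G (\<lambda>x' x''. f x' x'' y) (coact x)" .
    qed (use b in \<open>auto intro!: fc BH.tlift_closed G\<close>)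
    finally show ?thesis .
  qed
  have "tlift G ?g (tlift ?T (\<lambda>x y. ptensor K B ?HH x (comul y)) (coact b))
      = tlift G (\<lambda>x y. tlift G (f x) (comul y)) (coact b)"
    by (rule BHH.tlift_double_hom[OF G g BH.tensor_data_axioms]) (use b in auto)
  then show ?thesis using L ax by simp
qed

lemma coact_sum_counit:
  assumes f: "add_hom B G f" and b: "b \<in> carrier B"
  shows "tlift G (\<lambda>x y. f (counit y \<odot>\<^bsub>B\<^esub> x)) (coact b) = f b"
proof -
  have "f (tlift B (\<lambda>x y. counit y \<odot>\<^bsub>B\<^esub> x) (coact b)) = tlift G (\<lambda>x y. f (counit y \<odot>\<^bsub>B\<^esub> x)) (coact b)"
    by (rule BH.tlift_hom[OF B_group f G]) (use b in auto)
  then show ?thesis using coact_counit[OF b] by simp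
qed

lemma comul_sum_counit:
  assumes f: "add_hom H G f" and b: "b \<in> carrier H"
  shows "tlift G (\<lambda>x y. f (counit y \<odot>\<^bsub>H\<^esub> x)) (comul b) = f b"
proof -
  have "f (tlift H (\<lambda>x y. counit y \<odot>\<^bsub>H\<^esub> x) (comul b)) = tlift G (\<lambda>x y. f (counit y \<odot>\<^bsub>H\<^esub> x)) (comul b)"
    by (rule HH.tlift_hom[OF H_group f G]) (use b in auto)
  then show ?thesis using counit_right[OF b] by simp
qed

end

subsection \<open>Coinvariants\<close>

lemma A_simps [simp]: "add A = add B" "monoid.mult A = monoid.mult B" "one A = one B" "zero A = zero B"
  "smult A = smult B"
  by (simp_all add: A_def)

lemma carrier_A: "a \<in> carrier A \<longleftrightarrow> a \<in> carrier B \<and> coact a = ptensor K B H a \<one>\<^bsub>H\<^esub>"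
  by (simp add: A_def)

lemma A_in_B [simp]: "a \<in> carrier A \<Longrightarrow> a \<in> carrier B" by (simp add: carrier_A)

lemma one_in_A [simp]: "\<one>\<^bsub>B\<^esub> \<in> carrier A"
  using coactD(4) by (simp add: carrier_A alg_tensor_one)

text \<open>
  The scalars are coinvariants, so maps that are balanced over \<open>A\<close> are balanced over the ground
  field.
\<close>

lemma scalar_in_A [simp]:
  assumes "c \<in> carrier K" shows "c \<odot>\<^bsub>B\<^esub> \<one>\<^bsub>B\<^esub> \<in> carrier A"
proof -
  have "coact (c \<odot>\<^bsub>B\<^esub> \<one>\<^bsub>B\<^esub>)
      = tlift (tensor K B H) (\<lambda>x y. ptensor K B H (c \<odot>\<^bsub>B\<^esub> x) y) (ptensor K B H \<one>\<^bsub>B\<^esub> \<one>\<^bsub>H\<^esub>)"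
    using coactD(5)[of c "\<one>\<^bsub>B\<^esub>"] coactD(4) assms by (simp add: alg_tensor_smult alg_tensor_one)
  also have "\<dots> = ptensor K B H (c \<odot>\<^bsub>B\<^esub> \<one>\<^bsub>B\<^esub>) \<one>\<^bsub>H\<^esub>"
  proof (rule BH.tlift_ptensor[OF BH.abelian_group_tensor])
    show "balanced K B H (tensor K B H) (\<lambda>x y. ptensor K B H (c \<odot>\<^bsub>B\<^esub> x) y)"
      by (rule balancedI)
        (use assms in \<open>simp_all add: BH.ptensor_add_left BH.ptensor_add_right
           BH.ptensor_smult B.smult_r_distr H_smult_closed
           module.smult_assoc1[OF B_module, symmetric] module.smult_assoc1[OF H_module, symmetric]
           K_comm\<close>)
  qed auto
  finally show ?thesis using assms by (simp add: carrier_A)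
qed

lemma coact_sum_coinvariant:
  assumes G: "abelian_group G" and f: "balanced K B H G f" and a: "a \<in> carrier A" and b: "b \<in> carrier B"
  shows "tlift G f (coact (a \<otimes>\<^bsub>B\<^esub> b)) = tlift G (\<lambda>x h. f (a \<otimes>\<^bsub>B\<^esub> x) h) (coact b)"
    and "tlift G f (coact (b \<otimes>\<^bsub>B\<^esub> a)) = tlift G (\<lambda>x h. f (x \<otimes>\<^bsub>B\<^esub> a) h) (coact b)"
proof -
  interpret G: abelian_group G by fact
  note fD = balancedD[OF f]
  have ca: "coact a = ptensor K B H a \<one>\<^bsub>H\<^esub>" and aB: "a \<in> carrier B"
    using a by (auto simp: carrier_A)
  have g1: "balanced K B H G (\<lambda>x h. tlift G (\<lambda>x' h'. f (x \<otimes>\<^bsub>B\<^esub> x') (h \<otimes>\<^bsub>H\<^esub> h')) (coact b))"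
    by (rule balancedI)
      (use b in \<open>auto simp: B.X.l_distr X.l_distr fD B_scale_left H_scale_left
         intro!: BH.tlift_closed[OF G] BH.tlift_split[OF G] BH.tlift_cong[OF G]\<close>)
  have "tlift G f (coact (a \<otimes>\<^bsub>B\<^esub> b))
     = tlift G (\<lambda>x' h'. f (a \<otimes>\<^bsub>B\<^esub> x') (\<one>\<^bsub>H\<^esub> \<otimes>\<^bsub>H\<^esub> h')) (coact b)"
    using aB b by (simp add: coact_sum_mult[OF G f] ca BH.tlift_ptensor[OF G g1])
  also have "\<dots> = tlift G (\<lambda>x h. f (a \<otimes>\<^bsub>B\<^esub> x) h) (coact b)"
    by (rule BH.tlift_cong[OF G]) (use aB b fD(1) in auto)
  finally show "tlift G f (coact (a \<otimes>\<^bsub>B\<^esub> b)) = tlift G (\<lambda>x h. f (a \<otimes>\<^bsub>B\<^esub> x) h) (coact b)" .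
  have "tlift G f (coact (b \<otimes>\<^bsub>B\<^esub> a)) = tlift G (\<lambda>x h.
      tlift G (\<lambda>x' h'. f (x \<otimes>\<^bsub>B\<^esub> x') (h \<otimes>\<^bsub>H\<^esub> h')) (ptensor K B H a \<one>\<^bsub>H\<^esub>)) (coact b)"
    using aB b by (simp add: coact_sum_mult[OF G f] ca)
  also have "\<dots> = tlift G (\<lambda>x h. f (x \<otimes>\<^bsub>B\<^esub> a) h) (coact b)"
  proof (rule BH.tlift_cong[OF G])
    fix x h assume *: "x \<in> carrier B" "h \<in> carrier H"
    have "balanced K B H G (\<lambda>x' h'. f (x \<otimes>\<^bsub>B\<^esub> x') (h \<otimes>\<^bsub>H\<^esub> h'))"
      by (rule balancedI) (use * in \<open>simp_all add: B.X.r_distr X.r_distr fD B_scale_right H_scale_right\<close>)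
    then show "tlift G (\<lambda>x' h'. f (x \<otimes>\<^bsub>B\<^esub> x') (h \<otimes>\<^bsub>H\<^esub> h')) (ptensor K B H a \<one>\<^bsub>H\<^esub>) = f (x \<otimes>\<^bsub>B\<^esub> a) h"
      using * aB by (simp add: BH.tlift_ptensor[OF G])
  qed (use b aB fD(1) in auto)
  finally show "tlift G f (coact (b \<otimes>\<^bsub>B\<^esub> a)) = tlift G (\<lambda>x h. f (x \<otimes>\<^bsub>B\<^esub> a) h) (coact b)" .
qed

end

section \<open>The translation map of a Galois extension\<close>

locale galois_ext = comod_alg K H comul counit antipode B coact
  for K :: "'k ring" and H :: "('k, 'h) module" and comul :: "'h \<Rightarrow> ('h, 'h) tensors"
    and counit :: "'h \<Rightarrow> 'k" and antipode :: "'h \<Rightarrow> 'h"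
    and B :: "('k, 'b) module" and coact :: "'b \<Rightarrow> ('b, 'h) tensors" +
  assumes ff: "faithfully_flat_H_Galois"
begin

lemma B_left_module: "left_module A (left_reg B)"
  using ff by (simp add: faithfully_flat_H_Galois_def faithfully_flat_def)

lemma A_ring: "ring A"
  by (rule left_module.axioms(1)[OF B_left_module])

lemma A_mult_closed [simp]: "a \<in> carrier A \<Longrightarrow> a' \<in> carrier A \<Longrightarrow> a \<otimes>\<^bsub>B\<^esub> a' \<in> carrier A"
  using ring.ring_simprules(5)[OF A_ring] by simp

lemma left_reg_acted: "acted A (left_reg B)"
  by (auto simp: acted_def intro!: abelian_group_transfer[OF B_group])

lemma right_reg_acted: "acted A (right_reg B)"
  by (auto simp: acted_def intro!: abelian_group_transfer[OF B_group])

sublocale BB: tensor_data A "right_reg B" "left_reg B"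
  by (rule tensor_data.intro[OF right_reg_acted left_reg_acted])

abbreviation bb :: "'b \<Rightarrow> 'b \<Rightarrow> ('b, 'b) tensors" where
  "bb \<equiv> ptensor A (right_reg B) (left_reg B)"

abbreviation A_balanced :: "('g, 'w) ring_scheme \<Rightarrow> ('b \<Rightarrow> 'b \<Rightarrow> 'g) \<Rightarrow> bool" where
  "A_balanced \<equiv> balanced A (right_reg B) (left_reg B)"

lemma A_balancedD:
  assumes "A_balanced G f"
  shows "\<And>x y. x \<in> carrier B \<Longrightarrow> y \<in> carrier B \<Longrightarrow> f x y \<in> carrier G"
    and "\<And>x x' y. x \<in> carrier B \<Longrightarrow> x' \<in> carrier B \<Longrightarrow> y \<in> carrier B \<Longrightarrow>
           f (x \<oplus>\<^bsub>B\<^esub> x') y = f x y \<oplus>\<^bsub>G\<^esub> f x' y"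
    and "\<And>x y y'. x \<in> carrier B \<Longrightarrow> y \<in> carrier B \<Longrightarrow> y' \<in> carrier B \<Longrightarrow>
           f x (y \<oplus>\<^bsub>B\<^esub> y') = f x y \<oplus>\<^bsub>G\<^esub> f x y'"
    and "\<And>a x y. a \<in> carrier A \<Longrightarrow> x \<in> carrier B \<Longrightarrow> y \<in> carrier B \<Longrightarrow>
           f (x \<otimes>\<^bsub>B\<^esub> a) y = f x (a \<otimes>\<^bsub>B\<^esub> y)"
    and "\<And>c x y. c \<in> carrier K \<Longrightarrow> x \<in> carrier B \<Longrightarrow> y \<in> carrier B \<Longrightarrow>
           f (c \<odot>\<^bsub>B\<^esub> x) y = f x (c \<odot>\<^bsub>B\<^esub> y)"
proof -
  show 4: "\<And>a x y. a \<in> carrier A \<Longrightarrow> x \<in> carrier B \<Longrightarrow> y \<in> carrier B \<Longrightarrow>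
           f (x \<otimes>\<^bsub>B\<^esub> a) y = f x (a \<otimes>\<^bsub>B\<^esub> y)"
    using balancedD(4)[OF assms] by simp
  show "f (c \<odot>\<^bsub>B\<^esub> x) y = f x (c \<odot>\<^bsub>B\<^esub> y)" if "c \<in> carrier K" "x \<in> carrier B" "y \<in> carrier B" for c x y
    using 4[of "c \<odot>\<^bsub>B\<^esub> \<one>\<^bsub>B\<^esub>" x y] that by (simp add: scalar_mult)
qed (use balancedD[OF assms] in simp_all)

lemma A_balancedI:
  assumes "\<And>x y. x \<in> carrier B \<Longrightarrow> y \<in> carrier B \<Longrightarrow> f x y \<in> carrier G"
    and "\<And>x x' y. x \<in> carrier B \<Longrightarrow> x' \<in> carrier B \<Longrightarrow> y \<in> carrier B \<Longrightarrow>
           f (x \<oplus>\<^bsub>B\<^esub> x') y = f x y \<oplus>\<^bsub>G\<^esub> f x' y"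
    and "\<And>x y y'. x \<in> carrier B \<Longrightarrow> y \<in> carrier B \<Longrightarrow> y' \<in> carrier B \<Longrightarrow>
           f x (y \<oplus>\<^bsub>B\<^esub> y') = f x y \<oplus>\<^bsub>G\<^esub> f x y'"
    and "\<And>a x y. a \<in> carrier A \<Longrightarrow> x \<in> carrier B \<Longrightarrow> y \<in> carrier B \<Longrightarrow>
           f (x \<otimes>\<^bsub>B\<^esub> a) y = f x (a \<otimes>\<^bsub>B\<^esub> y)"
  shows "A_balanced G f"
  by (rule balancedI) (use assms in simp_all)

lemma bb_closed [simp]: "x \<in> carrier B \<Longrightarrow> y \<in> carrier B \<Longrightarrow> bb x y \<in> carrier BB"
  using BB.ptensor_closed by simp

subsection \<open>The canonical map and its inverse\<close>

lemma beta_balanced: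
  assumes b: "b \<in> carrier B"
  shows "A_balanced (tensor K B H)
     (\<lambda>x y. tlift (tensor K B H) (\<lambda>y' h. ptensor K B H (b \<otimes>\<^bsub>B\<^esub> (x \<otimes>\<^bsub>B\<^esub> y')) h) (coact y))"
proof -
  let ?T = "tensor K B H"
  have *: "balanced K B H ?T (\<lambda>y' h. ptensor K B H (b \<otimes>\<^bsub>B\<^esub> (x \<otimes>\<^bsub>B\<^esub> y')) h)" if "x \<in> carrier B" for x
    by (rule balancedI) (use b that in \<open>auto simp: B.X.r_distr BH.ptensor_add_left BH.ptensor_add_right
        B_scale_right BH.ptensor_smult\<close>)
  show ?thesis
  proof (rule A_balancedI)
    fix x x' y assume "x \<in> carrier B" "x' \<in> carrier B" "y \<in> carrier B"
    then show "tlift ?T (\<lambda>y' h. ptensor K B H (b \<otimes>\<^bsub>B\<^esub> ((x \<oplus>\<^bsub>B\<^esub> x') \<otimes>\<^bsub>B\<^esub> y')) h) (coact y)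
       = tlift ?T (\<lambda>y' h. ptensor K B H (b \<otimes>\<^bsub>B\<^esub> (x \<otimes>\<^bsub>B\<^esub> y')) h) (coact y)
         \<oplus>\<^bsub>?T\<^esub> tlift ?T (\<lambda>y' h. ptensor K B H (b \<otimes>\<^bsub>B\<^esub> (x' \<otimes>\<^bsub>B\<^esub> y')) h) (coact y)"
      using b by (intro BH.tlift_split[OF BH.abelian_group_tensor])
        (auto simp: B.X.l_distr B.X.r_distr BH.ptensor_add_left)
  next
    fix a x y assume "a \<in> carrier A" "x \<in> carrier B" "y \<in> carrier B"
    then show "tlift ?T (\<lambda>y' h. ptensor K B H (b \<otimes>\<^bsub>B\<^esub> (x \<otimes>\<^bsub>B\<^esub> a \<otimes>\<^bsub>B\<^esub> y')) h) (coact y)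
       = tlift ?T (\<lambda>y' h. ptensor K B H (b \<otimes>\<^bsub>B\<^esub> (x \<otimes>\<^bsub>B\<^esub> y')) h) (coact (a \<otimes>\<^bsub>B\<^esub> y))"
      using b by (subst coact_sum_coinvariant(1)[OF BH.abelian_group_tensor *], simp_all,
          intro BH.tlift_cong[OF BH.abelian_group_tensor]) (auto simp: B.X.m_assoc)
  qed (use b in \<open>auto simp: coact_sum_add[OF BH.abelian_group_tensor *]
        intro!: BH.tlift_closed[OF BH.abelian_group_tensor]\<close>)
qed

lemma beta_balanced1: "A_balanced (tensor K B H)
     (\<lambda>x y. tlift (tensor K B H) (\<lambda>y' h. ptensor K B H (x \<otimes>\<^bsub>B\<^esub> y') h) (coact y))"
  by (rule balanced_cong[OF beta_balanced[OF B.X.one_closed] right_reg_acted left_reg_acted],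
      intro BH.tlift_cong[OF BH.abelian_group_tensor]) auto

lemma beta_hom: "add_hom BB (tensor K B H) beta"
  unfolding beta_def by (rule BB.tlift_add_hom[OF BH.abelian_group_tensor beta_balanced1])

lemma beta_bb:
  "x \<in> carrier B \<Longrightarrow> y \<in> carrier B \<Longrightarrow>
    beta (bb x y) = tlift (tensor K B H) (\<lambda>y' h. ptensor K B H (x \<otimes>\<^bsub>B\<^esub> y') h) (coact y)"
  unfolding beta_def by (subst BB.tlift_ptensor[OF BH.abelian_group_tensor beta_balanced1]) auto

lemma beta_bij: "bij_betw beta (carrier BB) (carrier (tensor K B H))"
  using ff by (simp add: faithfully_flat_H_Galois_def H_Galois_def)

lemma beta_inj: "s \<in> carrier BB \<Longrightarrow> t \<in> carrier BB \<Longrightarrow> beta s = beta t \<Longrightarrow> s = t"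
  using beta_bij by (auto simp: bij_betw_def inj_on_def)

lemma tau_closed [simp]: "h \<in> carrier H \<Longrightarrow> tau h \<in> carrier BB"
  unfolding tau_def using beta_bij by (auto simp: bij_betw_def intro!: inv_into_into)

lemma beta_tau: "h \<in> carrier H \<Longrightarrow> beta (tau h) = ptensor K B H \<one>\<^bsub>B\<^esub> h"
  unfolding tau_def using beta_bij by (auto simp: bij_betw_def intro!: f_inv_into_f)

text \<open>
  Left multiplication by \<open>B\<close> on \<open>B \<otimes>\<^sub>A B\<close>. The canonical map commutes with it, so its inverse is \<open>b \<otimes> h
  \<mapsto> b \<tau>(h)\<close>.
\<close>

definition lmul :: "'b \<Rightarrow> ('b, 'b) tensors \<Rightarrow> ('b, 'b) tensors" where
  "lmul b = tlift BB (\<lambda>x y. bb (b \<otimes>\<^bsub>B\<^esub> x) y)"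

lemma lmul_closed [simp]: "b \<in> carrier B \<Longrightarrow> t \<in> carrier BB \<Longrightarrow> lmul b t \<in> carrier BB"
  unfolding lmul_def by (rule BB.tlift_closed[OF BB.abelian_group_tensor]) auto

lemma beta_lmul:
  assumes b: "b \<in> carrier B" and t: "t \<in> carrier BB"
  shows "beta (lmul b t) = tlift (tensor K B H) (\<lambda>x h. ptensor K B H (b \<otimes>\<^bsub>B\<^esub> x) h) (beta t)"
proof -
  let ?T = "tensor K B H"
  have f: "balanced K B H ?T (\<lambda>x h. ptensor K B H (b \<otimes>\<^bsub>B\<^esub> x) h)"
    by (rule balancedI) (use b in \<open>auto simp: B.X.r_distr BH.ptensor_add_left BH.ptensor_add_right
        B_scale_right BH.ptensor_smult\<close>)
  note f' = BH.tlift_add_hom[OF BH.abelian_group_tensor f]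
  have "beta (lmul b t) = tlift ?T (\<lambda>x y. beta (bb (b \<otimes>\<^bsub>B\<^esub> x) y)) t"
    unfolding lmul_def
    by (rule BB.tlift_hom[OF BB.abelian_group_tensor beta_hom BH.abelian_group_tensor t]) (use b in auto)
  also have "\<dots> = tlift ?T (\<lambda>x y. tlift ?T (\<lambda>x h. ptensor K B H (b \<otimes>\<^bsub>B\<^esub> x) h)
      (tlift ?T (\<lambda>y' h. ptensor K B H (x \<otimes>\<^bsub>B\<^esub> y') h) (coact y))) t"
  proof (rule BB.tlift_cong[OF BH.abelian_group_tensor t])
    fix x y assume *: "x \<in> carrier (right_reg B)" "y \<in> carrier (left_reg B)"
    have "tlift ?T (\<lambda>x h. ptensor K B H (b \<otimes>\<^bsub>B\<^esub> x) h)
      (tlift ?T (\<lambda>y' h. ptensor K B H (x \<otimes>\<^bsub>B\<^esub> y') h) (coact y))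
      = tlift ?T (\<lambda>y' h. ptensor K B H (b \<otimes>\<^bsub>B\<^esub> (x \<otimes>\<^bsub>B\<^esub> y')) h) (coact y)"
      by (rule BH.tlift_double_hom[OF BH.abelian_group_tensor f BH.tensor_data_axioms]) (use * in auto)
    also have "\<dots> = beta (bb (b \<otimes>\<^bsub>B\<^esub> x) y)"
      using * b by (simp add: beta_bb, intro BH.tlift_cong[OF BH.abelian_group_tensor])
        (auto simp: B.X.m_assoc)
    finally show "beta (bb (b \<otimes>\<^bsub>B\<^esub> x) y) = tlift ?T (\<lambda>x h. ptensor K B H (b \<otimes>\<^bsub>B\<^esub> x) h)
      (tlift ?T (\<lambda>y' h. ptensor K B H (x \<otimes>\<^bsub>B\<^esub> y') h) (coact y))" by simp
  qed (use b in \<open>auto intro!: BH.tlift_closed[OF BH.abelian_group_tensor]\<close>)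
  also have "\<dots> = tlift ?T (\<lambda>x h. ptensor K B H (b \<otimes>\<^bsub>B\<^esub> x) h) (beta t)"
    unfolding beta_def
    by (rule BB.tlift_hom[OF BH.abelian_group_tensor f' BH.abelian_group_tensor t, symmetric])
      (auto intro!: BH.tlift_closed[OF BH.abelian_group_tensor])
  finally show ?thesis .
qed

lemma beta_lmul_tau:
  assumes b: "b \<in> carrier B" and h: "h \<in> carrier H"
  shows "beta (lmul b (tau h)) = ptensor K B H b h"
proof -
  have f: "balanced K B H (tensor K B H) (\<lambda>x h. ptensor K B H (b \<otimes>\<^bsub>B\<^esub> x) h)"
    by (rule balancedI) (use b in \<open>auto simp: B.X.r_distr BH.ptensor_add_left BH.ptensor_add_right
        B_scale_right BH.ptensor_smult\<close>)
  show ?thesis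
    using assms by (simp add: beta_lmul beta_tau BH.tlift_ptensor[OF BH.abelian_group_tensor f])
qed

lemma tau_add:
  assumes "h \<in> carrier H" "h' \<in> carrier H"
  shows "tau (h \<oplus>\<^bsub>H\<^esub> h') = tau h \<oplus>\<^bsub>BB\<^esub> tau h'"
  using assms by (intro beta_inj)
    (auto simp: beta_tau add_homD(2)[OF beta_hom] BH.ptensor_add_right)

lemma tau_smult:
  assumes "c \<in> carrier K" "h \<in> carrier H"
  shows "tau (c \<odot>\<^bsub>H\<^esub> h) = lmul (c \<odot>\<^bsub>B\<^esub> \<one>\<^bsub>B\<^esub>) (tau h)"
  using assms by (intro beta_inj) (auto simp: beta_tau beta_lmul_tau BH.ptensor_smult)

text \<open>
  Both sides have the same image under the injective canonical map, because \<open>\<beta>(x y\<^sub>0 \<tau>(y\<^sub>1)) = x y\<^sub>0 \<otimes>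
  y\<^sub>1\<close>.
\<close>

lemma bb_expand:
  assumes x: "x \<in> carrier B" and y: "y \<in> carrier B"
  shows "bb x y = tlift BB (\<lambda>y' h. lmul (x \<otimes>\<^bsub>B\<^esub> y') (tau h)) (coact y)"
proof (rule beta_inj)
  have "beta (tlift BB (\<lambda>y' h. lmul (x \<otimes>\<^bsub>B\<^esub> y') (tau h)) (coact y))
      = tlift (tensor K B H) (\<lambda>y' h. beta (lmul (x \<otimes>\<^bsub>B\<^esub> y') (tau h))) (coact y)"
    by (rule BH.tlift_hom[OF BB.abelian_group_tensor beta_hom BH.abelian_group_tensor]) (use x y in auto)
  also have "\<dots> = beta (bb x y)"
    unfolding beta_bb[OF x y]
    by (rule BH.tlift_cong[OF BH.abelian_group_tensor]) (use x y in \<open>auto simp: beta_lmul_tau\<close>)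
  finally show "beta (bb x y) = beta (tlift BB (\<lambda>y' h. lmul (x \<otimes>\<^bsub>B\<^esub> y') (tau h)) (coact y))" by simp
qed (use x y in \<open>auto intro!: BH.tlift_closed[OF BB.abelian_group_tensor]\<close>)

subsection \<open>Identities for the translation map\<close>

definition trilinear :: "('g, 'w) ring_scheme \<Rightarrow> ('b \<Rightarrow> 'b \<Rightarrow> 'h \<Rightarrow> 'g) \<Rightarrow> bool" where
  "trilinear G f \<longleftrightarrow> (\<forall>k\<in>carrier H. A_balanced G (\<lambda>l r. f l r k))
     \<and> (\<forall>l\<in>carrier B. balanced K B H G (f l))"

context
  fixes G :: "('g, 'w) ring_scheme"
  assumes G: "abelian_group G"
begin

interpretation G: abelian_group G by (rule G)

lemma A_balanced_lmul:
  assumes f: "A_balanced G f" and b: "b \<in> carrier B"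
  shows "A_balanced G (\<lambda>x y. f (b \<otimes>\<^bsub>B\<^esub> x) y)"
  by (rule A_balancedI)
    (use b in \<open>auto simp: B.X.r_distr A_balancedD[OF f] B.X.m_assoc[symmetric]\<close>)

lemma tlift_lmul:
  assumes f: "A_balanced G f" and b: "b \<in> carrier B" and t: "t \<in> carrier BB"
  shows "tlift G f (lmul b t) = tlift G (\<lambda>x y. f (b \<otimes>\<^bsub>B\<^esub> x) y) t"
  unfolding lmul_def by (rule BB.tlift_double_hom[OF G f BB.tensor_data_axioms t]) (use b in auto)

lemma tau_sum_add:
  assumes "A_balanced G f" "h \<in> carrier H" "h' \<in> carrier H"
  shows "tlift G f (tau (h \<oplus>\<^bsub>H\<^esub> h')) = tlift G f (tau h) \<oplus>\<^bsub>G\<^esub> tlift G f (tau h')"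
  using assms by (simp add: tau_add BB.tlift_add[OF G])

lemma tau_sum_smult:
  assumes f: "A_balanced G f" and "c \<in> carrier K" "h \<in> carrier H"
  shows "tlift G f (tau (c \<odot>\<^bsub>H\<^esub> h)) = tlift G (\<lambda>l r. f (c \<odot>\<^bsub>B\<^esub> l) r) (tau h)"
  using assms by (auto simp: tau_smult tlift_lmul[OF f] scalar_mult A_balancedD[OF f] intro!: BB.tlift_cong[OF G])

lemma tau_sum_closed:
  assumes "A_balanced G f" "h \<in> carrier H"
  shows "tlift G f (tau h) \<in> carrier G"
  using assms A_balancedD(1)[OF assms(1)] by (intro BB.tlift_closed[OF G]) auto

text \<open>
  This is \<open>\<beta>(\<tau>(h)) = 1 \<otimes> h\<close>, tested against \<open>f\<close>.
\<close>

lemma tau_sum_coact_mult: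
  assumes f: "balanced K B H G f" and h: "h \<in> carrier H"
  shows "tlift G (\<lambda>l r. tlift G (\<lambda>r' k. f (l \<otimes>\<^bsub>B\<^esub> r') k) (coact r)) (tau h) = f \<one>\<^bsub>B\<^esub> h"
proof -
  let ?T = "tensor K B H"
  have "f \<one>\<^bsub>B\<^esub> h = tlift G f (beta (tau h))"
    using h by (simp add: beta_tau BH.tlift_ptensor[OF G f])
  also have "\<dots> = tlift G (\<lambda>l r. tlift G f (tlift ?T (\<lambda>x h. ptensor K B H (l \<otimes>\<^bsub>B\<^esub> x) h) (coact r))) (tau h)"
    unfolding beta_def
    by (rule BB.tlift_hom[OF BH.abelian_group_tensor BH.tlift_add_hom[OF G f] G])
      (use h in \<open>auto intro!: BH.tlift_closed[OF BH.abelian_group_tensor]\<close>)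
  also have "\<dots> = tlift G (\<lambda>l r. tlift G (\<lambda>r' k. f (l \<otimes>\<^bsub>B\<^esub> r') k) (coact r)) (tau h)"
  proof (rule BB.tlift_cong[OF G])
    fix l r assume "l \<in> carrier (right_reg B)" "r \<in> carrier (left_reg B)"
    then show "tlift G f (tlift ?T (\<lambda>x h. ptensor K B H (l \<otimes>\<^bsub>B\<^esub> x) h) (coact r))
      = tlift G (\<lambda>r' k. f (l \<otimes>\<^bsub>B\<^esub> r') k) (coact r)"
      by (intro BH.tlift_double_hom[OF G f BH.tensor_data_axioms]) auto
  qed (use h balancedD(1)[OF f] in \<open>auto intro!: BH.tlift_closed[OF G]\<close>)
  finally show ?thesis by simp
qed

text \<open>
  The other half of the bijectivity of \<open>\<beta>\<close>. It rewrites a function of two factors in \<open>B\<close> as a sum to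
  which \<open>tau_sum_coact_mult\<close> applies; this is how the translation map is related to \<open>A\<close> and to the
  coaction below.
\<close>

lemma galois_expand:
  assumes f: "A_balanced G f" and x: "x \<in> carrier B" and y: "y \<in> carrier B"
  shows "f x y = tlift G (\<lambda>y' h. tlift G (\<lambda>l r. f (x \<otimes>\<^bsub>B\<^esub> y' \<otimes>\<^bsub>B\<^esub> l) r) (tau h)) (coact y)"
proof -
  have "f x y = tlift G f (bb x y)"
    using x y by (simp add: BB.tlift_ptensor[OF G f])
  also have "\<dots> = tlift G (\<lambda>y' h. tlift G f (lmul (x \<otimes>\<^bsub>B\<^esub> y') (tau h))) (coact y)"
    unfolding bb_expand[OF x y]
    by (rule BH.tlift_hom[OF BB.abelian_group_tensor BB.tlift_add_hom[OF G f] G]) (use x y in auto)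
  also have "\<dots> = tlift G (\<lambda>y' h. tlift G (\<lambda>l r. f (x \<otimes>\<^bsub>B\<^esub> y' \<otimes>\<^bsub>B\<^esub> l) r) (tau h)) (coact y)"
    by (rule BH.tlift_cong[OF G])
      (use x y in \<open>auto simp: tlift_lmul[OF f] intro!: BB.tlift_closed[OF G] A_balancedD(1)[OF f]\<close>)
  finally show ?thesis .
qed

text \<open>
  A sum over the components of \<open>\<tau>(k)\<close> is again balanced in \<open>k\<close> and a parameter, and so can be the
  summand of another sum; the next lemma is the same for the comultiplication.
\<close>

lemma tau_param_balanced:
  assumes M: "acted K M"
    and F: "\<And>b. b \<in> carrier M \<Longrightarrow> A_balanced G (F b)"
    and add: "\<And>b b' l r. b \<in> carrier M \<Longrightarrow> b' \<in> carrier M \<Longrightarrow> l \<in> carrier B \<Longrightarrow> r \<in> carrier B \<Longrightarrow>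
        F (b \<oplus>\<^bsub>M\<^esub> b') l r = F b l r \<oplus>\<^bsub>G\<^esub> F b' l r"
    and sc: "\<And>c b l r. c \<in> carrier K \<Longrightarrow> b \<in> carrier M \<Longrightarrow> l \<in> carrier B \<Longrightarrow> r \<in> carrier B \<Longrightarrow>
        F (c \<odot>\<^bsub>M\<^esub> b) l r = F b (c \<odot>\<^bsub>B\<^esub> l) r"
  shows "balanced K M H G (\<lambda>b k. tlift G (F b) (tau k))"
proof (rule balancedI)
  fix b k assume *: "b \<in> carrier M" "k \<in> carrier H"
  show "tlift G (F b) (tau k) \<in> carrier G" by (rule tau_sum_closed[OF F]) fact+
next
  fix b b' k assume *: "b \<in> carrier M" "b' \<in> carrier M" "k \<in> carrier H"
  show "tlift G (F (b \<oplus>\<^bsub>M\<^esub> b')) (tau k) = tlift G (F b) (tau k) \<oplus>\<^bsub>G\<^esub> tlift G (F b') (tau k)"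
    by (rule BB.tlift_split[OF G]) (use * in \<open>auto simp: add A_balancedD(1)[OF F]\<close>)
next
  fix b k k' assume *: "b \<in> carrier M" "k \<in> carrier H" "k' \<in> carrier H"
  show "tlift G (F b) (tau (k \<oplus>\<^bsub>H\<^esub> k')) = tlift G (F b) (tau k) \<oplus>\<^bsub>G\<^esub> tlift G (F b) (tau k')"
    by (rule tau_sum_add[OF F]) fact+
next
  fix c b k assume *: "c \<in> carrier K" "b \<in> carrier M" "k \<in> carrier H"
  show "tlift G (F (c \<odot>\<^bsub>M\<^esub> b)) (tau k) = tlift G (F b) (tau (c \<odot>\<^bsub>H\<^esub> k))"
    unfolding tau_sum_smult[OF F[OF *(2)] *(1,3)]
    by (rule BB.tlift_cong[OF G]) (use * in \<open>auto simp: sc A_balancedD(1)[OF F]\<close>)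
qed

lemma comul_param_balanced:
  assumes M: "acted K M"
    and g1: "\<And>k. k \<in> carrier H \<Longrightarrow> balanced K M H G (\<lambda>b h. g b h k)"
    and g2: "\<And>b. b \<in> carrier M \<Longrightarrow> balanced K H H G (g b)"
  shows "balanced K M H G (\<lambda>b k. tlift G (g b) (comul k))"
proof (rule balancedI)
  fix b k assume *: "b \<in> carrier M" "k \<in> carrier H"
  show "tlift G (g b) (comul k) \<in> carrier G"
    by (rule HH.tlift_closed[OF G]) (use * balancedD(1)[OF g2] in auto)
next
  fix b b' k assume *: "b \<in> carrier M" "b' \<in> carrier M" "k \<in> carrier H"
  show "tlift G (g (b \<oplus>\<^bsub>M\<^esub> b')) (comul k) = tlift G (g b) (comul k) \<oplus>\<^bsub>G\<^esub> tlift G (g b') (comul k)"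
    by (rule HH.tlift_split[OF G]) (use * balancedD(1)[OF g2] balancedD(2)[OF g1] in auto)
next
  fix b k k' assume *: "b \<in> carrier M" "k \<in> carrier H" "k' \<in> carrier H"
  show "tlift G (g b) (comul (k \<oplus>\<^bsub>H\<^esub> k')) = tlift G (g b) (comul k) \<oplus>\<^bsub>G\<^esub> tlift G (g b) (comul k')"
    by (rule comul_sum_add[OF G g2]) fact+
next
  fix c b k assume *: "c \<in> carrier K" "b \<in> carrier M" "k \<in> carrier H"
  show "tlift G (g (c \<odot>\<^bsub>M\<^esub> b)) (comul k) = tlift G (g b) (comul (c \<odot>\<^bsub>H\<^esub> k))"
    unfolding comul_sum_smult[OF G g2[OF *(2)] *(1,3)]
    by (rule HH.tlift_cong[OF G]) (use * balancedD(1)[OF g2] balancedD(4)[OF g1] in auto)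
qed

lemma balanced_mult_left:
  assumes f: "balanced K B H G f" and b: "b \<in> carrier B"
  shows "balanced K B H G (\<lambda>x h. f (b \<otimes>\<^bsub>B\<^esub> x) h)"
  by (rule balancedI) (use b in \<open>auto simp: B.X.r_distr B_scale_right balancedD[OF f]\<close>)

text \<open>
  \<open>a \<tau>(h) = \<tau>(h) a\<close>: expand at \<open>r a\<close> and use that the coaction of \<open>r a\<close> is \<open>\<Sum> r\<^sub>0 a \<otimes> r\<^sub>1\<close>.
\<close>

lemma tau_sum_central:
  assumes f: "A_balanced G f" and a: "a \<in> carrier A" and h: "h \<in> carrier H"
  shows "tlift G (\<lambda>l r. f (a \<otimes>\<^bsub>B\<^esub> l) r) (tau h) = tlift G (\<lambda>l r. f l (r \<otimes>\<^bsub>B\<^esub> a)) (tau h)"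
proof -
  note fD = A_balancedD[OF f]
  let ?g = "\<lambda>b k. tlift G (\<lambda>l r. f (b \<otimes>\<^bsub>B\<^esub> a \<otimes>\<^bsub>B\<^esub> l) r) (tau k)"
  have aB: "a \<in> carrier B" using a by simp
  have F: "\<And>b. b \<in> carrier B \<Longrightarrow> A_balanced G (\<lambda>l r. f (b \<otimes>\<^bsub>B\<^esub> a \<otimes>\<^bsub>B\<^esub> l) r)"
    using A_balanced_lmul[OF f] aB by simp
  have g: "balanced K B H G ?g"
    by (rule tau_param_balanced[OF BK F])
      (use aB in \<open>auto simp: B.X.l_distr fD B_scale_left B_scale_right\<close>)
  have "tlift G (\<lambda>l r. f l (r \<otimes>\<^bsub>B\<^esub> a)) (tau h)
      = tlift G (\<lambda>l r. tlift G (\<lambda>r' k. ?g (l \<otimes>\<^bsub>B\<^esub> r') k) (coact r)) (tau h)"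
  proof (rule BB.tlift_cong[OF G])
    fix l r assume *: "l \<in> carrier (right_reg B)" "r \<in> carrier (left_reg B)"
    have b: "balanced K B H G (\<lambda>y' h. tlift G (\<lambda>l' r'. f (l \<otimes>\<^bsub>B\<^esub> y' \<otimes>\<^bsub>B\<^esub> l') r') (tau h))"
      by (rule tau_param_balanced[OF BK])
        (use * A_balanced_lmul[OF f] in \<open>auto simp: B.X.l_distr B.X.r_distr fD B_scale_left B_scale_right\<close>)
    have "f l (r \<otimes>\<^bsub>B\<^esub> a) = tlift G (\<lambda>y' h. tlift G (\<lambda>l' r'. f (l \<otimes>\<^bsub>B\<^esub> y' \<otimes>\<^bsub>B\<^esub> l') r') (tau h)) (coact (r \<otimes>\<^bsub>B\<^esub> a))"
      using * aB by (intro galois_expand[OF f]) auto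
    also have "\<dots> = tlift G (\<lambda>y' h. tlift G (\<lambda>l' r'. f (l \<otimes>\<^bsub>B\<^esub> (y' \<otimes>\<^bsub>B\<^esub> a) \<otimes>\<^bsub>B\<^esub> l') r') (tau h)) (coact r)"
      using * a by (intro coact_sum_coinvariant(2)[OF G b]) auto
    also have "\<dots> = tlift G (\<lambda>r' k. ?g (l \<otimes>\<^bsub>B\<^esub> r') k) (coact r)"
      by (intro BH.tlift_cong[OF G] BB.tlift_cong[OF G])
        (use * aB in \<open>auto simp: B.X.m_assoc intro!: BB.tlift_closed[OF G] fD(1)\<close>)
    finally show "f l (r \<otimes>\<^bsub>B\<^esub> a) = tlift G (\<lambda>r' k. ?g (l \<otimes>\<^bsub>B\<^esub> r') k) (coact r)" .
  qed (use h aB in \<open>auto intro!: BH.tlift_closed[OF G] BB.tlift_closed[OF G] fD(1)\<close>)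
  also have "\<dots> = ?g \<one>\<^bsub>B\<^esub> h" by (rule tau_sum_coact_mult[OF g h])
  also have "\<dots> = tlift G (\<lambda>l r. f (a \<otimes>\<^bsub>B\<^esub> l) r) (tau h)" using aB by simp
  finally show ?thesis by simp
qed

lemma trilinearD:
  assumes "trilinear G f"
  shows "\<And>k. k \<in> carrier H \<Longrightarrow> A_balanced G (\<lambda>l r. f l r k)"
    and "\<And>l. l \<in> carrier B \<Longrightarrow> balanced K B H G (f l)"
    and "\<And>r. r \<in> carrier B \<Longrightarrow> balanced K B H G (\<lambda>l k. f l r k)"
    and "\<And>l r k. l \<in> carrier B \<Longrightarrow> r \<in> carrier B \<Longrightarrow> k \<in> carrier H \<Longrightarrow> f l r k \<in> carrier G"
proof -
  show 1: "\<And>k. k \<in> carrier H \<Longrightarrow> A_balanced G (\<lambda>l r. f l r k)"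
    and 2: "\<And>l. l \<in> carrier B \<Longrightarrow> balanced K B H G (f l)"
    using assms by (auto simp: trilinear_def)
  show "balanced K B H G (\<lambda>l k. f l r k)" if "r \<in> carrier B" for r
  proof (rule balancedI)
    fix c l k assume "c \<in> carrier K" "l \<in> carrier B" "k \<in> carrier H"
    then show "f (c \<odot>\<^bsub>B\<^esub> l) r k = f l r (c \<odot>\<^bsub>H\<^esub> k)"
      using that A_balancedD(5)[OF 1, of k c l r] balancedD(4)[OF 2, of l c r k] by simp
  qed (use that in \<open>auto intro: A_balancedD(1,2)[OF 1] balancedD(3)[OF 2]\<close>)
  show "\<And>l r k. l \<in> carrier B \<Longrightarrow> r \<in> carrier B \<Longrightarrow> k \<in> carrier H \<Longrightarrow> f l r k \<in> carrier G"
    using balancedD(1)[OF 2] by blast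
qed

text \<open>
  \<open>\<Sum> l(h) \<otimes>\<^sub>A r(h)\<^sub>0 \<otimes> r(h)\<^sub>1 = \<Sum> l(h\<^sub>1) \<otimes>\<^sub>A r(h\<^sub>1) \<otimes> h\<^sub>2\<close>: expanding \<open>l \<otimes>\<^sub>A r\<^sub>0\<close> and using coassociativity
  turns the left-hand side into \<open>\<Sum> g(l r\<^sub>0, r\<^sub>1)\<close> with \<open>g(b, k) = \<Sum> f(b l(k\<^sub>1), r(k\<^sub>1), k\<^sub>2)\<close>, and this is
  \<open>g(1, h)\<close>.
\<close>

lemma tau_sum_coact_right:
  assumes f: "trilinear G f" and h: "h \<in> carrier H"
  shows "tlift G (\<lambda>l r. tlift G (f l) (coact r)) (tau h)
       = tlift G (\<lambda>h1 h2. tlift G (\<lambda>l r. f l r h2) (tau h1)) (comul h)"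
proof -
  note f1 = trilinearD(1)[OF f] and f2 = trilinearD(2)[OF f] and f3 = trilinearD(3)[OF f]
    and fc = trilinearD(4)[OF f]
  let ?g = "\<lambda>b k' k. tlift G (\<lambda>l r. f (b \<otimes>\<^bsub>B\<^esub> l) r k) (tau k')"
  have F: "\<And>b k. b \<in> carrier B \<Longrightarrow> k \<in> carrier H \<Longrightarrow> A_balanced G (\<lambda>l r. f (b \<otimes>\<^bsub>B\<^esub> l) r k)"
    by (rule A_balanced_lmul[OF f1])
  have g1: "balanced K B H G (\<lambda>b k'. ?g b k' k)" if "k \<in> carrier H" for k
    by (rule tau_param_balanced[OF BK F])
      (use that in \<open>auto simp: B.X.l_distr A_balancedD[OF f1] B_scale_left B_scale_right\<close>)
  have g2: "balanced K H H G (?g b)" if b: "b \<in> carrier B" for b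
  proof (rule balancedI)
    fix c x y assume *: "c \<in> carrier K" "x \<in> carrier H" "y \<in> carrier H"
    show "?g b (c \<odot>\<^bsub>H\<^esub> x) y = ?g b x (c \<odot>\<^bsub>H\<^esub> y)"
      unfolding tau_sum_smult[OF F[OF b *(3)] *(1,2)]
      by (rule BB.tlift_cong[OF G])
        (use * b in \<open>auto simp: B_scale_right balancedD(4)[OF f3] intro!: fc\<close>)
  qed (use b in \<open>auto simp: tau_sum_add[OF F] balancedD(3)[OF f2]
        intro!: BB.tlift_closed[OF G] BB.tlift_split[OF G] fc\<close>)
  have G2: "balanced K B H G (\<lambda>b k. tlift G (?g b) (comul k))"
    by (rule comul_param_balanced[OF BK g1 g2])
  have gc: "\<And>b k' k. b \<in> carrier B \<Longrightarrow> k' \<in> carrier H \<Longrightarrow> k \<in> carrier H \<Longrightarrow> ?g b k' k \<in> carrier G"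
    by (auto intro!: BB.tlift_closed[OF G] fc)
  have "tlift G (\<lambda>l r. tlift G (f l) (coact r)) (tau h)
     = tlift G (\<lambda>l r. tlift G (\<lambda>r' k. tlift G (?g (l \<otimes>\<^bsub>B\<^esub> r')) (comul k)) (coact r)) (tau h)"
  proof (rule BB.tlift_cong[OF G])
    fix l r assume "l \<in> carrier (right_reg B)" "r \<in> carrier (left_reg B)"
    then have *: "l \<in> carrier B" "r \<in> carrier B" by auto
    have "tlift G (f l) (coact r)
        = tlift G (\<lambda>r' k. tlift G (\<lambda>r'' k'. ?g (l \<otimes>\<^bsub>B\<^esub> r'') k' k) (coact r')) (coact r)"
    proof (rule BH.tlift_cong[OF G])
      fix r' k assume **: "r' \<in> carrier B" "k \<in> carrier H"
      show "f l r' k = tlift G (\<lambda>r'' k'. ?g (l \<otimes>\<^bsub>B\<^esub> r'') k' k) (coact r')"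
        by (rule galois_expand[OF f1]) (use * ** in auto)
    qed (use * in \<open>auto intro!: BH.tlift_closed[OF G] gc\<close>)
    also have "\<dots> = tlift G (\<lambda>r' k. tlift G (?g (l \<otimes>\<^bsub>B\<^esub> r')) (comul k)) (coact r)"
      by (rule coact_sum_coassoc[OF G balanced_mult_left[OF g1] g2]) (use * in auto)
    finally show "tlift G (f l) (coact r)
       = tlift G (\<lambda>r' k. tlift G (?g (l \<otimes>\<^bsub>B\<^esub> r')) (comul k)) (coact r)" .
  qed (use h in \<open>auto intro!: BH.tlift_closed[OF G] HH.tlift_closed[OF G] gc\<close>)
  also have "\<dots> = tlift G (?g \<one>\<^bsub>B\<^esub>) (comul h)"
    by (rule tau_sum_coact_mult[OF G2 h])
  also have "\<dots> = tlift G (\<lambda>h1 h2. tlift G (\<lambda>l r. f l r h2) (tau h1)) (comul h)"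
    by (intro HH.tlift_cong[OF G] BB.tlift_cong[OF G])
      (use h in \<open>auto intro!: BB.tlift_closed[OF G] fc\<close>)
  finally show ?thesis .
qed

lemma twist_balanced:
  assumes f: "trilinear G f" and x: "x \<in> carrier B"
  shows "\<And>r k1. r \<in> carrier B \<Longrightarrow> k1 \<in> carrier H \<Longrightarrow>
      balanced K B H G (\<lambda>l' k. f (x \<otimes>\<^bsub>B\<^esub> l') r (k1 \<otimes>\<^bsub>H\<^esub> k))"
    and "\<And>k1. k1 \<in> carrier H \<Longrightarrow> A_balanced G
      (\<lambda>l r. tlift G (\<lambda>l' k. f (x \<otimes>\<^bsub>B\<^esub> l') r (k1 \<otimes>\<^bsub>H\<^esub> k)) (coact l))"
    and "balanced K H H G (\<lambda>k1 k2. tlift G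
      (\<lambda>l r. tlift G (\<lambda>l' k. f (x \<otimes>\<^bsub>B\<^esub> l') r (k1 \<otimes>\<^bsub>H\<^esub> k)) (coact l)) (tau k2))"
proof -
  note f1 = trilinearD(1)[OF f] and f2 = trilinearD(2)[OF f] and f3 = trilinearD(3)[OF f]
    and fc = trilinearD(4)[OF f]
  let ?F = "\<lambda>x k1 l r. tlift G (\<lambda>l' k. f (x \<otimes>\<^bsub>B\<^esub> l') r (k1 \<otimes>\<^bsub>H\<^esub> k)) (coact l)"
  let ?g = "\<lambda>x k1 k2. tlift G (?F x k1) (tau k2)"
  have Fb: "balanced K B H G (\<lambda>l' k. f (x \<otimes>\<^bsub>B\<^esub> l') r (k1 \<otimes>\<^bsub>H\<^esub> k))"
    if "x \<in> carrier B" "r \<in> carrier B" "k1 \<in> carrier H" for x r k1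
    by (rule balancedI) (use that in \<open>auto simp: B.X.r_distr X.r_distr balancedD[OF f3]
          B_scale_right H_scale_right\<close>)
  have FA: "A_balanced G (?F x k1)" if *: "x \<in> carrier B" "k1 \<in> carrier H" for x k1
  proof (rule A_balancedI)
    fix a l r assume **: "a \<in> carrier A" "l \<in> carrier B" "r \<in> carrier B"
    have "?F x k1 (l \<otimes>\<^bsub>B\<^esub> a) r = tlift G (\<lambda>l' k. f (x \<otimes>\<^bsub>B\<^esub> (l' \<otimes>\<^bsub>B\<^esub> a)) r (k1 \<otimes>\<^bsub>H\<^esub> k)) (coact l)"
      by (rule coact_sum_coinvariant(2)[OF G Fb]) (use * ** in auto)
    also have "\<dots> = ?F x k1 l (a \<otimes>\<^bsub>B\<^esub> r)"
      by (rule BH.tlift_cong[OF G])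
        (use * ** in \<open>auto simp: B.X.m_assoc[symmetric] A_balancedD(4)[OF f1] intro!: fc\<close>)
    finally show "?F x k1 (l \<otimes>\<^bsub>B\<^esub> a) r = ?F x k1 l (a \<otimes>\<^bsub>B\<^esub> r)" .
  qed (use * in \<open>auto simp: coact_sum_add[OF G Fb] balancedD(2)[OF f2]
        intro!: BH.tlift_closed[OF G] BH.tlift_split[OF G] fc\<close>)
  have g2: "balanced K H H G (?g x)" if x: "x \<in> carrier B" for x
  proof (rule tau_param_balanced[OF HK FA[OF x]])
    fix c k l r assume *: "c \<in> carrier K" "k \<in> carrier H" "l \<in> carrier B" "r \<in> carrier B"
    show "?F x (c \<odot>\<^bsub>H\<^esub> k) l r = ?F x k (c \<odot>\<^bsub>B\<^esub> l) r"
      unfolding coact_sum_smult[OF G Fb[OF x *(4,2)] *(1,3)]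
      by (rule BH.tlift_cong[OF G])
        (use * x in \<open>auto simp: H_scale_left B_scale_right balancedD(4)[OF f3] intro!: fc\<close>)
  qed (use x in \<open>auto simp: X.l_distr balancedD(3)[OF f2] intro!: BH.tlift_split[OF G] fc\<close>)
  show "\<And>r k1. r \<in> carrier B \<Longrightarrow> k1 \<in> carrier H \<Longrightarrow>
      balanced K B H G (\<lambda>l' k. f (x \<otimes>\<^bsub>B\<^esub> l') r (k1 \<otimes>\<^bsub>H\<^esub> k))"
    by (rule Fb[OF x])
  show "\<And>k1. k1 \<in> carrier H \<Longrightarrow> A_balanced G (?F x k1)" by (rule FA[OF x])
  show "balanced K H H G (?g x)" by (rule g2[OF x])
qed

text \<open>
  \<open>\<Sum> l(h\<^sub>2)\<^sub>0 \<otimes>\<^sub>A r(h\<^sub>2) \<otimes> h\<^sub>1 l(h\<^sub>2)\<^sub>1 = \<Sum> l(h) \<otimes>\<^sub>A r(h) \<otimes> 1\<close>. Fact \<open>e\<close> of the proof expands \<open>l \<otimes>\<^sub>A r \<otimes> 1\<close> so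
  that, after coassociativity, the right-hand side is a sum of the form \<open>\<Sum> g(l r\<^sub>0, r\<^sub>1)\<close>; its value
  \<open>g(1, h)\<close> is the left-hand side.
\<close>

lemma tau_sum_coact_left:
  assumes f: "trilinear G f" and h: "h \<in> carrier H"
  shows "tlift G (\<lambda>h1 h2. tlift G (\<lambda>l r. tlift G (\<lambda>l' k. f l' r (h1 \<otimes>\<^bsub>H\<^esub> k)) (coact l)) (tau h2)) (comul h)
       = tlift G (\<lambda>l r. f l r \<one>\<^bsub>H\<^esub>) (tau h)"
proof -
  note f1 = trilinearD(1)[OF f] and f2 = trilinearD(2)[OF f] and f3 = trilinearD(3)[OF f]
    and fc = trilinearD(4)[OF f]
  let ?F = "\<lambda>x k1 l r. tlift G (\<lambda>l' k. f (x \<otimes>\<^bsub>B\<^esub> l') r (k1 \<otimes>\<^bsub>H\<^esub> k)) (coact l)"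
  let ?g = "\<lambda>x k1 k2. tlift G (?F x k1) (tau k2)"
  note Fb = twist_balanced(1)[OF f] and FA = twist_balanced(2)[OF f]
  have Fc: "\<And>x k1 l r. x \<in> carrier B \<Longrightarrow> k1 \<in> carrier H \<Longrightarrow> l \<in> carrier B \<Longrightarrow> r \<in> carrier B
     \<Longrightarrow> ?F x k1 l r \<in> carrier G"
    by (auto intro!: BH.tlift_closed[OF G] fc)
  have gc: "\<And>x k1 k2. x \<in> carrier B \<Longrightarrow> k1 \<in> carrier H \<Longrightarrow> k2 \<in> carrier H \<Longrightarrow> ?g x k1 k2 \<in> carrier G"
    by (auto intro!: BB.tlift_closed[OF G] Fc)
  have g1: "balanced K B H G (\<lambda>x k1. ?g x k1 k2)" if k2: "k2 \<in> carrier H" for k2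
    by (rule balancedI)
      (use k2 in \<open>auto simp: B.X.l_distr X.l_distr balancedD[OF f3] B_scale_left H_scale_left
        intro!: BB.tlift_closed[OF G] BB.tlift_split[OF G] BB.tlift_cong[OF G] Fc
          BH.tlift_split[OF G] BH.tlift_cong[OF G] fc\<close>)
  note g2 = twist_balanced(3)[OF f]
  have G2: "balanced K B H G (\<lambda>x k. tlift G (?g x) (comul k))"
    by (rule comul_param_balanced[OF BK g1 g2])
  have e: "f x y \<one>\<^bsub>H\<^esub> = tlift G (\<lambda>y' k. tlift G (?g (x \<otimes>\<^bsub>B\<^esub> y')) (comul k)) (coact y)"
    if x: "x \<in> carrier B" and y: "y \<in> carrier B" for x y
  proof -
    \<comment> \<open>\<open>e z w = \<Sum> f (x z\<^sub>0) w z\<^sub>1\<close> is \<open>A\<close>-balanced, so it can be expanded at \<open>z = 1\<close>.\<close>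
    let ?e = "\<lambda>z w. ?F x \<one>\<^bsub>H\<^esub> z w"
    have "f x y \<one>\<^bsub>H\<^esub> = ?e \<one>\<^bsub>B\<^esub> y"
      using x y by (simp add: coact_sum_one[OF G Fb])
    also have "\<dots> = tlift G (\<lambda>y' h. tlift G (\<lambda>l r. ?e (\<one>\<^bsub>B\<^esub> \<otimes>\<^bsub>B\<^esub> y' \<otimes>\<^bsub>B\<^esub> l) r) (tau h)) (coact y)"
      by (rule galois_expand[OF FA]) (use x y in auto)
    also have "\<dots> = tlift G (\<lambda>y' h. tlift G (\<lambda>l r. tlift G (\<lambda>y'' k. ?F (x \<otimes>\<^bsub>B\<^esub> y'') k l r)
         (coact y')) (tau h)) (coact y)"
    proof (intro BH.tlift_cong[OF G] BB.tlift_cong[OF G])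
      fix y' h l r assume "y' \<in> carrier B" "h \<in> carrier H" "l \<in> carrier (right_reg B)" "r \<in> carrier (left_reg B)"
      then have *: "y' \<in> carrier B" "h \<in> carrier H" "l \<in> carrier B" "r \<in> carrier B" by auto
      have "?e (\<one>\<^bsub>B\<^esub> \<otimes>\<^bsub>B\<^esub> y' \<otimes>\<^bsub>B\<^esub> l) r
         = tlift G (\<lambda>y'' k. tlift G (\<lambda>l' k'. f (x \<otimes>\<^bsub>B\<^esub> (y'' \<otimes>\<^bsub>B\<^esub> l')) r (\<one>\<^bsub>H\<^esub> \<otimes>\<^bsub>H\<^esub> (k \<otimes>\<^bsub>H\<^esub> k'))) (coact l)) (coact y')"
        using * x by (simp add: coact_sum_mult[OF G Fb])
      also have "\<dots> = tlift G (\<lambda>y'' k. ?F (x \<otimes>\<^bsub>B\<^esub> y'') k l r) (coact y')"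
        by (intro BH.tlift_cong[OF G]) (use * x in \<open>auto simp: B.X.m_assoc intro!: BH.tlift_closed[OF G] fc\<close>)
      finally show "?e (\<one>\<^bsub>B\<^esub> \<otimes>\<^bsub>B\<^esub> y' \<otimes>\<^bsub>B\<^esub> l) r = tlift G (\<lambda>y'' k. ?F (x \<otimes>\<^bsub>B\<^esub> y'') k l r) (coact y')" .
    qed (use x y in \<open>auto intro!: BB.tlift_closed[OF G] BH.tlift_closed[OF G] fc\<close>)
    also have "\<dots> = tlift G (\<lambda>y' h. tlift G (\<lambda>y'' k. ?g (x \<otimes>\<^bsub>B\<^esub> y'') k h) (coact y')) (coact y)"
      by (intro BH.tlift_cong[OF G] tlift_swap[OF BB.tensor_data_axioms BH.tensor_data_axioms G])
        (use x y in \<open>auto intro!: BH.tlift_closed[OF G] BB.tlift_closed[OF G] fc\<close>)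
    also have "\<dots> = tlift G (\<lambda>y' k. tlift G (?g (x \<otimes>\<^bsub>B\<^esub> y')) (comul k)) (coact y)"
      by (rule coact_sum_coassoc[OF G balanced_mult_left[OF g1] g2]) (use x y in auto)
    finally show ?thesis .
  qed
  have "tlift G (\<lambda>l r. f l r \<one>\<^bsub>H\<^esub>) (tau h)
     = tlift G (\<lambda>l r. tlift G (\<lambda>r' k. tlift G (?g (l \<otimes>\<^bsub>B\<^esub> r')) (comul k)) (coact r)) (tau h)"
    by (rule BB.tlift_cong[OF G])
      (use h in \<open>auto simp: e intro!: BH.tlift_closed[OF G] HH.tlift_closed[OF G] gc\<close>)
  also have "\<dots> = tlift G (?g \<one>\<^bsub>B\<^esub>) (comul h)"
    by (rule tau_sum_coact_mult[OF G2 h])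
  also have "\<dots> = tlift G (\<lambda>h1 h2. tlift G (\<lambda>l r. tlift G (\<lambda>l' k. f l' r (h1 \<otimes>\<^bsub>H\<^esub> k)) (coact l)) (tau h2)) (comul h)"
    by (intro HH.tlift_cong[OF G] BB.tlift_cong[OF G] BH.tlift_cong[OF G])
      (use h in \<open>auto intro!: BB.tlift_closed[OF G] BH.tlift_closed[OF G] fc\<close>)
  finally show ?thesis by simp
qed

text \<open>
  \<open>\<Sum> l(h) r(h) = \<epsilon>(h) 1\<close>, by applying the counit to the last factor in \<open>tau_sum_coact_mult\<close>.
\<close>

lemma tau_sum_product:
  assumes f: "add_hom B G f" and h: "h \<in> carrier H"
  shows "tlift G (\<lambda>l r. f (l \<otimes>\<^bsub>B\<^esub> r)) (tau h) = f (counit h \<odot>\<^bsub>B\<^esub> \<one>\<^bsub>B\<^esub>)"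
proof -
  note fD = add_homD[OF f]
  let ?g = "\<lambda>b k. f (counit k \<odot>\<^bsub>B\<^esub> b)"
  have g: "balanced K B H G ?g"
    by (rule balancedI)
      (auto simp: fD B.smult_r_distr B.smult_l_distr counitD(2,5)
         scalars_def module.smult_assoc1[OF B_module] K_comm, simp_all add: B.smult_assoc1[symmetric] K_comm)
  have "tlift G (\<lambda>l r. f (l \<otimes>\<^bsub>B\<^esub> r)) (tau h)
      = tlift G (\<lambda>l r. tlift G (\<lambda>r' k. ?g (l \<otimes>\<^bsub>B\<^esub> r') k) (coact r)) (tau h)"
  proof (rule BB.tlift_cong[OF G])
    fix l r assume "l \<in> carrier (right_reg B)" "r \<in> carrier (left_reg B)"
    then have *: "l \<in> carrier B" "r \<in> carrier B" by auto
    have "f (l \<otimes>\<^bsub>B\<^esub> r) = tlift G (\<lambda>r' k. f (l \<otimes>\<^bsub>B\<^esub> (counit k \<odot>\<^bsub>B\<^esub> r'))) (coact r)"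
      by (rule coact_sum_counit[OF G, symmetric])
        (use * in \<open>auto simp: add_hom_def fD B.X.r_distr\<close>)
    also have "\<dots> = tlift G (\<lambda>r' k. ?g (l \<otimes>\<^bsub>B\<^esub> r') k) (coact r)"
      by (rule BH.tlift_cong[OF G]) (use * in \<open>auto simp: B_scale_right fD\<close>)
    finally show "f (l \<otimes>\<^bsub>B\<^esub> r) = tlift G (\<lambda>r' k. ?g (l \<otimes>\<^bsub>B\<^esub> r') k) (coact r)" .
  qed (use h in \<open>auto intro!: BH.tlift_closed[OF G] fD(1)\<close>)
  then show ?thesis using tau_sum_coact_mult[OF g h] by simp
qed

end

end

section \<open>Tensor products of algebras\<close>

lemma assoc_algebraD:
  assumes "assoc_algebra K X"
  shows "module K X" "ring X"
  using assms by (auto simp: assoc_algebra_def)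

lemma op_ring_ring:
  assumes "ring R" shows "ring (op_ring R)"
proof -
  interpret ring R by fact
  show ?thesis
    by (rule ringI) (auto intro!: abelian_group_transfer[OF is_abelian_group] monoidI
        simp: m_assoc l_distr r_distr)
qed

lemma op_ring_module:
  assumes "module K X" shows "module K (op_ring X)"
proof -
  interpret module K X by fact
  show ?thesis
    by (rule moduleI) (auto intro!: abelian_group_transfer[OF M.abelian_group_axioms] R.cring_axioms
        simp: smult_l_distr smult_r_distr smult_assoc1)
qed

lemma op_ring_assoc_algebra:
  assumes "assoc_algebra K X" shows "assoc_algebra K (op_ring X)"
  using assms
  by (auto simp: assoc_algebra_def assoc_algebra_axioms_def op_ring_ring op_ring_module)

context
  fixes K :: "('k, 'x) ring_scheme" and X :: "('k, 'a, 'y) module_scheme"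
    and Y :: "('k, 'c, 'z) module_scheme"
  assumes X: "assoc_algebra K X" and Y: "assoc_algebra K Y"
begin

interpretation X: assoc_algebra K X by (rule X)
interpretation Y: assoc_algebra K Y by (rule Y)

interpretation T: tensor_data K X Y
  by (rule tensor_data.intro[OF acted_module[OF assoc_algebraD(1)[OF X]] acted_module[OF assoc_algebraD(1)[OF Y]]])

abbreviation (input) "XY \<equiv> alg_tensor K X Y"
abbreviation (input) "XYt \<equiv> tensor K X Y"

lemmas alg_tensor_group = T.abelian_group_tensor

lemma alg_tensor_inner_balanced:
  assumes "x \<in> carrier X" "y \<in> carrier Y"
  shows "balanced K X Y XYt (\<lambda>x' y'. ptensor K X Y (x \<otimes>\<^bsub>X\<^esub> x') (y \<otimes>\<^bsub>Y\<^esub> y'))"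
  by (rule balancedI)
    (use assms in \<open>simp_all add: X.X.r_distr Y.X.r_distr T.ptensor_add_left T.ptensor_add_right
       X.scale_mult_right Y.scale_mult_right T.ptensor_smult\<close>)

lemma alg_tensor_outer_balanced:
  assumes t: "t \<in> carrier XYt"
  shows "balanced K X Y XYt (\<lambda>x y. tlift XYt (\<lambda>x' y'. ptensor K X Y (x \<otimes>\<^bsub>X\<^esub> x') (y \<otimes>\<^bsub>Y\<^esub> y')) t)"
proof (rule balancedI)
  fix x y assume "x \<in> carrier X" "y \<in> carrier Y"
  then show "tlift XYt (\<lambda>x' y'. ptensor K X Y (x \<otimes>\<^bsub>X\<^esub> x') (y \<otimes>\<^bsub>Y\<^esub> y')) t \<in> carrier XYt"
    using t by (intro T.tlift_closed[OF alg_tensor_group]) auto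
next
  fix x x' y assume "x \<in> carrier X" "x' \<in> carrier X" "y \<in> carrier Y"
  then show "tlift XYt (\<lambda>x'' y'. ptensor K X Y ((x \<oplus>\<^bsub>X\<^esub> x') \<otimes>\<^bsub>X\<^esub> x'') (y \<otimes>\<^bsub>Y\<^esub> y')) t
     = tlift XYt (\<lambda>x'' y'. ptensor K X Y (x \<otimes>\<^bsub>X\<^esub> x'') (y \<otimes>\<^bsub>Y\<^esub> y')) t
       \<oplus>\<^bsub>XYt\<^esub> tlift XYt (\<lambda>x'' y'. ptensor K X Y (x' \<otimes>\<^bsub>X\<^esub> x'') (y \<otimes>\<^bsub>Y\<^esub> y')) t"
    using t by (intro T.tlift_split[OF alg_tensor_group]) (simp_all add: X.X.l_distr T.ptensor_add_left)
next
  fix x y y' assume "x \<in> carrier X" "y \<in> carrier Y" "y' \<in> carrier Y"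
  then show "tlift XYt (\<lambda>x'' y''. ptensor K X Y (x \<otimes>\<^bsub>X\<^esub> x'') ((y \<oplus>\<^bsub>Y\<^esub> y') \<otimes>\<^bsub>Y\<^esub> y'')) t
     = tlift XYt (\<lambda>x'' y''. ptensor K X Y (x \<otimes>\<^bsub>X\<^esub> x'') (y \<otimes>\<^bsub>Y\<^esub> y'')) t
       \<oplus>\<^bsub>XYt\<^esub> tlift XYt (\<lambda>x'' y''. ptensor K X Y (x \<otimes>\<^bsub>X\<^esub> x'') (y' \<otimes>\<^bsub>Y\<^esub> y'')) t"
    using t by (intro T.tlift_split[OF alg_tensor_group]) (simp_all add: Y.X.l_distr T.ptensor_add_right)
next
  fix c x y assume "c \<in> carrier K" "x \<in> carrier X" "y \<in> carrier Y"
  then show "tlift XYt (\<lambda>x'' y''. ptensor K X Y ((c \<odot>\<^bsub>X\<^esub> x) \<otimes>\<^bsub>X\<^esub> x'') (y \<otimes>\<^bsub>Y\<^esub> y'')) t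
     = tlift XYt (\<lambda>x'' y''. ptensor K X Y (x \<otimes>\<^bsub>X\<^esub> x'') ((c \<odot>\<^bsub>Y\<^esub> y) \<otimes>\<^bsub>Y\<^esub> y'')) t"
    using t by (intro T.tlift_cong[OF alg_tensor_group])
      (simp_all add: X.scale_mult_left Y.scale_mult_left T.ptensor_smult)
qed

lemma alg_tensor_mult_closed:
  assumes "s \<in> carrier XYt" "t \<in> carrier XYt"
  shows "s \<otimes>\<^bsub>XY\<^esub> t \<in> carrier XYt"
  unfolding alg_tensor_mult
  by (rule T.tlift_closed[OF alg_tensor_group assms(1)]) (rule balancedD(1)[OF alg_tensor_outer_balanced[OF assms(2)]])

lemma alg_tensor_mult_pure_left:
  assumes "x \<in> carrier X" "y \<in> carrier Y" "t \<in> carrier XYt"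
  shows "ptensor K X Y x y \<otimes>\<^bsub>XY\<^esub> t = tlift XYt (\<lambda>x' y'. ptensor K X Y (x \<otimes>\<^bsub>X\<^esub> x') (y \<otimes>\<^bsub>Y\<^esub> y')) t"
  unfolding alg_tensor_mult
  by (rule T.tlift_ptensor[OF alg_tensor_group alg_tensor_outer_balanced[OF assms(3)] assms(1,2)])

lemma alg_tensor_mult_pure:
  assumes "x \<in> carrier X" "y \<in> carrier Y" "x' \<in> carrier X" "y' \<in> carrier Y"
  shows "ptensor K X Y x y \<otimes>\<^bsub>XY\<^esub> ptensor K X Y x' y' = ptensor K X Y (x \<otimes>\<^bsub>X\<^esub> x') (y \<otimes>\<^bsub>Y\<^esub> y')"
  unfolding alg_tensor_mult_pure_left[OF assms(1,2) T.ptensor_closed[OF assms(3,4)]]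
  by (rule T.tlift_ptensor[OF alg_tensor_group alg_tensor_inner_balanced[OF assms(1,2)] assms(3,4)])

lemma alg_tensor_distrib_right:
  assumes "s \<in> carrier XYt" "s' \<in> carrier XYt" "t \<in> carrier XYt"
  shows "(s \<oplus>\<^bsub>XYt\<^esub> s') \<otimes>\<^bsub>XY\<^esub> t = (s \<otimes>\<^bsub>XY\<^esub> t) \<oplus>\<^bsub>XYt\<^esub> (s' \<otimes>\<^bsub>XY\<^esub> t)"
  unfolding alg_tensor_mult by (rule T.tlift_add[OF alg_tensor_group alg_tensor_outer_balanced[OF assms(3)] assms(1,2)])

lemma alg_tensor_distrib_left:
  assumes "s \<in> carrier XYt" "t \<in> carrier XYt" "t' \<in> carrier XYt"
  shows "s \<otimes>\<^bsub>XY\<^esub> (t \<oplus>\<^bsub>XYt\<^esub> t') = (s \<otimes>\<^bsub>XY\<^esub> t) \<oplus>\<^bsub>XYt\<^esub> (s \<otimes>\<^bsub>XY\<^esub> t')"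
  unfolding alg_tensor_mult
  by (rule T.tlift_split[OF alg_tensor_group assms(1)])
    (use assms balancedD(1)[OF alg_tensor_outer_balanced] T.tlift_add[OF alg_tensor_group alg_tensor_inner_balanced] in auto)

theorem alg_tensor_ring: "ring XY"
proof (rule ringI)
  show "abelian_group XY" by (rule abelian_group_transfer[OF alg_tensor_group]) simp_all
  have assoc: "(s \<otimes>\<^bsub>XY\<^esub> t) \<otimes>\<^bsub>XY\<^esub> u = s \<otimes>\<^bsub>XY\<^esub> (t \<otimes>\<^bsub>XY\<^esub> u)"
    if s: "s \<in> carrier XYt" and t: "t \<in> carrier XYt" and u: "u \<in> carrier XYt" for s t u
    using s
  proof (induction s rule: T.tensor_induct)
    case (pure x y)
    note xy = this
    show ?case using t
    proof (induction t rule: T.tensor_induct)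
      case (pure x' y')
      note xy' = this
      show ?case using u
      proof (induction u rule: T.tensor_induct)
        case (pure x'' y'')
        then show ?case using xy xy' by (simp add: alg_tensor_mult_pure X.X.m_assoc Y.X.m_assoc)
      next
        case (add s t)
        then show ?case using xy xy'
          by (simp add: alg_tensor_distrib_left alg_tensor_mult_closed)
      qed
    next
      case (add s t)
      then show ?case using xy u
        by (simp add: alg_tensor_distrib_left alg_tensor_distrib_right alg_tensor_mult_closed)
    qed
  next
    case (add s s')
    then show ?case using t u by (simp add: alg_tensor_distrib_right alg_tensor_mult_closed)
  qed
  have one: "\<one>\<^bsub>XY\<^esub> \<otimes>\<^bsub>XY\<^esub> t = t \<and> t \<otimes>\<^bsub>XY\<^esub> \<one>\<^bsub>XY\<^esub> = t" if "t \<in> carrier XYt" for t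
    using that
  proof (induction t rule: T.tensor_induct)
    case (pure x y)
    then show ?case by (simp add: alg_tensor_one alg_tensor_mult_pure)
  next
    case (add s t)
    then show ?case by (simp add: alg_tensor_one alg_tensor_distrib_left alg_tensor_distrib_right)
  qed
  show "monoid XY"
    by (rule monoidI) (simp_all add: alg_tensor_mult_closed assoc one, simp add: alg_tensor_one)
qed (simp_all add: alg_tensor_distrib_left alg_tensor_distrib_right)

end

section \<open>The enveloping algebra and its coinvariants\<close>

text \<open>
  Modules over \<open>\<Gamma>\<close> presuppose that \<open>\<Gamma>\<close> is a ring, so the extra assumption holds whenever there is such
  a module.
\<close>

locale galois_env = galois_ext K H comul counit antipode B coact
  for K :: "'k ring" and H :: "('k, 'h) module" and comul :: "'h \<Rightarrow> ('h, 'h) tensors"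
    and counit :: "'h \<Rightarrow> 'k" and antipode :: "'h \<Rightarrow> 'h"
    and B :: "('k, 'b) module" and coact :: "'b \<Rightarrow> ('b, 'h) tensors" +
  assumes Gamma_ring: "ring Gamma"
begin

lemma B_algebra: "assoc_algebra K B" by (rule B.assoc_algebra_axioms)
lemma Bop_algebra: "assoc_algebra K (op_ring B)" by (rule op_ring_assoc_algebra[OF B_algebra])

lemma Bop_acted: "acted K (op_ring B)"
  by (rule acted_module[OF assoc_algebraD(1)[OF Bop_algebra]])

sublocale EE: tensor_data K B "op_ring B"
  by (rule tensor_data.intro[OF BK Bop_acted])

abbreviation "Bt \<equiv> tensor K B (op_ring B)"

lemma Be_simps [simp]: "carrier Be = carrier Bt" "add Be = add Bt" "zero Be = zero Bt"
  by (simp_all add: env_def)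

lemma Be_one: "\<one>\<^bsub>Be\<^esub> = be \<one>\<^bsub>B\<^esub> \<one>\<^bsub>B\<^esub>" by (simp add: env_def alg_tensor_one)

lemma Be_ring: "ring Be" unfolding env_def by (rule alg_tensor_ring[OF B_algebra Bop_algebra])

sublocale BeR: ring Be by (rule Be_ring)

lemma Be_mult_closed [simp]:
  "s \<in> carrier Bt \<Longrightarrow> t \<in> carrier Bt \<Longrightarrow> s \<otimes>\<^bsub>Be\<^esub> t \<in> carrier Bt"
  using BeR.m_closed by simp

lemma Be_distrib:
  assumes "s \<in> carrier Bt" "t \<in> carrier Bt" "u \<in> carrier Bt"
  shows "(s \<oplus>\<^bsub>Bt\<^esub> t) \<otimes>\<^bsub>Be\<^esub> u = (s \<otimes>\<^bsub>Be\<^esub> u) \<oplus>\<^bsub>Bt\<^esub> (t \<otimes>\<^bsub>Be\<^esub> u)"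
    and "u \<otimes>\<^bsub>Be\<^esub> (s \<oplus>\<^bsub>Bt\<^esub> t) = (u \<otimes>\<^bsub>Be\<^esub> s) \<oplus>\<^bsub>Bt\<^esub> (u \<otimes>\<^bsub>Be\<^esub> t)"
  using assms BeR.l_distr[of s t u] BeR.r_distr[of s t u] by simp_all

lemma Be_assoc:
  "s \<in> carrier Bt \<Longrightarrow> t \<in> carrier Bt \<Longrightarrow> u \<in> carrier Bt \<Longrightarrow>
    (s \<otimes>\<^bsub>Be\<^esub> t) \<otimes>\<^bsub>Be\<^esub> u = s \<otimes>\<^bsub>Be\<^esub> (t \<otimes>\<^bsub>Be\<^esub> u)"
  using BeR.m_assoc by simp

lemma Be_one_mult [simp]: "t \<in> carrier Bt \<Longrightarrow> be \<one>\<^bsub>B\<^esub> \<one>\<^bsub>B\<^esub> \<otimes>\<^bsub>Be\<^esub> t = t"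
  "t \<in> carrier Bt \<Longrightarrow> t \<otimes>\<^bsub>Be\<^esub> be \<one>\<^bsub>B\<^esub> \<one>\<^bsub>B\<^esub> = t"
  using BeR.l_one BeR.r_one by (simp_all add: Be_one)

lemma be_closed [simp]: "b \<in> carrier B \<Longrightarrow> b' \<in> carrier B \<Longrightarrow> be b b' \<in> carrier Bt"
  using EE.ptensor_closed by simp

lemma be_mult:
  "b \<in> carrier B \<Longrightarrow> b' \<in> carrier B \<Longrightarrow> c \<in> carrier B \<Longrightarrow> c' \<in> carrier B \<Longrightarrow>
    be b b' \<otimes>\<^bsub>Be\<^esub> be c c' = be (b \<otimes>\<^bsub>B\<^esub> c) (c' \<otimes>\<^bsub>B\<^esub> b')"
  unfolding env_def by (simp add: alg_tensor_mult_pure[OF B_algebra Bop_algebra])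

lemma be_add:
  "b \<in> carrier B \<Longrightarrow> b' \<in> carrier B \<Longrightarrow> c \<in> carrier B \<Longrightarrow> be (b \<oplus>\<^bsub>B\<^esub> c) b' = be b b' \<oplus>\<^bsub>Bt\<^esub> be c b'"
  "b \<in> carrier B \<Longrightarrow> b' \<in> carrier B \<Longrightarrow> c \<in> carrier B \<Longrightarrow> be b (b' \<oplus>\<^bsub>B\<^esub> c) = be b b' \<oplus>\<^bsub>Bt\<^esub> be b c"
  using EE.ptensor_add_left EE.ptensor_add_right by simp_all

lemma be_smult:
  "k \<in> carrier K \<Longrightarrow> b \<in> carrier B \<Longrightarrow> b' \<in> carrier B \<Longrightarrow> be (k \<odot>\<^bsub>B\<^esub> b) b' = be b (k \<odot>\<^bsub>B\<^esub> b')"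
  using EE.ptensor_smult by simp

lemma Be_acted: "acted K Be"
  unfolding env_def by (rule alg_tensor_acted[OF EE.tensor_data_axioms])

sublocale BeH: tensor_data K Be H by (rule tensor_data.intro[OF Be_acted HK])

abbreviation "BeHt \<equiv> tensor K Be H"

lemma Be_smult_be:
  assumes "c \<in> carrier K" "b \<in> carrier B" "b' \<in> carrier B"
  shows "c \<odot>\<^bsub>Be\<^esub> be b b' = be (c \<odot>\<^bsub>B\<^esub> b) b'"
  unfolding env_def alg_tensor_smult
proof (rule EE.tlift_ptensor[OF EE.abelian_group_tensor])
  show "balanced K B (op_ring B) Bt (\<lambda>x y. be (c \<odot>\<^bsub>B\<^esub> x) y)"
    by (rule balancedI)
      (use assms in \<open>simp_all add: B.smult_r_distr be_add be_smult B.smult_assoc1[symmetric] K_comm\<close>)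
qed (use assms in simp_all)

lemma Be_smult_hom:
  assumes "c \<in> carrier K"
  shows "add_hom Be Be (\<lambda>t. c \<odot>\<^bsub>Be\<^esub> t)"
proof -
  have "balanced K B (op_ring B) Bt (\<lambda>x y. be (c \<odot>\<^bsub>B\<^esub> x) y)"
    by (rule balancedI)
      (use assms in \<open>simp_all add: B.smult_r_distr be_add be_smult B.smult_assoc1[symmetric] K_comm\<close>)
  from EE.tlift_add_hom[OF EE.abelian_group_tensor this] show ?thesis
    by (simp add: env_def alg_tensor_smult add_hom_def)
qed

lemma Be_smult_closed [simp]: "c \<in> carrier K \<Longrightarrow> t \<in> carrier Bt \<Longrightarrow> c \<odot>\<^bsub>Be\<^esub> t \<in> carrier Bt"
  using actedD(2)[OF Be_acted] by simp

lemma Be_smult_mult: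
  assumes "c \<in> carrier K" "s \<in> carrier Bt" "b \<in> carrier B" "b' \<in> carrier B"
  shows "be b b' \<otimes>\<^bsub>Be\<^esub> (c \<odot>\<^bsub>Be\<^esub> s) = c \<odot>\<^bsub>Be\<^esub> (be b b' \<otimes>\<^bsub>Be\<^esub> s)"
  using assms(2)
proof (induction s rule: EE.tensor_induct)
  case (pure x y)
  then show ?case using assms by (simp add: Be_smult_be be_mult B_scale_right)
next
  case (add s t)
  then show ?case using assms add_homD(2)[OF Be_smult_hom] by (simp add: Be_distrib)
qed

subsection \<open>The codiagonal coaction\<close>

context
  fixes G :: "('g, 'w) ring_scheme"
  assumes G: "abelian_group G"
begin

lemma codiag_balanced_inner:
  assumes f: "balanced K Be H G f" and xh: "x \<in> carrier B" "h \<in> carrier H"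
  shows "balanced K B H G (\<lambda>x' h'. f (be x x') (h \<otimes>\<^bsub>H\<^esub> h'))"
  by (rule balancedI)
    (use xh balancedD[OF f] in \<open>simp_all add: be_add X.r_distr H_scale_right be_smult[symmetric] Be_smult_be[symmetric]\<close>)

lemma codiag_balanced_middle:
  assumes f: "balanced K Be H G f" and b': "b' \<in> carrier B"
  shows "balanced K B H G (\<lambda>x h. tlift G (\<lambda>x' h'. f (be x x') (h \<otimes>\<^bsub>H\<^esub> h')) (coact b'))"
  by (rule balancedI)
    (use b' balancedD[OF f] in \<open>auto simp add: be_add X.l_distr H_scale_left Be_smult_be[symmetric]
      intro!: BH.tlift_closed[OF G] BH.tlift_split[OF G] BH.tlift_cong[OF G]\<close>)

lemma codiag_balanced:
  assumes f: "balanced K Be H G f"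
  shows "balanced K B (op_ring B) G (\<lambda>b b'. tlift G (\<lambda>x h. tlift G (\<lambda>x' h'. f (be x x') (h \<otimes>\<^bsub>H\<^esub> h')) (coact b')) (coact b))"
proof (rule balancedI)
  note fD = balancedD[OF f]
  note m = codiag_balanced_middle[OF f]
  note i = codiag_balanced_inner[OF f]
  fix b b' assume "b \<in> carrier B" "b' \<in> carrier (op_ring B)"
  then have *: "b \<in> carrier B" "b' \<in> carrier B" by auto
  show "tlift G (\<lambda>x h. tlift G (\<lambda>x' h'. f (be x x') (h \<otimes>\<^bsub>H\<^esub> h')) (coact b')) (coact b) \<in> carrier G"
    by (rule BH.tlift_closed[OF G]) (use * balancedD(1)[OF m] in auto)
  show "tlift G (\<lambda>x h. tlift G (\<lambda>x' h'. f (be x x') (h \<otimes>\<^bsub>H\<^esub> h')) (coact b')) (coact (b \<oplus>\<^bsub>B\<^esub> b2))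
     = tlift G (\<lambda>x h. tlift G (\<lambda>x' h'. f (be x x') (h \<otimes>\<^bsub>H\<^esub> h')) (coact b')) (coact b)
      \<oplus>\<^bsub>G\<^esub> tlift G (\<lambda>x h. tlift G (\<lambda>x' h'. f (be x x') (h \<otimes>\<^bsub>H\<^esub> h')) (coact b')) (coact b2)"
    if "b2 \<in> carrier B" for b2
    by (rule coact_sum_add[OF G m]) (use * that in auto)
  show "tlift G (\<lambda>x h. tlift G (\<lambda>x' h'. f (be x x') (h \<otimes>\<^bsub>H\<^esub> h')) (coact (b' \<oplus>\<^bsub>op_ring B\<^esub> b2))) (coact b)
     = tlift G (\<lambda>x h. tlift G (\<lambda>x' h'. f (be x x') (h \<otimes>\<^bsub>H\<^esub> h')) (coact b')) (coact b)
      \<oplus>\<^bsub>G\<^esub> tlift G (\<lambda>x h. tlift G (\<lambda>x' h'. f (be x x') (h \<otimes>\<^bsub>H\<^esub> h')) (coact b2)) (coact b)"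
    if "b2 \<in> carrier (op_ring B)" for b2
    by (rule BH.tlift_split[OF G]) (use * that fD(1) in \<open>auto simp: coact_sum_add[OF G i] intro!: BH.tlift_closed[OF G]\<close>)
  show "tlift G (\<lambda>x h. tlift G (\<lambda>x' h'. f (be x x') (h \<otimes>\<^bsub>H\<^esub> h')) (coact b')) (coact (c \<odot>\<^bsub>B\<^esub> b))
     = tlift G (\<lambda>x h. tlift G (\<lambda>x' h'. f (be x x') (h \<otimes>\<^bsub>H\<^esub> h')) (coact (c \<odot>\<^bsub>op_ring B\<^esub> b'))) (coact b)"
    if "c \<in> carrier K" for c
    unfolding coact_sum_smult[OF G m[OF *(2)] that *(1)]
    by (rule BH.tlift_cong[OF G]) (use * that fD(1) in \<open>auto simp: coact_sum_smult[OF G i] be_smult intro!: BH.tlift_closed[OF G] BH.tlift_cong[OF G]\<close>)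
qed

end

lemma BeHG: "abelian_group BeHt" by (rule BeH.abelian_group_tensor)

lemma codiag_hom: "add_hom Be BeHt codiag"
  using EE.tlift_add_hom[OF BeHG codiag_balanced[OF BeHG BeH.ptensor_balanced]]
  by (simp add: codiag_def add_hom_def)

lemma codiag_closed [simp]: "t \<in> carrier Bt \<Longrightarrow> codiag t \<in> carrier BeHt"
  using add_homD(1)[OF codiag_hom] by simp

lemma codiag_be:
  assumes "b \<in> carrier B" "b' \<in> carrier B"
  shows "codiag (be b b') = tlift BeHt (\<lambda>x h. tlift BeHt (\<lambda>x' h'.
     ptensor K Be H (be x x') (h \<otimes>\<^bsub>H\<^esub> h')) (coact b')) (coact b)"
  unfolding codiag_def
  by (rule EE.tlift_ptensor[OF BeHG codiag_balanced[OF BeHG BeH.ptensor_balanced]]) (use assms in auto)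

lemma codiag_sum_be:
  assumes G: "abelian_group G" and f: "balanced K Be H G f" and b: "b \<in> carrier B" "b' \<in> carrier B"
  shows "tlift G f (codiag (be b b')) = tlift G (\<lambda>x h. tlift G (\<lambda>x' h'. f (be x x') (h \<otimes>\<^bsub>H\<^esub> h')) (coact b')) (coact b)"
proof -
  have "tlift G f (codiag (be b b')) = tlift G (\<lambda>x h. tlift G f (tlift BeHt (\<lambda>x' h'.
     ptensor K Be H (be x x') (h \<otimes>\<^bsub>H\<^esub> h')) (coact b'))) (coact b)"
    unfolding codiag_be[OF b]
    by (rule BH.tlift_hom[OF BeHG BeH.tlift_add_hom[OF G f] G])
      (use b in \<open>auto intro!: BH.tlift_closed[OF BeHG]\<close>)
  also have "\<dots> = tlift G (\<lambda>x h. tlift G (\<lambda>x' h'. f (be x x') (h \<otimes>\<^bsub>H\<^esub> h')) (coact b')) (coact b)"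
  proof (rule BH.tlift_cong[OF G])
    fix x h assume "x \<in> carrier B" "h \<in> carrier H"
    then show "tlift G f (tlift BeHt (\<lambda>x' h'. ptensor K Be H (be x x') (h \<otimes>\<^bsub>H\<^esub> h')) (coact b'))
       = tlift G (\<lambda>x' h'. f (be x x') (h \<otimes>\<^bsub>H\<^esub> h')) (coact b')"
      using b by (intro BeH.tlift_double_hom[OF G f BH.tensor_data_axioms]) auto
  qed (use b balancedD(1)[OF f] in \<open>auto intro!: BH.tlift_closed[OF G]\<close>)
  finally show ?thesis .
qed

text \<open>
  For the action \<open>m \<cdot> y = (1 \<otimes> y) m\<close> of \<open>B\<close> on the second factor of \<open>B\<^sup>e\<close>, the coaction of \<open>m \<cdot> y\<close> is the
  product of the coactions of \<open>m\<close> and \<open>y\<close>: with the codiagonal coaction, \<open>B\<^sup>e\<close> is a relative Hopf module.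
\<close>

lemma codiag_sum_mult:
  assumes G: "abelian_group G" and f: "balanced K Be H G f"
    and y: "y \<in> carrier B" and m: "m \<in> carrier Bt"
  shows "balanced K Be H G (\<lambda>n h. tlift G (\<lambda>y' k. f (be \<one>\<^bsub>B\<^esub> y' \<otimes>\<^bsub>Be\<^esub> n) (h \<otimes>\<^bsub>H\<^esub> k)) (coact y))" (is "?A")
    and "tlift G f (codiag (be \<one>\<^bsub>B\<^esub> y \<otimes>\<^bsub>Be\<^esub> m))
    = tlift G (\<lambda>n h. tlift G (\<lambda>y' k. f (be \<one>\<^bsub>B\<^esub> y' \<otimes>\<^bsub>Be\<^esub> n) (h \<otimes>\<^bsub>H\<^esub> k)) (coact y)) (codiag m)" (is "?L m = ?R m")
proof -
  note fD = balancedD[OF f]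
  show A: ?A
    by (rule balancedI)
      (use y fD in \<open>auto simp: Be_distrib X.l_distr H_scale_left Be_smult_mult
         intro!: BH.tlift_closed[OF G] BH.tlift_split[OF G] BH.tlift_cong[OF G]\<close>)
  interpret G: abelian_group G by (rule G)
  note u = BeH.tlift_add[OF G]
  show "?L m = ?R m" using m
  proof (induction m rule: EE.tensor_induct)
    case (pure b b')
    then have b: "b \<in> carrier B" "b' \<in> carrier B" by auto
    have "?L (be b b') = tlift G (\<lambda>x h. tlift G (\<lambda>x' h'. f (be x x') (h \<otimes>\<^bsub>H\<^esub> h')) (coact (b' \<otimes>\<^bsub>B\<^esub> y))) (coact b)"
      using b y by (simp add: be_mult codiag_sum_be[OF G f])
    also have "\<dots> = tlift G (\<lambda>x h. tlift G (\<lambda>x' h'. tlift G (\<lambda>y' k. f (be \<one>\<^bsub>B\<^esub> y' \<otimes>\<^bsub>Be\<^esub> be x x') ((h \<otimes>\<^bsub>H\<^esub> h') \<otimes>\<^bsub>H\<^esub> k)) (coact y)) (coact b')) (coact b)"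
    proof (rule BH.tlift_cong[OF G])
      fix x h assume *: "x \<in> carrier B" "h \<in> carrier H"
      show "tlift G (\<lambda>x' h'. f (be x x') (h \<otimes>\<^bsub>H\<^esub> h')) (coact (b' \<otimes>\<^bsub>B\<^esub> y))
         = tlift G (\<lambda>x' h'. tlift G (\<lambda>y' k. f (be \<one>\<^bsub>B\<^esub> y' \<otimes>\<^bsub>Be\<^esub> be x x') ((h \<otimes>\<^bsub>H\<^esub> h') \<otimes>\<^bsub>H\<^esub> k)) (coact y)) (coact b')"
        unfolding coact_sum_mult[OF G codiag_balanced_inner[OF G f *] b(2) y]
        by (intro BH.tlift_cong[OF G]) (use b y * fD(1) in \<open>auto simp: be_mult X.m_assoc intro!: BH.tlift_closed[OF G]\<close>)
    qed (use b y fD(1) in \<open>auto intro!: BH.tlift_closed[OF G]\<close>)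
    also have "\<dots> = ?R (be b b')"
      by (rule codiag_sum_be[OF G A b, symmetric])
    finally show ?case .
  next
    case (add s t)
    then show ?case using y add_homD(2)[OF codiag_hom]
      by (simp add: Be_distrib u[OF f] u[OF A])
  qed
qed

lemma codiag_coinvariant:
  assumes "a \<in> carrier A" "a' \<in> carrier A"
  shows "codiag (be a a') = ptensor K Be H (be a a') \<one>\<^bsub>H\<^esub>"
proof -
  have *: "coact a = ptensor K B H a \<one>\<^bsub>H\<^esub>" "coact a' = ptensor K B H a' \<one>\<^bsub>H\<^esub>" "a \<in> carrier B" "a' \<in> carrier B"
    using assms by (auto simp: carrier_A)
  note b = BeH.ptensor_balanced
  have "codiag (be a a') = tlift BeHt (\<lambda>x' h'. ptensor K Be H (be a x') (\<one>\<^bsub>H\<^esub> \<otimes>\<^bsub>H\<^esub> h')) (coact a')"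
    unfolding codiag_be[OF *(3,4)] *(1)
    by (rule BH.tlift_ptensor[OF BeHG codiag_balanced_middle[OF BeHG b]]) (use * in auto)
  also have "\<dots> = ptensor K Be H (be a a') (\<one>\<^bsub>H\<^esub> \<otimes>\<^bsub>H\<^esub> \<one>\<^bsub>H\<^esub>)"
    unfolding *(2) by (rule BH.tlift_ptensor[OF BeHG codiag_balanced_inner[OF BeHG b]]) (use * in auto)
  finally show ?thesis by simp
qed

subsection \<open>The algebra \<open>\<Gamma>\<close>\<close>

lemma Gamma_simps [simp]: "add Gamma = add Bt" "zero Gamma = zero Bt"
  "monoid.mult Gamma = monoid.mult Be" "one Gamma = one Be"
  by (simp_all add: Gamma_def)

lemma carrier_Gamma: "t \<in> carrier Gamma \<longleftrightarrow> t \<in> carrier Bt \<and> codiag t = ptensor K Be H t \<one>\<^bsub>H\<^esub>"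
  by (simp add: Gamma_def)

lemma Gamma_in_Be [simp]: "t \<in> carrier Gamma \<Longrightarrow> t \<in> carrier Bt" by (simp add: carrier_Gamma)

lemma Gamma_group: "abelian_group Gamma" by (rule ring.is_abelian_group[OF Gamma_ring])

lemma Gamma_mult_closed [simp]: "s \<in> carrier Gamma \<Longrightarrow> t \<in> carrier Gamma \<Longrightarrow> s \<otimes>\<^bsub>Be\<^esub> t \<in> carrier Gamma"
  using ring.ring_simprules(5)[OF Gamma_ring, of s t] by simp

lemma Gamma_add_closed [simp]: "s \<in> carrier Gamma \<Longrightarrow> t \<in> carrier Gamma \<Longrightarrow> s \<oplus>\<^bsub>Bt\<^esub> t \<in> carrier Gamma"
  using abelian_groupE(1)[OF Gamma_group, of s t] by simp

lemma be_in_Gamma [simp]: "a \<in> carrier A \<Longrightarrow> a' \<in> carrier A \<Longrightarrow> be a a' \<in> carrier Gamma"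
  by (simp add: carrier_Gamma codiag_coinvariant)

lemma Be_group: "abelian_group Be" by (rule BeR.is_abelian_group)

end

section \<open>Transport of exactness along flat modules\<close>

lemma (in abelian_group) diff_eq_zero_iff:
  assumes "x \<in> carrier G" "y \<in> carrier G"
  shows "x \<ominus> y = \<zero> \<longleftrightarrow> x = y"
  using assms minus_equality[of x "\<ominus> y"] by (auto simp: a_minus_def r_neg)

lemma is_homD:
  assumes "is_hom R M N f"
  shows "\<And>x. x \<in> carrier M \<Longrightarrow> f x \<in> carrier N"
    and "\<And>x y. x \<in> carrier M \<Longrightarrow> y \<in> carrier M \<Longrightarrow> f (x \<oplus>\<^bsub>M\<^esub> y) = f x \<oplus>\<^bsub>N\<^esub> f y"
    and "\<And>r x. r \<in> carrier R \<Longrightarrow> x \<in> carrier M \<Longrightarrow> f (r \<odot>\<^bsub>M\<^esub> x) = r \<odot>\<^bsub>N\<^esub> f x"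
  using assms by (auto simp: is_hom_def)

lemma is_homI:
  assumes "\<And>x. x \<in> carrier M \<Longrightarrow> f x \<in> carrier N"
    and "\<And>x y. x \<in> carrier M \<Longrightarrow> y \<in> carrier M \<Longrightarrow> f (x \<oplus>\<^bsub>M\<^esub> y) = f x \<oplus>\<^bsub>N\<^esub> f y"
    and "\<And>r x. r \<in> carrier R \<Longrightarrow> x \<in> carrier M \<Longrightarrow> f (r \<odot>\<^bsub>M\<^esub> x) = r \<odot>\<^bsub>N\<^esub> f x"
  shows "is_hom R M N f"
  using assms by (auto simp: is_hom_def)

lemma is_hom_add_hom: "is_hom R M N f \<Longrightarrow> add_hom M N f"
  by (auto simp: is_hom_def add_hom_def)

lemma is_hom_op_ring [simp]: "is_hom (op_ring R) M N f \<longleftrightarrow> is_hom R M N f"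
  by (simp add: is_hom_def)

lemma left_module_acted: "left_module R M \<Longrightarrow> acted R M"
  by (simp add: left_module_def left_module_axioms_def acted_def)

lemma right_module_acted: "right_module R M \<Longrightarrow> acted R M"
  using left_module_acted[of "op_ring R" M] by (simp add: acted_def)

definition tensor_map :: "('r, 'x) ring_scheme \<Rightarrow> ('r, 'm, 'y) module_scheme
    \<Rightarrow> ('r, 'n, 'z) module_scheme \<Rightarrow> ('l \<Rightarrow> 'm) \<Rightarrow> ('l, 'n) tensors \<Rightarrow> ('m, 'n) tensors" where
  "tensor_map R Y N h = tlift (tensor R Y N) (\<lambda>x m. ptensor R Y N (h x) m)"

lemma tensor_map_balanced:
  assumes "acted R X" "acted R Y" "acted R N" "is_hom R X Y h"
  shows "balanced R X N (tensor R Y N) (\<lambda>x m. ptensor R Y N (h x) m)"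
proof -
  interpret Y: tensor_data R Y N by (rule tensor_data.intro[OF assms(2,3)])
  show ?thesis
    by (rule balancedI)
      (use is_homD[OF assms(4)] in \<open>simp_all add: Y.ptensor_add_left Y.ptensor_add_right Y.ptensor_smult\<close>)
qed

lemma tensor_map_hom:
  assumes "acted R X" "acted R Y" "acted R N" "is_hom R X Y h"
  shows "add_hom (tensor R X N) (tensor R Y N) (tensor_map R Y N h)"
  unfolding tensor_map_def
  by (rule tensor_data.tlift_add_hom[OF tensor_data.intro[OF assms(1,3)] _ tensor_map_balanced[OF assms]])
    (rule tensor_data.abelian_group_tensor[OF tensor_data.intro[OF assms(2,3)]])

lemma tensor_map_pure:
  assumes "acted R X" "acted R Y" "acted R N" "is_hom R X Y h" "x \<in> carrier X" "n \<in> carrier N"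
  shows "tensor_map R Y N h (ptensor R X N x n) = ptensor R Y N (h x) n"
  unfolding tensor_map_def
  by (rule tensor_data.tlift_ptensor[OF tensor_data.intro[OF assms(1,3)] _ tensor_map_balanced[OF assms(1-4)] assms(5,6)])
    (rule tensor_data.abelian_group_tensor[OF tensor_data.intro[OF assms(2,3)]])

lemma tensor_map_comp:
  assumes X: "acted R X" and Y: "acted R Y" and Z: "acted R Z" and N: "acted R N"
    and h: "is_hom R X Y h" and g: "is_hom R Y Z g" and t: "t \<in> carrier (tensor R X N)"
  shows "tensor_map R Z N g (tensor_map R Y N h t) = tensor_map R Z N (\<lambda>x. g (h x)) t"
proof -
  interpret X: tensor_data R X N by (rule tensor_data.intro[OF X N])
  interpret Z: tensor_data R Z N by (rule tensor_data.intro[OF Z N])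
  have gh: "is_hom R X Z (\<lambda>x. g (h x))" using is_homD[OF g] is_homD[OF h] by (intro is_homI) simp_all
  note 1 = tensor_map_hom[OF X Y N h] and 2 = tensor_map_hom[OF Y Z N g] and 3 = tensor_map_hom[OF X Z N gh]
  show ?thesis
  proof (rule X.tensor_ext[OF Z.abelian_group_tensor _ 3 _ t])
    show "add_hom (tensor R X N) (tensor R Z N) (\<lambda>t. tensor_map R Z N g (tensor_map R Y N h t))"
      using 1 2 by (auto simp: add_hom_def)
    fix x n assume "x \<in> carrier X" "n \<in> carrier N"
    then show "tensor_map R Z N g (tensor_map R Y N h (ptensor R X N x n))
        = tensor_map R Z N (\<lambda>x. g (h x)) (ptensor R X N x n)"
      using is_homD(1)[OF h]
      by (simp add: tensor_map_pure[OF X Y N h] tensor_map_pure[OF Y Z N g] tensor_map_pure[OF X Z N gh])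
  qed
qed

lemma tensor_map_cong:
  assumes X: "acted R X" and Y: "acted R Y" and N: "acted R N" and t: "t \<in> carrier (tensor R X N)"
    and "\<And>x. x \<in> carrier X \<Longrightarrow> h x \<in> carrier Y" and "\<And>x. x \<in> carrier X \<Longrightarrow> g x = h x"
  shows "tensor_map R Y N g t = tensor_map R Y N h t"
proof -
  interpret X: tensor_data R X N by (rule tensor_data.intro[OF X N])
  interpret Y: tensor_data R Y N by (rule tensor_data.intro[OF Y N])
  show ?thesis
    unfolding tensor_map_def by (rule X.tlift_cong[OF Y.abelian_group_tensor t]) (use assms in auto)
qed

lemma tensor_map_id:
  assumes "acted R X" "acted R N" "t \<in> carrier (tensor R X N)"
  shows "tensor_map R X N (\<lambda>x. x) t = t"
  unfolding tensor_map_def using tensor_data.tlift_id[OF tensor_data.intro[OF assms(1,2)] assms(3)] by simp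

text \<open>
  A copy of \<open>M\<close> on the image of an injection \<open>e\<close>. Flatness is tested on modules with elements of one
  fixed type; modules of other types are moved there in this way.
\<close>

definition transport :: "('m \<Rightarrow> 'u) \<Rightarrow> ('r, 'm, 'y) module_scheme \<Rightarrow> ('r, 'u) module" where
  "transport e M = \<lparr>carrier = e ` carrier M, monoid.mult = undefined, one = undefined,
     ring.zero = e \<zero>\<^bsub>M\<^esub>, add = (\<lambda>u v. e (inv_into UNIV e u \<oplus>\<^bsub>M\<^esub> inv_into UNIV e v)),
     smult = (\<lambda>r u. e (r \<odot>\<^bsub>M\<^esub> inv_into UNIV e u))\<rparr>"

lemma transport_simps:
  assumes "inj e"
  shows "carrier (transport e M) = e ` carrier M" "zero (transport e M) = e \<zero>\<^bsub>M\<^esub>"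
    "e x \<oplus>\<^bsub>transport e M\<^esub> e y = e (x \<oplus>\<^bsub>M\<^esub> y)" "r \<odot>\<^bsub>transport e M\<^esub> e x = e (r \<odot>\<^bsub>M\<^esub> x)"
  using assms by (simp_all add: transport_def)

lemma transport_left_module:
  assumes e: "inj e" and M: "left_module R M"
  shows "left_module R (transport e M)"
proof -
  interpret left_module R M by fact
  have ag: "abelian_group (transport e M)"
  proof (rule abelian_groupI)
    fix u assume "u \<in> carrier (transport e M)"
    then obtain x where x: "u = e x" "x \<in> carrier M" by (auto simp: transport_simps[OF e])
    then show "\<exists>y\<in>carrier (transport e M). y \<oplus>\<^bsub>transport e M\<^esub> u = \<zero>\<^bsub>transport e M\<^esub>"
      by (auto simp: transport_simps[OF e] intro!: bexI[of _ "\<ominus>\<^bsub>M\<^esub> x"] arg_cong[of _ _ e] M.l_neg)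
  qed (auto simp: transport_simps[OF e] M.a_ac)
  show ?thesis
    by (intro left_module.intro left_module_axioms.intro R.ring_axioms ag)
      (auto simp: transport_simps[OF e] lm_smult_closed lm_smult_l_distr lm_smult_r_distr lm_smult_assoc lm_smult_one)
qed

lemma transport_hom:
  assumes "inj e"
  shows "is_hom R M (transport e M) e" "is_hom R (transport e M) M (inv_into UNIV e)"
  using assms by (auto simp: is_hom_def transport_simps)

context galois_ext
begin

text \<open>
  Flatness as exactness of kernels: a tensor killed by \<open>g\<close> comes from \<open>X\<close>, for modules of any types that
  embed into the type of the test modules.
\<close>

lemma flat_kernel:
  fixes X :: "('b, 'u) module" and Y :: "('b, 'v) module" and Z :: "('b, 'w) module"
    and eX :: "'u \<Rightarrow> (('b, 'b) tensors, 'h) tensors" and eY :: "'v \<Rightarrow> (('b, 'b) tensors, 'h) tensors"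
    and eZ :: "'w \<Rightarrow> (('b, 'b) tensors, 'h) tensors"
  assumes X: "right_module A X" and Y: "right_module A Y" and Z: "right_module A Z"
    and e: "inj eX" "inj eY" "inj eZ"
    and f: "is_hom A X Y f" and g: "is_hom A Y Z g" and ex: "exact_at X Y Z f g"
    and y: "y \<in> carrier (tensor A Y (left_reg B))"
    and gy: "tensor_map A Z (left_reg B) g y = \<zero>\<^bsub>tensor A Z (left_reg B)\<^esub>"
  shows "\<exists>x\<in>carrier (tensor A X (left_reg B)). tensor_map A Y (left_reg B) f x = y"
proof -
  let ?N = "left_reg B"
  let ?X = "transport eX X" and ?Y = "transport eY Y" and ?Z = "transport eZ Z"
  let ?f = "\<lambda>u. eY (f (inv_into UNIV eX u))" and ?g = "\<lambda>u. eZ (g (inv_into UNIV eY u))"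
  have X': "right_module A ?X" and Y': "right_module A ?Y" and Z': "right_module A ?Z"
    using transport_left_module X Y Z e by blast+
  note N = left_reg_acted
  note acts = right_module_acted[OF X] right_module_acted[OF Y] right_module_acted[OF Z]
    right_module_acted[OF X'] right_module_acted[OF Y'] right_module_acted[OF Z']
  note tX = transport_hom[OF e(1), of A X] and tY = transport_hom[OF e(2), of A Y]
    and tZ = transport_hom[OF e(3), of A Z]
  note fD = is_homD[OF f] and gD = is_homD[OF g]
  note ts = transport_simps[OF e(1)] transport_simps[OF e(2)] transport_simps[OF e(3)] inv_f_f e
  have f': "is_hom A ?X ?Y ?f"
    by (intro is_homI) (auto simp: ts fD)
  have g': "is_hom A ?Y ?Z ?g"
    by (intro is_homI) (auto simp: ts gD)
  have "?f ` carrier ?X = eY ` f ` carrier X"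
    by (simp add: ts image_image)
  also have "\<dots> = {y \<in> carrier ?Y. ?g y = \<zero>\<^bsub>?Z\<^esub>}"
    using ex by (auto simp: exact_at_def ts inj_eq)
  finally have ex': "exact_at ?X ?Y ?Z ?f ?g" by (simp add: exact_at_def)
  have "exact_at (tensor A ?X ?N) (tensor A ?Y ?N) (tensor A ?Z ?N)
      (tensor_map A ?Y ?N ?f) (tensor_map A ?Z ?N ?g)"
    using ff[unfolded faithfully_flat_H_Galois_def faithfully_flat_def, THEN conjunct2, THEN conjunct2,
        rule_format, of ?X ?Y ?Z ?f ?g] ex' X' Y' Z' f' g'
    by (simp add: tensor_map_def)
  then have ker: "tensor_map A ?Y ?N ?f ` carrier (tensor A ?X ?N)
      = {y \<in> carrier (tensor A ?Y ?N). tensor_map A ?Z ?N ?g y = \<zero>\<^bsub>tensor A ?Z ?N\<^esub>}"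
    by (simp add: exact_at_def)
  let ?y = "tensor_map A ?Y ?N eY y"
  have yc: "?y \<in> carrier (tensor A ?Y ?N)"
    using add_homD(1)[OF tensor_map_hom[OF acts(2,5) N tY(1)] y] .
  have "tensor_map A ?Z ?N ?g ?y = tensor_map A ?Z ?N (\<lambda>y. ?g (eY y)) y"
    by (rule tensor_map_comp[OF acts(2,5,6) N tY(1) g' y])
  also have "\<dots> = tensor_map A ?Z ?N (\<lambda>y. eZ (g y)) y"
    by (rule tensor_map_cong[OF acts(2,6) N y]) (use gD in \<open>auto simp: ts\<close>)
  also have "\<dots> = tensor_map A ?Z ?N eZ (tensor_map A Z ?N g y)"
    by (rule tensor_map_comp[OF acts(2,3,6) N g tZ(1) y, symmetric])
  also have "\<dots> = \<zero>\<^bsub>tensor A ?Z ?N\<^esub>"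
    unfolding gy
    by (rule add_hom_zero[OF tensor_map_hom[OF acts(3,6) N tZ(1)]
          tensor_data.abelian_group_tensor[OF tensor_data.intro[OF acts(3) N]]
          tensor_data.abelian_group_tensor[OF tensor_data.intro[OF acts(6) N]]])
  finally have "?y \<in> tensor_map A ?Y ?N ?f ` carrier (tensor A ?X ?N)"
    unfolding ker using yc by simp
  then obtain x where x: "x \<in> carrier (tensor A ?X ?N)" "tensor_map A ?Y ?N ?f x = ?y"
    by force
  let ?x = "tensor_map A X ?N (inv_into UNIV eX) x"
  have xc: "?x \<in> carrier (tensor A X ?N)"
    using add_homD(1)[OF tensor_map_hom[OF acts(4,1) N tX(2)] x(1)] .
  have "tensor_map A Y ?N f ?x = tensor_map A Y ?N (\<lambda>x. f (inv_into UNIV eX x)) x"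
    by (rule tensor_map_comp[OF acts(4,1,2) N tX(2) f x(1)])
  also have "\<dots> = tensor_map A Y ?N (\<lambda>x. inv_into UNIV eY (?f x)) x"
    by (rule tensor_map_cong[OF acts(4,2) N x(1)]) (use fD in \<open>auto simp: ts\<close>)
  also have "\<dots> = tensor_map A Y ?N (inv_into UNIV eY) ?y"
    unfolding x(2)[symmetric] by (rule tensor_map_comp[OF acts(4,5,2) N f' tY(2) x(1), symmetric])
  also have "\<dots> = tensor_map A Y ?N (\<lambda>y. inv_into UNIV eY (eY y)) y"
    by (rule tensor_map_comp[OF acts(2,5,2) N tY y])
  also have "\<dots> = tensor_map A Y ?N (\<lambda>y. y) y"
    by (rule tensor_map_cong[OF acts(2,2) N y]) (use e in auto)
  also have "\<dots> = y" by (rule tensor_map_id[OF acts(2) N y])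
  finally show ?thesis using xc by blast
qed

end

section \<open>The structure theorem \<open>\<Gamma> \<otimes>\<^sub>A B \<cong> B\<^sup>e\<close>\<close>

context galois_env
begin

text \<open>
  \<open>B\<^sup>e\<close> and \<open>\<Gamma>\<close> as right \<open>A\<close>-modules through the second tensor factor.
\<close>

definition env_right :: "('k, ('b, 'b) tensors) module \<Rightarrow> ('b, ('b, 'b) tensors) module" where
  "env_right E = mk_module E (\<lambda>a t. be \<one>\<^bsub>B\<^esub> a \<otimes>\<^bsub>Be\<^esub> t)"

lemma env_right_simps [simp]:
  "carrier (env_right E) = carrier E" "add (env_right E) = add E" "zero (env_right E) = zero E"
  "a \<odot>\<^bsub>env_right E\<^esub> t = be \<one>\<^bsub>B\<^esub> a \<otimes>\<^bsub>Be\<^esub> t"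
  by (simp_all add: env_right_def)

lemma be_right_assoc:
  "x \<in> carrier B \<Longrightarrow> y \<in> carrier B \<Longrightarrow> t \<in> carrier Bt \<Longrightarrow>
    be \<one>\<^bsub>B\<^esub> y \<otimes>\<^bsub>Be\<^esub> (be \<one>\<^bsub>B\<^esub> x \<otimes>\<^bsub>Be\<^esub> t) = be \<one>\<^bsub>B\<^esub> (x \<otimes>\<^bsub>B\<^esub> y) \<otimes>\<^bsub>Be\<^esub> t"
  by (simp add: Be_assoc[symmetric] be_mult)

lemma env_right_module:
  assumes "E = Be \<or> E = Gamma"
  shows "right_module A (env_right E)"
proof (intro left_module.intro left_module_axioms.intro op_ring_ring A_ring)
  show "abelian_group (env_right E)"
    using assms Be_group Gamma_group by (auto simp: env_right_def)
qed (use assms in \<open>auto simp: be_add Be_distrib be_right_assoc\<close>)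

lemmas env_right_acted = right_module_acted[OF env_right_module]

lemma Be_right_acted: "acted A (env_right Be)" and Gamma_right_acted: "acted A (env_right Gamma)"
  by (auto intro: env_right_acted)

sublocale EB: tensor_data A "env_right Be" "left_reg B"
  by (rule tensor_data.intro[OF Be_right_acted left_reg_acted])

sublocale GB: tensor_data A "env_right Gamma" "left_reg B"
  by (rule tensor_data.intro[OF Gamma_right_acted left_reg_acted])

abbreviation "EB \<equiv> tensor A (env_right Be) (left_reg B)"
abbreviation "GB \<equiv> tensor A (env_right Gamma) (left_reg B)"
abbreviation "eb \<equiv> ptensor A (env_right Be) (left_reg B)"
abbreviation "gb \<equiv> ptensor A (env_right Gamma) (left_reg B)"

lemma EBG: "abelian_group EB" by (rule EB.abelian_group_tensor)
lemma GBG: "abelian_group GB" by (rule GB.abelian_group_tensor)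

lemma eb_closed [simp]: "t \<in> carrier Bt \<Longrightarrow> y \<in> carrier B \<Longrightarrow> eb t y \<in> carrier EB"
  using EB.ptensor_closed by simp

lemma gb_closed [simp]: "t \<in> carrier Gamma \<Longrightarrow> y \<in> carrier B \<Longrightarrow> gb t y \<in> carrier GB"
  using GB.ptensor_closed by simp

lemma eb_simps:
  "t \<in> carrier Bt \<Longrightarrow> t' \<in> carrier Bt \<Longrightarrow> y \<in> carrier B \<Longrightarrow> eb (t \<oplus>\<^bsub>Bt\<^esub> t') y = eb t y \<oplus>\<^bsub>EB\<^esub> eb t' y"
  "t \<in> carrier Bt \<Longrightarrow> y \<in> carrier B \<Longrightarrow> y' \<in> carrier B \<Longrightarrow> eb t (y \<oplus>\<^bsub>B\<^esub> y') = eb t y \<oplus>\<^bsub>EB\<^esub> eb t y'"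
  "a \<in> carrier A \<Longrightarrow> t \<in> carrier Bt \<Longrightarrow> y \<in> carrier B \<Longrightarrow> eb (be \<one>\<^bsub>B\<^esub> a \<otimes>\<^bsub>Be\<^esub> t) y = eb t (a \<otimes>\<^bsub>B\<^esub> y)"
  using EB.ptensor_add_left[of t t' y] EB.ptensor_add_right[of t y y'] EB.ptensor_smult[of a t y] by simp_all

text \<open>
  \<open>mu (t \<otimes>\<^sub>A y) = t \<cdot> y\<close>. The same formula is used on \<open>B\<^sup>e \<otimes>\<^sub>A B\<close> and on \<open>\<Gamma> \<otimes>\<^sub>A B\<close>; the structure theorem
  says that it is bijective on the latter.
\<close>

definition mu :: "(('b, 'b) tensors, 'b) tensors \<Rightarrow> ('b, 'b) tensors" where
  "mu = tlift Be (\<lambda>t y. be \<one>\<^bsub>B\<^esub> y \<otimes>\<^bsub>Be\<^esub> t)"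

lemma mu_balanced:
  assumes "E = Be \<or> E = Gamma"
  shows "balanced A (env_right E) (left_reg B) Be (\<lambda>t y. be \<one>\<^bsub>B\<^esub> y \<otimes>\<^bsub>Be\<^esub> t)"
  by (rule balancedI) (use assms in \<open>auto simp: be_add Be_distrib be_right_assoc\<close>)

lemma mu_hom: "add_hom EB Be mu" "add_hom GB Be mu"
  unfolding mu_def using mu_balanced EB.tlift_add_hom[OF Be_group] GB.tlift_add_hom[OF Be_group] by blast+

lemma mu_eb: "t \<in> carrier Bt \<Longrightarrow> y \<in> carrier B \<Longrightarrow> mu (eb t y) = be \<one>\<^bsub>B\<^esub> y \<otimes>\<^bsub>Be\<^esub> t"
  unfolding mu_def by (subst EB.tlift_ptensor[OF Be_group mu_balanced]) auto

lemma mu_gb: "t \<in> carrier Gamma \<Longrightarrow> y \<in> carrier B \<Longrightarrow> mu (gb t y) = be \<one>\<^bsub>B\<^esub> y \<otimes>\<^bsub>Be\<^esub> t"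
  unfolding mu_def by (subst GB.tlift_ptensor[OF Be_group mu_balanced]) auto

lemma mu_closed [simp]: "u \<in> carrier GB \<Longrightarrow> mu u \<in> carrier Bt"
  using add_homD(1)[OF mu_hom(2)] by simp

definition incl_GB :: "(('b, 'b) tensors, 'b) tensors \<Rightarrow> (('b, 'b) tensors, 'b) tensors" where
  "incl_GB = tensor_map A (env_right Be) (left_reg B) (\<lambda>t. t)"

lemma Gamma_incl_hom: "is_hom A (env_right Gamma) (env_right Be) (\<lambda>t. t)"
  by (auto simp: is_hom_def)

lemma incl_GB_hom: "add_hom GB EB incl_GB"
  unfolding incl_GB_def by (rule tensor_map_hom[OF Gamma_right_acted Be_right_acted left_reg_acted Gamma_incl_hom])

lemma incl_GB_gb: "t \<in> carrier Gamma \<Longrightarrow> y \<in> carrier B \<Longrightarrow> incl_GB (gb t y) = eb t y"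
  unfolding incl_GB_def by (subst tensor_map_pure[OF Gamma_right_acted Be_right_acted left_reg_acted Gamma_incl_hom]) auto

lemma mu_incl_GB:
  assumes "u \<in> carrier GB" shows "mu (incl_GB u) = mu u"
  using GB.tensor_ext[OF Be_group _ mu_hom(2) _ assms, of "\<lambda>u. mu (incl_GB u)"] incl_GB_hom mu_hom(1)
  by (simp add: add_hom_def incl_GB_gb mu_gb mu_eb)

text \<open>
  An arbitrary injection of the type of \<open>B\<^sup>e\<close> into the type of the test modules.
\<close>

lemma tensor_type_embedding: "inj (\<lambda>t :: ('b, 'b) tensors. {frag_of (t, undefined)} :: (('b, 'b) tensors, 'h) tensors)"
  by (auto simp: inj_def frag_of_eq)

text \<open>
  Flatness for the exact sequence \<open>0 \<rightarrow> \<Gamma> \<rightarrow> B\<^sup>e\<close>.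
\<close>

lemma incl_GB_inj:
  assumes u: "u \<in> carrier GB" "v \<in> carrier GB" and eq: "incl_GB u = incl_GB v"
  shows "u = v"
proof -
  interpret gj: group_hom "add_monoid GB" "add_monoid EB" incl_GB
    by (rule add_hom_group_hom[OF incl_GB_hom GBG EBG])
  let ?N = "left_reg B"
  define Zm where "Zm = (env_right Gamma)\<lparr>carrier := {\<zero>\<^bsub>Bt\<^esub>}\<rparr>"
  have Gz: "\<zero>\<^bsub>Bt\<^esub> \<in> carrier Gamma" using abelian_groupE(2)[OF Gamma_group] by simp
  interpret ER: left_module "op_ring A" "env_right Gamma" using env_right_module by blast
  have Zs: "carrier Zm = {\<zero>\<^bsub>Bt\<^esub>}" "add Zm = add Bt" "zero Zm = zero Bt" "smult Zm = smult (env_right Gamma)"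
    by (simp_all add: Zm_def)
  have zz: "\<zero>\<^bsub>Bt\<^esub> \<oplus>\<^bsub>Bt\<^esub> \<zero>\<^bsub>Bt\<^esub> = \<zero>\<^bsub>Bt\<^esub>" by simp
  have az: "be \<one>\<^bsub>B\<^esub> a \<otimes>\<^bsub>Be\<^esub> \<zero>\<^bsub>Bt\<^esub> = \<zero>\<^bsub>Bt\<^esub>" if "a \<in> carrier B" for a
    using BeR.r_null[of "be \<one>\<^bsub>B\<^esub> a"] that by simp
  have ZG: "abelian_group Zm"
    by (rule abelian_groupI) (auto simp: Zs)
  have Zmod: "right_module A Zm"
    by (intro left_module.intro left_module_axioms.intro op_ring_ring A_ring ZG)
      (use az in \<open>auto simp: Zs\<close>)
  have f: "is_hom A Zm (env_right Gamma) (\<lambda>t. t)"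
    using Gz by (auto simp: is_hom_def Zs)
  have ex: "exact_at Zm (env_right Gamma) (env_right Be) (\<lambda>t. t) (\<lambda>t. t)"
    using Gz by (auto simp: exact_at_def Zs)
  have Zact: "acted A Zm" by (rule right_module_acted[OF Zmod])
  interpret ZB: tensor_data A Zm ?N by (rule tensor_data.intro[OF Zact left_reg_acted])
  have w: "u \<ominus>\<^bsub>GB\<^esub> v \<in> carrier GB"
    using u abelian_group.minus_closed[OF GBG] by blast
  have "incl_GB (u \<ominus>\<^bsub>GB\<^esub> v) = incl_GB u \<oplus>\<^bsub>EB\<^esub> incl_GB (\<ominus>\<^bsub>GB\<^esub> v)"
    unfolding a_minus_def using u GB.T.a_inv_closed by (intro add_homD(2)[OF incl_GB_hom]) auto
  also have "\<dots> = \<zero>\<^bsub>EB\<^esub>"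
    using u eq add_homD(1)[OF incl_GB_hom] by (simp add: add_hom_minus[OF incl_GB_hom GBG EBG] EB.T.r_neg)
  finally obtain x where x: "x \<in> carrier (tensor A Zm ?N)"
      "tensor_map A (env_right Gamma) ?N (\<lambda>t. t) x = u \<ominus>\<^bsub>GB\<^esub> v"
    using flat_kernel[OF Zmod env_right_module env_right_module tensor_type_embedding tensor_type_embedding tensor_type_embedding f Gamma_incl_hom ex w]
    unfolding incl_GB_def by auto
  have "tensor_map A (env_right Gamma) ?N (\<lambda>t. t) x = \<zero>\<^bsub>GB\<^esub>"
    using x(1)
  proof (induction x rule: ZB.tensor_induct)
    case (pure s y)
    then show ?case
      using GB.ptensor_zero[of y] by (subst tensor_map_pure[OF Zact Gamma_right_acted left_reg_acted f]) (auto simp: Zs)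
  next
    case (add s t)
    then show ?case
      by (simp add: add_homD(2)[OF tensor_map_hom[OF Zact Gamma_right_acted left_reg_acted f]])
  qed
  then have "u \<ominus>\<^bsub>GB\<^esub> v = \<zero>\<^bsub>GB\<^esub>" using x(2) by simp
  then show ?thesis using u GB.T.diff_eq_zero_iff by blast
qed

subsection \<open>Injectivity of \<open>mu\<close>\<close>

lemma be_smult_right:
  assumes "c \<in> carrier K" "l \<in> carrier B" "n \<in> carrier Bt"
  shows "be \<one>\<^bsub>B\<^esub> (c \<odot>\<^bsub>B\<^esub> l) \<otimes>\<^bsub>Be\<^esub> n = be \<one>\<^bsub>B\<^esub> l \<otimes>\<^bsub>Be\<^esub> (c \<odot>\<^bsub>Be\<^esub> n)"
  using assms(3)
proof (induction n rule: EE.tensor_induct)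
  case (pure x y)
  then show ?case using assms by (simp add: Be_smult_be be_mult be_smult B_scale_right B_scale_left)
next
  case (add s t)
  then show ?case using assms add_homD(2)[OF Be_smult_hom] by (simp add: Be_distrib)
qed

lemma omega_inner_balanced:
  assumes "n \<in> carrier Bt"
  shows "A_balanced EB (\<lambda>l r. eb (be \<one>\<^bsub>B\<^esub> l \<otimes>\<^bsub>Be\<^esub> n) r)"
  by (rule A_balancedI)
    (use assms in \<open>simp_all add: be_add Be_distrib eb_simps(1,2) be_right_assoc[symmetric] eb_simps(3)\<close>)

lemma omega_balanced:
  "balanced K Be H EB (\<lambda>n h. tlift EB (\<lambda>l r. eb (be \<one>\<^bsub>B\<^esub> l \<otimes>\<^bsub>Be\<^esub> n) r) (tau h))"
  by (rule tau_param_balanced[OF EBG Be_acted omega_inner_balanced])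
    (simp_all add: Be_distrib eb_simps(1,2) be_smult_right)

text \<open>
  For \<open>t\<close> in \<open>\<Gamma>\<close> the coaction of \<open>t \<cdot> y\<close> is \<open>\<Sum> t \<cdot> y\<^sub>0 \<otimes> y\<^sub>1\<close>, and \<open>\<Sum> t \<cdot> (y\<^sub>0 l(y\<^sub>1)) \<otimes>\<^sub>A r(y\<^sub>1) = t \<otimes>\<^sub>A y\<close> by
  \<open>galois_expand\<close>. So \<open>m \<mapsto> \<Sum> m\<^sub>0 \<cdot> l(m\<^sub>1) \<otimes>\<^sub>A r(m\<^sub>1)\<close> undoes \<open>mu\<close>, up to the inclusion into \<open>B\<^sup>e \<otimes>\<^sub>A B\<close>.
\<close>

lemma omega_codiag_mu:
  assumes "u \<in> carrier GB"
  shows "tlift EB (\<lambda>n h. tlift EB (\<lambda>l r. eb (be \<one>\<^bsub>B\<^esub> l \<otimes>\<^bsub>Be\<^esub> n) r) (tau h)) (codiag (mu u)) = incl_GB u"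
    (is "tlift EB ?om (codiag (mu u)) = _")
proof (rule GB.tensor_ext[OF EBG _ incl_GB_hom _ assms])
  show "add_hom GB EB (\<lambda>u. tlift EB ?om (codiag (mu u)))"
    using BeH.tlift_add_hom[OF EBG omega_balanced] codiag_hom mu_hom(2)
    by (simp add: add_hom_def)
  fix t y assume "t \<in> carrier (env_right Gamma)" "y \<in> carrier (left_reg B)"
  then have t: "t \<in> carrier Gamma" "t \<in> carrier Bt" "codiag t = ptensor K Be H t \<one>\<^bsub>H\<^esub>" and y: "y \<in> carrier B"
    by (auto simp: carrier_Gamma)
  have omc: "?om n h \<in> carrier EB" if "n \<in> carrier Bt" "h \<in> carrier H" for n h
    using balancedD(1)[OF omega_balanced] that by simp
  have "tlift EB ?om (codiag (mu (gb t y))) = tlift EB (\<lambda>y' k. ?om (be \<one>\<^bsub>B\<^esub> y' \<otimes>\<^bsub>Be\<^esub> t) (\<one>\<^bsub>H\<^esub> \<otimes>\<^bsub>H\<^esub> k)) (coact y)"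
    unfolding mu_gb[OF t(1) y] codiag_sum_mult(2)[OF EBG omega_balanced y t(2)] t(3)
    by (rule BeH.tlift_ptensor[OF EBG codiag_sum_mult(1)[OF EBG omega_balanced y t(2)]]) (use t in auto)
  also have "\<dots> = tlift EB (\<lambda>y' k. tlift EB (\<lambda>l r. eb (be \<one>\<^bsub>B\<^esub> (\<one>\<^bsub>B\<^esub> \<otimes>\<^bsub>B\<^esub> y' \<otimes>\<^bsub>B\<^esub> l) \<otimes>\<^bsub>Be\<^esub> t) r) (tau k)) (coact y)"
    by (intro BH.tlift_cong[OF EBG]; (simp; intro BB.tlift_cong[OF EBG])?)
      (use y t in \<open>auto simp: be_right_assoc intro!: BB.tlift_closed[OF EBG]\<close>)
  also have "\<dots> = eb (be \<one>\<^bsub>B\<^esub> \<one>\<^bsub>B\<^esub> \<otimes>\<^bsub>Be\<^esub> t) y"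
    by (rule galois_expand[OF EBG omega_inner_balanced, symmetric]) (use t y in auto)
  also have "\<dots> = incl_GB (gb t y)" using t y by (simp add: incl_GB_gb)
  finally show "tlift EB ?om (codiag (mu (gb t y))) = incl_GB (gb t y)" .
qed

lemma mu_inj:
  assumes "u \<in> carrier GB" "v \<in> carrier GB" "mu u = mu v" shows "u = v"
  using incl_GB_inj[OF assms(1,2)] omega_codiag_mu[OF assms(1)] omega_codiag_mu[OF assms(2)] assms(3) by simp

end

context galois_env
begin

subsection \<open>Surjectivity of \<open>mu\<close>\<close>

text \<open>
  \<open>B\<^sup>e \<otimes> H\<close> as a right \<open>A\<close>-module through the second factor of \<open>B\<^sup>e\<close>. It is the target of \<open>delta\<close>, whose
  kernel is \<open>\<Gamma>\<close>.
\<close>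

definition BeHr :: "('b, (('b, 'b) tensors, 'h) tensors) module" where
  "BeHr = mk_module BeHt (\<lambda>a. tlift BeHt (\<lambda>n h. ptensor K Be H (be \<one>\<^bsub>B\<^esub> a \<otimes>\<^bsub>Be\<^esub> n) h))"

lemma BeHr_simps [simp]: "carrier BeHr = carrier BeHt" "add BeHr = add BeHt" "zero BeHr = zero BeHt"
  by (simp_all add: BeHr_def)

lemma BeH_simps:
  "n \<in> carrier Bt \<Longrightarrow> n' \<in> carrier Bt \<Longrightarrow> h \<in> carrier H \<Longrightarrow>
    ptensor K Be H (n \<oplus>\<^bsub>Bt\<^esub> n') h = ptensor K Be H n h \<oplus>\<^bsub>BeHt\<^esub> ptensor K Be H n' h"
  "n \<in> carrier Bt \<Longrightarrow> h \<in> carrier H \<Longrightarrow> h' \<in> carrier H \<Longrightarrow>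
    ptensor K Be H n (h \<oplus>\<^bsub>H\<^esub> h') = ptensor K Be H n h \<oplus>\<^bsub>BeHt\<^esub> ptensor K Be H n h'"
  "c \<in> carrier K \<Longrightarrow> n \<in> carrier Bt \<Longrightarrow> h \<in> carrier H \<Longrightarrow>
    ptensor K Be H (c \<odot>\<^bsub>Be\<^esub> n) h = ptensor K Be H n (c \<odot>\<^bsub>H\<^esub> h)"
  using BeH.ptensor_add_left[of n n' h] BeH.ptensor_add_right[of n h h'] BeH.ptensor_smult[of c n h]
  by simp_all

lemma BeH_closed [simp]: "n \<in> carrier Bt \<Longrightarrow> h \<in> carrier H \<Longrightarrow> ptensor K Be H n h \<in> carrier BeHt"
  using BeH.ptensor_closed by simp

lemma BeHr_balanced:
  assumes "a \<in> carrier B"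
  shows "balanced K Be H BeHt (\<lambda>n h. ptensor K Be H (be \<one>\<^bsub>B\<^esub> a \<otimes>\<^bsub>Be\<^esub> n) h)"
  by (rule balancedI) (use assms in \<open>simp_all add: Be_distrib BeH_simps Be_smult_mult\<close>)

lemma BeHr_smult_hom: "a \<in> carrier B \<Longrightarrow> add_hom BeHt BeHt (\<lambda>z. a \<odot>\<^bsub>BeHr\<^esub> z)"
  using BeH.tlift_add_hom[OF BeHG BeHr_balanced] by (simp add: BeHr_def)

lemma BeHr_smult_pure:
  assumes "a \<in> carrier B" "n \<in> carrier Bt" "h \<in> carrier H"
  shows "a \<odot>\<^bsub>BeHr\<^esub> ptensor K Be H n h = ptensor K Be H (be \<one>\<^bsub>B\<^esub> a \<otimes>\<^bsub>Be\<^esub> n) h"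
  using BeH.tlift_ptensor[OF BeHG BeHr_balanced[OF assms(1)]] assms by (simp add: BeHr_def)

lemma BeHr_module: "right_module A BeHr"
proof (intro left_module.intro left_module_axioms.intro op_ring_ring A_ring)
  show "abelian_group BeHr" by (simp add: BeHr_def BeHG)
  note hm = add_homD[OF BeHr_smult_hom]
  show "a \<odot>\<^bsub>BeHr\<^esub> x \<in> carrier BeHr" if "a \<in> carrier (op_ring A)" "x \<in> carrier BeHr" for a x
    using that hm(1) by simp
  show "a \<odot>\<^bsub>BeHr\<^esub> (x \<oplus>\<^bsub>BeHr\<^esub> y) = a \<odot>\<^bsub>BeHr\<^esub> x \<oplus>\<^bsub>BeHr\<^esub> a \<odot>\<^bsub>BeHr\<^esub> y"
    if "a \<in> carrier (op_ring A)" "x \<in> carrier BeHr" "y \<in> carrier BeHr" for a x y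
    using that hm(2) by simp
  have ag: "u \<oplus>\<^bsub>BeHt\<^esub> v \<oplus>\<^bsub>BeHt\<^esub> (u' \<oplus>\<^bsub>BeHt\<^esub> v') = u \<oplus>\<^bsub>BeHt\<^esub> u' \<oplus>\<^bsub>BeHt\<^esub> (v \<oplus>\<^bsub>BeHt\<^esub> v')"
    if "u \<in> carrier BeHt" "v \<in> carrier BeHt" "u' \<in> carrier BeHt" "v' \<in> carrier BeHt" for u v u' v'
    using that by (simp add: BeH.T.a_ac)
  have "(a \<oplus>\<^bsub>B\<^esub> b) \<odot>\<^bsub>BeHr\<^esub> x = a \<odot>\<^bsub>BeHr\<^esub> x \<oplus>\<^bsub>BeHt\<^esub> b \<odot>\<^bsub>BeHr\<^esub> x"
    if "a \<in> carrier B" "b \<in> carrier B" "x \<in> carrier BeHt" for a b x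
    using that(3)
  proof (induction x rule: BeH.tensor_induct)
    case (pure x y)
    then show ?case using that by (simp add: BeHr_smult_pure be_add Be_distrib BeH_simps)
  next
    case (add s t)
    then show ?case using that hm by (simp add: ag)
  qed
  then show "(a \<oplus>\<^bsub>op_ring A\<^esub> b) \<odot>\<^bsub>BeHr\<^esub> x = a \<odot>\<^bsub>BeHr\<^esub> x \<oplus>\<^bsub>BeHr\<^esub> b \<odot>\<^bsub>BeHr\<^esub> x"
    if "a \<in> carrier (op_ring A)" "b \<in> carrier (op_ring A)" "x \<in> carrier BeHr" for a b x
    using that by simp
  have "(b \<otimes>\<^bsub>B\<^esub> a) \<odot>\<^bsub>BeHr\<^esub> x = a \<odot>\<^bsub>BeHr\<^esub> (b \<odot>\<^bsub>BeHr\<^esub> x)"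
    if "a \<in> carrier B" "b \<in> carrier B" "x \<in> carrier BeHt" for a b x
    using that(3)
  proof (induction x rule: BeH.tensor_induct)
    case (pure x y)
    then show ?case using that by (simp add: BeHr_smult_pure be_right_assoc)
  next
    case (add s t)
    then show ?case using that hm by simp
  qed
  then show "(a \<otimes>\<^bsub>op_ring A\<^esub> b) \<odot>\<^bsub>BeHr\<^esub> x = a \<odot>\<^bsub>BeHr\<^esub> (b \<odot>\<^bsub>BeHr\<^esub> x)"
    if "a \<in> carrier (op_ring A)" "b \<in> carrier (op_ring A)" "x \<in> carrier BeHr" for a b x
    using that by simp
  have "\<one>\<^bsub>B\<^esub> \<odot>\<^bsub>BeHr\<^esub> x = x" if "x \<in> carrier BeHt" for x
    using that
  proof (induction x rule: BeH.tensor_induct)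
    case (pure x y)
    then show ?case by (simp add: BeHr_smult_pure)
  next
    case (add s t)
    then show ?case using hm by simp
  qed
  then show "\<one>\<^bsub>op_ring A\<^esub> \<odot>\<^bsub>BeHr\<^esub> x = x" if "x \<in> carrier BeHr" for x
    using that by simp
qed

lemma codiag_mult_coinvariant:
  assumes a: "a \<in> carrier A" and t: "t \<in> carrier Bt"
  shows "codiag (be \<one>\<^bsub>B\<^esub> a \<otimes>\<^bsub>Be\<^esub> t) = a \<odot>\<^bsub>BeHr\<^esub> codiag t"
proof -
  have aB: "a \<in> carrier B" and ca: "coact a = ptensor K B H a \<one>\<^bsub>H\<^esub>" using a by (auto simp: carrier_A)
  note bal = BeH.ptensor_balanced
  have "codiag (be \<one>\<^bsub>B\<^esub> a \<otimes>\<^bsub>Be\<^esub> t) = tlift BeHt (ptensor K Be H) (codiag (be \<one>\<^bsub>B\<^esub> a \<otimes>\<^bsub>Be\<^esub> t))"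
    using aB t by (simp add: BeH.tlift_id)
  also have "\<dots> = tlift BeHt (\<lambda>n h. tlift BeHt (\<lambda>y' k. ptensor K Be H (be \<one>\<^bsub>B\<^esub> y' \<otimes>\<^bsub>Be\<^esub> n) (h \<otimes>\<^bsub>H\<^esub> k)) (coact a)) (codiag t)"
    by (rule codiag_sum_mult(2)[OF BeHG bal aB t])
  also have "\<dots> = tlift BeHt (\<lambda>n h. ptensor K Be H (be \<one>\<^bsub>B\<^esub> a \<otimes>\<^bsub>Be\<^esub> n) h) (codiag t)"
  proof (rule BeH.tlift_cong[OF BeHG])
    fix n h assume *: "n \<in> carrier Be" "h \<in> carrier H"
    have "balanced K B H BeHt (\<lambda>y' k. ptensor K Be H (be \<one>\<^bsub>B\<^esub> y' \<otimes>\<^bsub>Be\<^esub> n) (h \<otimes>\<^bsub>H\<^esub> k))"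
      by (rule balancedI)
        (use * in \<open>simp_all add: be_add Be_distrib X.r_distr BeH_simps be_smult_right Be_smult_mult H_scale_right\<close>)
    then show "tlift BeHt (\<lambda>y' k. ptensor K Be H (be \<one>\<^bsub>B\<^esub> y' \<otimes>\<^bsub>Be\<^esub> n) (h \<otimes>\<^bsub>H\<^esub> k)) (coact a)
        = ptensor K Be H (be \<one>\<^bsub>B\<^esub> a \<otimes>\<^bsub>Be\<^esub> n) h"
      using * aB unfolding ca by (simp add: BH.tlift_ptensor[OF BeHG])
  qed (use t aB in auto)
  finally show ?thesis by (simp add: BeHr_def)
qed

definition delta :: "('b, 'b) tensors \<Rightarrow> (('b, 'b) tensors, 'h) tensors" where
  "delta t = codiag t \<ominus>\<^bsub>BeHt\<^esub> ptensor K Be H t \<one>\<^bsub>H\<^esub>"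

lemma delta_closed [simp]: "t \<in> carrier Bt \<Longrightarrow> delta t \<in> carrier BeHt"
  by (simp add: delta_def BeH.T.minus_closed)

lemma delta_hom: "is_hom A (env_right Be) BeHr delta"
proof (rule is_homI)
  fix x y assume "x \<in> carrier (env_right Be)" "y \<in> carrier (env_right Be)"
  then have *: "x \<in> carrier Bt" "y \<in> carrier Bt" by auto
  have ag: "u \<oplus>\<^bsub>BeHt\<^esub> v \<oplus>\<^bsub>BeHt\<^esub> (u' \<oplus>\<^bsub>BeHt\<^esub> v') = u \<oplus>\<^bsub>BeHt\<^esub> u' \<oplus>\<^bsub>BeHt\<^esub> (v \<oplus>\<^bsub>BeHt\<^esub> v')"
    if "u \<in> carrier BeHt" "v \<in> carrier BeHt" "u' \<in> carrier BeHt" "v' \<in> carrier BeHt" for u v u' v'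
    using that by (simp add: BeH.T.a_ac)
  show "delta (x \<oplus>\<^bsub>env_right Be\<^esub> y) = delta x \<oplus>\<^bsub>BeHr\<^esub> delta y"
    using * add_homD(2)[OF codiag_hom, of x y]
    by (simp add: delta_def a_minus_def BeH_simps BeH.T.minus_add ag)
next
  fix a x assume *: "a \<in> carrier A" "x \<in> carrier (env_right Be)"
  then have "a \<in> carrier B" "x \<in> carrier Bt" by auto
  note hm = BeHr_smult_hom[OF this(1)]
  show "delta (a \<odot>\<^bsub>env_right Be\<^esub> x) = a \<odot>\<^bsub>BeHr\<^esub> delta x"
    using * by (simp add: delta_def codiag_mult_coinvariant a_minus_def add_homD(2)[OF hm]
       BeHr_smult_pure add_hom_minus[OF hm BeHG BeHG])
qed simp

lemma delta_exact: "exact_at (env_right Gamma) (env_right Be) BeHr (\<lambda>t. t) delta"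
proof -
  have "t \<in> carrier Gamma \<longleftrightarrow> t \<in> carrier Bt \<and> delta t = \<zero>\<^bsub>BeHt\<^esub>" for t
    using BeH.T.diff_eq_zero_iff[of "codiag t" "ptensor K Be H t \<one>\<^bsub>H\<^esub>"]
    by (simp add: carrier_Gamma delta_def cong: conj_cong)
  then show ?thesis unfolding exact_at_def by simp blast
qed

sublocale ZB: tensor_data A BeHr "left_reg B"
  by (rule tensor_data.intro[OF right_module_acted[OF BeHr_module] left_reg_acted])

abbreviation "ZB \<equiv> tensor A BeHr (left_reg B)"
abbreviation "zb \<equiv> ptensor A BeHr (left_reg B)"

lemma ZBG: "abelian_group ZB" by (rule ZB.abelian_group_tensor)

lemma zb_closed [simp]: "z \<in> carrier BeHt \<Longrightarrow> y \<in> carrier B \<Longrightarrow> zb z y \<in> carrier ZB"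
  using ZB.ptensor_closed by simp

lemma zb_simps:
  "z \<in> carrier BeHt \<Longrightarrow> z' \<in> carrier BeHt \<Longrightarrow> y \<in> carrier B \<Longrightarrow> zb (z \<oplus>\<^bsub>BeHt\<^esub> z') y = zb z y \<oplus>\<^bsub>ZB\<^esub> zb z' y"
  "z \<in> carrier BeHt \<Longrightarrow> y \<in> carrier B \<Longrightarrow> y' \<in> carrier B \<Longrightarrow> zb z (y \<oplus>\<^bsub>B\<^esub> y') = zb z y \<oplus>\<^bsub>ZB\<^esub> zb z y'"
  "a \<in> carrier A \<Longrightarrow> z \<in> carrier BeHt \<Longrightarrow> y \<in> carrier B \<Longrightarrow> zb (a \<odot>\<^bsub>BeHr\<^esub> z) y = zb z (a \<otimes>\<^bsub>B\<^esub> y)"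
  using ZB.ptensor_add_left[of z z' y] ZB.ptensor_add_right[of z y y'] ZB.ptensor_smult[of a z y] by simp_all

lemma zb_trilinear:
  assumes b: "b \<in> carrier B"
  shows "trilinear ZB (\<lambda>l r k. zb (ptensor K Be H (be b l) k) r)"
proof -
  have "A_balanced ZB (\<lambda>l r. zb (ptensor K Be H (be b l) k) r)" if k: "k \<in> carrier H" for k
  proof (rule A_balancedI)
    fix a x y assume *: "a \<in> carrier A" "x \<in> carrier B" "y \<in> carrier B"
    have "zb (ptensor K Be H (be b (x \<otimes>\<^bsub>B\<^esub> a)) k) y = zb (a \<odot>\<^bsub>BeHr\<^esub> ptensor K Be H (be b x) k) y"
      using * b k by (simp add: BeHr_smult_pure be_mult)
    also have "\<dots> = zb (ptensor K Be H (be b x) k) (a \<otimes>\<^bsub>B\<^esub> y)"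
      using * b k by (simp add: zb_simps)
    finally show "zb (ptensor K Be H (be b (x \<otimes>\<^bsub>B\<^esub> a)) k) y = zb (ptensor K Be H (be b x) k) (a \<otimes>\<^bsub>B\<^esub> y)" .
  qed (use b k in \<open>simp_all add: be_add BeH_simps zb_simps(1,2)\<close>)
  moreover have "balanced K B H ZB (\<lambda>r k. zb (ptensor K Be H (be b l) k) r)" if l: "l \<in> carrier B" for l
  proof (rule balancedI)
    fix c r k assume *: "c \<in> carrier K" "r \<in> carrier B" "k \<in> carrier H"
    have "zb (ptensor K Be H (be b l) k) (c \<odot>\<^bsub>B\<^esub> r) = zb (ptensor K Be H (be b l) k) ((c \<odot>\<^bsub>B\<^esub> \<one>\<^bsub>B\<^esub>) \<otimes>\<^bsub>B\<^esub> r)"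
      using * by (simp add: scalar_mult)
    also have "\<dots> = zb ((c \<odot>\<^bsub>B\<^esub> \<one>\<^bsub>B\<^esub>) \<odot>\<^bsub>BeHr\<^esub> ptensor K Be H (be b l) k) r"
      using * b l by (simp add: zb_simps)
    also have "(c \<odot>\<^bsub>B\<^esub> \<one>\<^bsub>B\<^esub>) \<odot>\<^bsub>BeHr\<^esub> ptensor K Be H (be b l) k = ptensor K Be H (be b l) (c \<odot>\<^bsub>H\<^esub> k)"
    proof -
      have "be \<one>\<^bsub>B\<^esub> (c \<odot>\<^bsub>B\<^esub> \<one>\<^bsub>B\<^esub>) \<otimes>\<^bsub>Be\<^esub> be b l = c \<odot>\<^bsub>Be\<^esub> be b l"
        using * b l by (simp add: be_mult scalar_mult Be_smult_be be_smult)
      then show ?thesis using * b l by (simp add: BeHr_smult_pure BeH_simps)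
    qed
    finally show "zb (ptensor K Be H (be b l) k) (c \<odot>\<^bsub>B\<^esub> r) = zb (ptensor K Be H (be b l) (c \<odot>\<^bsub>H\<^esub> k)) r" .
  qed (use b l in \<open>simp_all add: BeH_simps zb_simps(1,2)\<close>)
  ultimately show ?thesis unfolding trilinear_def by simp
qed

text \<open>
  \<open>sigma b = \<Sum> (b\<^sub>0 \<otimes> l(b\<^sub>1)) \<otimes>\<^sub>A r(b\<^sub>1)\<close>, the prospective preimage of \<open>b \<otimes> 1\<close> under \<open>mu\<close>, still in \<open>B\<^sup>e \<otimes>\<^sub>A B\<close>.
\<close>

definition sigma :: "'b \<Rightarrow> (('b, 'b) tensors, 'b) tensors" where
  "sigma b = tlift EB (\<lambda>b' h. tlift EB (\<lambda>l r. eb (be b' l) r) (tau h)) (coact b)"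

lemma sigma_closed [simp]: "b \<in> carrier B \<Longrightarrow> sigma b \<in> carrier EB"
  unfolding sigma_def by (intro BH.tlift_closed[OF EBG] BB.tlift_closed[OF EBG]) auto

lemma sigma_sum:
  assumes G: "abelian_group G" and f: "balanced A (env_right Be) (left_reg B) G f" and b: "b \<in> carrier B"
  shows "tlift G f (sigma b) = tlift G (\<lambda>b' h. tlift G (\<lambda>l r. f (be b' l) r) (tau h)) (coact b)"
proof -
  have fc: "f t y \<in> carrier G" if "t \<in> carrier Bt" "y \<in> carrier B" for t y
    using balancedD(1)[OF f, of t y] that by simp
  have "tlift G f (sigma b) = tlift G (\<lambda>b' h. tlift G f (tlift EB (\<lambda>l r. eb (be b' l) r) (tau h))) (coact b)"
    unfolding sigma_def
    by (rule BH.tlift_hom[OF EBG EB.tlift_add_hom[OF G f] G])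
      (use b in \<open>auto intro!: BB.tlift_closed[OF EBG]\<close>)
  also have "\<dots> = tlift G (\<lambda>b' h. tlift G (\<lambda>l r. f (be b' l) r) (tau h)) (coact b)"
    by (intro BH.tlift_cong[OF G] EB.tlift_double_hom[OF G f BB.tensor_data_axioms])
      (use b fc in \<open>auto intro!: BB.tlift_closed[OF G]\<close>)
  finally show ?thesis .
qed

lemma zb_coact_twist:
  assumes "b \<in> carrier B" "l \<in> carrier B" "r \<in> carrier B"
  shows "zb (codiag (be b l)) r
     = tlift ZB (\<lambda>x h. tlift ZB (\<lambda>x' h'. zb (ptensor K Be H (be x x') (h \<otimes>\<^bsub>H\<^esub> h')) r) (coact l)) (coact b)"
proof -
  have u: "add_hom BeHt ZB (\<lambda>z. zb z r)" using assms by (simp add: add_hom_def zb_simps)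
  have "zb (codiag (be b l)) r = tlift ZB (\<lambda>n h. zb (ptensor K Be H n h) r) (codiag (be b l))"
    using BeH.tlift_hom[OF BeHG u ZBG, of "codiag (be b l)" "ptensor K Be H"] assms
    by (simp add: BeH.tlift_id)
  also have "\<dots> = tlift ZB (\<lambda>x h. tlift ZB (\<lambda>x' h'. zb (ptensor K Be H (be x x') (h \<otimes>\<^bsub>H\<^esub> h')) r) (coact l)) (coact b)"
    by (rule codiag_sum_be[OF ZBG])
      (use assms in \<open>auto intro!: balancedI simp: BeH_simps zb_simps\<close>)
  finally show ?thesis .
qed

text \<open>
  The coaction of \<open>b\<^sub>0 \<otimes> l(b\<^sub>1)\<close> is \<open>\<Sum> (b\<^sub>0 \<otimes> l(b\<^sub>2)\<^sub>0) \<otimes> b\<^sub>1 l(b\<^sub>2)\<^sub>1\<close> by coassociativity, and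
  \<open>tau_sum_coact_left\<close> identifies \<open>\<Sum> h\<^sub>1 l(h\<^sub>2)\<^sub>1\<close> with \<open>1\<close>.
\<close>

lemma sigma_kernel:
  assumes b: "b \<in> carrier B"
  shows "tensor_map A BeHr (left_reg B) delta (sigma b) = \<zero>\<^bsub>ZB\<^esub>"
proof -
  have db: "balanced A (env_right Be) (left_reg B) ZB (\<lambda>x m. zb (delta x) m)"
    using tensor_map_balanced[OF Be_right_acted right_module_acted[OF BeHr_module] left_reg_acted delta_hom] .
  let ?S = "\<lambda>F. tlift ZB (\<lambda>b' h. tlift ZB (\<lambda>l r. zb (F (be b' l)) r) (tau h)) (coact b)"
  let ?f = "\<lambda>l r k b. zb (ptensor K Be H (be b l) k) r"
  let ?g = "\<lambda>x h h'. tlift ZB (\<lambda>l r. tlift ZB (\<lambda>x' k. zb (ptensor K Be H (be x x') (h \<otimes>\<^bsub>H\<^esub> k)) r) (coact l)) (tau h')"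
  have g1: "balanced K B H ZB (\<lambda>x h. ?g x h h')" if "h' \<in> carrier H" for h'
  proof (rule balancedI)
    fix x h assume "x \<in> carrier B" "h \<in> carrier H"
    then show "?g x h h' \<in> carrier ZB"
      using that by (intro BB.tlift_closed[OF ZBG] BH.tlift_closed[OF ZBG]) simp_all
  next
    fix x y h assume "x \<in> carrier B" "y \<in> carrier B" "h \<in> carrier H"
    then show "?g (x \<oplus>\<^bsub>B\<^esub> y) h h' = ?g x h h' \<oplus>\<^bsub>ZB\<^esub> ?g y h h'"
      using that by (intro BB.tlift_split[OF ZBG] BH.tlift_split[OF ZBG] BH.tlift_closed[OF ZBG])
        (simp_all add: be_add BeH_simps zb_simps)
  next
    fix x h k assume "x \<in> carrier B" "h \<in> carrier H" "k \<in> carrier H"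
    then show "?g x (h \<oplus>\<^bsub>H\<^esub> k) h' = ?g x h h' \<oplus>\<^bsub>ZB\<^esub> ?g x k h'"
      using that by (intro BB.tlift_split[OF ZBG] BH.tlift_split[OF ZBG] BH.tlift_closed[OF ZBG])
        (simp_all add: X.l_distr BeH_simps zb_simps)
  next
    fix c x h assume "c \<in> carrier K" "x \<in> carrier B" "h \<in> carrier H"
    then show "?g (c \<odot>\<^bsub>B\<^esub> x) h h' = ?g x (c \<odot>\<^bsub>H\<^esub> h) h'"
      using that by (intro BB.tlift_cong[OF ZBG] BH.tlift_cong[OF ZBG] BH.tlift_closed[OF ZBG])
        (simp_all add: H_scale_left Be_smult_be[symmetric] BeH_simps)
  qed
  have g2: "balanced K H H ZB (?g x)" if x: "x \<in> carrier B" for x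
  proof (rule balanced_cong[OF twist_balanced(3)[OF ZBG zb_trilinear[OF x] B.X.one_closed] HK HK])
    fix h h' assume "h \<in> carrier H" "h' \<in> carrier H"
    then show "?g x h h' = tlift ZB (\<lambda>l r. tlift ZB (\<lambda>l' k. zb (ptensor K Be H (be x (\<one>\<^bsub>B\<^esub> \<otimes>\<^bsub>B\<^esub> l')) (h \<otimes>\<^bsub>H\<^esub> k)) r) (coact l)) (tau h')"
      using x by (intro BB.tlift_cong[OF ZBG] BH.tlift_cong[OF ZBG]) (auto simp: BH.tlift_closed[OF ZBG])
  qed
  have "?S codiag = tlift ZB (\<lambda>b' h. tlift ZB (\<lambda>l r. tlift ZB (\<lambda>x h. tlift ZB (\<lambda>x' h'.
      zb (ptensor K Be H (be x x') (h \<otimes>\<^bsub>H\<^esub> h')) r) (coact l)) (coact b')) (tau h)) (coact b)"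
    by (intro BH.tlift_cong[OF ZBG] BB.tlift_cong[OF ZBG] BB.tlift_closed[OF ZBG] BH.tlift_closed[OF ZBG])
      (use b in \<open>simp_all add: zb_coact_twist\<close>)
  also have "\<dots> = tlift ZB (\<lambda>b' h'. tlift ZB (\<lambda>x h. ?g x h h') (coact b')) (coact b)"
    by (intro BH.tlift_cong[OF ZBG] tlift_swap[OF BB.tensor_data_axioms BH.tensor_data_axioms ZBG]
        BB.tlift_closed[OF ZBG] BH.tlift_closed[OF ZBG]) (use b in simp_all)
  also have "\<dots> = tlift ZB (\<lambda>x y. tlift ZB (?g x) (comul y)) (coact b)"
    by (rule coact_sum_coassoc[OF ZBG g1 g2 b])
  also have "\<dots> = ?S (\<lambda>t. ptensor K Be H t \<one>\<^bsub>H\<^esub>)"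
    by (intro BH.tlift_cong[OF ZBG] tau_sum_coact_left[OF ZBG zb_trilinear] BB.tlift_closed[OF ZBG])
      (use b in simp_all)
  finally have eq: "?S codiag = ?S (\<lambda>t. ptensor K Be H t \<one>\<^bsub>H\<^esub>)" .
  have sp: "zb (codiag t) r = zb (delta t) r \<oplus>\<^bsub>ZB\<^esub> zb (ptensor K Be H t \<one>\<^bsub>H\<^esub>) r" if "t \<in> carrier Bt" "r \<in> carrier B" for t r
  proof -
    have "codiag t = delta t \<oplus>\<^bsub>BeHt\<^esub> ptensor K Be H t \<one>\<^bsub>H\<^esub>"
      using that by (simp add: delta_def a_minus_def BeH.T.a_assoc BeH.T.l_neg)
    then show ?thesis using that by (simp add: zb_simps)
  qed
  have "?S codiag = ?S delta \<oplus>\<^bsub>ZB\<^esub> ?S (\<lambda>t. ptensor K Be H t \<one>\<^bsub>H\<^esub>)"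
    by (intro BH.tlift_split[OF ZBG] BB.tlift_split[OF ZBG] BB.tlift_closed[OF ZBG]) (use b in \<open>simp_all add: sp\<close>)
  moreover have "?S delta \<in> carrier ZB" "?S (\<lambda>t. ptensor K Be H t \<one>\<^bsub>H\<^esub>) \<in> carrier ZB"
    using b by (auto intro!: BH.tlift_closed[OF ZBG] BB.tlift_closed[OF ZBG])
  ultimately have "?S delta = \<zero>\<^bsub>ZB\<^esub>"
    using eq by (metis ZB.T.add.l_cancel_one' ZB.T.add.m_comm)
  then show ?thesis
    unfolding tensor_map_def sigma_sum[OF ZBG db b] .
qed

lemma mu_sigma:
  assumes b: "b \<in> carrier B"
  shows "mu (sigma b) = be b \<one>\<^bsub>B\<^esub>"
proof -
  have "mu (sigma b) = tlift Be (\<lambda>b' h. tlift Be (\<lambda>l r. be \<one>\<^bsub>B\<^esub> r \<otimes>\<^bsub>Be\<^esub> be b' l) (tau h)) (coact b)"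
    unfolding mu_def using sigma_sum[OF Be_group mu_balanced b] by blast
  also have "\<dots> = tlift Be (\<lambda>b' h. be (counit h \<odot>\<^bsub>B\<^esub> b') \<one>\<^bsub>B\<^esub>) (coact b)"
  proof (rule BH.tlift_cong[OF Be_group])
    fix b' h assume *: "b' \<in> carrier B" "h \<in> carrier H"
    have "tlift Be (\<lambda>l r. be \<one>\<^bsub>B\<^esub> r \<otimes>\<^bsub>Be\<^esub> be b' l) (tau h) = tlift Be (\<lambda>l r. be b' (l \<otimes>\<^bsub>B\<^esub> r)) (tau h)"
      by (rule BB.tlift_cong[OF Be_group]) (use * in \<open>simp_all add: be_mult\<close>)
    also have "\<dots> = be b' (counit h \<odot>\<^bsub>B\<^esub> \<one>\<^bsub>B\<^esub>)"
      by (rule tau_sum_product[OF Be_group]) (use * in \<open>simp_all add: add_hom_def be_add\<close>)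
    finally show "tlift Be (\<lambda>l r. be \<one>\<^bsub>B\<^esub> r \<otimes>\<^bsub>Be\<^esub> be b' l) (tau h) = be (counit h \<odot>\<^bsub>B\<^esub> b') \<one>\<^bsub>B\<^esub>"
      using * by (simp add: be_smult)
  qed (use b in simp_all)
  also have "\<dots> = be b \<one>\<^bsub>B\<^esub>"
    by (rule coact_sum_counit[OF Be_group _ b]) (simp add: add_hom_def be_add)
  finally show ?thesis .
qed

lemma sigma_lift:
  assumes b: "b \<in> carrier B"
  shows "\<exists>u\<in>carrier GB. incl_GB u = sigma b"
  using flat_kernel[OF env_right_module env_right_module BeHr_module tensor_type_embedding tensor_type_embedding
      inj_on_id2 Gamma_incl_hom delta_hom delta_exact sigma_closed[OF b] sigma_kernel[OF b]]
  unfolding incl_GB_def by blast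

text \<open>
  The image of \<open>mu\<close> is stable under \<open>B\<close> acting on the second factor, so it contains all \<open>b \<otimes> b'\<close> as soon
  as it contains all \<open>b \<otimes> 1\<close>.
\<close>

lemma mu_bij: "bij_betw mu (carrier GB) (carrier Bt)"
proof -
  have "t \<in> mu ` carrier GB" if "t \<in> carrier Bt" for t
    using that
  proof (induction t rule: EE.tensor_induct)
    case (pure b b')
    then have b: "b \<in> carrier B" "b' \<in> carrier B" by auto
    obtain u where u: "u \<in> carrier GB" "incl_GB u = sigma b" using sigma_lift[OF b(1)] by blast
    have mu_u: "mu u = be b \<one>\<^bsub>B\<^esub>" using mu_incl_GB[OF u(1)] u(2) mu_sigma[OF b(1)] by simp
    have "\<exists>v\<in>carrier GB. mu v = be \<one>\<^bsub>B\<^esub> b' \<otimes>\<^bsub>Be\<^esub> mu u"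
      using u(1)
    proof (induction u rule: GB.tensor_induct)
      case (pure t y)
      then show ?case using b by (intro bexI[of _ "gb t (y \<otimes>\<^bsub>B\<^esub> b')"]) (auto simp: mu_gb be_right_assoc simp del: equalityI)
    next
      case (add s t)
      then obtain v w where "v \<in> carrier GB" "w \<in> carrier GB" "mu v = be \<one>\<^bsub>B\<^esub> b' \<otimes>\<^bsub>Be\<^esub> mu s" "mu w = be \<one>\<^bsub>B\<^esub> b' \<otimes>\<^bsub>Be\<^esub> mu t"
        by blast
      then show ?case using add b add_homD(2)[OF mu_hom(2)]
        by (intro bexI[of _ "v \<oplus>\<^bsub>GB\<^esub> w"]) (simp_all add: Be_distrib)
    qed
    then obtain v where "v \<in> carrier GB" "mu v = be b b'" using b by (auto simp: mu_u be_mult)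
    then show ?case by (metis imageI)
  next
    case (add s t)
    then obtain v w where "v \<in> carrier GB" "w \<in> carrier GB" "mu v = s" "mu w = t" by blast
    then have "mu (v \<oplus>\<^bsub>GB\<^esub> w) = s \<oplus>\<^bsub>Bt\<^esub> t" "v \<oplus>\<^bsub>GB\<^esub> w \<in> carrier GB"
      using add_homD(2)[OF mu_hom(2)] by simp_all
    then show ?case by (metis imageI)
  qed
  then have "mu ` carrier GB = carrier Bt"
    using mu_closed by blast
  then show ?thesis using mu_inj by (simp add: bij_betw_def inj_on_def)
qed

definition phi :: "('b, 'b) tensors \<Rightarrow> (('b, 'b) tensors, 'b) tensors" where
  "phi = inv_into (carrier GB) mu"

lemma phi_closed [simp]: "t \<in> carrier Bt \<Longrightarrow> phi t \<in> carrier GB"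
  unfolding phi_def using mu_bij by (auto simp: bij_betw_def intro!: inv_into_into)

lemma mu_phi: "t \<in> carrier Bt \<Longrightarrow> mu (phi t) = t"
  unfolding phi_def using mu_bij by (intro f_inv_into_f) (simp add: bij_betw_def)

lemma phi_mu: "u \<in> carrier GB \<Longrightarrow> phi (mu u) = u"
  by (rule mu_inj) (simp_all add: mu_phi)

lemma phi_hom: "add_hom Be GB phi"
proof (rule add_homI)
  fix x y assume "x \<in> carrier Be" "y \<in> carrier Be"
  then show "phi (x \<oplus>\<^bsub>Be\<^esub> y) = phi x \<oplus>\<^bsub>GB\<^esub> phi y"
    using add_homD(2)[OF mu_hom(2)] by (intro mu_inj) (simp_all add: mu_phi)
qed simp

lemma incl_GB_phi: "b \<in> carrier B \<Longrightarrow> incl_GB (phi (be b \<one>\<^bsub>B\<^esub>)) = sigma b"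
  using sigma_lift[of b] mu_sigma[of b] phi_mu mu_incl_GB by metis

end

section \<open>The element in \<open>B \<otimes>\<^sub>A \<Gamma> \<otimes>\<^sub>A B\<close>\<close>

context galois_env
begin

text \<open>
  The functions on \<open>B \<times> E \<times> B\<close> that induce homomorphisms on \<open>B \<otimes>\<^sub>A E \<otimes>\<^sub>A B\<close>.
\<close>

definition balanced3 :: "('k, ('b, 'b) tensors) module \<Rightarrow> ('g, 'w) ring_scheme
    \<Rightarrow> ('b \<Rightarrow> ('b, 'b) tensors \<Rightarrow> 'b \<Rightarrow> 'g) \<Rightarrow> bool" where
  "balanced3 E G g \<longleftrightarrow>
     (\<forall>x\<in>carrier B. \<forall>t\<in>carrier E. \<forall>y\<in>carrier B. g x t y \<in> carrier G
       \<and> (\<forall>x'\<in>carrier B. g (x \<oplus>\<^bsub>B\<^esub> x') t y = g x t y \<oplus>\<^bsub>G\<^esub> g x' t y)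
       \<and> (\<forall>t'\<in>carrier E. g x (t \<oplus>\<^bsub>Bt\<^esub> t') y = g x t y \<oplus>\<^bsub>G\<^esub> g x t' y)
       \<and> (\<forall>y'\<in>carrier B. g x t (y \<oplus>\<^bsub>B\<^esub> y') = g x t y \<oplus>\<^bsub>G\<^esub> g x t y')
       \<and> (\<forall>a\<in>carrier A. g (x \<otimes>\<^bsub>B\<^esub> a) t y = g x (be a \<one>\<^bsub>B\<^esub> \<otimes>\<^bsub>Be\<^esub> t) y
            \<and> g x (be \<one>\<^bsub>B\<^esub> a \<otimes>\<^bsub>Be\<^esub> t) y = g x t (a \<otimes>\<^bsub>B\<^esub> y)))"

lemma balanced3D:
  assumes "balanced3 E G g" "x \<in> carrier B" "t \<in> carrier E" "y \<in> carrier B"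
  shows "g x t y \<in> carrier G"
    and "\<And>x'. x' \<in> carrier B \<Longrightarrow> g (x \<oplus>\<^bsub>B\<^esub> x') t y = g x t y \<oplus>\<^bsub>G\<^esub> g x' t y"
    and "\<And>t'. t' \<in> carrier E \<Longrightarrow> g x (t \<oplus>\<^bsub>Bt\<^esub> t') y = g x t y \<oplus>\<^bsub>G\<^esub> g x t' y"
    and "\<And>y'. y' \<in> carrier B \<Longrightarrow> g x t (y \<oplus>\<^bsub>B\<^esub> y') = g x t y \<oplus>\<^bsub>G\<^esub> g x t y'"
    and "\<And>a. a \<in> carrier A \<Longrightarrow> g (x \<otimes>\<^bsub>B\<^esub> a) t y = g x (be a \<one>\<^bsub>B\<^esub> \<otimes>\<^bsub>Be\<^esub> t) y"
    and "\<And>a. a \<in> carrier A \<Longrightarrow> g x (be \<one>\<^bsub>B\<^esub> a \<otimes>\<^bsub>Be\<^esub> t) y = g x t (a \<otimes>\<^bsub>B\<^esub> y)"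
  using assms(1)[unfolded balanced3_def, THEN bspec, OF assms(2), THEN bspec, OF assms(3),
      THEN bspec, OF assms(4)]
  by simp_all

lemma balanced3I:
  assumes "\<And>x t y. x \<in> carrier B \<Longrightarrow> t \<in> carrier E \<Longrightarrow> y \<in> carrier B \<Longrightarrow> g x t y \<in> carrier G"
    and "\<And>x t y x'. x \<in> carrier B \<Longrightarrow> t \<in> carrier E \<Longrightarrow> y \<in> carrier B \<Longrightarrow>
      x' \<in> carrier B \<Longrightarrow> g (x \<oplus>\<^bsub>B\<^esub> x') t y = g x t y \<oplus>\<^bsub>G\<^esub> g x' t y"
    and "\<And>x t y t'. x \<in> carrier B \<Longrightarrow> t \<in> carrier E \<Longrightarrow> y \<in> carrier B \<Longrightarrow>
      t' \<in> carrier E \<Longrightarrow> g x (t \<oplus>\<^bsub>Bt\<^esub> t') y = g x t y \<oplus>\<^bsub>G\<^esub> g x t' y"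
    and "\<And>x t y y'. x \<in> carrier B \<Longrightarrow> t \<in> carrier E \<Longrightarrow> y \<in> carrier B \<Longrightarrow>
      y' \<in> carrier B \<Longrightarrow> g x t (y \<oplus>\<^bsub>B\<^esub> y') = g x t y \<oplus>\<^bsub>G\<^esub> g x t y'"
    and "\<And>x t y a. x \<in> carrier B \<Longrightarrow> t \<in> carrier E \<Longrightarrow> y \<in> carrier B \<Longrightarrow>
      a \<in> carrier A \<Longrightarrow> g (x \<otimes>\<^bsub>B\<^esub> a) t y = g x (be a \<one>\<^bsub>B\<^esub> \<otimes>\<^bsub>Be\<^esub> t) y"
    and "\<And>x t y a. x \<in> carrier B \<Longrightarrow> t \<in> carrier E \<Longrightarrow> y \<in> carrier B \<Longrightarrow>
      a \<in> carrier A \<Longrightarrow> g x (be \<one>\<^bsub>B\<^esub> a \<otimes>\<^bsub>Be\<^esub> t) y = g x t (a \<otimes>\<^bsub>B\<^esub> y)"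
  shows "balanced3 E G g"
  unfolding balanced3_def using assms by simp

lemma balanced3_Gamma: "balanced3 Be G g \<Longrightarrow> balanced3 Gamma G g"
  unfolding balanced3_def by simp

lemma be_comm:
  "a \<in> carrier B \<Longrightarrow> b \<in> carrier B \<Longrightarrow> t \<in> carrier Bt \<Longrightarrow>
    be a \<one>\<^bsub>B\<^esub> \<otimes>\<^bsub>Be\<^esub> (be \<one>\<^bsub>B\<^esub> b \<otimes>\<^bsub>Be\<^esub> t) = be \<one>\<^bsub>B\<^esub> b \<otimes>\<^bsub>Be\<^esub> (be a \<one>\<^bsub>B\<^esub> \<otimes>\<^bsub>Be\<^esub> t)"
  by (simp add: Be_assoc[symmetric] be_mult)

lemma env_left_simps [simp]:
  "carrier (env_left E) = carrier E" "add (env_left E) = add E" "zero (env_left E) = zero E"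
  "a \<odot>\<^bsub>env_left E\<^esub> t = be a \<one>\<^bsub>B\<^esub> \<otimes>\<^bsub>Be\<^esub> t"
  by (simp_all add: env_left_def)

subsection \<open>Sums over \<open>B \<otimes>\<^sub>A E \<otimes>\<^sub>A B\<close>\<close>

context
  fixes E :: "('k, ('b, 'b) tensors) module"
  assumes E: "E = Be \<or> E = Gamma"
begin

lemma bimod_closed [simp]: "t \<in> carrier E \<Longrightarrow> t \<in> carrier Bt"
  and bimod_left_closed [simp]: "a \<in> carrier A \<Longrightarrow> t \<in> carrier E \<Longrightarrow> be a \<one>\<^bsub>B\<^esub> \<otimes>\<^bsub>Be\<^esub> t \<in> carrier E"
  and bimod_right_closed [simp]: "a \<in> carrier A \<Longrightarrow> t \<in> carrier E \<Longrightarrow> be \<one>\<^bsub>B\<^esub> a \<otimes>\<^bsub>Be\<^esub> t \<in> carrier E"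
  and bimod_add [simp]: "add E = add Bt"
  and bimod_group: "abelian_group E"
  using E Be_group Gamma_group by auto

lemma env_left_acted: "acted A (env_left E)"
  by (auto simp: acted_def intro!: abelian_group_transfer[OF bimod_group])

interpretation L: tensor_data A "right_reg B" "env_left E"
  by (rule tensor_data.intro[OF right_reg_acted env_left_acted])

abbreviation (input) "BEt \<equiv> tensor A (right_reg B) (env_left E)"
abbreviation (input) "pL \<equiv> ptensor A (right_reg B) (env_left E)"

lemma pL_simps:
  "x \<in> carrier B \<Longrightarrow> x' \<in> carrier B \<Longrightarrow> t \<in> carrier E \<Longrightarrow> pL (x \<oplus>\<^bsub>B\<^esub> x') t = pL x t \<oplus>\<^bsub>BEt\<^esub> pL x' t"
  "x \<in> carrier B \<Longrightarrow> t \<in> carrier E \<Longrightarrow> t' \<in> carrier E \<Longrightarrow> pL x (t \<oplus>\<^bsub>Bt\<^esub> t') = pL x t \<oplus>\<^bsub>BEt\<^esub> pL x t'"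
  "a \<in> carrier A \<Longrightarrow> x \<in> carrier B \<Longrightarrow> t \<in> carrier E \<Longrightarrow> pL (x \<otimes>\<^bsub>B\<^esub> a) t = pL x (be a \<one>\<^bsub>B\<^esub> \<otimes>\<^bsub>Be\<^esub> t)"
  "x \<in> carrier B \<Longrightarrow> t \<in> carrier E \<Longrightarrow> pL x t \<in> carrier BEt"
  using L.ptensor_add_left[of x x' t] L.ptensor_add_right[of x t t'] L.ptensor_smult[of a x t]
    L.ptensor_closed[of x t] by simp_all

lemma BE_action_balanced:
  assumes "a \<in> carrier A"
  shows "balanced A (right_reg B) (env_left E) BEt (\<lambda>x t. pL x (be \<one>\<^bsub>B\<^esub> a \<otimes>\<^bsub>Be\<^esub> t))"
  by (rule balancedI) (use assms in \<open>simp_all add: pL_simps Be_distrib be_comm\<close>)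

lemma BE_simps [simp]: "carrier (BE E) = carrier BEt" "add (BE E) = add BEt"
  by (simp_all add: BE_def Let_def)

lemma BE_smult: "a \<odot>\<^bsub>BE E\<^esub> v = tlift BEt (\<lambda>x t. pL x (be \<one>\<^bsub>B\<^esub> a \<otimes>\<^bsub>Be\<^esub> t)) v"
  by (simp add: BE_def Let_def)

lemma BE_acted: "acted A (BE E)"
  unfolding acted_def BE_smult
  by (auto simp: BE_def Let_def L.abelian_group_tensor
      intro!: L.tlift_closed[OF L.abelian_group_tensor] L.ptensor_closed)

interpretation LR: tensor_data A "BE E" "left_reg B"
  by (rule tensor_data.intro[OF BE_acted left_reg_acted])

lemma BEB_group: "abelian_group (BEB E)"
  unfolding BEB_def by (rule LR.abelian_group_tensor)

lemma ptensor3_balanced: "balanced3 E (BEB E) (ptensor3 E)"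
proof (rule balanced3I)
  fix x t y a assume *: "x \<in> carrier B" "t \<in> carrier E" "y \<in> carrier B" "a \<in> carrier A"
  have "pL x (be \<one>\<^bsub>B\<^esub> a \<otimes>\<^bsub>Be\<^esub> t) = a \<odot>\<^bsub>BE E\<^esub> pL x t"
    unfolding BE_smult
    by (rule L.tlift_ptensor[OF L.abelian_group_tensor BE_action_balanced, symmetric]) (use * in simp_all)
  then show "ptensor3 E x (be \<one>\<^bsub>B\<^esub> a \<otimes>\<^bsub>Be\<^esub> t) y = ptensor3 E x t (a \<otimes>\<^bsub>B\<^esub> y)"
    using * LR.ptensor_smult[of a "pL x t" y] by (simp add: ptensor3_def pL_simps(4))
qed (use LR.ptensor_closed LR.ptensor_add_left LR.ptensor_add_right
    in \<open>simp_all add: ptensor3_def BEB_def pL_simps\<close>)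

context
  fixes G :: "('g, 'w) ring_scheme"
  assumes G: "abelian_group G"
begin

lemma tlift3_inner_balanced:
  assumes "balanced3 E G g" "y \<in> carrier B"
  shows "balanced A (right_reg B) (env_left E) G (\<lambda>x t. g x t y)"
  by (rule balancedI) (use assms(2) balanced3D[OF assms(1)] in simp_all)

lemma tlift3_outer_balanced:
  assumes g: "balanced3 E G g"
  shows "balanced A (BE E) (left_reg B) G (\<lambda>v y. tlift G (\<lambda>x t. g x t y) v)"
proof (rule balancedI)
  note gD = balanced3D[OF g]
  note b = tlift3_inner_balanced[OF g]
  fix a v y assume *: "a \<in> carrier A" "v \<in> carrier (BE E)" "y \<in> carrier (left_reg B)"
  have "tlift G (\<lambda>x t. g x t y) (a \<odot>\<^bsub>BE E\<^esub> v) = tlift G (\<lambda>x t. g x (be \<one>\<^bsub>B\<^esub> a \<otimes>\<^bsub>Be\<^esub> t) y) v"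
    unfolding BE_smult by (rule L.tlift_double_hom[OF G b L.tensor_data_axioms]) (use * in simp_all)
  also have "\<dots> = tlift G (\<lambda>x t. g x t (a \<odot>\<^bsub>left_reg B\<^esub> y)) v"
    by (rule L.tlift_cong[OF G]) (use * gD in simp_all)
  finally show "tlift G (\<lambda>x t. g x t y) (a \<odot>\<^bsub>BE E\<^esub> v) = tlift G (\<lambda>x t. g x t (a \<odot>\<^bsub>left_reg B\<^esub> y)) v" .
next
  note gD = balanced3D[OF g]
  fix v y y' assume *: "v \<in> carrier (BE E)" "y \<in> carrier (left_reg B)" "y' \<in> carrier (left_reg B)"
  then show "tlift G (\<lambda>x t. g x t (y \<oplus>\<^bsub>left_reg B\<^esub> y')) v = tlift G (\<lambda>x t. g x t y) v \<oplus>\<^bsub>G\<^esub> tlift G (\<lambda>x t. g x t y') v"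
    by (intro L.tlift_split[OF G]) (use gD in simp_all)
qed (use balanced3D[OF g] L.tlift_add[OF G tlift3_inner_balanced[OF g]] in \<open>auto intro!: L.tlift_closed[OF G]\<close>)

lemma tlift3_hom: "balanced3 E G g \<Longrightarrow> add_hom (BEB E) G (tlift3 G g)"
  using LR.tlift_add_hom[OF G tlift3_outer_balanced] by (simp add: tlift3_def[abs_def] BEB_def)

lemma tlift3_pure:
  assumes g: "balanced3 E G g" and "x \<in> carrier B" "t \<in> carrier E" "y \<in> carrier B"
  shows "tlift3 G g (ptensor3 E x t y) = g x t y"
  using assms(2-) pL_simps(4)
  by (simp add: tlift3_def ptensor3_def LR.tlift_ptensor[OF G tlift3_outer_balanced[OF g]]
      L.tlift_ptensor[OF G tlift3_inner_balanced[OF g]])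

lemma tlift3_closed:
  assumes "w \<in> carrier (BEB E)"
    and "\<And>x t y. x \<in> carrier B \<Longrightarrow> t \<in> carrier E \<Longrightarrow> y \<in> carrier B \<Longrightarrow> g x t y \<in> carrier G"
  shows "tlift3 G g w \<in> carrier G"
  using assms unfolding tlift3_def BEB_def
  by (intro LR.tlift_closed[OF G] L.tlift_closed[OF G]) simp_all

lemma tlift3_cong:
  assumes "w \<in> carrier (BEB E)"
    and "\<And>x t y. x \<in> carrier B \<Longrightarrow> t \<in> carrier E \<Longrightarrow> y \<in> carrier B \<Longrightarrow> f x t y \<in> carrier G"
    and "\<And>x t y. x \<in> carrier B \<Longrightarrow> t \<in> carrier E \<Longrightarrow> y \<in> carrier B \<Longrightarrow> g x t y = f x t y"
  shows "tlift3 G g w = tlift3 G f w"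
  using assms unfolding tlift3_def BEB_def
  by (intro LR.tlift_cong[OF G] L.tlift_cong[OF G] L.tlift_closed[OF G]) simp_all

lemma tlift3_split:
  assumes "w \<in> carrier (BEB E)"
    and "\<And>x t y. x \<in> carrier B \<Longrightarrow> t \<in> carrier E \<Longrightarrow> y \<in> carrier B \<Longrightarrow> f x t y \<in> carrier G"
    and "\<And>x t y. x \<in> carrier B \<Longrightarrow> t \<in> carrier E \<Longrightarrow> y \<in> carrier B \<Longrightarrow> f' x t y \<in> carrier G"
    and "\<And>x t y. x \<in> carrier B \<Longrightarrow> t \<in> carrier E \<Longrightarrow> y \<in> carrier B \<Longrightarrow> g x t y = f x t y \<oplus>\<^bsub>G\<^esub> f' x t y"
  shows "tlift3 G g w = tlift3 G f w \<oplus>\<^bsub>G\<^esub> tlift3 G f' w"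
  using assms unfolding tlift3_def BEB_def
  by (intro LR.tlift_split[OF G] L.tlift_split[OF G] L.tlift_closed[OF G]) simp_all

lemma tlift3_comp_hom:
  assumes u: "add_hom G G' u" and G': "abelian_group G'" and w: "w \<in> carrier (BEB E)"
    and g: "\<And>x t y. x \<in> carrier B \<Longrightarrow> t \<in> carrier E \<Longrightarrow> y \<in> carrier B \<Longrightarrow> g x t y \<in> carrier G"
  shows "u (tlift3 G g w) = tlift3 G' (\<lambda>x t y. u (g x t y)) w"
proof -
  have "u (tlift3 G g w) = tlift G' (\<lambda>v y. u (tlift G (\<lambda>x t. g x t y) v)) w"
    unfolding tlift3_def using w g
    by (intro LR.tlift_hom[OF G u G'] L.tlift_closed[OF G]) (simp_all add: BEB_def)
  also have "\<dots> = tlift3 G' (\<lambda>x t y. u (g x t y)) w"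
    unfolding tlift3_def using w g add_homD(1)[OF u]
    by (intro LR.tlift_cong[OF G'] L.tlift_hom[OF G u G'] L.tlift_closed[OF G'])  (simp_all add: BEB_def)
  finally show ?thesis .
qed

lemma BEB_ext:
  assumes u: "add_hom (BEB E) G u" and v: "add_hom (BEB E) G v"
    and eq: "\<And>x t y. x \<in> carrier B \<Longrightarrow> t \<in> carrier E \<Longrightarrow> y \<in> carrier B \<Longrightarrow> u (ptensor3 E x t y) = v (ptensor3 E x t y)"
    and w: "w \<in> carrier (BEB E)"
  shows "u w = v w"
proof (rule LR.tensor_ext[OF G u[unfolded BEB_def] v[unfolded BEB_def] _ w[unfolded BEB_def]])
  fix z y assume *: "z \<in> carrier (BE E)" "y \<in> carrier (left_reg B)"
  let ?p = "\<lambda>z. ptensor A (BE E) (left_reg B) z y"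
  have p: "add_hom BEt (BEB E) ?p"
    using * LR.ptensor_add_left LR.ptensor_closed by (simp add: add_hom_def BEB_def)
  show "u (?p z) = v (?p z)"
  proof (rule L.tensor_ext[OF G, where u = "\<lambda>z. u (?p z)" and v = "\<lambda>z. v (?p z)"])
    show "add_hom BEt G (\<lambda>z. u (?p z))" "add_hom BEt G (\<lambda>z. v (?p z))"
      using p u v by (auto simp: add_hom_def)
  qed (use * eq in \<open>simp_all add: ptensor3_def\<close>)
qed

end

end

(* Once E is generalized, the left-hand sides of these rules no longer determine it. *)
declare bimod_closed [simp del] bimod_left_closed [simp del] bimod_right_closed [simp del] bimod_add [simp del]

subsection \<open>Sums over \<open>\<Gamma> \<otimes>\<^sub>A B\<close> and the inverse of \<open>mu\<close>\<close>

text \<open>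
  Surjectivity of \<open>mu\<close> as an induction principle: \<open>B\<^sup>e\<close> is spanned by the products \<open>t \<cdot> y\<close> with \<open>t\<close> in \<open>\<Gamma>\<close>.
  Together with \<open>phi_sum_pure\<close> it replaces computations with \<open>phi\<close>.
\<close>

lemma Be_induct_Gamma [consumes 1, case_names pure add]:
  assumes "m \<in> carrier Bt"
    and "\<And>t y. t \<in> carrier Gamma \<Longrightarrow> y \<in> carrier B \<Longrightarrow> P (be \<one>\<^bsub>B\<^esub> y \<otimes>\<^bsub>Be\<^esub> t)"
    and "\<And>s t. s \<in> carrier Bt \<Longrightarrow> t \<in> carrier Bt \<Longrightarrow> P s \<Longrightarrow> P t \<Longrightarrow> P (s \<oplus>\<^bsub>Bt\<^esub> t)"
  shows "P m"
proof -
  have "P (mu u)" if "u \<in> carrier GB" for u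
    using that
  proof (induction u rule: GB.tensor_induct)
    case (pure t y)
    then show ?case using assms(2) by (simp add: mu_gb)
  next
    case (add s t)
    then show ?case using assms(3) add_homD(2)[OF mu_hom(2)] by simp
  qed
  from this[of "phi m"] show ?thesis using assms(1) by (simp add: mu_phi)
qed

lemma mult_left_hom: "s \<in> carrier Bt \<Longrightarrow> add_hom Be Be (\<lambda>m. s \<otimes>\<^bsub>Be\<^esub> m)"
  and mult_right_hom: "s \<in> carrier Bt \<Longrightarrow> add_hom Be Be (\<lambda>m. m \<otimes>\<^bsub>Be\<^esub> s)"
  by (simp_all add: add_hom_def Be_distrib)

abbreviation Gamma_balanced :: "('g, 'w) ring_scheme \<Rightarrow> (('b, 'b) tensors \<Rightarrow> 'b \<Rightarrow> 'g) \<Rightarrow> bool" where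
  "Gamma_balanced \<equiv> balanced A (env_right Gamma) (left_reg B)"

context
  fixes G :: "('g, 'w) ring_scheme"
  assumes G: "abelian_group G"
begin

lemma phi_sum_hom: "Gamma_balanced G f \<Longrightarrow> add_hom Be G (\<lambda>m. tlift G f (phi m))"
  using GB.tlift_add_hom[OF G] phi_hom by (simp add: add_hom_def)

lemma phi_sum_pure:
  assumes "Gamma_balanced G f" "t \<in> carrier Gamma" "y \<in> carrier B"
  shows "tlift G f (phi (be \<one>\<^bsub>B\<^esub> y \<otimes>\<^bsub>Be\<^esub> t)) = f t y"
  using assms GB.tlift_ptensor[OF G assms(1), of t y] phi_mu[of "gb t y"] by (simp add: mu_gb)

lemma phi_sum_eqI:
  assumes f: "Gamma_balanced G f" and f': "Gamma_balanced G f'"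
    and F: "add_hom Be Be F" and m: "m \<in> carrier Bt"
    and eq: "\<And>t y. t \<in> carrier Gamma \<Longrightarrow> y \<in> carrier B \<Longrightarrow>
      tlift G f' (phi (F (be \<one>\<^bsub>B\<^esub> y \<otimes>\<^bsub>Be\<^esub> t))) = f t y"
  shows "tlift G f (phi m) = tlift G f' (phi (F m))"
  using m
proof (induction m rule: Be_induct_Gamma)
  case (pure t y)
  then show ?case using eq by (simp add: phi_sum_pure[OF f])
next
  case (add s t)
  then show ?case
    using add_homD[OF phi_sum_hom[OF f]] add_homD[OF phi_sum_hom[OF f']] add_homD[OF F] by simp
qed

lemma phi_sum_sigma:
  assumes f: "balanced A (env_right Be) (left_reg B) G f" and b: "b \<in> carrier B"
  shows "tlift G f (phi (be b \<one>\<^bsub>B\<^esub>)) = tlift G f (sigma b)"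
proof -
  have f': "Gamma_balanced G f"
    by (rule balancedI) (use balancedD[OF f] in simp_all)
  have "tlift G f (incl_GB u) = tlift G f u" if "u \<in> carrier GB" for u
  proof (rule GB.tensor_ext[OF G _ GB.tlift_add_hom[OF G f'] _ that])
    show "add_hom GB G (\<lambda>u. tlift G f (incl_GB u))"
      using EB.tlift_add_hom[OF G f] incl_GB_hom by (simp add: add_hom_def)
    fix t y assume "t \<in> carrier (env_right Gamma)" "y \<in> carrier (left_reg B)"
    then show "tlift G f (incl_GB (gb t y)) = tlift G f (gb t y)"
      by (simp add: incl_GB_gb EB.tlift_ptensor[OF G f] GB.tlift_ptensor[OF G f'])
  qed
  from this[of "phi (be b \<one>\<^bsub>B\<^esub>)"] show ?thesis using b by (simp add: incl_GB_phi)
qed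

lemma balanced3_Gamma_balanced:
  assumes "balanced3 Gamma G g" "x \<in> carrier B"
  shows "Gamma_balanced G (g x)"
  by (rule balancedI) (use assms(2) balanced3D[OF assms(1)] in simp_all)

lemma phi_sum_closed:
  assumes "balanced3 Gamma G g" "x \<in> carrier B" "m \<in> carrier Bt"
  shows "tlift G (g x) (phi m) \<in> carrier G"
  using add_homD(1)[OF phi_sum_hom[OF balanced3_Gamma_balanced[OF assms(1,2)]]] assms(3) by simp

lemma phi_sum_add_left:
  assumes g: "balanced3 Gamma G g" and "x \<in> carrier B" "x' \<in> carrier B" "m \<in> carrier Bt"
  shows "tlift G (g (x \<oplus>\<^bsub>B\<^esub> x')) (phi m) = tlift G (g x) (phi m) \<oplus>\<^bsub>G\<^esub> tlift G (g x') (phi m)"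
  by (rule GB.tlift_split[OF G]) (use assms(2-) balanced3D[OF g] in simp_all)

lemma phi_sum_add_right:
  assumes g: "balanced3 Gamma G g" and "x \<in> carrier B" "m \<in> carrier Bt" "m' \<in> carrier Bt"
  shows "tlift G (g x) (phi (m \<oplus>\<^bsub>Bt\<^esub> m')) = tlift G (g x) (phi m) \<oplus>\<^bsub>G\<^esub> tlift G (g x) (phi m')"
  using add_homD(2)[OF phi_sum_hom[OF balanced3_Gamma_balanced[OF assms(1,2)]], of m m'] assms(3,4) by simp

lemma phi_sum_left:
  assumes g: "balanced3 Gamma G g" and x: "x \<in> carrier B" and a: "a \<in> carrier A" and m: "m \<in> carrier Bt"
  shows "tlift G (g (x \<otimes>\<^bsub>B\<^esub> a)) (phi m) = tlift G (g x) (phi (be a \<one>\<^bsub>B\<^esub> \<otimes>\<^bsub>Be\<^esub> m))"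
proof (rule phi_sum_eqI[OF balanced3_Gamma_balanced[OF g] balanced3_Gamma_balanced[OF g x] mult_left_hom m])
  fix t y assume *: "t \<in> carrier Gamma" "y \<in> carrier B"
  have "be a \<one>\<^bsub>B\<^esub> \<otimes>\<^bsub>Be\<^esub> (be \<one>\<^bsub>B\<^esub> y \<otimes>\<^bsub>Be\<^esub> t) = be \<one>\<^bsub>B\<^esub> y \<otimes>\<^bsub>Be\<^esub> (be a \<one>\<^bsub>B\<^esub> \<otimes>\<^bsub>Be\<^esub> t)"
    using * a by (simp add: be_comm)
  then show "tlift G (g x) (phi (be a \<one>\<^bsub>B\<^esub> \<otimes>\<^bsub>Be\<^esub> (be \<one>\<^bsub>B\<^esub> y \<otimes>\<^bsub>Be\<^esub> t))) = g (x \<otimes>\<^bsub>B\<^esub> a) t y"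
    using * a x balanced3D(5)[OF g] by (simp add: phi_sum_pure[OF balanced3_Gamma_balanced[OF g x]])
qed (use x a in simp_all)

text \<open>
  A balanced function on \<open>B \<times> \<Gamma> \<times> B\<close> extends to \<open>B \<times> B\<^sup>e \<times> B\<close> by decomposing \<open>m \<cdot> y\<close> in \<open>B\<^sup>e\<close> as a sum of
  products of elements of \<open>\<Gamma>\<close> and \<open>B\<close>. Every sum over a preimage of \<open>\<kappa>(h)\<close> is thereby a sum over \<open>\<kappa>(h)\<close>
  itself.
\<close>

lemma balanced3_extend:
  assumes g: "balanced3 Gamma G g"
  shows "balanced3 Be G (\<lambda>x m y. tlift G (g x) (phi (be \<one>\<^bsub>B\<^esub> y \<otimes>\<^bsub>Be\<^esub> m)))"
  by (rule balanced3I)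
    (simp_all add: phi_sum_closed[OF g] phi_sum_add_left[OF g] phi_sum_add_right[OF g] phi_sum_left[OF g]
      be_add Be_distrib be_comm be_right_assoc)

lemma phi_sum_A_balanced:
  assumes g: "balanced3 Gamma G g" and b: "b \<in> carrier B"
  shows "A_balanced G (\<lambda>l r. tlift G (g l) (phi (be r b)))"
  by (rule A_balancedI)
    (use b in \<open>simp_all add: phi_sum_closed[OF g] phi_sum_add_left[OF g] phi_sum_add_right[OF g] phi_sum_left[OF g]
      be_add be_mult\<close>)

end

subsection \<open>Sums over \<open>kappa_Gamma\<close>\<close>

abbreviation "BBB \<equiv> BEB Be"

lemma BBB_group: "abelian_group BBB" and BGB_group: "abelian_group (BEB Gamma)"
  by (simp_all add: BEB_group)

lemma ptensor3_closed [simp]: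
  "x \<in> carrier B \<Longrightarrow> t \<in> carrier Bt \<Longrightarrow> y \<in> carrier B \<Longrightarrow> ptensor3 Be x t y \<in> carrier BBB"
  using balanced3D(1)[OF ptensor3_balanced[of Be]] by simp

lemma kappa_sum:
  assumes G: "abelian_group G" and g: "balanced3 Be G g" and h: "h \<in> carrier H"
  shows "kappa h \<in> carrier BBB" (is ?A)
    and "tlift3 G g (kappa h) = tlift G (\<lambda>h1 h2. tlift G (\<lambda>l r. tlift G (\<lambda>l' r'. g l (be r l') r') (tau h2)) (tau h1)) (comul h)"
proof -
  note u = tlift3_hom[of Be, OF _ G g, simplified]
  note BG = BBB_group
  have gc: "\<And>x t y. x \<in> carrier B \<Longrightarrow> t \<in> carrier Bt \<Longrightarrow> y \<in> carrier B \<Longrightarrow> g x t y \<in> carrier G"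
    using balanced3D(1)[OF g] by simp
  show ?A unfolding kappa_def
    by (intro HH.tlift_closed[OF BG] BB.tlift_closed[OF BG]) (use h in simp_all)
  have "tlift3 G g (kappa h) = tlift G (\<lambda>h1 h2. tlift3 G g (tlift BBB (\<lambda>l r. tlift BBB (\<lambda>l' r'. ptensor3 Be l (be r l') r') (tau h2)) (tau h1))) (comul h)"
    unfolding kappa_def
    by (rule HH.tlift_hom[OF BG u G]) (use h in \<open>auto intro!: BB.tlift_closed[OF BG]\<close>)
  also have "\<dots> = tlift G (\<lambda>h1 h2. tlift G (\<lambda>l r. tlift3 G g (tlift BBB (\<lambda>l' r'. ptensor3 Be l (be r l') r') (tau h2))) (tau h1)) (comul h)"
    by (intro HH.tlift_cong[OF G] BB.tlift_hom[OF BG u G] BB.tlift_closed[OF G] BB.tlift_closed[OF BG] add_homD(1)[OF u])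
      (use h in simp_all)
  also have "\<dots> = tlift G (\<lambda>h1 h2. tlift G (\<lambda>l r. tlift G (\<lambda>l' r'. tlift3 G g (ptensor3 Be l (be r l') r')) (tau h2)) (tau h1)) (comul h)"
    by (intro HH.tlift_cong[OF G] BB.tlift_cong[OF G] BB.tlift_hom[OF BG u G] BB.tlift_closed[OF G] add_homD(1)[OF u])
      (use h in simp_all)
  also have "\<dots> = tlift G (\<lambda>h1 h2. tlift G (\<lambda>l r. tlift G (\<lambda>l' r'. g l (be r l') r') (tau h2)) (tau h1)) (comul h)"
    by (intro HH.tlift_cong[OF G] BB.tlift_cong[OF G] BB.tlift_closed[OF G])
      (use h gc in \<open>simp_all add: tlift3_pure[of Be, OF _ G g]\<close>)
  finally show "tlift3 G g (kappa h) = tlift G (\<lambda>h1 h2. tlift G (\<lambda>l r. tlift G (\<lambda>l' r'. g l (be r l') r') (tau h2)) (tau h1)) (comul h)" .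
qed

abbreviation "BGB_incl \<equiv> tlift3 BBB (\<lambda>x t y. ptensor3 Be x t y)"

text \<open>
  The preimage is \<open>\<Sum> l(h) \<otimes>\<^sub>A phi(r(h) \<otimes> 1)\<close>: its image is \<open>\<Sum> l(h) \<otimes>\<^sub>A sigma(r(h))\<close>, and this is \<open>\<kappa>(h)\<close> by
  \<open>tau_sum_coact_right\<close>.
\<close>

lemma kappa_in_image:
  assumes h: "h \<in> carrier H"
  shows "kappa h \<in> BGB_incl ` carrier (BEB Gamma)"
proof
  let ?G = "BEB Gamma" and ?p = "ptensor3 Gamma" and ?q = "ptensor3 Be"
  note GG = BGB_group and BG = BBB_group
  have p: "balanced3 Gamma ?G ?p" by (rule ptensor3_balanced) simp
  have q: "balanced3 Be BBB ?q" by (rule ptensor3_balanced) simp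
  note q' = balanced3_Gamma[OF q]
  note J = tlift3_hom[of Gamma, OF _ BG q', simplified]
  let ?w = "tlift ?G (\<lambda>l r. tlift ?G (?p l) (phi (be r \<one>\<^bsub>B\<^esub>))) (tau h)"
  have pc: "?p x t y \<in> carrier ?G" if "x \<in> carrier B" "t \<in> carrier Gamma" "y \<in> carrier B" for x t y
    using balanced3D(1)[OF p] that by simp
  show "?w \<in> carrier ?G"
    by (rule BB.tlift_closed[OF GG]) (use h in \<open>simp_all add: phi_sum_closed[OF GG p]\<close>)
  have q1: "balanced A (env_right Be) (left_reg B) BBB (?q l)" if "l \<in> carrier B" for l
    by (rule balancedI) (use that balanced3D[OF q] in simp_all)
  have F: "A_balanced BBB (\<lambda>l' r'. ?q l (be r l') r')" if "l \<in> carrier B" "r \<in> carrier B" for l r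
  proof (rule A_balancedI)
    fix a x y assume *: "a \<in> carrier A" "x \<in> carrier B" "y \<in> carrier B"
    have "be r (x \<otimes>\<^bsub>B\<^esub> a) = be \<one>\<^bsub>B\<^esub> a \<otimes>\<^bsub>Be\<^esub> be r x" using * that by (simp add: be_mult)
    then show "?q l (be r (x \<otimes>\<^bsub>B\<^esub> a)) y = ?q l (be r x) (a \<otimes>\<^bsub>B\<^esub> y)"
      using * that balanced3D(6)[OF q] by simp
  qed (use that balanced3D(3,4)[OF q] in \<open>simp_all add: be_add\<close>)
  let ?f = "\<lambda>l r k. tlift BBB (\<lambda>l' r'. ?q l (be r l') r') (tau k)"
  have "A_balanced BBB (\<lambda>l r. ?f l r k)" if k: "k \<in> carrier H" for k
  proof (rule A_balancedI)
    fix a x y assume *: "a \<in> carrier A" "x \<in> carrier B" "y \<in> carrier B"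
    show "?f (x \<otimes>\<^bsub>B\<^esub> a) y k = ?f x (a \<otimes>\<^bsub>B\<^esub> y) k"
      by (rule BB.tlift_cong[OF BG]) (use * k balanced3D(5)[OF q] in \<open>simp_all add: be_mult\<close>)
  next
    fix x x' y assume *: "x \<in> carrier B" "x' \<in> carrier B" "y \<in> carrier B"
    show "?f (x \<oplus>\<^bsub>B\<^esub> x') y k = ?f x y k \<oplus>\<^bsub>BBB\<^esub> ?f x' y k"
      by (rule BB.tlift_split[OF BG]) (use * k balanced3D(2)[OF q] in simp_all)
  next
    fix x x' y assume *: "x \<in> carrier B" "x' \<in> carrier B" "y \<in> carrier B"
    show "?f y (x \<oplus>\<^bsub>B\<^esub> x') k = ?f y x k \<oplus>\<^bsub>BBB\<^esub> ?f y x' k"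
      by (rule BB.tlift_split[OF BG]) (use * k balanced3D(3)[OF q] in \<open>simp_all add: be_add\<close>)
  qed (use k in \<open>auto intro!: BB.tlift_closed[OF BG]\<close>)
  moreover have "balanced K B H BBB (?f l)" if l: "l \<in> carrier B" for l
    by (rule tau_param_balanced[OF BG BK F[OF l]])
      (use l balanced3D(3)[OF q] in \<open>simp_all add: be_add be_smult\<close>)
  ultimately have f: "trilinear BBB ?f" by (simp add: trilinear_def)
  have "BGB_incl ?w = tlift BBB (\<lambda>l r. BGB_incl (tlift ?G (?p l) (phi (be r \<one>\<^bsub>B\<^esub>)))) (tau h)"
    by (rule BB.tlift_hom[OF GG J BG]) (use h in \<open>simp_all add: phi_sum_closed[OF GG p]\<close>)
  also have "\<dots> = tlift BBB (\<lambda>l r. tlift BBB (?f l) (coact r)) (tau h)"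
  proof (rule BB.tlift_cong[OF BG])
    fix l r assume "l \<in> carrier (right_reg B)" "r \<in> carrier (left_reg B)"
    then have *: "l \<in> carrier B" "r \<in> carrier B" by simp_all
    have "BGB_incl (tlift ?G (?p l) (phi (be r \<one>\<^bsub>B\<^esub>))) = tlift BBB (\<lambda>t y. BGB_incl (?p l t y)) (phi (be r \<one>\<^bsub>B\<^esub>))"
      by (rule GB.tlift_hom[OF GG J BG]) (use * pc in simp_all)
    also have "\<dots> = tlift BBB (?q l) (phi (be r \<one>\<^bsub>B\<^esub>))"
      by (rule GB.tlift_cong[OF BG]) (use * in \<open>simp_all add: tlift3_pure[of Gamma, OF _ BG q']\<close>)
    also have "\<dots> = tlift BBB (?f l) (coact r)"
      unfolding phi_sum_sigma[OF BG q1[OF *(1)] *(2)] by (rule sigma_sum[OF BG q1[OF *(1)] *(2)])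
    finally show "BGB_incl (tlift ?G (?p l) (phi (be r \<one>\<^bsub>B\<^esub>))) = tlift BBB (?f l) (coact r)" .
  next
    fix l r assume "l \<in> carrier (right_reg B)" "r \<in> carrier (left_reg B)"
    then show "tlift BBB (?f l) (coact r) \<in> carrier BBB"
      by (intro BH.tlift_closed[OF BG] BB.tlift_closed[OF BG]) simp_all
  qed (use h in simp)
  also have "\<dots> = kappa h"
    unfolding kappa_def by (rule tau_sum_coact_right[OF BG f h])
  finally show "kappa h = BGB_incl ?w" by simp
qed

lemma kappa_Gamma_closed [simp]: "h \<in> carrier H \<Longrightarrow> kappa_Gamma h \<in> carrier (BEB Gamma)"
  unfolding kappa_Gamma_def by (rule inv_into_into[OF kappa_in_image])

lemma BGB_incl_kappa_Gamma: "h \<in> carrier H \<Longrightarrow> BGB_incl (kappa_Gamma h) = kappa h"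
  unfolding kappa_Gamma_def by (rule f_inv_into_f[OF kappa_in_image])

context
  fixes G :: "('g, 'w) ring_scheme"
  assumes G: "abelian_group G"
begin

text \<open>
  The extension of \<open>g\<close> turns the sum into one over \<open>\<kappa>(h)\<close>, where the two inner factors combine to
  \<open>l(h\<^sub>2) r(h\<^sub>2) = \<epsilon>(h\<^sub>2) 1\<close> and the counit removes \<open>h\<^sub>2\<close>.
\<close>

lemma kappa_Gamma_sum:
  assumes g: "balanced3 Gamma G g" and h: "h \<in> carrier H"
  shows "tlift3 G g (kappa_Gamma h) = tlift G (\<lambda>l r. tlift G (g l) (phi (be r \<one>\<^bsub>B\<^esub>))) (tau h)"
proof -
  interpret G: abelian_group G by (rule G)
  let ?g = "\<lambda>x m y. tlift G (g x) (phi (be \<one>\<^bsub>B\<^esub> y \<otimes>\<^bsub>Be\<^esub> m))"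
  have g': "balanced3 Be G ?g" by (rule balanced3_extend[OF G g])
  have q: "balanced3 Be BBB (ptensor3 Be)" by (rule ptensor3_balanced) simp
  note J = tlift3_hom[of Gamma, OF _ BBB_group balanced3_Gamma[OF q], simplified]
  note u = tlift3_hom[of Be, OF _ G g', simplified]
  note pc = phi_sum_closed[OF G g]
  have "tlift3 G g w = tlift3 G ?g (BGB_incl w)" if "w \<in> carrier (BEB Gamma)" for w
  proof (rule BEB_ext[of Gamma, OF _ G tlift3_hom[of Gamma, OF _ G g] _ _ that])
    show "add_hom (BEB Gamma) G (\<lambda>w. tlift3 G ?g (BGB_incl w))"
      using u J by (simp add: add_hom_def)
    fix x t y assume "x \<in> carrier B" "t \<in> carrier Gamma" "y \<in> carrier B"
    then show "tlift3 G g (ptensor3 Gamma x t y) = tlift3 G ?g (BGB_incl (ptensor3 Gamma x t y))"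
      by (simp add: tlift3_pure[of Gamma, OF _ G g] tlift3_pure[of Gamma, OF _ BBB_group balanced3_Gamma[OF q]]
          tlift3_pure[of Be, OF _ G g'] phi_sum_pure[OF G balanced3_Gamma_balanced[OF G g]])
  qed simp_all
  then have "tlift3 G g (kappa_Gamma h) = tlift3 G ?g (kappa h)"
    using h by (simp add: BGB_incl_kappa_Gamma)
  also have "\<dots> = tlift G (\<lambda>h1 h2. tlift G (\<lambda>l r. tlift G (\<lambda>l' r'. ?g l (be r l') r') (tau h2)) (tau h1)) (comul h)"
    by (rule kappa_sum(2)[OF G g' h])
  also have "\<dots> = tlift G (\<lambda>h1 h2. tlift G (\<lambda>l r. tlift G (g l) (phi (be r \<one>\<^bsub>B\<^esub>))) (tau (counit h2 \<odot>\<^bsub>H\<^esub> h1))) (comul h)"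
  proof (rule HH.tlift_cong[OF G])
    fix h1 h2 assume *: "h1 \<in> carrier H" "h2 \<in> carrier H"
    let ?c = "counit h2"
    note fA = phi_sum_A_balanced[OF G g B.X.one_closed]
    have "tlift G (\<lambda>l r. tlift G (\<lambda>l' r'. ?g l (be r l') r') (tau h2)) (tau h1)
        = tlift G (\<lambda>l r. tlift G (g (?c \<odot>\<^bsub>B\<^esub> l)) (phi (be r \<one>\<^bsub>B\<^esub>))) (tau h1)"
    proof (rule BB.tlift_cong[OF G])
      fix l r assume "l \<in> carrier (right_reg B)" "r \<in> carrier (left_reg B)"
      then have lr: "l \<in> carrier B" "r \<in> carrier B" by simp_all
      have "tlift G (\<lambda>l' r'. ?g l (be r l') r') (tau h2) = tlift G (\<lambda>l' r'. tlift G (g l) (phi (be r (l' \<otimes>\<^bsub>B\<^esub> r')))) (tau h2)"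
        by (rule BB.tlift_cong[OF G]) (use lr * in \<open>simp_all add: be_mult pc\<close>)
      also have "\<dots> = tlift G (g l) (phi (be r (?c \<odot>\<^bsub>B\<^esub> \<one>\<^bsub>B\<^esub>)))"
        by (rule tau_sum_product[OF G]) (use lr * in \<open>simp_all add: add_hom_def be_add pc phi_sum_add_right[OF G g]\<close>)
      also have "be r (?c \<odot>\<^bsub>B\<^esub> \<one>\<^bsub>B\<^esub>) = be (?c \<odot>\<^bsub>B\<^esub> r) \<one>\<^bsub>B\<^esub>"
        using lr * by (simp add: be_smult)
      also have "tlift G (g l) (phi (be (?c \<odot>\<^bsub>B\<^esub> r) \<one>\<^bsub>B\<^esub>)) = tlift G (g (?c \<odot>\<^bsub>B\<^esub> l)) (phi (be r \<one>\<^bsub>B\<^esub>))"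
        using A_balancedD(5)[OF fA, of ?c l r] lr * by simp
      finally show "tlift G (\<lambda>l' r'. ?g l (be r l') r') (tau h2) = tlift G (g (?c \<odot>\<^bsub>B\<^esub> l)) (phi (be r \<one>\<^bsub>B\<^esub>))" .
    qed (use * in \<open>simp_all add: pc\<close>)
    also have "\<dots> = tlift G (\<lambda>l r. tlift G (g l) (phi (be r \<one>\<^bsub>B\<^esub>))) (tau (?c \<odot>\<^bsub>H\<^esub> h1))"
      by (rule tau_sum_smult[OF G fA, symmetric]) (use * in simp_all)
    finally show "tlift G (\<lambda>l r. tlift G (\<lambda>l' r'. ?g l (be r l') r') (tau h2)) (tau h1)
      = tlift G (\<lambda>l r. tlift G (g l) (phi (be r \<one>\<^bsub>B\<^esub>))) (tau (?c \<odot>\<^bsub>H\<^esub> h1))" .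
  next
    fix h1 h2 assume *: "h1 \<in> carrier H" "h2 \<in> carrier H"
    show "tlift G (\<lambda>l r. tlift G (g l) (phi (be r \<one>\<^bsub>B\<^esub>))) (tau (counit h2 \<odot>\<^bsub>H\<^esub> h1)) \<in> carrier G"
      by (rule BB.tlift_closed[OF G]) (use * in \<open>simp_all add: pc\<close>)
  qed (use h in simp)
  also have "\<dots> = tlift G (\<lambda>l r. tlift G (g l) (phi (be r \<one>\<^bsub>B\<^esub>))) (tau h)"
  proof (rule comul_sum_counit[OF G _ h])
    note fA = phi_sum_A_balanced[OF G g B.X.one_closed]
    show "add_hom H G (\<lambda>h. tlift G (\<lambda>l r. tlift G (g l) (phi (be r \<one>\<^bsub>B\<^esub>))) (tau h))"
      by (simp add: add_hom_def tau_sum_add[OF G fA] tau_sum_closed[OF G fA])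
  qed
  finally show ?thesis .
qed

text \<open>
  \<open>a \<kappa>(h) a' = \<kappa>(h) (a \<otimes> a')\<close>. By \<open>kappa_Gamma_sum\<close> the two sides are sums over \<open>\<Sum> a l(h) \<otimes>\<^sub>A (r(h) \<otimes>
  a')\<close> and \<open>\<Sum> l(h) \<otimes>\<^sub>A (r(h) a \<otimes> a')\<close>, so \<open>tau_sum_central\<close> applies.
\<close>

lemma kappa_Gamma_central:
  assumes g: "balanced3 Gamma G g" and h: "h \<in> carrier H" and a: "a \<in> carrier A" "a' \<in> carrier A"
  shows "tlift3 G (\<lambda>x t y. g (a \<otimes>\<^bsub>B\<^esub> x) t (y \<otimes>\<^bsub>B\<^esub> a')) (kappa_Gamma h)
       = tlift3 G (\<lambda>x t y. g x (t \<otimes>\<^bsub>Be\<^esub> be a a') y) (kappa_Gamma h)"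
proof -
  note gD = balanced3D[OF g]
  have aB: "a \<in> carrier B" "a' \<in> carrier B" using a by simp_all
  have g1: "balanced3 Gamma G (\<lambda>x t y. g (a \<otimes>\<^bsub>B\<^esub> x) t (y \<otimes>\<^bsub>B\<^esub> a'))"
  proof (rule balanced3I)
    fix x t y c assume *: "x \<in> carrier B" "t \<in> carrier Gamma" "y \<in> carrier B" "c \<in> carrier A"
    have "g (a \<otimes>\<^bsub>B\<^esub> x \<otimes>\<^bsub>B\<^esub> c) t (y \<otimes>\<^bsub>B\<^esub> a') = g (a \<otimes>\<^bsub>B\<^esub> x) (be c \<one>\<^bsub>B\<^esub> \<otimes>\<^bsub>Be\<^esub> t) (y \<otimes>\<^bsub>B\<^esub> a')"
      by (rule gD(5)) (use * aB in simp_all)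
    then show "g (a \<otimes>\<^bsub>B\<^esub> (x \<otimes>\<^bsub>B\<^esub> c)) t (y \<otimes>\<^bsub>B\<^esub> a') = g (a \<otimes>\<^bsub>B\<^esub> x) (be c \<one>\<^bsub>B\<^esub> \<otimes>\<^bsub>Be\<^esub> t) (y \<otimes>\<^bsub>B\<^esub> a')"
      using * aB by (simp add: B.X.m_assoc)
    have "g (a \<otimes>\<^bsub>B\<^esub> x) (be \<one>\<^bsub>B\<^esub> c \<otimes>\<^bsub>Be\<^esub> t) (y \<otimes>\<^bsub>B\<^esub> a') = g (a \<otimes>\<^bsub>B\<^esub> x) t (c \<otimes>\<^bsub>B\<^esub> (y \<otimes>\<^bsub>B\<^esub> a'))"
      by (rule gD(6)) (use * aB in simp_all)
    then show "g (a \<otimes>\<^bsub>B\<^esub> x) (be \<one>\<^bsub>B\<^esub> c \<otimes>\<^bsub>Be\<^esub> t) (y \<otimes>\<^bsub>B\<^esub> a') = g (a \<otimes>\<^bsub>B\<^esub> x) t (c \<otimes>\<^bsub>B\<^esub> y \<otimes>\<^bsub>B\<^esub> a')"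
      using * aB by (simp add: B.X.m_assoc)
  qed (use aB in \<open>simp_all add: gD(1-4) B.X.r_distr B.X.l_distr\<close>)
  have g2: "balanced3 Gamma G (\<lambda>x t y. g x (t \<otimes>\<^bsub>Be\<^esub> be a a') y)"
    by (rule balanced3I)
      (use a in \<open>simp_all add: gD(1-4) Be_distrib, simp_all add: Be_assoc gD(5,6)\<close>)
  have "tlift3 G (\<lambda>x t y. g (a \<otimes>\<^bsub>B\<^esub> x) t (y \<otimes>\<^bsub>B\<^esub> a')) (kappa_Gamma h)
      = tlift G (\<lambda>l r. tlift G (g (a \<otimes>\<^bsub>B\<^esub> l)) (phi (be r a'))) (tau h)"
    unfolding kappa_Gamma_sum[OF g1 h]
  proof (rule BB.tlift_cong[OF G])
    fix l r assume "l \<in> carrier (right_reg B)" "r \<in> carrier (left_reg B)"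
    then have *: "l \<in> carrier B" "r \<in> carrier B" "a \<otimes>\<^bsub>B\<^esub> l \<in> carrier B" using aB by simp_all
    have "tlift G (\<lambda>t y. g (a \<otimes>\<^bsub>B\<^esub> l) t (y \<otimes>\<^bsub>B\<^esub> a')) (phi (be r \<one>\<^bsub>B\<^esub>))
        = tlift G (g (a \<otimes>\<^bsub>B\<^esub> l)) (phi (be \<one>\<^bsub>B\<^esub> a' \<otimes>\<^bsub>Be\<^esub> be r \<one>\<^bsub>B\<^esub>))"
      by (rule phi_sum_eqI[OF G balanced3_Gamma_balanced[OF G g1] balanced3_Gamma_balanced[OF G g] mult_left_hom])
        (use * aB in \<open>simp_all add: be_right_assoc phi_sum_pure[OF G balanced3_Gamma_balanced[OF G g]]\<close>)
    then show "tlift G (\<lambda>t y. g (a \<otimes>\<^bsub>B\<^esub> l) t (y \<otimes>\<^bsub>B\<^esub> a')) (phi (be r \<one>\<^bsub>B\<^esub>)) = tlift G (g (a \<otimes>\<^bsub>B\<^esub> l)) (phi (be r a'))"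
      using * aB by (simp add: be_mult)
  qed (use h aB in \<open>simp_all add: phi_sum_closed[OF G g]\<close>)
  also have "\<dots> = tlift G (\<lambda>l r. tlift G (g l) (phi (be (r \<otimes>\<^bsub>B\<^esub> a) a'))) (tau h)"
    by (rule tau_sum_central[OF G phi_sum_A_balanced[OF G g aB(2)] a(1) h])
  also have "\<dots> = tlift3 G (\<lambda>x t y. g x (t \<otimes>\<^bsub>Be\<^esub> be a a') y) (kappa_Gamma h)"
    unfolding kappa_Gamma_sum[OF g2 h]
  proof (rule BB.tlift_cong[OF G])
    fix l r assume "l \<in> carrier (right_reg B)" "r \<in> carrier (left_reg B)"
    then have *: "l \<in> carrier B" "r \<in> carrier B" by simp_all
    have "tlift G (\<lambda>t y. g l (t \<otimes>\<^bsub>Be\<^esub> be a a') y) (phi (be r \<one>\<^bsub>B\<^esub>))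
        = tlift G (g l) (phi (be r \<one>\<^bsub>B\<^esub> \<otimes>\<^bsub>Be\<^esub> be a a'))"
      by (rule phi_sum_eqI[OF G balanced3_Gamma_balanced[OF G g2] balanced3_Gamma_balanced[OF G g] mult_right_hom])
        (use * aB a in \<open>simp_all add: Be_assoc phi_sum_pure[OF G balanced3_Gamma_balanced[OF G g]]\<close>)
    then show "tlift G (g l) (phi (be (r \<otimes>\<^bsub>B\<^esub> a) a')) = tlift G (\<lambda>t y. g l (t \<otimes>\<^bsub>Be\<^esub> be a a') y) (phi (be r \<one>\<^bsub>B\<^esub>))"
      using * aB by (simp add: be_mult)
  qed (use h in \<open>simp_all add: phi_sum_closed[OF G g2]\<close>)
  finally show ?thesis .
qed

end

end

section \<open>Spaces of homomorphisms\<close>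

lemma Hom_mod_simps [simp]:
  "f \<in> carrier (Hom_mod R M N sc) \<longleftrightarrow> is_hom R M N f \<and> f \<in> extensional (carrier M)"
  "f \<oplus>\<^bsub>Hom_mod R M N sc\<^esub> g = (\<lambda>x\<in>carrier M. f x \<oplus>\<^bsub>N\<^esub> g x)"
  "\<zero>\<^bsub>Hom_mod R M N sc\<^esub> = (\<lambda>x\<in>carrier M. \<zero>\<^bsub>N\<^esub>)"
  "c \<odot>\<^bsub>Hom_mod R M N sc\<^esub> f = (\<lambda>x\<in>carrier M. sc c (f x))"
  by (simp_all add: Hom_mod_def)

text \<open>
  The elements of \<open>R\<close> act on \<open>N\<close> by additive maps that commute with the ground field. In this form the
  lemma applies to Hom spaces into \<open>Hom_Ae_H M N\<close> as well as into \<open>N\<close> itself.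
\<close>

lemma Hom_mod_module:
  assumes M: "acted R M" and N: "acted R N"
    and radd: "\<And>r n n'. r \<in> carrier R \<Longrightarrow> n \<in> carrier N \<Longrightarrow> n' \<in> carrier N \<Longrightarrow>
        r \<odot>\<^bsub>N\<^esub> (n \<oplus>\<^bsub>N\<^esub> n') = r \<odot>\<^bsub>N\<^esub> n \<oplus>\<^bsub>N\<^esub> r \<odot>\<^bsub>N\<^esub> n'"
    and sc: "module K (mk_module N sc)"
    and comm: "\<And>r c n. r \<in> carrier R \<Longrightarrow> c \<in> carrier K \<Longrightarrow> n \<in> carrier N \<Longrightarrow>
        r \<odot>\<^bsub>N\<^esub> sc c n = sc c (r \<odot>\<^bsub>N\<^esub> n)"
  shows "module K (Hom_mod R M N sc)"
proof -
  interpret M: abelian_group M using M by (simp add: acted_def)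
  interpret N: abelian_group N using N by (simp add: acted_def)
  interpret S: module K "mk_module N sc" by (rule sc)
  note MD = actedD(2)[OF M] and ND = actedD(2)[OF N]
  have rh: "add_hom N N (\<lambda>n. r \<odot>\<^bsub>N\<^esub> n)" if "r \<in> carrier R" for r
    using that ND radd by (simp add: add_hom_def)
  note rz = add_hom_zero[OF rh N.abelian_group_axioms N.abelian_group_axioms]
    and rm = add_hom_minus[OF rh N.abelian_group_axioms N.abelian_group_axioms]
  let ?Hm = "Hom_mod R M N sc"
  note SS = S.smult_closed S.smult_l_distr S.smult_r_distr S.smult_assoc1 S.smult_one
  have ext: "f = g" if "f \<in> extensional (carrier M)" "g \<in> extensional (carrier M)"
      "\<And>x. x \<in> carrier M \<Longrightarrow> f x = g x" for f g
    using that by (rule extensionalityI)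
  have ag: "abelian_group ?Hm"
  proof (rule abelian_groupI)
    fix f assume "f \<in> carrier ?Hm"
    then have f: "is_hom R M N f" "f \<in> extensional (carrier M)" by simp_all
    note fD = is_homD[OF f(1)]
    show "\<exists>g\<in>carrier ?Hm. g \<oplus>\<^bsub>?Hm\<^esub> f = \<zero>\<^bsub>?Hm\<^esub>"
    proof (rule bexI[of _ "\<lambda>x\<in>carrier M. \<ominus>\<^bsub>N\<^esub> f x"])
      show "(\<lambda>x\<in>carrier M. \<ominus>\<^bsub>N\<^esub> f x) \<oplus>\<^bsub>?Hm\<^esub> f = \<zero>\<^bsub>?Hm\<^esub>"
        by (intro ext) (simp_all add: fD N.l_neg)
      show "(\<lambda>x\<in>carrier M. \<ominus>\<^bsub>N\<^esub> f x) \<in> carrier ?Hm"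
        by (simp, intro is_homI) (simp_all add: fD MD N.minus_add rm)
    qed
  next
    fix f g assume "f \<in> carrier ?Hm" "g \<in> carrier ?Hm"
    then have f: "is_hom R M N f" "is_hom R M N g" by simp_all
    note fD = is_homD[OF f(1)] and gD = is_homD[OF f(2)]
    show "f \<oplus>\<^bsub>?Hm\<^esub> g \<in> carrier ?Hm"
      by (simp, intro is_homI) (simp_all add: fD gD MD radd N.a_ac)
    show "f \<oplus>\<^bsub>?Hm\<^esub> g = g \<oplus>\<^bsub>?Hm\<^esub> f"
      by (intro ext) (simp_all add: fD gD N.a_comm)
  next
    fix f g h assume "f \<in> carrier ?Hm" "g \<in> carrier ?Hm" "h \<in> carrier ?Hm"
    then show "f \<oplus>\<^bsub>?Hm\<^esub> g \<oplus>\<^bsub>?Hm\<^esub> h = f \<oplus>\<^bsub>?Hm\<^esub> (g \<oplus>\<^bsub>?Hm\<^esub> h)"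
      by (intro ext) (simp_all add: is_homD(1)[of R M N] N.a_assoc)
  next
    fix f assume "f \<in> carrier ?Hm"
    then show "\<zero>\<^bsub>?Hm\<^esub> \<oplus>\<^bsub>?Hm\<^esub> f = f"
      by (intro ext) (simp_all add: is_homD(1)[of R M N])
  next
    show "\<zero>\<^bsub>?Hm\<^esub> \<in> carrier ?Hm"
      by (simp, intro is_homI) (simp_all add: MD rz)
  qed
  show ?thesis
  proof (rule moduleI[OF module.axioms(1)[OF sc] ag])
    fix c f assume *: "c \<in> carrier K" "f \<in> carrier ?Hm"
    then have f: "is_hom R M N f" by simp
    note fD = is_homD[OF f]
    show "c \<odot>\<^bsub>?Hm\<^esub> f \<in> carrier ?Hm"
      by (simp, intro is_homI)
        (use * SS in \<open>simp_all add: fD MD comm\<close>)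
  next
    fix c d f assume *: "c \<in> carrier K" "d \<in> carrier K" "f \<in> carrier ?Hm"
    show "(c \<oplus>\<^bsub>K\<^esub> d) \<odot>\<^bsub>?Hm\<^esub> f = c \<odot>\<^bsub>?Hm\<^esub> f \<oplus>\<^bsub>?Hm\<^esub> d \<odot>\<^bsub>?Hm\<^esub> f"
      by (intro ext) (use * SS in \<open>simp_all add: is_homD(1)[of R M N]\<close>)
    show "(c \<otimes>\<^bsub>K\<^esub> d) \<odot>\<^bsub>?Hm\<^esub> f = c \<odot>\<^bsub>?Hm\<^esub> (d \<odot>\<^bsub>?Hm\<^esub> f)"
      by (intro ext) (use * SS in \<open>simp_all add: is_homD(1)[of R M N]\<close>)
  next
    fix c f g assume *: "c \<in> carrier K" "f \<in> carrier ?Hm" "g \<in> carrier ?Hm"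
    show "c \<odot>\<^bsub>?Hm\<^esub> (f \<oplus>\<^bsub>?Hm\<^esub> g) = c \<odot>\<^bsub>?Hm\<^esub> f \<oplus>\<^bsub>?Hm\<^esub> c \<odot>\<^bsub>?Hm\<^esub> g"
      by (intro ext) (use * SS in \<open>simp_all add: is_homD(1)[of R M N]\<close>)
  next
    fix f assume *: "f \<in> carrier ?Hm"
    show "\<one>\<^bsub>K\<^esub> \<odot>\<^bsub>?Hm\<^esub> f = f"
      by (intro ext) (use * SS in \<open>simp_all add: is_homD(1)[of R M N]\<close>)
  qed
qed

section \<open>The functors \<open>Hom\<^bsub>A\<^sup>e\<^esub>(M,N)\<close> and \<open>B\<^sup>e \<otimes>\<^bsub>A\<^sup>e\<^esub> M\<close>\<close>

locale galois_bimodule = galois_env K H comul counit antipode B coact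
  for K :: "'k ring" and H :: "('k, 'h) module" and comul :: "'h \<Rightarrow> ('h, 'h) tensors"
    and counit :: "'h \<Rightarrow> 'k" and antipode :: "'h \<Rightarrow> 'h"
    and B :: "('k, 'b) module" and coact :: "'b \<Rightarrow> ('b, 'h) tensors" +
  fixes N :: "('b, 'n) bimodule"
  assumes N: "bimodule K B N"
begin

subsection \<open>The \<open>B\<^sup>e\<close>-module of a bimodule\<close>

lemma N_group: "abelian_group N"
  using N by (simp add: bimodule_def)

sublocale NG: abelian_group N by (rule N_group)

lemma N_left: "left_module B (mk_module N (lact N))"
  and N_right: "right_module B (mk_module N (\<lambda>b n. ract N n b))"
  using N by (auto simp: bimodule_def bimodule_axioms_def)

lemma lact_simps:
  assumes "b \<in> carrier B" "n \<in> carrier N"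
  shows "lact N b n \<in> carrier N"
    and "\<And>b'. b' \<in> carrier B \<Longrightarrow> lact N (b \<oplus>\<^bsub>B\<^esub> b') n = lact N b n \<oplus>\<^bsub>N\<^esub> lact N b' n"
    and "\<And>n'. n' \<in> carrier N \<Longrightarrow> lact N b (n \<oplus>\<^bsub>N\<^esub> n') = lact N b n \<oplus>\<^bsub>N\<^esub> lact N b n'"
    and "\<And>b'. b' \<in> carrier B \<Longrightarrow> lact N (b \<otimes>\<^bsub>B\<^esub> b') n = lact N b (lact N b' n)"
  using left_module.lm_smult_closed[OF N_left, of b n] left_module.lm_smult_l_distr[OF N_left, of b _ n]
    left_module.lm_smult_r_distr[OF N_left, of b n] left_module.lm_smult_assoc[OF N_left, of b _ n] assms
  by simp_all

lemma ract_simps: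
  assumes "b \<in> carrier B" "n \<in> carrier N"
  shows "ract N n b \<in> carrier N"
    and "\<And>b'. b' \<in> carrier B \<Longrightarrow> ract N n (b \<oplus>\<^bsub>B\<^esub> b') = ract N n b \<oplus>\<^bsub>N\<^esub> ract N n b'"
    and "\<And>n'. n' \<in> carrier N \<Longrightarrow> ract N (n \<oplus>\<^bsub>N\<^esub> n') b = ract N n b \<oplus>\<^bsub>N\<^esub> ract N n' b"
    and "\<And>b'. b' \<in> carrier B \<Longrightarrow> ract N n (b \<otimes>\<^bsub>B\<^esub> b') = ract N (ract N n b) b'"
  using left_module.lm_smult_closed[OF N_right, of b n] left_module.lm_smult_l_distr[OF N_right, of b _ n]
    left_module.lm_smult_r_distr[OF N_right, of b n] left_module.lm_smult_assoc[OF N_right, of _ b n] assms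
  by simp_all

lemma N_one [simp]: "n \<in> carrier N \<Longrightarrow> lact N \<one>\<^bsub>B\<^esub> n = n" "n \<in> carrier N \<Longrightarrow> ract N n \<one>\<^bsub>B\<^esub> = n"
  using left_module.lm_smult_one[OF N_left, of n] left_module.lm_smult_one[OF N_right, of n] by simp_all

lemma lact_ract: "b \<in> carrier B \<Longrightarrow> n \<in> carrier N \<Longrightarrow> b' \<in> carrier B \<Longrightarrow>
    ract N (lact N b n) b' = lact N b (ract N n b')"
  and N_central: "c \<in> carrier K \<Longrightarrow> n \<in> carrier N \<Longrightarrow>
    ract N n (c \<odot>\<^bsub>B\<^esub> \<one>\<^bsub>B\<^esub>) = lact N (c \<odot>\<^bsub>B\<^esub> \<one>\<^bsub>B\<^esub>) n"
  using N by (auto simp: bimodule_def bimodule_axioms_def)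

lemmas N_simps = lact_simps ract_simps lact_ract

abbreviation act :: "('b, 'b) tensors \<Rightarrow> 'n \<Rightarrow> 'n" where
  "act s n \<equiv> s \<odot>\<^bsub>env_module N\<^esub> n"

lemma env_module_simps [simp]: "carrier (env_module N) = carrier N" "add (env_module N) = add N"
  "zero (env_module N) = zero N"
  by (simp_all add: env_module_def)

lemma act_def: "act s n = tlift N (\<lambda>b b'. lact N b (ract N n b')) s"
  by (simp add: env_module_def)

lemma lact_scalar:
  assumes "c \<in> carrier K" "b \<in> carrier B" "n \<in> carrier N"
  shows "lact N (c \<odot>\<^bsub>B\<^esub> b) n = lact N b (lact N (c \<odot>\<^bsub>B\<^esub> \<one>\<^bsub>B\<^esub>) n)"
    and "lact N (c \<odot>\<^bsub>B\<^esub> b) n = lact N (c \<odot>\<^bsub>B\<^esub> \<one>\<^bsub>B\<^esub>) (lact N b n)"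
    and "ract N n (c \<odot>\<^bsub>B\<^esub> b) = lact N (c \<odot>\<^bsub>B\<^esub> \<one>\<^bsub>B\<^esub>) (ract N n b)"
proof -
  show "lact N (c \<odot>\<^bsub>B\<^esub> b) n = lact N b (lact N (c \<odot>\<^bsub>B\<^esub> \<one>\<^bsub>B\<^esub>) n)"
    using assms lact_simps(4)[of b n "c \<odot>\<^bsub>B\<^esub> \<one>\<^bsub>B\<^esub>"] by (simp add: scalar_mult)
  show "lact N (c \<odot>\<^bsub>B\<^esub> b) n = lact N (c \<odot>\<^bsub>B\<^esub> \<one>\<^bsub>B\<^esub>) (lact N b n)"
    using assms lact_simps(4)[of "c \<odot>\<^bsub>B\<^esub> \<one>\<^bsub>B\<^esub>" n b] by (simp add: scalar_mult)
  show "ract N n (c \<odot>\<^bsub>B\<^esub> b) = lact N (c \<odot>\<^bsub>B\<^esub> \<one>\<^bsub>B\<^esub>) (ract N n b)"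
    using assms ract_simps(4)[of b n "c \<odot>\<^bsub>B\<^esub> \<one>\<^bsub>B\<^esub>"]
    by (simp add: scalar_mult N_central ract_simps)
qed

lemma act_balanced:
  assumes n: "n \<in> carrier N"
  shows "balanced K B (op_ring B) N (\<lambda>b b'. lact N b (ract N n b'))"
proof (rule balancedI)
  fix c b b' assume "c \<in> carrier K" "b \<in> carrier B" "b' \<in> carrier (op_ring B)"
  then show "lact N (c \<odot>\<^bsub>B\<^esub> b) (ract N n b') = lact N b (ract N n (c \<odot>\<^bsub>op_ring B\<^esub> b'))"
    using n lact_scalar(1)[of c b "ract N n b'"] lact_scalar(3)[of c b' n] by (simp add: ract_simps)
qed (use n in \<open>simp_all add: N_simps(1-3) ract_simps\<close>)

lemma act_be: "b \<in> carrier B \<Longrightarrow> b' \<in> carrier B \<Longrightarrow> n \<in> carrier N \<Longrightarrow>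
    act (be b b') n = lact N b (ract N n b')"
  unfolding act_def by (rule EE.tlift_ptensor[OF N_group act_balanced]) simp_all

lemma act_closed [simp]: "s \<in> carrier Bt \<Longrightarrow> n \<in> carrier N \<Longrightarrow> act s n \<in> carrier N"
  unfolding act_def by (rule EE.tlift_closed[OF N_group]) (simp_all add: N_simps(1) ract_simps)

lemma act_add_left: "s \<in> carrier Bt \<Longrightarrow> t \<in> carrier Bt \<Longrightarrow> n \<in> carrier N \<Longrightarrow>
    act (s \<oplus>\<^bsub>Bt\<^esub> t) n = act s n \<oplus>\<^bsub>N\<^esub> act t n"
  unfolding act_def by (rule EE.tlift_add[OF N_group act_balanced])

lemma act_add_right: "s \<in> carrier Bt \<Longrightarrow> n \<in> carrier N \<Longrightarrow> n' \<in> carrier N \<Longrightarrow>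
    act s (n \<oplus>\<^bsub>N\<^esub> n') = act s n \<oplus>\<^bsub>N\<^esub> act s n'"
  unfolding act_def by (rule EE.tlift_split[OF N_group]) (simp_all add: lact_simps ract_simps)

lemma act_hom: "s \<in> carrier Bt \<Longrightarrow> add_hom N N (act s)"
  by (simp add: add_hom_def act_add_right)

lemma act_assoc:
  assumes "s \<in> carrier Bt" "t \<in> carrier Bt" "n \<in> carrier N"
  shows "act (s \<otimes>\<^bsub>Be\<^esub> t) n = act s (act t n)"
  using assms(1)
proof (induction s rule: EE.tensor_induct)
  case (pure b b')
  then have b: "b \<in> carrier B" "b' \<in> carrier B" by simp_all
  show ?case using assms(2)
  proof (induction t rule: EE.tensor_induct)
    case (pure x y)
    then show ?case using b assms(3) by (simp add: be_mult act_be lact_simps ract_simps lact_ract)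
  next
    case (add s t)
    then show ?case using b assms(3) by (simp add: Be_distrib act_add_left act_add_right)
  qed
next
  case (add s s')
  then show ?case using assms(2,3) by (simp add: Be_distrib act_add_left)
qed

lemma act_one: "n \<in> carrier N \<Longrightarrow> act (be \<one>\<^bsub>B\<^esub> \<one>\<^bsub>B\<^esub>) n = n"
  by (simp add: act_be lact_simps ract_simps)

lemma scale_N_module: "module K (mk_module N (scale_N N))"
proof (rule moduleI[OF module.axioms(1)[OF B_module]])
  show "abelian_group (mk_module N (scale_N N))" by (simp add: N_group)
  fix c d n assume *: "c \<in> carrier K" "d \<in> carrier K" "n \<in> carrier (mk_module N (scale_N N))"
  have "(c \<otimes>\<^bsub>K\<^esub> d) \<odot>\<^bsub>B\<^esub> \<one>\<^bsub>B\<^esub> = c \<odot>\<^bsub>B\<^esub> (d \<odot>\<^bsub>B\<^esub> \<one>\<^bsub>B\<^esub>)"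
    using * by (simp add: B.smult_assoc1)
  then show "(c \<otimes>\<^bsub>K\<^esub> d) \<odot>\<^bsub>mk_module N (scale_N N)\<^esub> n
      = c \<odot>\<^bsub>mk_module N (scale_N N)\<^esub> (d \<odot>\<^bsub>mk_module N (scale_N N)\<^esub> n)"
    using * lact_scalar(2)[of c "d \<odot>\<^bsub>B\<^esub> \<one>\<^bsub>B\<^esub>" n] by (simp add: scale_N_def)
  show "(c \<oplus>\<^bsub>K\<^esub> d) \<odot>\<^bsub>mk_module N (scale_N N)\<^esub> n
      = c \<odot>\<^bsub>mk_module N (scale_N N)\<^esub> n \<oplus>\<^bsub>mk_module N (scale_N N)\<^esub> d \<odot>\<^bsub>mk_module N (scale_N N)\<^esub> n"
    using * by (simp add: scale_N_def B.smult_l_distr lact_simps)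
qed (simp_all add: scale_N_def lact_simps)

lemma scale_N_closed [simp]: "c \<in> carrier K \<Longrightarrow> n \<in> carrier N \<Longrightarrow> scale_N N c n \<in> carrier N"
  by (simp add: scale_N_def lact_simps)

lemma scale_N_hom: "c \<in> carrier K \<Longrightarrow> add_hom N N (scale_N N c)"
  by (simp add: add_hom_def scale_N_def lact_simps)

lemma act_scale:
  assumes "s \<in> carrier Bt" "c \<in> carrier K" "n \<in> carrier N"
  shows "act s (scale_N N c n) = scale_N N c (act s n)"
  using assms(1)
proof (induction s rule: EE.tensor_induct)
  case (pure b b')
  then have "lact N b (lact N (c \<odot>\<^bsub>B\<^esub> \<one>\<^bsub>B\<^esub>) (ract N n b')) = lact N (c \<odot>\<^bsub>B\<^esub> \<one>\<^bsub>B\<^esub>) (lact N b (ract N n b'))"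
    using assms lact_scalar(1,2)[of c b "ract N n b'"] by (simp add: ract_simps)
  then show ?case using pure assms by (simp add: act_be scale_N_def lact_simps lact_ract)
next
  case (add s t)
  then show ?case using assms add_homD(2)[OF scale_N_hom] by (simp add: act_add_left)
qed

subsection \<open>Restriction along \<open>A\<^sup>e \<rightarrow> \<Gamma>\<close>\<close>

lemma A_acted: "acted K A"
proof -
  have "c \<odot>\<^bsub>B\<^esub> a \<in> carrier A" if "c \<in> carrier K" "a \<in> carrier A" for c a
    using A_mult_closed[OF scalar_in_A[OF that(1)] that(2)] that by (simp add: scalar_mult)
  then show ?thesis using ring.is_abelian_group[OF A_ring] by (simp add: acted_def)
qed

lemma Aop_acted: "acted K (op_ring A)"
  using A_acted by (auto simp: acted_def intro: abelian_group_transfer)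

sublocale AA: tensor_data K A "op_ring A"
  by (rule tensor_data.intro[OF A_acted Aop_acted])

lemma Ae_simps [simp]: "carrier Ae = carrier (tensor K A (op_ring A))" "add Ae = add (tensor K A (op_ring A))"
  by (simp_all add: env_def)

abbreviation ae :: "'b \<Rightarrow> 'b \<Rightarrow> ('b, 'b) tensors" where
  "ae \<equiv> ptensor K A (op_ring A)"

lemma incl_balanced: "balanced K A (op_ring A) Be be"
  by (rule balancedI) (simp_all add: be_add be_smult)

lemma incl_hom: "add_hom (tensor K A (op_ring A)) Be incl_e"
  unfolding incl_e_def by (rule AA.tlift_add_hom[OF Be_group incl_balanced])

lemma incl_ae [simp]: "a \<in> carrier A \<Longrightarrow> a' \<in> carrier A \<Longrightarrow> incl_e (ae a a') = be a a'"
  unfolding incl_e_def by (rule AA.tlift_ptensor[OF Be_group incl_balanced]) simp_all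

lemma incl_in_Gamma [simp]:
  assumes "c \<in> carrier (tensor K A (op_ring A))"
  shows "incl_e c \<in> carrier Gamma"
  using assms
proof (induction c rule: AA.tensor_induct)
  case (add s t)
  then show ?case using add_homD(2)[OF incl_hom] by simp
qed simp

lemma incl_in_Be [simp]: "c \<in> carrier (tensor K A (op_ring A)) \<Longrightarrow> incl_e c \<in> carrier Bt"
  by (rule Gamma_in_Be[OF incl_in_Gamma])

lemma restr_simps [simp]: "carrier (restr X) = carrier X" "add (restr X) = add X" "zero (restr X) = zero X"
  "c \<odot>\<^bsub>restr X\<^esub> m = incl_e c \<odot>\<^bsub>X\<^esub> m"
  by (simp_all add: restr_def)

lemma restr_env_acted: "acted Ae (restr (env_module N))"
  by (auto simp: acted_def intro!: abelian_group_transfer[OF N_group])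

lemma Be_right_e_acted: "acted Ae Be_right"
  by (auto simp: acted_def intro!: abelian_group_transfer[OF Be_group])

end

locale galois_module = galois_bimodule K H comul counit antipode B coact N
  for K :: "'k ring" and H :: "('k, 'h) module" and comul :: "'h \<Rightarrow> ('h, 'h) tensors"
    and counit :: "'h \<Rightarrow> 'k" and antipode :: "'h \<Rightarrow> 'h"
    and B :: "('k, 'b) module" and coact :: "'b \<Rightarrow> ('b, 'h) tensors"
    and N :: "('b, 'n) bimodule" +
  fixes M :: "(('b, 'b) tensors, 'm) module"
  assumes M: "left_module Gamma M"
begin

sublocale MG: abelian_group M using M by (simp add: left_module_def)

lemma M_simps:
  assumes "s \<in> carrier Gamma" "m \<in> carrier M"
  shows "s \<odot>\<^bsub>M\<^esub> m \<in> carrier M"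
    and "\<And>s'. s' \<in> carrier Gamma \<Longrightarrow> (s \<oplus>\<^bsub>Bt\<^esub> s') \<odot>\<^bsub>M\<^esub> m = s \<odot>\<^bsub>M\<^esub> m \<oplus>\<^bsub>M\<^esub> s' \<odot>\<^bsub>M\<^esub> m"
    and "\<And>m'. m' \<in> carrier M \<Longrightarrow> s \<odot>\<^bsub>M\<^esub> (m \<oplus>\<^bsub>M\<^esub> m') = s \<odot>\<^bsub>M\<^esub> m \<oplus>\<^bsub>M\<^esub> s \<odot>\<^bsub>M\<^esub> m'"
    and "\<And>s'. s' \<in> carrier Gamma \<Longrightarrow> (s \<otimes>\<^bsub>Be\<^esub> s') \<odot>\<^bsub>M\<^esub> m = s \<odot>\<^bsub>M\<^esub> (s' \<odot>\<^bsub>M\<^esub> m)"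
  using left_module.lm_smult_closed[OF M, of s m] left_module.lm_smult_l_distr[OF M, of s _ m]
    left_module.lm_smult_r_distr[OF M, of s m] left_module.lm_smult_assoc[OF M, of s _ m] assms by simp_all

lemma restr_acted: "acted Ae (restr M)"
  by (auto simp: acted_def M_simps intro!: abelian_group_transfer[OF MG.abelian_group_axioms])

subsection \<open>The action on \<open>Hom\<^bsub>A\<^sup>e\<^esub>(M,N)\<close>\<close>

lemma Hom_Ae_iff: "f \<in> carrier (Hom_Ae M N) \<longleftrightarrow> f \<in> extensional (carrier M)
    \<and> (\<forall>m\<in>carrier M. f m \<in> carrier N)
    \<and> (\<forall>m\<in>carrier M. \<forall>m'\<in>carrier M. f (m \<oplus>\<^bsub>M\<^esub> m') = f m \<oplus>\<^bsub>N\<^esub> f m')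
    \<and> (\<forall>c\<in>carrier (tensor K A (op_ring A)). \<forall>m\<in>carrier M. f (incl_e c \<odot>\<^bsub>M\<^esub> m) = act (incl_e c) (f m))"
  by (auto simp: Hom_Ae_def is_hom_def)

lemma Hom_AeD:
  assumes "f \<in> carrier (Hom_Ae M N)"
  shows "f \<in> extensional (carrier M)" "\<And>m. m \<in> carrier M \<Longrightarrow> f m \<in> carrier N"
    and "\<And>m m'. m \<in> carrier M \<Longrightarrow> m' \<in> carrier M \<Longrightarrow> f (m \<oplus>\<^bsub>M\<^esub> m') = f m \<oplus>\<^bsub>N\<^esub> f m'"
    and "\<And>c m. c \<in> carrier (tensor K A (op_ring A)) \<Longrightarrow> m \<in> carrier M \<Longrightarrow> f (incl_e c \<odot>\<^bsub>M\<^esub> m) = act (incl_e c) (f m)"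
    and "\<And>a a' m. a \<in> carrier A \<Longrightarrow> a' \<in> carrier A \<Longrightarrow> m \<in> carrier M \<Longrightarrow>
        f (be a a' \<odot>\<^bsub>M\<^esub> m) = act (be a a') (f m)"
proof -
  show "\<And>a a' m. a \<in> carrier A \<Longrightarrow> a' \<in> carrier A \<Longrightarrow> m \<in> carrier M \<Longrightarrow>
        f (be a a' \<odot>\<^bsub>M\<^esub> m) = act (be a a') (f m)"
    using assms AA.ptensor_closed unfolding Hom_Ae_iff by (metis incl_ae op_ring_simps(1))
qed (use assms in \<open>simp_all add: Hom_Ae_iff\<close>)

lemma Hom_Ae_module: "module K (Hom_Ae M N)"
  unfolding Hom_Ae_def
  by (rule Hom_mod_module[OF restr_acted restr_env_acted])
    (simp_all add: act_add_right act_scale, use scale_N_module in \<open>simp add: mk_module_def restr_def env_module_def\<close>)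

lemma Hom_Ae_H_simps [simp]: "carrier (Hom_Ae_H M N) = carrier (Hom_Ae M N)"
  "add (Hom_Ae_H M N) = add (Hom_Ae M N)" "zero (Hom_Ae_H M N) = zero (Hom_Ae M N)"
  by (simp_all add: Hom_Ae_H_def)

lemma Hom_Ae_add: "m \<in> carrier M \<Longrightarrow> (f \<oplus>\<^bsub>Hom_Ae M N\<^esub> g) m = f m \<oplus>\<^bsub>N\<^esub> g m"
  by (simp add: Hom_Ae_def)

text \<open>
  The summand \<open>x f(t m) y\<close> of the action of \<open>H\<close> on a homomorphism \<open>f\<close>.
\<close>

definition sandwich :: "('m \<Rightarrow> 'n) \<Rightarrow> 'm \<Rightarrow> 'b \<Rightarrow> ('b, 'b) tensors \<Rightarrow> 'b \<Rightarrow> 'n" where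
  "sandwich f m x t y = act (be x y) (f (t \<odot>\<^bsub>M\<^esub> m))"

lemma sandwich_balanced:
  assumes f: "f \<in> carrier (Hom_Ae M N)" and m: "m \<in> carrier M"
  shows "balanced3 Gamma N (sandwich f m)"
proof (rule balanced3I)
  note fD = Hom_AeD[OF f]
  fix x t y a assume *: "x \<in> carrier B" "t \<in> carrier Gamma" "y \<in> carrier B" "a \<in> carrier A"
  then have n: "f (t \<odot>\<^bsub>M\<^esub> m) \<in> carrier N" using m fD(2) by (simp add: M_simps)
  show "sandwich f m (x \<otimes>\<^bsub>B\<^esub> a) t y = sandwich f m x (be a \<one>\<^bsub>B\<^esub> \<otimes>\<^bsub>Be\<^esub> t) y"
    using * m n by (simp add: sandwich_def M_simps fD(5) act_assoc[symmetric] be_mult)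
  show "sandwich f m x (be \<one>\<^bsub>B\<^esub> a \<otimes>\<^bsub>Be\<^esub> t) y = sandwich f m x t (a \<otimes>\<^bsub>B\<^esub> y)"
    using * m n by (simp add: sandwich_def M_simps fD(5) act_assoc[symmetric] be_mult)
qed (use m Hom_AeD[OF f] in \<open>simp_all add: sandwich_def M_simps be_add act_add_left act_add_right\<close>)

lemma Hom_Ae_H_smult:
  assumes f: "f \<in> carrier (Hom_Ae M N)" and h: "h \<in> carrier H" and m: "m \<in> carrier M"
  shows "(h \<odot>\<^bsub>Hom_Ae_H M N\<^esub> f) m = tlift3 N (sandwich f m) (kappa_Gamma h)"
proof -
  have "tlift3 N (\<lambda>x t y. ract N (lact N x (f (t \<odot>\<^bsub>M\<^esub> m))) y) (kappa_Gamma h)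
      = tlift3 N (sandwich f m) (kappa_Gamma h)"
    by (rule tlift3_cong[of Gamma, OF _ N_group])
      (use f h m Hom_AeD(2)[OF f] in \<open>simp_all add: sandwich_def act_be lact_ract M_simps lact_simps(1) ract_simps(1)\<close>)
  then show ?thesis using m by (simp add: Hom_Ae_H_def)
qed

text \<open>
  The action of \<open>h\<close> preserves \<open>A\<^sup>e\<close>-linearity because \<open>a \<kappa>(h) a' = \<kappa>(h) (a \<otimes> a')\<close>.
\<close>

lemma Hom_Ae_H_closed:
  assumes f: "f \<in> carrier (Hom_Ae M N)" and h: "h \<in> carrier H"
  shows "h \<odot>\<^bsub>Hom_Ae_H M N\<^esub> f \<in> carrier (Hom_Ae M N)"
proof -
  note fD = Hom_AeD[OF f]
  let ?f = "h \<odot>\<^bsub>Hom_Ae_H M N\<^esub> f"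
  note fs = Hom_Ae_H_smult[OF f h]
  note sc = balanced3D(1)[OF sandwich_balanced[OF f]]
  have cl: "?f m \<in> carrier N" if "m \<in> carrier M" for m
    unfolding fs[OF that] by (rule tlift3_closed[of Gamma, OF _ N_group]) (use h that sc in simp_all)
  have add: "?f (m \<oplus>\<^bsub>M\<^esub> m') = ?f m \<oplus>\<^bsub>N\<^esub> ?f m'" if "m \<in> carrier M" "m' \<in> carrier M" for m m'
    unfolding fs[OF that(1)] fs[OF that(2)] fs[OF MG.a_closed[OF that]]
    by (rule tlift3_split[of Gamma, OF _ N_group])
      (use h that sc fD in \<open>simp_all add: sandwich_def M_simps act_add_right\<close>)
  have lin: "?f (incl_e c \<odot>\<^bsub>M\<^esub> m) = act (incl_e c) (?f m)" if c: "c \<in> carrier (tensor K A (op_ring A))" and m: "m \<in> carrier M" for c m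
    using c
  proof (induction c rule: AA.tensor_induct)
    case (pure a a')
    then have a: "a \<in> carrier A" "a' \<in> carrier A" by simp_all
    have "?f (be a a' \<odot>\<^bsub>M\<^esub> m) = tlift3 N (\<lambda>x t y. sandwich f m x (t \<otimes>\<^bsub>Be\<^esub> be a a') y) (kappa_Gamma h)"
      using a m by (subst fs) (simp_all add: M_simps,
        intro tlift3_cong[of Gamma, OF _ N_group], use h fD in \<open>simp_all add: sandwich_def M_simps\<close>)
    also have "\<dots> = tlift3 N (\<lambda>x t y. sandwich f m (a \<otimes>\<^bsub>B\<^esub> x) t (y \<otimes>\<^bsub>B\<^esub> a')) (kappa_Gamma h)"
      by (rule kappa_Gamma_central[OF N_group sandwich_balanced[OF f m] h a, symmetric])
    also have "\<dots> = tlift3 N (\<lambda>x t y. act (be a a') (sandwich f m x t y)) (kappa_Gamma h)"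
      by (rule tlift3_cong[of Gamma, OF _ N_group])
        (use a m h sc fD in \<open>simp_all add: sandwich_def M_simps act_assoc[symmetric] be_mult\<close>)
    also have "\<dots> = act (be a a') (?f m)"
      unfolding fs[OF m]
      by (rule tlift3_comp_hom[of Gamma, OF _ N_group act_hom N_group, symmetric]) (use a m h sc in simp_all)
    finally show ?case using a by simp
  next
    case (add s t)
    then show ?case using m cl \<open>\<And>m' m. m \<in> carrier M \<Longrightarrow> m' \<in> carrier M \<Longrightarrow> ?f (m \<oplus>\<^bsub>M\<^esub> m') = ?f m \<oplus>\<^bsub>N\<^esub> ?f m'\<close>
      by (simp add: add_homD(2)[OF incl_hom] M_simps act_add_left)
  qed
  have "?f \<in> extensional (carrier M)" by (simp add: Hom_Ae_H_def)
  then show ?thesis using cl add lin by (simp add: Hom_Ae_iff)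
qed

lemma Hom_Ae_H_acted: "acted (op_ring H) (Hom_Ae_H M N)"
  using Hom_Ae_H_closed module.axioms(2)[OF Hom_Ae_module]
  by (auto simp: acted_def intro: abelian_group_transfer)

lemma Hom_Ae_closed:
  "f \<in> carrier (Hom_Ae M N) \<Longrightarrow> g \<in> carrier (Hom_Ae M N) \<Longrightarrow> f \<oplus>\<^bsub>Hom_Ae M N\<^esub> g \<in> carrier (Hom_Ae M N)"
  "c \<in> carrier K \<Longrightarrow> f \<in> carrier (Hom_Ae M N) \<Longrightarrow> c \<odot>\<^bsub>Hom_Ae M N\<^esub> f \<in> carrier (Hom_Ae M N)"
  using abelian_groupE(1)[OF module.axioms(2)[OF Hom_Ae_module]] module.smult_closed[OF Hom_Ae_module] by auto

lemma Hom_Ae_H_add: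
  assumes f: "f \<in> carrier (Hom_Ae M N)" "g \<in> carrier (Hom_Ae M N)" and h: "h \<in> carrier H"
  shows "h \<odot>\<^bsub>Hom_Ae_H M N\<^esub> (f \<oplus>\<^bsub>Hom_Ae M N\<^esub> g) = h \<odot>\<^bsub>Hom_Ae_H M N\<^esub> f \<oplus>\<^bsub>Hom_Ae M N\<^esub> h \<odot>\<^bsub>Hom_Ae_H M N\<^esub> g"
proof (rule extensionalityI[of _ "carrier M"])
  fix m assume m: "m \<in> carrier M"
  note fg = Hom_Ae_closed(1)[OF f]
  have "(h \<odot>\<^bsub>Hom_Ae_H M N\<^esub> (f \<oplus>\<^bsub>Hom_Ae M N\<^esub> g)) m = (h \<odot>\<^bsub>Hom_Ae_H M N\<^esub> f) m \<oplus>\<^bsub>N\<^esub> (h \<odot>\<^bsub>Hom_Ae_H M N\<^esub> g) m"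
    unfolding Hom_Ae_H_smult[OF f(1) h m] Hom_Ae_H_smult[OF f(2) h m] Hom_Ae_H_smult[OF fg h m]
    by (rule tlift3_split[of Gamma, OF _ N_group])
      (use f h m Hom_AeD(2)[OF f(1)] Hom_AeD(2)[OF f(2)] in \<open>simp_all add: sandwich_def M_simps Hom_Ae_add act_add_right\<close>)
  then show "(h \<odot>\<^bsub>Hom_Ae_H M N\<^esub> (f \<oplus>\<^bsub>Hom_Ae M N\<^esub> g)) m
     = (h \<odot>\<^bsub>Hom_Ae_H M N\<^esub> f \<oplus>\<^bsub>Hom_Ae M N\<^esub> h \<odot>\<^bsub>Hom_Ae_H M N\<^esub> g) m"
    using m by (simp add: Hom_Ae_add)
qed (simp_all add: Hom_Ae_H_def, simp add: Hom_Ae_def)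

lemma Hom_Ae_smult: "m \<in> carrier M \<Longrightarrow> (c \<odot>\<^bsub>Hom_Ae M N\<^esub> f) m = scale_N N c (f m)"
  by (simp add: Hom_Ae_def)

lemma Hom_Ae_H_scale:
  assumes f: "f \<in> carrier (Hom_Ae M N)" and c: "c \<in> carrier K" and h: "h \<in> carrier H"
  shows "h \<odot>\<^bsub>Hom_Ae_H M N\<^esub> (c \<odot>\<^bsub>Hom_Ae M N\<^esub> f) = c \<odot>\<^bsub>Hom_Ae M N\<^esub> (h \<odot>\<^bsub>Hom_Ae_H M N\<^esub> f)"
proof (rule extensionalityI[of _ "carrier M"])
  fix m assume m: "m \<in> carrier M"
  note cf = Hom_Ae_closed(2)[OF c f]
  note sc = balanced3D(1)[OF sandwich_balanced[OF f]]
  have "(h \<odot>\<^bsub>Hom_Ae_H M N\<^esub> (c \<odot>\<^bsub>Hom_Ae M N\<^esub> f)) m = tlift3 N (\<lambda>x t y. scale_N N c (sandwich f m x t y)) (kappa_Gamma h)"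
    unfolding Hom_Ae_H_smult[OF cf h m]
    by (rule tlift3_cong[of Gamma, OF _ N_group])
      (use f c h m sc Hom_AeD(2)[OF f] in \<open>simp_all add: sandwich_def M_simps Hom_Ae_smult act_scale\<close>)
  also have "\<dots> = scale_N N c ((h \<odot>\<^bsub>Hom_Ae_H M N\<^esub> f) m)"
    unfolding Hom_Ae_H_smult[OF f h m]
    by (rule tlift3_comp_hom[of Gamma, OF _ N_group scale_N_hom N_group, symmetric]) (use c h m sc in simp_all)
  finally show "(h \<odot>\<^bsub>Hom_Ae_H M N\<^esub> (c \<odot>\<^bsub>Hom_Ae M N\<^esub> f)) m = (c \<odot>\<^bsub>Hom_Ae M N\<^esub> (h \<odot>\<^bsub>Hom_Ae_H M N\<^esub> f)) m"
    using m by (simp add: Hom_Ae_smult)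
qed (simp_all add: Hom_Ae_H_def, simp add: Hom_Ae_def)

subsection \<open>The actions on \<open>B\<^sup>e \<otimes>\<^bsub>A\<^sup>e\<^esub> M\<close>\<close>

sublocale TI: tensor_data Ae Be_right "restr M"
  by (rule tensor_data.intro[OF Be_right_e_acted restr_acted])

abbreviation "It \<equiv> tensor Ae Be_right (restr M)"
abbreviation "it \<equiv> ptensor Ae Be_right (restr M)"

lemma It_group: "abelian_group It" by (rule TI.abelian_group_tensor)

lemma it_closed [simp]: "s \<in> carrier Bt \<Longrightarrow> m \<in> carrier M \<Longrightarrow> it s m \<in> carrier It"
  using TI.ptensor_closed by simp

lemma it_simps:
  "s \<in> carrier Bt \<Longrightarrow> s' \<in> carrier Bt \<Longrightarrow> m \<in> carrier M \<Longrightarrow> it (s \<oplus>\<^bsub>Bt\<^esub> s') m = it s m \<oplus>\<^bsub>It\<^esub> it s' m"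
  "s \<in> carrier Bt \<Longrightarrow> m \<in> carrier M \<Longrightarrow> m' \<in> carrier M \<Longrightarrow> it s (m \<oplus>\<^bsub>M\<^esub> m') = it s m \<oplus>\<^bsub>It\<^esub> it s m'"
  "c \<in> carrier (tensor K A (op_ring A)) \<Longrightarrow> s \<in> carrier Bt \<Longrightarrow> m \<in> carrier M \<Longrightarrow>
     it (s \<otimes>\<^bsub>Be\<^esub> incl_e c) m = it s (incl_e c \<odot>\<^bsub>M\<^esub> m)"
  using TI.ptensor_add_left[of s s' m] TI.ptensor_add_right[of s m m'] TI.ptensor_smult[of c s m] by simp_all

lemma it_be:
  "a \<in> carrier A \<Longrightarrow> a' \<in> carrier A \<Longrightarrow> s \<in> carrier Bt \<Longrightarrow> m \<in> carrier M \<Longrightarrow>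
     it s (be a a' \<odot>\<^bsub>M\<^esub> m) = it (s \<otimes>\<^bsub>Be\<^esub> be a a') m"
  using it_simps(3)[of "ae a a'" s m] AA.ptensor_closed[of a a'] by simp

lemma Ind_simps [simp]: "carrier (Ind M) = carrier It" "add (Ind M) = add It" "zero (Ind M) = zero It"
  "carrier (Ind_H M) = carrier It" "add (Ind_H M) = add It" "zero (Ind_H M) = zero It"
  by (simp_all add: Ind_def Ind_H_def Let_def)

lemma Ind_smult: "c \<odot>\<^bsub>Ind M\<^esub> v = tlift It (\<lambda>t m. it (c \<otimes>\<^bsub>Be\<^esub> t) m) v"
  by (simp add: Ind_def Let_def)

lemma Ind_balanced:
  assumes "c \<in> carrier Bt"
  shows "balanced Ae Be_right (restr M) It (\<lambda>t m. it (c \<otimes>\<^bsub>Be\<^esub> t) m)"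
  by (rule balancedI)
    (use assms in \<open>simp_all add: Be_distrib it_simps Be_assoc[symmetric]\<close>)

lemma Ind_smult_hom: "c \<in> carrier Bt \<Longrightarrow> add_hom It It (\<lambda>v. c \<odot>\<^bsub>Ind M\<^esub> v)"
  unfolding Ind_smult by (rule TI.tlift_add_hom[OF It_group Ind_balanced])

lemma Ind_smult_it:
  "c \<in> carrier Bt \<Longrightarrow> s \<in> carrier Bt \<Longrightarrow> m \<in> carrier M \<Longrightarrow> c \<odot>\<^bsub>Ind M\<^esub> it s m = it (c \<otimes>\<^bsub>Be\<^esub> s) m"
  unfolding Ind_smult by (rule TI.tlift_ptensor[OF It_group Ind_balanced]) simp_all

text \<open>
  The summand \<open>(b x \<otimes> y b') \<otimes> t m\<close> of the action of \<open>H\<close> on \<open>(b \<otimes> b') \<otimes> m\<close>.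
\<close>

definition spread :: "'b \<Rightarrow> 'b \<Rightarrow> 'm \<Rightarrow> 'b \<Rightarrow> ('b, 'b) tensors \<Rightarrow> 'b \<Rightarrow> (('b, 'b) tensors, 'm) tensors" where
  "spread b b' m = (\<lambda>x t y. it (be (b \<otimes>\<^bsub>B\<^esub> x) (y \<otimes>\<^bsub>B\<^esub> b')) (t \<odot>\<^bsub>M\<^esub> m))"

lemma spread_balanced:
  assumes b: "b \<in> carrier B" "b' \<in> carrier B" and m: "m \<in> carrier M"
  shows "balanced3 Gamma It (spread b b' m)"
  by (rule balanced3I)
    (use b m in \<open>simp_all add: spread_def M_simps B.X.r_distr B.X.l_distr be_add it_simps(1,2) it_be be_mult B.X.m_assoc\<close>)

lemma Ind_H_smult: "h \<odot>\<^bsub>Ind_H M\<^esub> v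
    = tlift It (\<lambda>s m. tlift It (\<lambda>b b'. tlift3 It (spread b b' m) (kappa_Gamma h)) s) v"
  by (simp add: Ind_H_def Let_def spread_def)

context
  fixes h assumes h: "h \<in> carrier H"
begin

lemma spread_closed:
  "b \<in> carrier B \<Longrightarrow> b' \<in> carrier B \<Longrightarrow> m \<in> carrier M \<Longrightarrow>
    tlift3 It (spread b b' m) (kappa_Gamma h) \<in> carrier It"
  by (rule tlift3_closed[of Gamma, OF _ It_group]) (use h balanced3D(1)[OF spread_balanced] in simp_all)

lemma Ind_H_inner_balanced:
  assumes m: "m \<in> carrier M"
  shows "balanced K B (op_ring B) It (\<lambda>b b'. tlift3 It (spread b b' m) (kappa_Gamma h))"
proof (rule balancedI)
  note sc = balanced3D(1)[OF spread_balanced]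
  fix b c b' assume "b \<in> carrier B" "c \<in> carrier B" "b' \<in> carrier (op_ring B)"
  then show "tlift3 It (spread (b \<oplus>\<^bsub>B\<^esub> c) b' m) (kappa_Gamma h)
     = tlift3 It (spread b b' m) (kappa_Gamma h) \<oplus>\<^bsub>It\<^esub> tlift3 It (spread c b' m) (kappa_Gamma h)"
    by (intro tlift3_split[of Gamma, OF _ It_group])
      (use m h sc in \<open>simp_all add: spread_def M_simps B.X.l_distr be_add it_simps(1)\<close>)
next
  note sc = balanced3D(1)[OF spread_balanced]
  fix b b' c assume "b \<in> carrier B" "b' \<in> carrier (op_ring B)" "c \<in> carrier (op_ring B)"
  then show "tlift3 It (spread b (b' \<oplus>\<^bsub>op_ring B\<^esub> c) m) (kappa_Gamma h)
     = tlift3 It (spread b b' m) (kappa_Gamma h) \<oplus>\<^bsub>It\<^esub> tlift3 It (spread b c m) (kappa_Gamma h)"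
    by (intro tlift3_split[of Gamma, OF _ It_group])
      (use m h sc in \<open>simp_all add: spread_def M_simps B.X.r_distr be_add it_simps(1)\<close>)
next
  note sc = balanced3D(1)[OF spread_balanced]
  fix k b b' assume "k \<in> carrier K" "b \<in> carrier B" "b' \<in> carrier (op_ring B)"
  then show "tlift3 It (spread (k \<odot>\<^bsub>B\<^esub> b) b' m) (kappa_Gamma h)
     = tlift3 It (spread b (k \<odot>\<^bsub>op_ring B\<^esub> b') m) (kappa_Gamma h)"
    by (intro tlift3_cong[of Gamma, OF _ It_group])
      (use m h sc in \<open>simp_all add: spread_def M_simps B_scale_left B_scale_right be_smult\<close>)
qed (use m spread_closed in simp_all)

lemma Ind_H_smult_pure:
  "b \<in> carrier B \<Longrightarrow> b' \<in> carrier B \<Longrightarrow> m \<in> carrier M \<Longrightarrow>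
   tlift It (\<lambda>b b'. tlift3 It (spread b b' m) (kappa_Gamma h)) (be b b') = tlift3 It (spread b b' m) (kappa_Gamma h)"
  by (rule EE.tlift_ptensor[OF It_group Ind_H_inner_balanced]) simp_all

lemma spread_add:
  assumes "b \<in> carrier B" "b' \<in> carrier B" "m \<in> carrier M" "m' \<in> carrier M"
  shows "tlift3 It (spread b b' (m \<oplus>\<^bsub>M\<^esub> m')) (kappa_Gamma h)
     = tlift3 It (spread b b' m) (kappa_Gamma h) \<oplus>\<^bsub>It\<^esub> tlift3 It (spread b b' m') (kappa_Gamma h)"
  by (rule tlift3_split[of Gamma, OF _ It_group])
    (use assms h balanced3D(1)[OF spread_balanced] in \<open>simp_all add: spread_def M_simps it_simps(2)\<close>)

text \<open>
  Compatibility with the relations of the tensor product over \<open>A\<^sup>e\<close> is again the identity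
  \<open>a \<kappa>(h) a' = \<kappa>(h) (a \<otimes> a')\<close>.
\<close>

lemma Ind_H_balanced:
  "balanced Ae Be_right (restr M) It
     (\<lambda>s m. tlift It (\<lambda>b b'. tlift3 It (spread b b' m) (kappa_Gamma h)) s)"
    (is "balanced _ _ _ _ ?E")
proof -
  have Eh: "add_hom Bt It (\<lambda>s. ?E s m)" if "m \<in> carrier M" for m
    by (rule EE.tlift_add_hom[OF It_group Ind_H_inner_balanced[OF that]])
  have Em: "?E s (m \<oplus>\<^bsub>M\<^esub> m') = ?E s m \<oplus>\<^bsub>It\<^esub> ?E s m'"
    if "s \<in> carrier Bt" "m \<in> carrier M" "m' \<in> carrier M" for s m m'
    by (rule EE.tlift_split[OF It_group]) (use that in \<open>simp_all add: spread_closed spread_add\<close>)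
  have E: "?E (s \<otimes>\<^bsub>Be\<^esub> incl_e c) m = ?E s (incl_e c \<odot>\<^bsub>M\<^esub> m)"
    if c: "c \<in> carrier (tensor K A (op_ring A))" and s: "s \<in> carrier Bt" and m: "m \<in> carrier M" for c s m
    using c
  proof (induction c rule: AA.tensor_induct)
    case (pure a a')
    then have a: "a \<in> carrier A" "a' \<in> carrier A" by simp_all
    have "?E (s \<otimes>\<^bsub>Be\<^esub> be a a') m = ?E s (be a a' \<odot>\<^bsub>M\<^esub> m)"
      using s
    proof (induction s rule: EE.tensor_induct)
      case (pure b b')
      then have b: "b \<in> carrier B" "b' \<in> carrier B" by simp_all
      note sc = balanced3D(1)[OF spread_balanced]
      have "?E (be b b' \<otimes>\<^bsub>Be\<^esub> be a a') m = tlift3 It (spread (b \<otimes>\<^bsub>B\<^esub> a) (a' \<otimes>\<^bsub>B\<^esub> b') m) (kappa_Gamma h)"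
        using a b m by (simp add: be_mult Ind_H_smult_pure)
      also have "\<dots> = tlift3 It (\<lambda>x t y. spread b b' m (a \<otimes>\<^bsub>B\<^esub> x) t (y \<otimes>\<^bsub>B\<^esub> a')) (kappa_Gamma h)"
        by (rule tlift3_cong[of Gamma, OF _ It_group])
          (use a b m h sc in \<open>simp_all add: spread_def M_simps B.X.m_assoc\<close>)
      also have "\<dots> = tlift3 It (\<lambda>x t y. spread b b' m x (t \<otimes>\<^bsub>Be\<^esub> be a a') y) (kappa_Gamma h)"
        by (rule kappa_Gamma_central[OF It_group spread_balanced[OF b m] h a])
      also have "\<dots> = tlift3 It (spread b b' (be a a' \<odot>\<^bsub>M\<^esub> m)) (kappa_Gamma h)"
        by (rule tlift3_cong[of Gamma, OF _ It_group])
          (use a b m h in \<open>simp_all add: spread_def M_simps\<close>)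
      also have "\<dots> = ?E (be b b') (be a a' \<odot>\<^bsub>M\<^esub> m)"
        using a b m by (simp add: Ind_H_smult_pure M_simps)
      finally show ?case .
    next
      case (add s t)
      then show ?case using a m by (simp add: Be_distrib add_homD(2)[OF Eh] M_simps)
    qed
    then show ?case using a by simp
  next
    case (add c d)
    then show ?case using s m by (simp add: add_homD(2)[OF incl_hom] Be_distrib add_homD(2)[OF Eh] M_simps Em)
  qed
  show ?thesis
    by (rule balancedI) (use add_homD[OF Eh] Em E in simp_all)
qed

lemma Ind_H_smult_hom: "add_hom It It (\<lambda>v. h \<odot>\<^bsub>Ind_H M\<^esub> v)"
  unfolding Ind_H_smult by (rule TI.tlift_add_hom[OF It_group Ind_H_balanced])

lemma Ind_H_smult_it:
  assumes "b \<in> carrier B" "b' \<in> carrier B" "m \<in> carrier M"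
  shows "h \<odot>\<^bsub>Ind_H M\<^esub> it (be b b') m = tlift3 It (spread b b' m) (kappa_Gamma h)"
proof -
  have "h \<odot>\<^bsub>Ind_H M\<^esub> it (be b b') m = tlift It (\<lambda>b b'. tlift3 It (spread b b' m) (kappa_Gamma h)) (be b b')"
    unfolding Ind_H_smult by (rule TI.tlift_ptensor[OF It_group Ind_H_balanced]) (use assms in simp_all)
  then show ?thesis using assms by (simp add: Ind_H_smult_pure)
qed

end

lemma It_ext:
  assumes G: "abelian_group G" and u: "add_hom It G u" and v: "add_hom It G v"
    and eq: "\<And>b b' m. b \<in> carrier B \<Longrightarrow> b' \<in> carrier B \<Longrightarrow> m \<in> carrier M \<Longrightarrow> u (it (be b b') m) = v (it (be b b') m)"
    and w: "w \<in> carrier It"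
  shows "u w = v w"
proof (rule TI.tensor_ext[OF G u v _ w])
  fix s m assume "s \<in> carrier Be_right" "m \<in> carrier (restr M)"
  then have *: "s \<in> carrier Bt" "m \<in> carrier M" by simp_all
  show "u (it s m) = v (it s m)" using *(1)
  proof (induction s rule: EE.tensor_induct)
    case (pure b b')
    then show ?case using eq * by simp
  next
    case (add s t)
    then show ?case using * by (simp add: it_simps(1) add_homD(2)[OF u] add_homD(2)[OF v])
  qed
qed

text \<open>
  The two actions commute because \<open>B\<^sup>e\<close> multiplies the outer sides of \<open>b x\<close> and \<open>y b'\<close>, and \<open>\<kappa>(h)\<close> the
  inner ones.
\<close>

lemma Ind_H_commute:
  assumes h: "h \<in> carrier H" and c: "c \<in> carrier Bt" and v: "v \<in> carrier It"
  shows "h \<odot>\<^bsub>Ind_H M\<^esub> (c \<odot>\<^bsub>Ind M\<^esub> v) = c \<odot>\<^bsub>Ind M\<^esub> (h \<odot>\<^bsub>Ind_H M\<^esub> v)"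
  using c
proof (induction c rule: EE.tensor_induct)
  case (pure d d')
  then have d: "d \<in> carrier B" "d' \<in> carrier B" "be d d' \<in> carrier Bt" by simp_all
  note ch = Ind_smult_hom[OF d(3)] and hh = Ind_H_smult_hom[OF h]
  show ?case
  proof (rule It_ext[OF It_group _ _ _ v])
    show "add_hom It It (\<lambda>v. h \<odot>\<^bsub>Ind_H M\<^esub> (be d d' \<odot>\<^bsub>Ind M\<^esub> v))" "add_hom It It (\<lambda>v. be d d' \<odot>\<^bsub>Ind M\<^esub> (h \<odot>\<^bsub>Ind_H M\<^esub> v))"
      using ch hh by (simp_all add: add_hom_def)
    fix b b' m assume *: "b \<in> carrier B" "b' \<in> carrier B" "m \<in> carrier M"
    note sc = balanced3D(1)[OF spread_balanced[OF *]]
    have "be d d' \<odot>\<^bsub>Ind M\<^esub> (h \<odot>\<^bsub>Ind_H M\<^esub> it (be b b') m)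
       = tlift3 It (\<lambda>x t y. be d d' \<odot>\<^bsub>Ind M\<^esub> spread b b' m x t y) (kappa_Gamma h)"
      unfolding Ind_H_smult_it[OF h *]
      by (rule tlift3_comp_hom[of Gamma, OF _ It_group ch It_group]) (use h sc in simp_all)
    also have "\<dots> = tlift3 It (spread (d \<otimes>\<^bsub>B\<^esub> b) (b' \<otimes>\<^bsub>B\<^esub> d') m) (kappa_Gamma h)"
      by (rule tlift3_cong[of Gamma, OF _ It_group])
        (use d * h in \<open>simp_all add: spread_def M_simps Ind_smult_it be_mult B.X.m_assoc\<close>)
    also have "\<dots> = h \<odot>\<^bsub>Ind_H M\<^esub> (be d d' \<odot>\<^bsub>Ind M\<^esub> it (be b b') m)"
      using d * h by (simp add: Ind_smult_it be_mult Ind_H_smult_it)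
    finally show "h \<odot>\<^bsub>Ind_H M\<^esub> (be d d' \<odot>\<^bsub>Ind M\<^esub> it (be b b') m) = be d d' \<odot>\<^bsub>Ind M\<^esub> (h \<odot>\<^bsub>Ind_H M\<^esub> it (be b b') m)"
      by simp
  qed
next
  case (add s t)
  have sp: "(s \<oplus>\<^bsub>Bt\<^esub> t) \<odot>\<^bsub>Ind M\<^esub> v = s \<odot>\<^bsub>Ind M\<^esub> v \<oplus>\<^bsub>It\<^esub> t \<odot>\<^bsub>Ind M\<^esub> v" if "v \<in> carrier It" for v
    unfolding Ind_smult
    by (rule TI.tlift_split[OF It_group]) (use that add in \<open>simp_all add: Be_distrib it_simps(1)\<close>)
  show ?case
    using add v h sp[of v] sp[of "h \<odot>\<^bsub>Ind_H M\<^esub> v"] add_homD[OF Ind_H_smult_hom[OF h]] add_homD(1)[OF Ind_smult_hom]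
    by simp
qed

lemma Ind_H_acted: "acted H (Ind_H M)"
  using add_homD(1)[OF Ind_H_smult_hom]
  by (auto simp: acted_def intro: abelian_group_transfer[OF It_group])

subsection \<open>\<open>A\<^sup>e\<close>-linear maps extend to \<open>B\<^sup>e\<close>-linear ones\<close>

lemma extend_balanced:
  assumes f: "f \<in> carrier (Hom_Ae M N)"
  shows "balanced Ae Be_right (restr M) N (\<lambda>s m. act s (f m))"
  by (rule balancedI)
    (use Hom_AeD[OF f] in \<open>simp_all add: act_add_left act_add_right act_assoc\<close>)

lemma extend_it:
  assumes f: "f \<in> carrier (Hom_Ae M N)" and "s \<in> carrier Bt" "m \<in> carrier M"
  shows "tlift N (\<lambda>s m. act s (f m)) (it s m) = act s (f m)"
  by (rule TI.tlift_ptensor[OF N_group extend_balanced[OF f]]) (use assms in simp_all)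

lemma extend_hom: "f \<in> carrier (Hom_Ae M N) \<Longrightarrow> add_hom It N (tlift N (\<lambda>s m. act s (f m)))"
  by (rule TI.tlift_add_hom[OF N_group extend_balanced])

text \<open>
  The extension of \<open>f\<close> takes the summand \<open>spread b b' m x t y\<close> to \<open>b (x f(t m) y) b'\<close>, so acting with \<open>h\<close>
  on \<open>f\<close> or on the argument gives the same sum over \<open>\<kappa>(h)\<close>.
\<close>

lemma extend_H:
  assumes f: "f \<in> carrier (Hom_Ae M N)" and h: "h \<in> carrier H" and v: "v \<in> carrier It"
  shows "tlift N (\<lambda>s m. act s ((h \<odot>\<^bsub>Hom_Ae_H M N\<^esub> f) m)) v
       = tlift N (\<lambda>s m. act s (f m)) (h \<odot>\<^bsub>Ind_H M\<^esub> v)"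
proof -
  note fh = Hom_Ae_H_closed[OF f h]
  note fD = Hom_AeD[OF f]
  show ?thesis
  proof (rule It_ext[OF N_group extend_hom[OF fh] _ _ v])
    show "add_hom It N (\<lambda>v. tlift N (\<lambda>s m. act s (f m)) (h \<odot>\<^bsub>Ind_H M\<^esub> v))"
      using extend_hom[OF f] Ind_H_smult_hom[OF h] by (simp add: add_hom_def)
    fix b b' m assume *: "b \<in> carrier B" "b' \<in> carrier B" "m \<in> carrier M"
    note sc = balanced3D(1)[OF spread_balanced[OF *]]
    have "tlift N (\<lambda>s m. act s ((h \<odot>\<^bsub>Hom_Ae_H M N\<^esub> f) m)) (it (be b b') m)
        = act (be b b') (tlift3 N (sandwich f m) (kappa_Gamma h))"
      using * by (simp add: extend_it[OF fh] Hom_Ae_H_smult[OF f h])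
    also have "\<dots> = tlift3 N (\<lambda>x t y. act (be b b') (sandwich f m x t y)) (kappa_Gamma h)"
      by (rule tlift3_comp_hom[of Gamma, OF _ N_group act_hom N_group])
        (use * h balanced3D(1)[OF sandwich_balanced[OF f *(3)]] in simp_all)
    also have "\<dots> = tlift3 N (\<lambda>x t y. tlift N (\<lambda>s m. act s (f m)) (spread b b' m x t y)) (kappa_Gamma h)"
      by (rule tlift3_cong[of Gamma, OF _ N_group])
        (use * h fD(2) in \<open>simp_all add: spread_def sandwich_def extend_it[OF f] M_simps act_assoc[symmetric] be_mult\<close>)
    also have "\<dots> = tlift N (\<lambda>s m. act s (f m)) (tlift3 It (spread b b' m) (kappa_Gamma h))"
      by (rule tlift3_comp_hom[of Gamma, OF _ It_group extend_hom[OF f] N_group, symmetric]) (use h sc in simp_all)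
    also have "\<dots> = tlift N (\<lambda>s m. act s (f m)) (h \<odot>\<^bsub>Ind_H M\<^esub> it (be b b') m)"
      using * by (simp add: Ind_H_smult_it[OF h])
    finally show "tlift N (\<lambda>s m. act s ((h \<odot>\<^bsub>Hom_Ae_H M N\<^esub> f) m)) (it (be b b') m)
       = tlift N (\<lambda>s m. act s (f m)) (h \<odot>\<^bsub>Ind_H M\<^esub> it (be b b') m)" .
  qed
qed

end

section \<open>The adjunction\<close>

lemma is_hom_zero: "is_hom R M N f \<Longrightarrow> abelian_group M \<Longrightarrow> abelian_group N \<Longrightarrow> f \<zero>\<^bsub>M\<^esub> = \<zero>\<^bsub>N\<^esub>"
  by (rule add_hom_zero[OF is_hom_add_hom])

context galois_bimodule
begin

text \<open>
  The signs of the differentials as scalars of the ground field; linearity over the field then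
  takes care of them.
\<close>

definition sgn_K :: "nat \<Rightarrow> 'k" where
  "sgn_K n = (if even n then \<one>\<^bsub>K\<^esub> else \<ominus>\<^bsub>K\<^esub> \<one>\<^bsub>K\<^esub>)"

lemma K_cring: "cring K" by (rule module.axioms(1)[OF B_module])

lemma sgn_K_closed [simp]: "sgn_K n \<in> carrier K"
proof -
  interpret cring K by (rule K_cring)
  show ?thesis by (simp add: sgn_K_def)
qed

lemma signed_scale:
  assumes "n \<in> carrier N"
  shows "signed N k n = scale_N N (sgn_K k) n"
proof -
  interpret S: module K "mk_module N (scale_N N)" by (rule scale_N_module)
  show ?thesis
    using assms S.smult_one[of n] S.smult_l_minus[of "\<one>\<^bsub>K\<^esub>" n]
    by (simp add: signed_def sgn_K_def)
qed

lemma signed_closed [simp]: "n \<in> carrier N \<Longrightarrow> signed N k n \<in> carrier N"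
  by (simp add: signed_scale)

lemma signed_hom: "add_hom N N (signed N k)"
  by (simp add: add_hom_def signed_scale add_homD(2)[OF scale_N_hom])

lemma signed_act: "s \<in> carrier Bt \<Longrightarrow> n \<in> carrier N \<Longrightarrow> act s (signed N k n) = signed N k (act s n)"
  by (simp add: signed_scale act_scale)

lemma signed_zero [simp]: "signed N k \<zero>\<^bsub>N\<^esub> = \<zero>\<^bsub>N\<^esub>"
  by (rule add_hom_zero[OF signed_hom N_group N_group])

lemma signed_anticommute:
  assumes "n \<in> carrier N"
  shows "signed N (i + Suc j) (signed N j n) \<oplus>\<^bsub>N\<^esub> signed N j (signed N (i + j) n) = \<zero>\<^bsub>N\<^esub>"
  using assms by (auto simp: signed_def NG.l_neg NG.r_neg)

end

locale galois_pair = galois_module K H comul counit antipode B coact N M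
  for K :: "'k ring" and H :: "('k, 'h) module" and comul :: "'h \<Rightarrow> ('h, 'h) tensors"
    and counit :: "'h \<Rightarrow> 'k" and antipode :: "'h \<Rightarrow> 'h"
    and B :: "('k, 'b) module" and coact :: "'b \<Rightarrow> ('b, 'h) tensors"
    and N :: "('b, 'n) bimodule" and M :: "(('b, 'b) tensors, 'm) module" +
  fixes L :: "('h, 'l) module"
  assumes L: "right_module H L"
begin

lemma L_acted: "acted H L" by (rule right_module_acted[OF L])

lemmas L_group = actedD(1)[OF L_acted] and L_smult_closed [simp] = actedD(2)[OF L_acted]

sublocale LG: abelian_group L by (rule L_group)

sublocale W: tensor_data H L "Ind_H M"
  by (rule tensor_data.intro[OF L_acted Ind_H_acted])

abbreviation "Wt \<equiv> tensor H L (Ind_H M)"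
abbreviation "wt \<equiv> ptensor H L (Ind_H M)"

lemma W_group: "abelian_group Wt" by (rule W.abelian_group_tensor)

lemma wt_closed [simp]: "l \<in> carrier L \<Longrightarrow> v \<in> carrier It \<Longrightarrow> wt l v \<in> carrier Wt"
  using W.ptensor_closed by simp

lemma wt_simps:
  "l \<in> carrier L \<Longrightarrow> l' \<in> carrier L \<Longrightarrow> v \<in> carrier It \<Longrightarrow> wt (l \<oplus>\<^bsub>L\<^esub> l') v = wt l v \<oplus>\<^bsub>Wt\<^esub> wt l' v"
  "l \<in> carrier L \<Longrightarrow> v \<in> carrier It \<Longrightarrow> v' \<in> carrier It \<Longrightarrow> wt l (v \<oplus>\<^bsub>It\<^esub> v') = wt l v \<oplus>\<^bsub>Wt\<^esub> wt l v'"
  "h \<in> carrier H \<Longrightarrow> l \<in> carrier L \<Longrightarrow> v \<in> carrier It \<Longrightarrow> wt (h \<odot>\<^bsub>L\<^esub> l) v = wt l (h \<odot>\<^bsub>Ind_H M\<^esub> v)"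
  using W.ptensor_add_left[of l l' v] W.ptensor_add_right[of l v v'] W.ptensor_smult[of h l v] by simp_all

lemma tensor_Ind_simps [simp]:
  "carrier (tensor_Ind L M) = carrier Wt" "add (tensor_Ind L M) = add Wt" "zero (tensor_Ind L M) = zero Wt"
  by (simp_all add: tensor_Ind_def Let_def)

lemma tensor_Ind_group: "abelian_group (tensor_Ind L M)"
  by (rule abelian_group_transfer[OF W_group]) simp_all

lemma tensor_Ind_smult: "c \<odot>\<^bsub>tensor_Ind L M\<^esub> w = tlift Wt (\<lambda>l v. wt l (c \<odot>\<^bsub>Ind M\<^esub> v)) w"
  by (simp add: tensor_Ind_def Let_def)

lemma tensor_Ind_balanced:
  assumes c: "c \<in> carrier Bt"
  shows "balanced H L (Ind_H M) Wt (\<lambda>l v. wt l (c \<odot>\<^bsub>Ind M\<^esub> v))"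
  by (rule balancedI)
    (use c add_homD[OF Ind_smult_hom[OF c]] in \<open>simp_all add: wt_simps Ind_H_commute\<close>)

lemma tensor_Ind_smult_hom: "c \<in> carrier Bt \<Longrightarrow> add_hom Wt Wt (\<lambda>w. c \<odot>\<^bsub>tensor_Ind L M\<^esub> w)"
  unfolding tensor_Ind_smult by (rule W.tlift_add_hom[OF W_group tensor_Ind_balanced])

lemma tensor_Ind_smult_wt:
  "c \<in> carrier Bt \<Longrightarrow> l \<in> carrier L \<Longrightarrow> v \<in> carrier It \<Longrightarrow>
    c \<odot>\<^bsub>tensor_Ind L M\<^esub> wt l v = wt l (c \<odot>\<^bsub>Ind M\<^esub> v)"
  unfolding tensor_Ind_smult by (rule W.tlift_ptensor[OF W_group tensor_Ind_balanced]) simp_all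

lemma tensor_Ind_acted: "acted Be (tensor_Ind L M)"
  using tensor_Ind_group add_homD(1)[OF tensor_Ind_smult_hom] by (simp add: acted_def)

lemma W_ext:
  assumes G: "abelian_group G" and u: "add_hom Wt G u" and v: "add_hom Wt G v"
    and eq: "\<And>l s m. l \<in> carrier L \<Longrightarrow> s \<in> carrier Bt \<Longrightarrow> m \<in> carrier M \<Longrightarrow>
      u (wt l (it s m)) = v (wt l (it s m))"
    and w: "w \<in> carrier Wt"
  shows "u w = v w"
proof (rule W.tensor_ext[OF G u v _ w])
  fix l z assume "l \<in> carrier L" "z \<in> carrier (Ind_H M)"
  then have *: "l \<in> carrier L" "z \<in> carrier It" by simp_all
  show "u (wt l z) = v (wt l z)" using *(2)
  proof (induction z rule: TI.tensor_induct)
    case (pure s m)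
    then show ?case using eq * by simp
  next
    case (add s t)
    then show ?case using * by (simp add: wt_simps(2) add_homD(2)[OF u] add_homD(2)[OF v])
  qed
qed

abbreviation "CHom \<equiv> Hom_mod (op_ring H) L (Hom_Ae_H M N) (smult (Hom_Ae M N))"
abbreviation "CTen \<equiv> Hom_mod Be (tensor_Ind L M) (env_module N) (scale_N N)"

lemma CHomD:
  assumes "f \<in> carrier CHom"
  shows "f \<in> extensional (carrier L)"
    and "\<And>l. l \<in> carrier L \<Longrightarrow> f l \<in> carrier (Hom_Ae M N)"
    and "\<And>l m. l \<in> carrier L \<Longrightarrow> m \<in> carrier M \<Longrightarrow> f l m \<in> carrier N"
    and "\<And>l l'. l \<in> carrier L \<Longrightarrow> l' \<in> carrier L \<Longrightarrow> f (l \<oplus>\<^bsub>L\<^esub> l') = f l \<oplus>\<^bsub>Hom_Ae M N\<^esub> f l'"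
    and "\<And>l l' m. l \<in> carrier L \<Longrightarrow> l' \<in> carrier L \<Longrightarrow> m \<in> carrier M \<Longrightarrow> f (l \<oplus>\<^bsub>L\<^esub> l') m = f l m \<oplus>\<^bsub>N\<^esub> f l' m"
    and "\<And>h l. h \<in> carrier H \<Longrightarrow> l \<in> carrier L \<Longrightarrow> f (h \<odot>\<^bsub>L\<^esub> l) = h \<odot>\<^bsub>Hom_Ae_H M N\<^esub> f l"
proof -
  have f: "is_hom (op_ring H) L (Hom_Ae_H M N) f" "f \<in> extensional (carrier L)" using assms by simp_all
  note fD = is_homD[OF f(1)]
  show 1: "\<And>l. l \<in> carrier L \<Longrightarrow> f l \<in> carrier (Hom_Ae M N)" using fD(1) by simp
  show 2: "\<And>l l'. l \<in> carrier L \<Longrightarrow> l' \<in> carrier L \<Longrightarrow> f (l \<oplus>\<^bsub>L\<^esub> l') = f l \<oplus>\<^bsub>Hom_Ae M N\<^esub> f l'"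
    using fD(2) by simp
  show "\<And>l m. l \<in> carrier L \<Longrightarrow> m \<in> carrier M \<Longrightarrow> f l m \<in> carrier N"
    using Hom_AeD(2)[OF 1] by simp
  show "\<And>l l' m. l \<in> carrier L \<Longrightarrow> l' \<in> carrier L \<Longrightarrow> m \<in> carrier M \<Longrightarrow> f (l \<oplus>\<^bsub>L\<^esub> l') m = f l m \<oplus>\<^bsub>N\<^esub> f l' m"
    by (simp add: 2 Hom_Ae_add)
  show "\<And>h l. h \<in> carrier H \<Longrightarrow> l \<in> carrier L \<Longrightarrow> f (h \<odot>\<^bsub>L\<^esub> l) = h \<odot>\<^bsub>Hom_Ae_H M N\<^esub> f l"
    using fD(3) by simp
qed (use assms in simp)

lemma CHom_module: "module K CHom"
proof (rule Hom_mod_module)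
  show "acted (op_ring H) L" using L_acted by (simp add: acted_def)
  show "acted (op_ring H) (Hom_Ae_H M N)" by (rule Hom_Ae_H_acted)
  have "mk_module (Hom_Ae_H M N) (smult (Hom_Ae M N)) = mk_module (Hom_Ae M N) (smult (Hom_Ae M N))"
    by (simp add: mk_module_def Hom_Ae_H_def)
  moreover have "module K (mk_module (Hom_Ae M N) (smult (Hom_Ae M N)))"
    using Hom_Ae_module by (simp add: mk_module_def Hom_Ae_def Hom_mod_def)
  ultimately show "module K (mk_module (Hom_Ae_H M N) (smult (Hom_Ae M N)))" by simp
qed (simp_all add: Hom_Ae_H_add Hom_Ae_H_scale)

lemma CTenD:
  assumes "F \<in> carrier CTen"
  shows "F \<in> extensional (carrier Wt)"
    and "add_hom Wt N F"
    and "\<And>c w. c \<in> carrier Bt \<Longrightarrow> w \<in> carrier Wt \<Longrightarrow> F (c \<odot>\<^bsub>tensor_Ind L M\<^esub> w) = act c (F w)"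
proof -
  have f: "is_hom Be (tensor_Ind L M) (env_module N) F" using assms by simp
  note fD = is_homD[OF f]
  show "add_hom Wt N F" using fD(1,2) by (simp add: add_hom_def)
  show "\<And>c w. c \<in> carrier Bt \<Longrightarrow> w \<in> carrier Wt \<Longrightarrow> F (c \<odot>\<^bsub>tensor_Ind L M\<^esub> w) = act c (F w)"
    using fD(3) by simp
qed (use assms in simp)

lemma CTen_module: "module K CTen"
proof (rule Hom_mod_module[OF tensor_Ind_acted])
  show "acted Be (env_module N)"
    by (auto simp: acted_def intro!: abelian_group_transfer[OF N_group])
  have "mk_module (env_module N) (scale_N N) = mk_module N (scale_N N)"
    by (simp add: mk_module_def env_module_def)
  then show "module K (mk_module (env_module N) (scale_N N))" using scale_N_module by simp
qed (simp_all add: act_add_right act_scale)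

definition adj :: "('l \<Rightarrow> 'm \<Rightarrow> 'n) \<Rightarrow> ('l, (('b, 'b) tensors, 'm) tensors) tensors \<Rightarrow> 'n" where
  "adj f = (\<lambda>w\<in>carrier Wt. tlift N (\<lambda>l v. tlift N (\<lambda>s m. act s (f l m)) v) w)"

definition adj_inv :: "(('l, (('b, 'b) tensors, 'm) tensors) tensors \<Rightarrow> 'n) \<Rightarrow> 'l \<Rightarrow> 'm \<Rightarrow> 'n" where
  "adj_inv F = (\<lambda>l\<in>carrier L. \<lambda>m\<in>carrier M. F (wt l (it (be \<one>\<^bsub>B\<^esub> \<one>\<^bsub>B\<^esub>) m)))"

lemma adj_balanced:
  assumes f: "f \<in> carrier CHom"
  shows "balanced H L (Ind_H M) N (\<lambda>l v. tlift N (\<lambda>s m. act s (f l m)) v)"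
proof (rule balancedI)
  note fD = CHomD[OF f]
  note e = extend_hom[OF fD(2)]
  fix l l' v assume *: "l \<in> carrier L" "l' \<in> carrier L" "v \<in> carrier (Ind_H M)"
  show "tlift N (\<lambda>s m. act s (f (l \<oplus>\<^bsub>L\<^esub> l') m)) v
     = tlift N (\<lambda>s m. act s (f l m)) v \<oplus>\<^bsub>N\<^esub> tlift N (\<lambda>s m. act s (f l' m)) v"
    by (rule TI.tlift_split[OF N_group]) (use * fD in \<open>simp_all add: act_add_right\<close>)
qed (use add_homD[OF extend_hom[OF CHomD(2)[OF f]]] CHomD(6)[OF f] extend_H[OF CHomD(2)[OF f]] in simp_all)

lemma adj_wt:
  assumes f: "f \<in> carrier CHom" and "l \<in> carrier L" "v \<in> carrier It"
  shows "adj f (wt l v) = tlift N (\<lambda>s m. act s (f l m)) v"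
proof -
  have "wt l v \<in> carrier Wt" using assms by simp
  then show ?thesis
    using W.tlift_ptensor[OF N_group adj_balanced[OF f]] assms by (simp add: adj_def)
qed

lemma adj_pure:
  assumes f: "f \<in> carrier CHom" and "l \<in> carrier L" "s \<in> carrier Bt" "m \<in> carrier M"
  shows "adj f (wt l (it s m)) = act s (f l m)"
  using assms by (simp add: adj_wt extend_it[OF CHomD(2)])

lemma adj_hom: "f \<in> carrier CHom \<Longrightarrow> add_hom Wt N (adj f)"
  using W.tlift_add_hom[OF N_group adj_balanced] by (simp add: add_hom_def adj_def)

lemma adj_closed:
  assumes f: "f \<in> carrier CHom"
  shows "adj f \<in> carrier CTen"
proof -
  note aD = add_homD[OF adj_hom[OF f]]
  have lin: "adj f (c \<odot>\<^bsub>tensor_Ind L M\<^esub> w) = act c (adj f w)" if c: "c \<in> carrier Bt" and w: "w \<in> carrier Wt" for c w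
  proof (rule W_ext[OF N_group _ _ _ w])
    show "add_hom Wt N (\<lambda>w. adj f (c \<odot>\<^bsub>tensor_Ind L M\<^esub> w))" "add_hom Wt N (\<lambda>w. act c (adj f w))"
      using adj_hom[OF f] tensor_Ind_smult_hom[OF c] act_hom[OF c] by (simp_all add: add_hom_def)
    fix l s m assume "l \<in> carrier L" "s \<in> carrier Bt" "m \<in> carrier M"
    then show "adj f (c \<odot>\<^bsub>tensor_Ind L M\<^esub> wt l (it s m)) = act c (adj f (wt l (it s m)))"
      using c CHomD(3)[OF f] by (simp add: tensor_Ind_smult_wt Ind_smult_it adj_pure[OF f] act_assoc)
  qed
  have "is_hom Be (tensor_Ind L M) (env_module N) (adj f)"
    by (rule is_homI) (use aD lin in simp_all)
  then show ?thesis by (simp add: adj_def)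
qed

text \<open>
  \<open>H\<close>-linearity of \<open>adj_inv F\<close> comes from the relation \<open>l h \<otimes> v = l \<otimes> h v\<close> at \<open>v = 1 \<otimes> m\<close>.
\<close>

lemma adj_inv_closed:
  assumes F: "F \<in> carrier CTen"
  shows "adj_inv F \<in> carrier CHom"
proof -
  note FD = CTenD[OF F]
  note Fh = add_homD[OF FD(2)]
  let ?i = "be \<one>\<^bsub>B\<^esub> \<one>\<^bsub>B\<^esub>"
  have i: "?i \<in> carrier Bt" by simp
  have Fs: "F (wt l (it s m)) = act s (F (wt l (it ?i m)))"
    if "l \<in> carrier L" "s \<in> carrier Bt" "m \<in> carrier M" for l s m
    using FD(3)[of s "wt l (it ?i m)"] that by (simp add: tensor_Ind_smult_wt Ind_smult_it)
  have H1: "adj_inv F l \<in> carrier (Hom_Ae M N)" if l: "l \<in> carrier L" for l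
    unfolding Hom_Ae_iff
  proof (intro conjI ballI)
    fix c m assume *: "c \<in> carrier (tensor K A (op_ring A))" "m \<in> carrier M"
    have "it ?i (incl_e c \<odot>\<^bsub>M\<^esub> m) = it (incl_e c) m"
      using * it_simps(3)[of c ?i m] by simp
    then show "adj_inv F l (incl_e c \<odot>\<^bsub>M\<^esub> m) = act (incl_e c) (adj_inv F l m)"
      using * l Fs[of l "incl_e c" m] by (simp add: adj_inv_def M_simps)
  qed (use l Fh in \<open>simp_all add: adj_inv_def it_simps wt_simps\<close>)
  have "is_hom (op_ring H) L (Hom_Ae_H M N) (adj_inv F)"
  proof (rule is_homI)
    fix l l' assume *: "l \<in> carrier L" "l' \<in> carrier L"
    show "adj_inv F (l \<oplus>\<^bsub>L\<^esub> l') = adj_inv F l \<oplus>\<^bsub>Hom_Ae_H M N\<^esub> adj_inv F l'"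
      by (rule extensionalityI[of _ "carrier M"])
        (use * Fh in \<open>simp_all add: adj_inv_def Hom_Ae_add wt_simps\<close>, simp add: Hom_Ae_def)
  next
    fix h l assume "h \<in> carrier (op_ring H)" "l \<in> carrier L"
    then have *: "h \<in> carrier H" "l \<in> carrier L" by simp_all
    show "adj_inv F (h \<odot>\<^bsub>L\<^esub> l) = h \<odot>\<^bsub>Hom_Ae_H M N\<^esub> adj_inv F l"
    proof (rule extensionalityI[of _ "carrier M"])
      fix m assume m: "m \<in> carrier M"
      have u: "add_hom It N (\<lambda>v. F (wt l v))"
        using * Fh by (simp add: add_hom_def wt_simps)
      have "adj_inv F (h \<odot>\<^bsub>L\<^esub> l) m = F (wt l (tlift3 It (spread \<one>\<^bsub>B\<^esub> \<one>\<^bsub>B\<^esub> m) (kappa_Gamma h)))"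
        using * m by (simp add: adj_inv_def wt_simps Ind_H_smult_it)
      also have "\<dots> = tlift3 N (\<lambda>x t y. F (wt l (spread \<one>\<^bsub>B\<^esub> \<one>\<^bsub>B\<^esub> m x t y))) (kappa_Gamma h)"
        by (rule tlift3_comp_hom[of Gamma, OF _ It_group u N_group])
          (use * m balanced3D(1)[OF spread_balanced] in simp_all)
      also have "\<dots> = tlift3 N (sandwich (adj_inv F l) m) (kappa_Gamma h)"
      proof (rule tlift3_cong[of Gamma, OF _ N_group])
        fix x t y assume **: "x \<in> carrier B" "t \<in> carrier Gamma" "y \<in> carrier B"
        then show "sandwich (adj_inv F l) m x t y \<in> carrier N"
          using balanced3D(1)[OF sandwich_balanced[OF H1[OF *(2)] m]] by simp
        show "F (wt l (spread \<one>\<^bsub>B\<^esub> \<one>\<^bsub>B\<^esub> m x t y)) = sandwich (adj_inv F l) m x t y"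
          using Fs[of l "be x y" "t \<odot>\<^bsub>M\<^esub> m"] * ** m
          by (simp add: spread_def sandwich_def adj_inv_def M_simps)
      qed (use * in simp_all)
      also have "\<dots> = (h \<odot>\<^bsub>Hom_Ae_H M N\<^esub> adj_inv F l) m"
        using * m by (simp add: Hom_Ae_H_smult[OF H1])
      finally show "adj_inv F (h \<odot>\<^bsub>L\<^esub> l) m = (h \<odot>\<^bsub>Hom_Ae_H M N\<^esub> adj_inv F l) m" .
    qed (use * in \<open>simp_all add: adj_inv_def Hom_Ae_H_def\<close>)
  qed (use H1 in simp)
  then show ?thesis by (simp add: adj_inv_def)
qed

lemma adj_inv_adj:
  assumes f: "f \<in> carrier CHom"
  shows "adj_inv (adj f) = f"
proof (rule extensionalityI[of _ "carrier L"])
  fix l assume l: "l \<in> carrier L"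
  note fD = CHomD[OF f]
  show "adj_inv (adj f) l = f l"
    by (rule extensionalityI[of _ "carrier M"])
      (use l fD(3) Hom_AeD(1)[OF fD(2)] in \<open>simp_all add: adj_inv_def adj_pure[OF f] act_one\<close>)
qed (use CHomD(1)[OF f] in \<open>simp_all add: adj_inv_def\<close>)

lemma adj_adj_inv:
  assumes F: "F \<in> carrier CTen"
  shows "adj (adj_inv F) = F"
proof (rule extensionalityI[of _ "carrier Wt"])
  note FD = CTenD[OF F]
  note f = adj_inv_closed[OF F]
  fix w assume w: "w \<in> carrier Wt"
  show "adj (adj_inv F) w = F w"
  proof (rule W_ext[OF N_group adj_hom[OF f] FD(2) _ w])
    fix l s m assume *: "l \<in> carrier L" "s \<in> carrier Bt" "m \<in> carrier M"
    have "adj (adj_inv F) (wt l (it s m)) = act s (F (wt l (it (be \<one>\<^bsub>B\<^esub> \<one>\<^bsub>B\<^esub>) m)))"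
      using * by (simp add: adj_pure[OF f]) (simp add: adj_inv_def)
    also have "\<dots> = F (wt l (it s m))"
      using FD(3)[of s "wt l (it (be \<one>\<^bsub>B\<^esub> \<one>\<^bsub>B\<^esub>) m)"] * by (simp add: tensor_Ind_smult_wt Ind_smult_it)
    finally show "adj (adj_inv F) (wt l (it s m)) = F (wt l (it s m))" .
  qed
qed (use CTenD(1)[OF F] in \<open>simp_all add: adj_def\<close>)

lemma adj_bij: "bij_betw adj (carrier CHom) (carrier CTen)"
  by (rule bij_betw_byWitness[where f' = adj_inv]; intro ballI image_subsetI)
    (rule adj_inv_adj adj_adj_inv adj_closed adj_inv_closed, assumption)+

lemma CTen_eqI:
  assumes "F \<in> extensional (carrier Wt)" "F' \<in> extensional (carrier Wt)" "add_hom Wt N F" "add_hom Wt N F'"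
    and "\<And>l s m. l \<in> carrier L \<Longrightarrow> s \<in> carrier Bt \<Longrightarrow> m \<in> carrier M \<Longrightarrow> F (wt l (it s m)) = F' (wt l (it s m))"
  shows "F = F'"
  by (rule extensionalityI[OF assms(1,2)]) (rule W_ext[OF N_group assms(3-5)])

lemma adj_is_hom: "is_hom K CHom CTen adj"
proof (rule is_homI)
  interpret C: module K CHom by (rule CHom_module)
  interpret D: module K CTen by (rule CTen_module)
  show cl: "adj f \<in> carrier CTen" if "f \<in> carrier CHom" for f using that by (rule adj_closed)
  show "adj (f \<oplus>\<^bsub>CHom\<^esub> g) = adj f \<oplus>\<^bsub>CTen\<^esub> adj g" if f: "f \<in> carrier CHom" and g: "g \<in> carrier CHom" for f g
  proof (rule CTen_eqI)
    have fg: "f \<oplus>\<^bsub>CHom\<^esub> g \<in> carrier CHom" by (rule abelian_groupE(1)[OF module.axioms(2)[OF CHom_module] f g])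
    have D: "adj f \<oplus>\<^bsub>CTen\<^esub> adj g \<in> carrier CTen" by (rule abelian_groupE(1)[OF module.axioms(2)[OF CTen_module] cl[OF f] cl[OF g]])
    show "adj (f \<oplus>\<^bsub>CHom\<^esub> g) \<in> extensional (carrier Wt)" "add_hom Wt N (adj (f \<oplus>\<^bsub>CHom\<^esub> g))"
      using CTenD(1,2)[OF cl[OF fg]] by simp_all
    show "adj f \<oplus>\<^bsub>CTen\<^esub> adj g \<in> extensional (carrier Wt)" "add_hom Wt N (adj f \<oplus>\<^bsub>CTen\<^esub> adj g)"
      using CTenD(1,2)[OF D] by simp_all
    fix l s m assume *: "l \<in> carrier L" "s \<in> carrier Bt" "m \<in> carrier M"
    have "adj (f \<oplus>\<^bsub>CHom\<^esub> g) (wt l (it s m)) = act s ((f \<oplus>\<^bsub>CHom\<^esub> g) l m)"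
      by (rule adj_pure[OF fg *])
    also have "\<dots> = (adj f \<oplus>\<^bsub>CTen\<^esub> adj g) (wt l (it s m))"
      using * CHomD(3)[OF f] CHomD(3)[OF g]
      by (simp add: Hom_Ae_add act_add_right adj_pure[OF f] adj_pure[OF g])
    finally show "adj (f \<oplus>\<^bsub>CHom\<^esub> g) (wt l (it s m)) = (adj f \<oplus>\<^bsub>CTen\<^esub> adj g) (wt l (it s m))" .
  qed
  show "adj (c \<odot>\<^bsub>CHom\<^esub> f) = c \<odot>\<^bsub>CTen\<^esub> adj f" if c: "c \<in> carrier K" and f: "f \<in> carrier CHom" for c f
  proof (rule CTen_eqI)
    have cf: "c \<odot>\<^bsub>CHom\<^esub> f \<in> carrier CHom" using c f by (rule C.smult_closed)
    have D: "c \<odot>\<^bsub>CTen\<^esub> adj f \<in> carrier CTen" using c cl[OF f] by (rule D.smult_closed)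
    show "adj (c \<odot>\<^bsub>CHom\<^esub> f) \<in> extensional (carrier Wt)" "add_hom Wt N (adj (c \<odot>\<^bsub>CHom\<^esub> f))"
      using CTenD(1,2)[OF cl[OF cf]] by simp_all
    show "c \<odot>\<^bsub>CTen\<^esub> adj f \<in> extensional (carrier Wt)" "add_hom Wt N (c \<odot>\<^bsub>CTen\<^esub> adj f)"
      using CTenD(1,2)[OF D] by simp_all
    fix l s m assume *: "l \<in> carrier L" "s \<in> carrier Bt" "m \<in> carrier M"
    have "adj (c \<odot>\<^bsub>CHom\<^esub> f) (wt l (it s m)) = act s ((c \<odot>\<^bsub>CHom\<^esub> f) l m)"
      by (rule adj_pure[OF cf *])
    also have "\<dots> = (c \<odot>\<^bsub>CTen\<^esub> adj f) (wt l (it s m))"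
      using * c CHomD(3)[OF f] by (simp add: Hom_Ae_smult act_scale adj_pure[OF f])
    finally show "adj (c \<odot>\<^bsub>CHom\<^esub> f) (wt l (it s m)) = (c \<odot>\<^bsub>CTen\<^esub> adj f) (wt l (it s m))" .
  qed
qed

end

section \<open>Naturality\<close>

subsection \<open>Horizontal maps\<close>

locale galois_pair_hmap = galois_pair K H comul counit antipode B coact N M L
    + Y: galois_pair K H comul counit antipode B coact N M L'
  for K :: "'k ring" and H :: "('k, 'h) module" and comul :: "'h \<Rightarrow> ('h, 'h) tensors"
    and counit :: "'h \<Rightarrow> 'k" and antipode :: "'h \<Rightarrow> 'h"
    and B :: "('k, 'b) module" and coact :: "'b \<Rightarrow> ('b, 'h) tensors"
    and N :: "('b, 'n) bimodule" and M :: "(('b, 'b) tensors, 'm) module"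
    and L :: "('h, 'l) module" and L' :: "('h, 'l) module" +
  fixes d :: "'l \<Rightarrow> 'l"
  assumes d: "is_hom H L' L d"
begin

lemmas dD = is_homD[OF d]

text \<open>
  The horizontal differential induced by \<open>d\<close>, with sign \<open>(-1)^k\<close>.
\<close>

definition hpull :: "nat \<Rightarrow> ('l \<Rightarrow> 'm \<Rightarrow> 'n) \<Rightarrow> 'l \<Rightarrow> 'm \<Rightarrow> 'n" where
  "hpull k f = (\<lambda>l\<in>carrier L'. \<lambda>m\<in>carrier M. signed N k (f (d l) m))"

lemma hpull_eq:
  assumes f: "f \<in> carrier CHom" and l: "l \<in> carrier L'"
  shows "hpull k f l = sgn_K k \<odot>\<^bsub>Hom_Ae M N\<^esub> f (d l)"
proof (rule extensionalityI[of _ "carrier M"])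
  show "sgn_K k \<odot>\<^bsub>Hom_Ae M N\<^esub> f (d l) \<in> extensional (carrier M)" by (simp add: Hom_Ae_def)
qed (use l f dD CHomD(3)[OF f] in \<open>simp_all add: hpull_def Hom_Ae_smult signed_scale\<close>)

lemma hpull_closed:
  assumes f: "f \<in> carrier CHom"
  shows "hpull k f \<in> carrier Y.CHom"
proof -
  note fD = CHomD[OF f]
  interpret HA: module K "Hom_Ae M N" by (rule Hom_Ae_module)
  have "is_hom (op_ring H) L' (Hom_Ae_H M N) (hpull k f)"
  proof (rule is_homI)
    fix l assume "l \<in> carrier L'"
    then show "hpull k f l \<in> carrier (Hom_Ae_H M N)"
      using fD(2) dD(1) by (simp add: hpull_eq[OF f] Hom_Ae_closed(2))
  next
    fix l l' assume *: "l \<in> carrier L'" "l' \<in> carrier L'"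
    then show "hpull k f (l \<oplus>\<^bsub>L'\<^esub> l') = hpull k f l \<oplus>\<^bsub>Hom_Ae_H M N\<^esub> hpull k f l'"
      using fD(2,4) dD HA.smult_r_distr by (simp add: hpull_eq[OF f])
  next
    fix h l assume "h \<in> carrier (op_ring H)" "l \<in> carrier L'"
    then show "hpull k f (h \<odot>\<^bsub>L'\<^esub> l) = h \<odot>\<^bsub>Hom_Ae_H M N\<^esub> hpull k f l"
      using fD(2,6) dD by (simp add: hpull_eq[OF f] Hom_Ae_H_scale)
  qed
  then show ?thesis by (simp add: hpull_def)
qed

lemma hpull_is_hom: "is_hom K CHom Y.CHom (hpull k)"
proof (rule is_homI)
  show "hpull k f \<in> carrier Y.CHom" if "f \<in> carrier CHom" for f using that by (rule hpull_closed)
next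
  fix f g assume f: "f \<in> carrier CHom" and g: "g \<in> carrier CHom"
  note fD = CHomD(3)[OF f] and gD = CHomD(3)[OF g]
  show "hpull k (f \<oplus>\<^bsub>CHom\<^esub> g) = hpull k f \<oplus>\<^bsub>Y.CHom\<^esub> hpull k g"
    by (rule ext, rule ext)
      (use fD gD dD(1) in \<open>auto simp: hpull_def restrict_def Hom_Ae_def add_homD(2)[OF signed_hom]\<close>)
next
  fix c f assume c: "c \<in> carrier K" and f: "f \<in> carrier CHom"
  note fD = CHomD(3)[OF f]
  have "signed N k (scale_N N c n) = scale_N N c (signed N k n)" if "n \<in> carrier N" for n
    using c that add_hom_minus[OF scale_N_hom[OF c] N_group N_group] by (simp add: signed_def)
  then show "hpull k (c \<odot>\<^bsub>CHom\<^esub> f) = c \<odot>\<^bsub>Y.CHom\<^esub> hpull k f"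
    by (intro ext) (use fD dD(1) in \<open>auto simp: hpull_def restrict_def Hom_Ae_def\<close>)
qed

lemma hmap_balanced:
  "balanced H L' (Ind_H M) (tensor_Ind L M) (\<lambda>l v. wt (d l) v)"
  by (rule balancedI) (use dD in \<open>simp_all add: wt_simps\<close>)

lemma adj_hpull:
  assumes f: "f \<in> carrier CHom"
  shows "Y.adj (hpull k f) = (\<lambda>w\<in>carrier (tensor_Ind L' M).
     signed N k (adj f (tlift (tensor_Ind L M) (\<lambda>l v. wt (d l) v) w)))"
proof (rule Y.CTen_eqI)
  note hf = hpull_closed[OF f, of k]
  note t = Y.W.tlift_add_hom[OF tensor_Ind_group hmap_balanced]
  note tp = Y.W.tlift_ptensor[OF tensor_Ind_group hmap_balanced]
  note a = adj_hom[OF f]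
  show "Y.adj (hpull k f) \<in> extensional (carrier Y.Wt)" by (simp add: Y.adj_def)
  show "add_hom Y.Wt N (Y.adj (hpull k f))" by (rule Y.adj_hom[OF hf])
  show "add_hom Y.Wt N (\<lambda>w\<in>carrier (tensor_Ind L' M).
     signed N k (adj f (tlift (tensor_Ind L M) (\<lambda>l v. wt (d l) v) w)))"
    using t a signed_hom[of k] by (simp add: add_hom_def)
  fix l s m assume *: "l \<in> carrier L'" "s \<in> carrier Bt" "m \<in> carrier M"
  have "Y.adj (hpull k f) (Y.wt l (it s m)) = act s (signed N k (f (d l) m))"
    using * by (simp add: Y.adj_pure[OF hf]) (simp add: hpull_def)
  also have "\<dots> = signed N k (adj f (wt (d l) (it s m)))"
    using * dD(1) CHomD(3)[OF f] by (simp add: adj_pure[OF f] signed_act)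
  finally show "Y.adj (hpull k f) (Y.wt l (it s m)) = (\<lambda>w\<in>carrier (tensor_Ind L' M).
     signed N k (adj f (tlift (tensor_Ind L M) (\<lambda>l v. wt (d l) v) w))) (Y.wt l (it s m))"
    using * by (simp add: tp)
qed simp

end

subsection \<open>Vertical maps\<close>

locale galois_pair_vmap = galois_pair K H comul counit antipode B coact N M L
    + Y: galois_pair K H comul counit antipode B coact N M' L
  for K :: "'k ring" and H :: "('k, 'h) module" and comul :: "'h \<Rightarrow> ('h, 'h) tensors"
    and counit :: "'h \<Rightarrow> 'k" and antipode :: "'h \<Rightarrow> 'h"
    and B :: "('k, 'b) module" and coact :: "'b \<Rightarrow> ('b, 'h) tensors"
    and N :: "('b, 'n) bimodule" and M :: "(('b, 'b) tensors, 'm) module"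
    and M' :: "(('b, 'b) tensors, 'm) module" and L :: "('h, 'l) module" +
  fixes p :: "'m \<Rightarrow> 'm"
  assumes p: "is_hom Gamma M' M p"
begin

lemmas pD = is_homD[OF p]

definition precomp :: "('m \<Rightarrow> 'n) \<Rightarrow> 'm \<Rightarrow> 'n" where
  "precomp g = (\<lambda>m\<in>carrier M'. g (p m))"

lemma precomp_closed:
  assumes g: "g \<in> carrier (Hom_Ae M N)"
  shows "precomp g \<in> carrier (Hom_Ae M' N)"
  unfolding Y.Hom_Ae_iff using Hom_AeD[OF g] pD by (simp add: precomp_def Y.M_simps)

lemma precomp_H:
  assumes g: "g \<in> carrier (Hom_Ae M N)" and h: "h \<in> carrier H"
  shows "precomp (h \<odot>\<^bsub>Hom_Ae_H M N\<^esub> g) = h \<odot>\<^bsub>Hom_Ae_H M' N\<^esub> precomp g"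
proof (rule extensionalityI[of _ "carrier M'"])
  fix m assume m: "m \<in> carrier M'"
  have "(h \<odot>\<^bsub>Hom_Ae_H M' N\<^esub> precomp g) m = tlift3 N (Y.sandwich (precomp g) m) (kappa_Gamma h)"
    by (rule Y.Hom_Ae_H_smult[OF precomp_closed[OF g] h m])
  also have "\<dots> = tlift3 N (sandwich g (p m)) (kappa_Gamma h)"
    by (rule tlift3_cong[of Gamma, OF _ N_group])
      (use h m pD balanced3D(1)[OF sandwich_balanced[OF g]]
        in \<open>simp_all add: Y.sandwich_def precomp_def Y.M_simps, simp_all add: sandwich_def\<close>)
  also have "\<dots> = precomp (h \<odot>\<^bsub>Hom_Ae_H M N\<^esub> g) m"
    using m pD(1) by (simp add: precomp_def Hom_Ae_H_smult[OF g h])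
  finally show "precomp (h \<odot>\<^bsub>Hom_Ae_H M N\<^esub> g) m = (h \<odot>\<^bsub>Hom_Ae_H M' N\<^esub> precomp g) m" by simp
qed (simp_all add: precomp_def Hom_Ae_H_def)

lemma precomp_add:
  assumes "g \<in> carrier (Hom_Ae M N)" "g' \<in> carrier (Hom_Ae M N)"
  shows "precomp (g \<oplus>\<^bsub>Hom_Ae M N\<^esub> g') = precomp g \<oplus>\<^bsub>Hom_Ae M' N\<^esub> precomp g'"
  by (rule ext) (use pD(1) in \<open>simp add: precomp_def Hom_Ae_def restrict_def\<close>)

text \<open>
  The vertical differential induced by \<open>p\<close>, with sign \<open>(-1)^k\<close>.
\<close>

definition vpull :: "nat \<Rightarrow> ('l \<Rightarrow> 'm \<Rightarrow> 'n) \<Rightarrow> 'l \<Rightarrow> 'm \<Rightarrow> 'n" where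
  "vpull k f = (\<lambda>l\<in>carrier L. \<lambda>m\<in>carrier M'. signed N k (f l (p m)))"

lemma vpull_eq:
  assumes f: "f \<in> carrier CHom" and l: "l \<in> carrier L"
  shows "vpull k f l = sgn_K k \<odot>\<^bsub>Hom_Ae M' N\<^esub> precomp (f l)"
proof (rule extensionalityI[of _ "carrier M'"])
  show "sgn_K k \<odot>\<^bsub>Hom_Ae M' N\<^esub> precomp (f l) \<in> extensional (carrier M')" by (simp add: Hom_Ae_def)
qed (use l f pD CHomD(3)[OF f] in \<open>simp_all add: vpull_def precomp_def Y.Hom_Ae_smult signed_scale\<close>)

lemma vpull_closed:
  assumes f: "f \<in> carrier CHom"
  shows "vpull k f \<in> carrier Y.CHom"
proof -
  note fD = CHomD[OF f]
  interpret HA: module K "Hom_Ae M' N" by (rule Y.Hom_Ae_module)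
  have "is_hom (op_ring H) L (Hom_Ae_H M' N) (vpull k f)"
  proof (rule is_homI)
    fix l assume "l \<in> carrier L"
    then show "vpull k f l \<in> carrier (Hom_Ae_H M' N)"
      using fD(2) precomp_closed by (simp add: vpull_eq[OF f] Y.Hom_Ae_closed(2))
  next
    fix l l' assume *: "l \<in> carrier L" "l' \<in> carrier L"
    then show "vpull k f (l \<oplus>\<^bsub>L\<^esub> l') = vpull k f l \<oplus>\<^bsub>Hom_Ae_H M' N\<^esub> vpull k f l'"
      using fD(2,4) precomp_closed HA.smult_r_distr by (simp add: vpull_eq[OF f] precomp_add)
  next
    fix h l assume "h \<in> carrier (op_ring H)" "l \<in> carrier L"
    then show "vpull k f (h \<odot>\<^bsub>L\<^esub> l) = h \<odot>\<^bsub>Hom_Ae_H M' N\<^esub> vpull k f l"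
      using fD(2,6) precomp_closed by (simp add: vpull_eq[OF f] Y.Hom_Ae_H_scale precomp_H)
  qed
  then show ?thesis by (simp add: vpull_def)
qed

lemma vpull_is_hom: "is_hom K CHom Y.CHom (vpull k)"
proof (rule is_homI)
  show "vpull k f \<in> carrier Y.CHom" if "f \<in> carrier CHom" for f using that by (rule vpull_closed)
next
  fix f g assume f: "f \<in> carrier CHom" and g: "g \<in> carrier CHom"
  note fD = CHomD(3)[OF f] and gD = CHomD(3)[OF g]
  show "vpull k (f \<oplus>\<^bsub>CHom\<^esub> g) = vpull k f \<oplus>\<^bsub>Y.CHom\<^esub> vpull k g"
    by (rule ext, rule ext)
      (use fD gD pD(1) in \<open>auto simp: vpull_def restrict_def Hom_Ae_def add_homD(2)[OF signed_hom]\<close>)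
next
  fix c f assume c: "c \<in> carrier K" and f: "f \<in> carrier CHom"
  note fD = CHomD(3)[OF f]
  have "signed N k (scale_N N c n) = scale_N N c (signed N k n)" if "n \<in> carrier N" for n
    using c that add_hom_minus[OF scale_N_hom[OF c] N_group N_group] by (simp add: signed_def)
  then show "vpull k (c \<odot>\<^bsub>CHom\<^esub> f) = c \<odot>\<^bsub>Y.CHom\<^esub> vpull k f"
    by (intro ext) (use fD pD(1) in \<open>auto simp: vpull_def restrict_def Hom_Ae_def\<close>)
qed

abbreviation "imap \<equiv> tlift (Ind M) (\<lambda>t m. it t (p m))"

lemma Ind_group: "abelian_group (Ind M)"
  by (rule abelian_group_transfer[OF It_group]) simp_all

lemma imap_balanced: "balanced Ae Be_right (restr M') (Ind M) (\<lambda>t m. it t (p m))"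
  by (rule balancedI) (use pD in \<open>simp_all add: it_simps\<close>)

lemma imap_hom: "add_hom Y.It It imap"
  using Y.TI.tlift_add_hom[OF Ind_group imap_balanced] by (simp add: add_hom_def)

lemma imap_it: "s \<in> carrier Bt \<Longrightarrow> m \<in> carrier M' \<Longrightarrow> imap (Y.it s m) = it s (p m)"
  by (rule Y.TI.tlift_ptensor[OF Ind_group imap_balanced]) simp_all

text \<open>
  \<open>B\<^sup>e \<otimes> p\<close> commutes with the action of \<open>h\<close>, because \<open>p\<close> commutes with the components of \<open>\<kappa>(h)\<close> in \<open>\<Gamma>\<close>.
\<close>

lemma imap_H:
  assumes h: "h \<in> carrier H" and v: "v \<in> carrier Y.It"
  shows "imap (h \<odot>\<^bsub>Ind_H M'\<^esub> v) = h \<odot>\<^bsub>Ind_H M\<^esub> imap v"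
proof (rule Y.It_ext[OF It_group _ _ _ v])
  show "add_hom Y.It It (\<lambda>v. imap (h \<odot>\<^bsub>Ind_H M'\<^esub> v))" "add_hom Y.It It (\<lambda>v. h \<odot>\<^bsub>Ind_H M\<^esub> imap v)"
    using imap_hom Y.Ind_H_smult_hom[OF h] Ind_H_smult_hom[OF h] by (simp_all add: add_hom_def)
  fix b b' m assume *: "b \<in> carrier B" "b' \<in> carrier B" "m \<in> carrier M'"
  note sc = balanced3D(1)[OF Y.spread_balanced[OF *]]
  have "imap (h \<odot>\<^bsub>Ind_H M'\<^esub> Y.it (be b b') m) = tlift3 It (\<lambda>x t y. imap (Y.spread b b' m x t y)) (kappa_Gamma h)"
    unfolding Y.Ind_H_smult_it[OF h *]
    by (rule tlift3_comp_hom[of Gamma, OF _ Y.It_group imap_hom It_group]) (use h sc in simp_all)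
  also have "\<dots> = tlift3 It (spread b b' (p m)) (kappa_Gamma h)"
    by (rule tlift3_cong[of Gamma, OF _ It_group])
      (use * h pD balanced3D(1)[OF spread_balanced[OF *(1,2) pD(1)[OF *(3)]]]
        in \<open>simp_all add: Y.spread_def imap_it Y.M_simps, simp_all add: spread_def\<close>)
  also have "\<dots> = h \<odot>\<^bsub>Ind_H M\<^esub> imap (Y.it (be b b') m)"
    using * pD(1) by (simp add: imap_it Ind_H_smult_it[OF h])
  finally show "imap (h \<odot>\<^bsub>Ind_H M'\<^esub> Y.it (be b b') m) = h \<odot>\<^bsub>Ind_H M\<^esub> imap (Y.it (be b b') m)" .
qed

lemma vmap_balanced:
  "balanced H L (Ind_H M') (tensor_Ind L M) (\<lambda>l v. wt l (imap v))"
  by (rule balancedI) (use add_homD[OF imap_hom] in \<open>simp_all add: wt_simps imap_H\<close>)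

lemma adj_vpull:
  assumes f: "f \<in> carrier CHom"
  shows "Y.adj (vpull k f) = (\<lambda>w\<in>carrier (tensor_Ind L M').
     signed N k (adj f (tlift (tensor_Ind L M) (\<lambda>l v. wt l (imap v)) w)))"
proof (rule Y.CTen_eqI)
  note hf = vpull_closed[OF f, of k]
  note t = Y.W.tlift_add_hom[OF tensor_Ind_group vmap_balanced]
  note tp = Y.W.tlift_ptensor[OF tensor_Ind_group vmap_balanced]
  note a = adj_hom[OF f]
  show "Y.adj (vpull k f) \<in> extensional (carrier Y.Wt)" by (simp add: Y.adj_def)
  show "add_hom Y.Wt N (Y.adj (vpull k f))" by (rule Y.adj_hom[OF hf])
  show "add_hom Y.Wt N (\<lambda>w\<in>carrier (tensor_Ind L M').
     signed N k (adj f (tlift (tensor_Ind L M) (\<lambda>l v. wt l (imap v)) w)))"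
    using t a signed_hom[of k] by (simp add: add_hom_def)
  fix l s m assume *: "l \<in> carrier L" "s \<in> carrier Bt" "m \<in> carrier M'"
  have "Y.adj (vpull k f) (Y.wt l (Y.it s m)) = act s (signed N k (f l (p m)))"
    using * by (simp add: Y.adj_pure[OF hf]) (simp add: vpull_def)
  also have "\<dots> = signed N k (adj f (wt l (it s (p m))))"
    using * pD(1) CHomD(3)[OF f] by (simp add: adj_pure[OF f] signed_act)
  finally show "Y.adj (vpull k f) (Y.wt l (Y.it s m)) = (\<lambda>w\<in>carrier (tensor_Ind L M').
     signed N k (adj f (tlift (tensor_Ind L M) (\<lambda>l v. wt l (imap v)) w))) (Y.wt l (Y.it s m))"
    using * by (simp add: tp imap_it)
qed simp

end

section \<open>Bicomplexes\<close>

text \<open>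
  Linearity of the differentials of \<open>D\<close> and the bicomplex identities follow from those of \<open>C\<close>, since
  every element of \<open>D\<close> has the form \<open>\<Phi>(f)\<close>.
\<close>

lemma bicomplex_iso_transport:
  assumes C: "bicomplex K C dh dv"
    and D: "\<And>i j. module K (D i j)"
    and \<Phi>: "\<And>i j. is_hom K (C i j) (D i j) (\<Phi> i j)"
    and bij: "\<And>i j. bij_betw (\<Phi> i j) (carrier (C i j)) (carrier (D i j))"
    and h: "\<And>i j f. f \<in> carrier (C i j) \<Longrightarrow> \<Phi> (Suc i) j (dh i j f) = eh i j (\<Phi> i j f)"
    and v: "\<And>i j f. f \<in> carrier (C i j) \<Longrightarrow> \<Phi> i (Suc j) (dv i j f) = ev i j (\<Phi> i j f)"
  shows "bicomplex_iso K C dh dv D eh ev \<Phi>"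
proof -
  have Cm: "\<And>i j. module K (C i j)"
    and dh: "\<And>i j. is_hom K (C i j) (C (Suc i) j) (dh i j)"
    and dv: "\<And>i j. is_hom K (C i j) (C i (Suc j)) (dv i j)"
    and dd: "\<And>i j f. f \<in> carrier (C i j) \<Longrightarrow>
          dh (Suc i) j (dh i j f) = \<zero>\<^bsub>C (Suc (Suc i)) j\<^esub>
        \<and> dv i (Suc j) (dv i j f) = \<zero>\<^bsub>C i (Suc (Suc j))\<^esub>
        \<and> dh i (Suc j) (dv i j f) \<oplus>\<^bsub>C (Suc i) (Suc j)\<^esub> dv (Suc i) j (dh i j f)
            = \<zero>\<^bsub>C (Suc i) (Suc j)\<^esub>"
    using C unfolding bicomplex_def by blast+
  have Cg: "abelian_group (C i j)" and Dg: "abelian_group (D i j)" for i j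
    using Cm[of i j] D[of i j] by (auto simp: module_def)
  note \<Phi>D = is_homD[OF \<Phi>] and dhD = is_homD[OF dh] and dvD = is_homD[OF dv]
  have \<Phi>0: "\<Phi> i j \<zero>\<^bsub>C i j\<^esub> = \<zero>\<^bsub>D i j\<^esub>" for i j
    by (rule is_hom_zero[OF \<Phi> Cg Dg])
  have pull: "\<exists>f\<in>carrier (C i j). F = \<Phi> i j f" if "F \<in> carrier (D i j)" for F i j
    using bij[of i j] that by (auto simp: bij_betw_def)
  have hom: "is_hom K (D i j) (D i' j') e"
    if d: "is_hom K (C i j) (C i' j') d" and e: "\<And>f. f \<in> carrier (C i j) \<Longrightarrow> \<Phi> i' j' (d f) = e (\<Phi> i j f)"
    for i j i' j' d e
  proof (rule is_homI)
    note dD = is_homD[OF d]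
    fix F assume "F \<in> carrier (D i j)"
    then obtain f where f: "f \<in> carrier (C i j)" "F = \<Phi> i j f" using pull by blast
    show "e F \<in> carrier (D i' j')" using f \<Phi>D(1) dD(1) e[symmetric] by simp
    show "e (c \<odot>\<^bsub>D i j\<^esub> F) = c \<odot>\<^bsub>D i' j'\<^esub> e F" if c: "c \<in> carrier K" for c
    proof -
      have "e (c \<odot>\<^bsub>D i j\<^esub> F) = e (\<Phi> i j (c \<odot>\<^bsub>C i j\<^esub> f))" using f c \<Phi>D(3) by simp
      also have "\<dots> = \<Phi> i' j' (d (c \<odot>\<^bsub>C i j\<^esub> f))"
        using e module.smult_closed[OF Cm c f(1)] by simp
      finally show ?thesis using f c dD \<Phi>D(3) e by simp
    qed
    show "e (F \<oplus>\<^bsub>D i j\<^esub> F') = e F \<oplus>\<^bsub>D i' j'\<^esub> e F'" if F': "F' \<in> carrier (D i j)" for F'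
    proof -
      obtain g where g: "g \<in> carrier (C i j)" "F' = \<Phi> i j g" using pull[OF F'] by blast
      have "e (F \<oplus>\<^bsub>D i j\<^esub> F') = e (\<Phi> i j (f \<oplus>\<^bsub>C i j\<^esub> g))" using f g \<Phi>D(2) by simp
      also have "\<dots> = \<Phi> i' j' (d (f \<oplus>\<^bsub>C i j\<^esub> g))"
        using e abelian_groupE(1)[OF Cg f(1) g(1)] by simp
      finally show ?thesis using f g dD \<Phi>D(2) e by simp
    qed
  qed
  have "bicomplex K D eh ev"
    unfolding bicomplex_def
  proof (intro allI conjI ballI)
    fix i j
    show "module K (D i j)" by (rule D)
    show "is_hom K (D i j) (D (Suc i) j) (eh i j)" by (rule hom[OF dh h])
    show "is_hom K (D i j) (D i (Suc j)) (ev i j)" by (rule hom[OF dv v])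
    fix F assume "F \<in> carrier (D i j)"
    then obtain f where f: "f \<in> carrier (C i j)" "F = \<Phi> i j f" using pull by blast
    note fh = dhD(1)[OF f(1)] and fv = dvD(1)[OF f(1)]
    show "eh (Suc i) j (eh i j F) = \<zero>\<^bsub>D (Suc (Suc i)) j\<^esub>"
      using f dd[OF f(1)] \<Phi>0[of "Suc (Suc i)" j] h[OF fh] h[OF f(1)] by simp
    show "ev i (Suc j) (ev i j F) = \<zero>\<^bsub>D i (Suc (Suc j))\<^esub>"
      using f dd[OF f(1)] \<Phi>0[of i "Suc (Suc j)"] v[OF fv] v[OF f(1)] by simp
    have "\<Phi> (Suc i) (Suc j) (dh i (Suc j) (dv i j f) \<oplus>\<^bsub>C (Suc i) (Suc j)\<^esub> dv (Suc i) j (dh i j f))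
        = \<Phi> (Suc i) (Suc j) (dh i (Suc j) (dv i j f)) \<oplus>\<^bsub>D (Suc i) (Suc j)\<^esub> \<Phi> (Suc i) (Suc j) (dv (Suc i) j (dh i j f))"
      by (rule \<Phi>D(2)[OF dhD(1)[OF fv] dvD(1)[OF fh]])
    then show "eh i (Suc j) (ev i j F) \<oplus>\<^bsub>D (Suc i) (Suc j)\<^esub> ev (Suc i) j (eh i j F) = \<zero>\<^bsub>D (Suc i) (Suc j)\<^esub>"
      using f dd[OF f(1)] \<Phi>0[of "Suc i" "Suc j"] h[OF fv] h[OF f(1)] v[OF fh] v[OF f(1)] by simp
  qed
  then show ?thesis
    unfolding bicomplex_iso_def using C \<Phi> bij h v by simp
qed

locale galois_bicomplex = galois_bimodule K H comul counit antipode B coact N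
  for K :: "'k ring" and H :: "('k, 'h) module" and comul :: "'h \<Rightarrow> ('h, 'h) tensors"
    and counit :: "'h \<Rightarrow> 'k" and antipode :: "'h \<Rightarrow> 'h"
    and B :: "('k, 'b) module" and coact :: "'b \<Rightarrow> ('b, 'h) tensors"
    and N :: "('b, 'n) bimodule" +
  fixes L :: "nat \<Rightarrow> ('h, 'l) module" and dL :: "nat \<Rightarrow> 'l \<Rightarrow> 'l"
    and P :: "nat \<Rightarrow> (('b, 'b) tensors, 'm) module" and dP :: "nat \<Rightarrow> 'm \<Rightarrow> 'm"
  assumes L: "right_module H (L i)" and dL: "is_hom H (L (Suc i)) (L i) (dL i)"
    and dL_dL: "l \<in> carrier (L (Suc (Suc i))) \<Longrightarrow> dL i (dL (Suc i) l) = \<zero>\<^bsub>L i\<^esub>"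
    and P: "left_module Gamma (P j)" and dP: "is_hom Gamma (P (Suc j)) (P j) (dP j)"
    and dP_dP: "m \<in> carrier (P (Suc (Suc j))) \<Longrightarrow> dP j (dP (Suc j) m) = \<zero>\<^bsub>P j\<^esub>"
begin

lemma pair: "galois_pair K H comul counit antipode B coact N (P j) (L i)"
  by (intro galois_pair.intro galois_pair_axioms.intro galois_module.intro galois_module_axioms.intro
      galois_bimodule_axioms L P)

lemma hmap: "galois_pair_hmap K H comul counit antipode B coact N (P j) (L i) (L (Suc i)) (dL i)"
  by (intro galois_pair_hmap.intro galois_pair_hmap_axioms.intro pair dL)

lemma vmap: "galois_pair_vmap K H comul counit antipode B coact N (P j) (P (Suc j)) (L i) (dP j)"
  by (intro galois_pair_vmap.intro galois_pair_vmap_axioms.intro pair dP)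

lemma dh_hpull: "dh_Hom L dL P N i j = galois_pair_hmap.hpull N (P j) (L (Suc i)) (dL i) (i + j)"
  by (simp add: fun_eq_iff dh_Hom_def galois_pair_hmap.hpull_def[OF hmap])

lemma dv_vpull: "dv_Hom L P dP N i j = galois_pair_vmap.vpull N (P (Suc j)) (L i) (dP j) j"
  by (simp add: fun_eq_iff dv_Hom_def galois_pair_vmap.vpull_def[OF vmap])

lemma C_Hom_bicomplex: "bicomplex K (C_Hom L P N) (dh_Hom L dL P N) (dv_Hom L P dP N)"
  unfolding bicomplex_def
proof (intro allI conjI ballI)
  fix i j
  show "module K (C_Hom L P N i j)"
    unfolding C_Hom_def by (rule galois_pair.CHom_module[OF pair])
  show "is_hom K (C_Hom L P N i j) (C_Hom L P N (Suc i) j) (dh_Hom L dL P N i j)"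
    unfolding C_Hom_def dh_hpull by (rule galois_pair_hmap.hpull_is_hom[OF hmap])
  show "is_hom K (C_Hom L P N i j) (C_Hom L P N i (Suc j)) (dv_Hom L P dP N i j)"
    unfolding C_Hom_def dv_vpull by (rule galois_pair_vmap.vpull_is_hom[OF vmap])
  fix f assume "f \<in> carrier (C_Hom L P N i j)"
  note fD = galois_pair.CHomD[OF pair this[unfolded C_Hom_def]]
  have Lg: "abelian_group (L i)" by (rule actedD(1)[OF right_module_acted[OF L]])
  have Pg: "abelian_group (P j)" by (rule actedD(1)[OF left_module_acted[OF P]])
  have f0: "f \<zero>\<^bsub>L i\<^esub> m = \<zero>\<^bsub>N\<^esub>" if "m \<in> carrier (P j)" for m
    using add_hom_zero[of "L i" N "\<lambda>l. f l m"] that fD(3,5) Lg N_group by (simp add: add_hom_def)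
  have f0': "f l \<zero>\<^bsub>P j\<^esub> = \<zero>\<^bsub>N\<^esub>" if "l \<in> carrier (L i)" for l
    using add_hom_zero[of "P j" N "f l"] that fD(3) Pg N_group
      galois_module.Hom_AeD(3)[OF galois_pair.axioms(1)[OF pair] fD(2)] by (simp add: add_hom_def)
  note dLc = is_homD(1)[OF dL] and dPc = is_homD(1)[OF dP]
  show "dh_Hom L dL P N (Suc i) j (dh_Hom L dL P N i j f) = \<zero>\<^bsub>C_Hom L P N (Suc (Suc i)) j\<^esub>"
    by (rule ext) (auto simp: dh_Hom_def C_Hom_def Hom_Ae_def restrict_def Hom_Ae_H_def dLc dL_dL f0)
  show "dv_Hom L P dP N i (Suc j) (dv_Hom L P dP N i j f) = \<zero>\<^bsub>C_Hom L P N i (Suc (Suc j))\<^esub>"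
    by (rule ext) (auto simp: dv_Hom_def C_Hom_def Hom_Ae_def restrict_def Hom_Ae_H_def dPc dP_dP f0')
  show "dh_Hom L dL P N i (Suc j) (dv_Hom L P dP N i j f)
      \<oplus>\<^bsub>C_Hom L P N (Suc i) (Suc j)\<^esub> dv_Hom L P dP N (Suc i) j (dh_Hom L dL P N i j f)
      = \<zero>\<^bsub>C_Hom L P N (Suc i) (Suc j)\<^esub>"
  proof -
    have "signed N (i + Suc j) (signed N j (f (dL i l) (dP j m))) \<oplus>\<^bsub>N\<^esub>
        signed N j (signed N (i + j) (f (dL i l) (dP j m))) = \<zero>\<^bsub>N\<^esub>"
      if "l \<in> carrier (L (Suc i))" "m \<in> carrier (P (Suc j))" for l m
      by (rule signed_anticommute) (use that fD(3) dLc dPc in simp)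
    then show ?thesis
      by (intro ext) (auto simp: dv_Hom_def dh_Hom_def C_Hom_def Hom_Ae_def restrict_def Hom_Ae_H_def dPc dLc)
  qed
qed

theorem adj_bicomplex_iso:
  "bicomplex_iso K (C_Hom L P N) (dh_Hom L dL P N) (dv_Hom L P dP N)
     (C_tensor L P N) (dh_tensor L dL P N) (dv_tensor L P dP N)
     (\<lambda>i j. galois_pair.adj K H comul B coact N (P j) (L i))"
proof (rule bicomplex_iso_transport[OF C_Hom_bicomplex])
  fix i j
  show "module K (C_tensor L P N i j)"
    unfolding C_tensor_def by (rule galois_pair.CTen_module[OF pair])
  show "is_hom K (C_Hom L P N i j) (C_tensor L P N i j) (galois_pair.adj K H comul B coact N (P j) (L i))"
    unfolding C_Hom_def C_tensor_def by (rule galois_pair.adj_is_hom[OF pair])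
  show "bij_betw (galois_pair.adj K H comul B coact N (P j) (L i))
      (carrier (C_Hom L P N i j)) (carrier (C_tensor L P N i j))"
    unfolding C_Hom_def C_tensor_def by (rule galois_pair.adj_bij[OF pair])
  fix f assume f: "f \<in> carrier (C_Hom L P N i j)"
  show "galois_pair.adj K H comul B coact N (P j) (L (Suc i)) (dh_Hom L dL P N i j f)
      = dh_tensor L dL P N i j (galois_pair.adj K H comul B coact N (P j) (L i) f)"
    unfolding dh_hpull dh_tensor_def
    by (rule galois_pair_hmap.adj_hpull[OF hmap f[unfolded C_Hom_def]])
  show "galois_pair.adj K H comul B coact N (P (Suc j)) (L i) (dv_Hom L P dP N i j f)
      = dv_tensor L P dP N i j (galois_pair.adj K H comul B coact N (P j) (L i) f)"
    unfolding dv_vpull dv_tensor_def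
    by (rule galois_pair_vmap.adj_vpull[OF vmap f[unfolded C_Hom_def]])
qed

end

lemma projective_resolution_complex:
  assumes "projective_resolution R M P d e"
  shows "left_module R (P n)" "is_hom R (P (Suc n)) (P n) (d n)"
    "x \<in> carrier (P (Suc (Suc n))) \<Longrightarrow> d n (d (Suc n) x) = \<zero>\<^bsub>P n\<^esub>"
proof -
  show "left_module R (P n)" "is_hom R (P (Suc n)) (P n) (d n)"
    using assms by (auto simp: projective_resolution_def projective_def)
  have "exact_at (P (Suc (Suc n))) (P (Suc n)) (P n) (d (Suc n)) (d n)"
    using assms by (simp add: projective_resolution_def)
  then show "x \<in> carrier (P (Suc (Suc n))) \<Longrightarrow> d n (d (Suc n) x) = \<zero>\<^bsub>P n\<^esub>"
    unfolding exact_at_def by blast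
qed

theorem proposition4p1:
  fixes K :: "'k ring"
    and H :: "('k, 'h) module" and comul :: "'h \<Rightarrow> ('h, 'h) tensors"
    and counit :: "'h \<Rightarrow> 'k" and antipode :: "'h \<Rightarrow> 'h"
    and B :: "('k, 'b) module" and coact :: "'b \<Rightarrow> ('b, 'h) tensors"
    and L :: "nat \<Rightarrow> ('h, 'l) module" and dL :: "nat \<Rightarrow> 'l \<Rightarrow> 'l" and eL :: "'l \<Rightarrow> 'k"
    and P :: "nat \<Rightarrow> (('b, 'b) tensors, 'm) module" and dP :: "nat \<Rightarrow> 'm \<Rightarrow> 'm" and eP :: "'m \<Rightarrow> 'b"
    and N :: "('b, 'n) bimodule"
  assumes "hopf_algebra K H comul counit antipode"
    and "bij_betw antipode (carrier H) (carrier H)"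
    and "comodule_algebra K H comul counit antipode B coact"
    and "galois_data.faithfully_flat_H_Galois K H B coact"
    and "projective_resolution (op_ring H) (trivial_module K counit) L dL eL"
    and "projective_resolution (galois_data.Gamma K H B coact) (galois_data.A_Gamma K H B coact) P dP eP"
    and "bimodule K B N"
  shows "\<exists>\<Phi>. bicomplex_iso K
      (galois_data.C_Hom K H comul B coact L P N)
      (galois_data.dh_Hom L dL P N)
      (galois_data.dv_Hom L P dP N)
      (galois_data.C_tensor K H comul B coact L P N)
      (galois_data.dh_tensor K H comul B coact L dL P N)
      (galois_data.dv_tensor K H comul B coact L P dP N)
      \<Phi>"
proof -
  note L = projective_resolution_complex[OF assms(5)]
  note P = projective_resolution_complex[OF assms(6)]
  have "galois_bicomplex K H comul counit antipode B coact N L dL P dP"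
  proof (intro galois_bicomplex.intro galois_bimodule.intro galois_env.intro galois_ext.intro
      comod_alg.intro galois_ext_axioms.intro galois_env_axioms.intro galois_bimodule_axioms.intro
      galois_bicomplex_axioms.intro assms)
    show "ring (galois_data.Gamma K H B coact)"
      using P(1)[of 0] by (simp add: left_module_def)
  qed (use L P in simp_all)
  then show ?thesis
    by (intro exI) (rule galois_bicomplex.adj_bicomplex_iso)
qed

end
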